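(* Let $k$ be a field, $B$ a finite-dimensional $k$-algebra, $M\in\mathsf{mod}\,B$, and $A=B[M]$ the one-point extension, with new simple right $A$-module $S_0$. Then $$\operatorname{ddell}_A S_0\le 1\quad\Longleftrightarrow\quad M\oplus Q\in\mathcal C_M*\mathcal C_M\ \text{ for some } Q\in\mathsf{proj}\,B.$$
   Context: All modules are finitely generated right modules. $\mathsf{mod}$ and $\mathsf{proj}$ denote the categories of finitely generated right modules and of finitely generated projectives; $\underline{\mathsf{mod}}$ is the stable category modulo projectives; $\Omega_\Lambda X$ is the kernel of a projective cover of $X$; $\mathsf{add}$ denotes closure under finite direct sums and direct summands. One-point extension: $A=B[M]=\begin{pmatrix}k&M\\0&B\end{pmatrix}$, $e_0=\begin{pmatrix}1&0\\0&0\end{pmatrix}$, $P_0=e_0A$, $S_0=P_0/\operatorname{rad}P_0$. $\mathcal T_M=\{N\in\mathsf{mod}\,B\mid N\text{ embeds into an object of }\mathsf{add}(B\oplus M)\}$ and $\mathcal C_M=\mathsf{add}\bigl(\mathsf{proj}\,B\cup\{\Omega_BN\mid N\in\mathcal T_M\}\bigr)$. For full subcategories $\mathcal U,\mathcal V$ of $\mathsf{mod}\,B$, $\mathcal U*\mathcal V$ consists of the modules $E$ admitting a short exact sequence $0\to U\to E\to V\to0$ with $U\in\mathcal U$, $V\in\mathcal V$. Derived delooping level (for a finite-dimensional algebra $\Lambda$): for $r\ge1$ and $X\in\mathsf{mod}\,\Lambda$, $r\text{-}\operatorname{dell}_\Lambda X$ is the infimum of the integers $n\ge0$ such that $\Omega_\Lambda^nX$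 is a retract of $\Omega_\Lambda^{n+r}Y$ in $\underline{\mathsf{mod}}\,\Lambda$ for some $Y\in\mathsf{mod}\,\Lambda$; $\operatorname{ddell}_\Lambda X$ is the infimum of the integers $m\ge0$ for which there are $0\le n\le m$ and an exact sequence $0\to C_n\to\cdots\to C_0\to X\to0$ in $\mathsf{mod}\,\Lambda$ with $(i+1)\text{-}\operatorname{dell}_\Lambda C_i\le m-i$ for $0\le i\le n$. The infimum of the empty set is $\infty$. *)

theory Defs
  imports "HOL-Library.Extended_Nat" "HOL-Algebra.AbelCoset" "HOL-Algebra.Module"
begin

text \<open>
  A \<open>K\<close>-algebra is given by a record of type \<^typ>\<open>('k, 'a) module\<close>: its ring structure together with
  the action \<open>\<odot>\<close> of \<open>K\<close>. It need not be commutative, and it may be zero.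
\<close>

locale fd_algebra =
  K: field K + Alg: ring \<Lambda> + Mod: module K \<Lambda>
  for K :: "'k ring" and \<Lambda> :: "('k, 'a) module" +
  assumes smult_mult_left: "\<lbrakk>c \<in> carrier K; x \<in> carrier \<Lambda>; y \<in> carrier \<Lambda>\<rbrakk> \<Longrightarrow>
      (c \<odot>\<^bsub>\<Lambda>\<^esub> x) \<otimes>\<^bsub>\<Lambda>\<^esub> y = c \<odot>\<^bsub>\<Lambda>\<^esub> (x \<otimes>\<^bsub>\<Lambda>\<^esub> y)"
    and smult_mult_right: "\<lbrakk>c \<in> carrier K; x \<in> carrier \<Lambda>; y \<in> carrier \<Lambda>\<rbrakk> \<Longrightarrow>
      x \<otimes>\<^bsub>\<Lambda>\<^esub> (c \<odot>\<^bsub>\<Lambda>\<^esub> y) = c \<odot>\<^bsub>\<Lambda>\<^esub> (x \<otimes>\<^bsub>\<Lambda>\<^esub> y)"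
    and finite_dim: "\<exists>S. finite S \<and> S \<subseteq> carrier \<Lambda> \<and>
      (\<forall>x\<in>carrier \<Lambda>. \<exists>c\<in>S \<rightarrow> carrier K. x = (\<Oplus>\<^bsub>\<Lambda>\<^esub>s\<in>S. c s \<odot>\<^bsub>\<Lambda>\<^esub> s))"


section \<open>Right modules\<close>

text \<open>
  As in \<^typ>\<open>('a, 'b) module\<close>, the fields \<open>mult\<close> and \<open>one\<close> inherited from \<^typ>\<open>'b ring\<close> carry no
  meaning; extending \<^typ>\<open>'b ring\<close> only makes the theory of \<^const>\<open>abelian_group\<close> available.
\<close>

record ('a, 'x) rmodule = "'x ring" +
  ract :: "'x \<Rightarrow> 'a \<Rightarrow> 'x"  (infixl \<open>\<triangleleft>\<index>\<close> 70)

locale right_module =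
  Alg: ring \<Lambda> + AbGr: abelian_group X
  for \<Lambda> :: "('k, 'a) module" and X :: "('a, 'x) rmodule" +
  assumes ract_closed: "\<lbrakk>x \<in> carrier X; r \<in> carrier \<Lambda>\<rbrakk> \<Longrightarrow> x \<triangleleft>\<^bsub>X\<^esub> r \<in> carrier X"
    and ract_add_left: "\<lbrakk>x \<in> carrier X; y \<in> carrier X; r \<in> carrier \<Lambda>\<rbrakk> \<Longrightarrow>
      (x \<oplus>\<^bsub>X\<^esub> y) \<triangleleft>\<^bsub>X\<^esub> r = x \<triangleleft>\<^bsub>X\<^esub> r \<oplus>\<^bsub>X\<^esub> y \<triangleleft>\<^bsub>X\<^esub> r"
    and ract_add_right: "\<lbrakk>x \<in> carrier X; r \<in> carrier \<Lambda>; s \<in> carrier \<Lambda>\<rbrakk> \<Longrightarrow>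
      x \<triangleleft>\<^bsub>X\<^esub> (r \<oplus>\<^bsub>\<Lambda>\<^esub> s) = x \<triangleleft>\<^bsub>X\<^esub> r \<oplus>\<^bsub>X\<^esub> x \<triangleleft>\<^bsub>X\<^esub> s"
    and ract_mult: "\<lbrakk>x \<in> carrier X; r \<in> carrier \<Lambda>; s \<in> carrier \<Lambda>\<rbrakk> \<Longrightarrow>
      x \<triangleleft>\<^bsub>X\<^esub> (r \<otimes>\<^bsub>\<Lambda>\<^esub> s) = (x \<triangleleft>\<^bsub>X\<^esub> r) \<triangleleft>\<^bsub>X\<^esub> s"
    and ract_one: "x \<in> carrier X \<Longrightarrow> x \<triangleleft>\<^bsub>X\<^esub> \<one>\<^bsub>\<Lambda>\<^esub> = x"

locale fg_right_module = right_module +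
  assumes finitely_generated: "\<exists>T. finite T \<and> T \<subseteq> carrier X \<and>
      (\<forall>x\<in>carrier X. \<exists>a\<in>T \<rightarrow> carrier \<Lambda>. x = (\<Oplus>\<^bsub>X\<^esub>t\<in>T. t \<triangleleft>\<^bsub>X\<^esub> a t))"

definition rhom :: "('k, 'a) module \<Rightarrow> ('a, 'x) rmodule \<Rightarrow> ('a, 'y) rmodule \<Rightarrow> ('x \<Rightarrow> 'y) set" where
  "rhom \<Lambda> X Y = {f \<in> carrier X \<rightarrow> carrier Y.
     (\<forall>x\<in>carrier X. \<forall>y\<in>carrier X. f (x \<oplus>\<^bsub>X\<^esub> y) = f x \<oplus>\<^bsub>Y\<^esub> f y) \<and>
     (\<forall>x\<in>carrier X. \<forall>r\<in>carrier \<Lambda>. f (x \<triangleleft>\<^bsub>X\<^esub> r) = f x \<triangleleft>\<^bsub>Y\<^esub> r)}"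

definition mono_rhom :: "('k, 'a) module \<Rightarrow> ('a, 'x) rmodule \<Rightarrow> ('a, 'y) rmodule \<Rightarrow> ('x \<Rightarrow> 'y) set" where
  "mono_rhom \<Lambda> X Y = {f \<in> rhom \<Lambda> X Y. inj_on f (carrier X)}"

definition epi_rhom :: "('k, 'a) module \<Rightarrow> ('a, 'x) rmodule \<Rightarrow> ('a, 'y) rmodule \<Rightarrow> ('x \<Rightarrow> 'y) set" where
  "epi_rhom \<Lambda> X Y = {f \<in> rhom \<Lambda> X Y. f ` carrier X = carrier Y}"

definition riso :: "('k, 'a) module \<Rightarrow> ('a, 'x) rmodule \<Rightarrow> ('a, 'y) rmodule \<Rightarrow> bool" where
  "riso \<Lambda> X Y \<longleftrightarrow> (\<exists>f\<in>rhom \<Lambda> X Y. bij_betw f (carrier X) (carrier Y))"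

definition rsubmodule :: "('k, 'a) module \<Rightarrow> 'x set \<Rightarrow> ('a, 'x) rmodule \<Rightarrow> bool" where
  "rsubmodule \<Lambda> N X \<longleftrightarrow> additive_subgroup N X \<and> (\<forall>x\<in>N. \<forall>r\<in>carrier \<Lambda>. x \<triangleleft>\<^bsub>X\<^esub> r \<in> N)"

definition maximal_rsubmodule :: "('k, 'a) module \<Rightarrow> 'x set \<Rightarrow> ('a, 'x) rmodule \<Rightarrow> bool" where
  "maximal_rsubmodule \<Lambda> N X \<longleftrightarrow> rsubmodule \<Lambda> N X \<and> N \<noteq> carrier X \<and>
     (\<forall>L. rsubmodule \<Lambda> L X \<and> N \<subseteq> L \<longrightarrow> L = N \<or> L = carrier X)"

definition mod_rad :: "('k, 'a) module \<Rightarrow> ('a, 'x) rmodule \<Rightarrow> 'x set" where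
  "mod_rad \<Lambda> X = carrier X \<inter> \<Inter>{N. maximal_rsubmodule \<Lambda> N X}"

definition restrict_to :: "('a, 'x) rmodule \<Rightarrow> 'x set \<Rightarrow> ('a, 'x) rmodule" where
  "restrict_to X N = X\<lparr>carrier := N\<rparr>"

definition quot_rmodule :: "('a, 'x) rmodule \<Rightarrow> 'x set \<Rightarrow> ('a, 'x set) rmodule" where
  "quot_rmodule X N = \<lparr>carrier = a_rcosets\<^bsub>X\<^esub> N, mult = undefined, one = undefined,
     zero = N, add = set_add X, ract = (\<lambda>C r. \<Union>x\<in>C. N +>\<^bsub>X\<^esub> (x \<triangleleft>\<^bsub>X\<^esub> r))\<rparr>"

definition regular_rmodule :: "('k, 'a) module \<Rightarrow> ('a, 'a) rmodule" where
  "regular_rmodule \<Lambda> = \<lparr>carrier = carrier \<Lambda>, mult = undefined, one = undefined,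
     zero = \<zero>\<^bsub>\<Lambda>\<^esub>, add = add \<Lambda>, ract = mult \<Lambda>\<rparr>"

definition rdsum :: "('a, 'x) rmodule \<Rightarrow> ('a, 'y) rmodule \<Rightarrow> ('a, 'x \<times> 'y) rmodule" where
  "rdsum X Y = \<lparr>carrier = carrier X \<times> carrier Y, mult = undefined, one = undefined,
     zero = (\<zero>\<^bsub>X\<^esub>, \<zero>\<^bsub>Y\<^esub>),
     add = (\<lambda>(x, y) (x', y'). (x \<oplus>\<^bsub>X\<^esub> x', y \<oplus>\<^bsub>Y\<^esub> y')),
     ract = (\<lambda>(x, y) r. (x \<triangleleft>\<^bsub>X\<^esub> r, y \<triangleleft>\<^bsub>Y\<^esub> r))\<rparr>"

text \<open>The direct sum of \<open>F 0, \<dots>, F (n - 1)\<close>.\<close>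

definition fin_dsum :: "nat \<Rightarrow> (nat \<Rightarrow> ('a, 'x) rmodule) \<Rightarrow> ('a, nat \<Rightarrow> 'x) rmodule" where
  "fin_dsum n F = \<lparr>carrier = (\<Pi>\<^sub>E i\<in>{..<n}. carrier (F i)), mult = undefined, one = undefined,
     zero = (\<lambda>i\<in>{..<n}. \<zero>\<^bsub>F i\<^esub>),
     add = (\<lambda>x y. \<lambda>i\<in>{..<n}. x i \<oplus>\<^bsub>F i\<^esub> y i),
     ract = (\<lambda>x r. \<lambda>i\<in>{..<n}. x i \<triangleleft>\<^bsub>F i\<^esub> r)\<rparr>"


section \<open>The category of finitely generated modules\<close>

text \<open>
  HOL cannot quantify over the types of carriers, so the objects of \<open>mod \<Lambda>\<close> are taken to be the
  finitely generated right modules whose carrier is a set of elements of \<^typ>\<open>nat \<Rightarrow> 'k\<close>, where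
  \<^typ>\<open>'k\<close> is the type of scalars. No isomorphism class is lost: see \<open>ex_riso_fgmod\<close> below.
  Predicates on a single module (\<^const>\<open>fg_right_module\<close>, \<open>projective\<close>, \<open>ddell\<close>, \<dots>) allow arbitrary
  carrier types.
\<close>

type_synonym ('k, 'a) umod = "('a, nat \<Rightarrow> 'k) rmodule"

definition fgmod :: "('k, 'a) module \<Rightarrow> ('k, 'a) umod set" where
  "fgmod \<Lambda> = {X. fg_right_module \<Lambda> X}"

definition projective :: "('k, 'a) module \<Rightarrow> ('a, 'x) rmodule \<Rightarrow> bool" where
  "projective \<Lambda> P \<longleftrightarrow> (\<forall>X\<in>fgmod \<Lambda>. \<forall>Y\<in>fgmod \<Lambda>. \<forall>g\<in>epi_rhom \<Lambda> X Y. \<forall>h\<in>rhom \<Lambda> P Y.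
     \<exists>f\<in>rhom \<Lambda> P X. \<forall>x\<in>carrier P. g (f x) = h x)"

definition fgproj :: "('k, 'a) module \<Rightarrow> ('k, 'a) umod set" where
  "fgproj \<Lambda> = {P \<in> fgmod \<Lambda>. projective \<Lambda> P}"

definition add_closure :: "('k, 'a) module \<Rightarrow> ('a, 'x) rmodule set \<Rightarrow> ('k, 'a) umod set" where
  "add_closure \<Lambda> \<S> = {X \<in> fgmod \<Lambda>. \<exists>Y\<in>fgmod \<Lambda>. \<exists>n F. (\<forall>i<n. F i \<in> \<S>) \<and>
     riso \<Lambda> (rdsum X Y) (fin_dsum n F)}"

definition extension_class ::
  "('k, 'a) module \<Rightarrow> ('k, 'a) umod set \<Rightarrow> ('k, 'a) umod set \<Rightarrow> ('a, 'x) rmodule set" where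
  "extension_class \<Lambda> \<U> \<V> = {E. fg_right_module \<Lambda> E \<and>
     (\<exists>U\<in>\<U>. \<exists>V\<in>\<V>. \<exists>f\<in>mono_rhom \<Lambda> U E. \<exists>g\<in>epi_rhom \<Lambda> E V. f ` carrier U = a_kernel E V g)}"


section \<open>Syzygies and stable retracts\<close>

definition superfluous :: "('k, 'a) module \<Rightarrow> 'x set \<Rightarrow> ('a, 'x) rmodule \<Rightarrow> bool" where
  "superfluous \<Lambda> N X \<longleftrightarrow> rsubmodule \<Lambda> N X \<and>
     (\<forall>L. rsubmodule \<Lambda> L X \<and> N <+>\<^bsub>X\<^esub> L = carrier X \<longrightarrow> L = carrier X)"

definition projective_cover ::
  "('k, 'a) module \<Rightarrow> ('a, 'p) rmodule \<Rightarrow> ('p \<Rightarrow> 'x) \<Rightarrow> ('a, 'x) rmodule \<Rightarrow> bool" where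
  "projective_cover \<Lambda> P p X \<longleftrightarrow> fg_right_module \<Lambda> P \<and> projective \<Lambda> P \<and>
     p \<in> epi_rhom \<Lambda> P X \<and> superfluous \<Lambda> (a_kernel P X p) P"

text \<open>
  Syzygies are determined only up to isomorphism, so they are relations: \<open>Z\<close> is (isomorphic to)
  \<open>\<Omega> X\<close>, respectively \<open>\<Omega>\<^sup>n X\<close>.
\<close>

definition is_syzygy :: "('k, 'a) module \<Rightarrow> ('a, 'x) rmodule \<Rightarrow> ('k, 'a) umod \<Rightarrow> bool" where
  "is_syzygy \<Lambda> X Z \<longleftrightarrow> Z \<in> fgmod \<Lambda> \<and> (\<exists>P\<in>fgproj \<Lambda>. \<exists>p. projective_cover \<Lambda> P p X \<and>
     riso \<Lambda> (restrict_to P (a_kernel P X p)) Z)"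

fun is_nth_syzygy :: "('k, 'a) module \<Rightarrow> nat \<Rightarrow> ('a, 'x) rmodule \<Rightarrow> ('k, 'a) umod \<Rightarrow> bool" where
  "is_nth_syzygy \<Lambda> 0 X Z \<longleftrightarrow> Z \<in> fgmod \<Lambda> \<and> riso \<Lambda> X Z"
| "is_nth_syzygy \<Lambda> (Suc n) X Z \<longleftrightarrow> (\<exists>W\<in>fgmod \<Lambda>. is_nth_syzygy \<Lambda> n X W \<and> is_syzygy \<Lambda> W Z)"

definition factors_through_projective ::
  "('k, 'a) module \<Rightarrow> ('a, 'x) rmodule \<Rightarrow> ('a, 'y) rmodule \<Rightarrow> ('x \<Rightarrow> 'y) \<Rightarrow> bool" where
  "factors_through_projective \<Lambda> X Y h \<longleftrightarrow> (\<exists>P\<in>fgproj \<Lambda>. \<exists>a\<in>rhom \<Lambda> X P. \<exists>b\<in>rhom \<Lambda> P Y.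
     \<forall>x\<in>carrier X. h x = b (a x))"

text \<open>
  A morphism of the stable category is a homomorphism modulo those that factor through a
  projective, so \<open>X\<close> is a retract of \<open>Z\<close> there iff \<open>id - g \<circ> f\<close> factors through a projective for
  some \<open>f : X \<rightarrow> Z\<close> and \<open>g : Z \<rightarrow> X\<close>.
\<close>

definition stable_retract :: "('k, 'a) module \<Rightarrow> ('a, 'x) rmodule \<Rightarrow> ('a, 'z) rmodule \<Rightarrow> bool" where
  "stable_retract \<Lambda> X Z \<longleftrightarrow> (\<exists>f\<in>rhom \<Lambda> X Z. \<exists>g\<in>rhom \<Lambda> Z X.
     factors_through_projective \<Lambda> X X (\<lambda>x. x \<ominus>\<^bsub>X\<^esub> g (f x)))"


section \<open>Derived delooping level\<close>

text \<open>In \<^typ>\<open>enat\<close>, the infimum of the empty set is \<open>\<infinity>\<close>.\<close>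

definition dell :: "('k, 'a) module \<Rightarrow> nat \<Rightarrow> ('a, 'x) rmodule \<Rightarrow> enat" where
  "dell \<Lambda> r X = Inf {enat n | n. \<exists>Y\<in>fgmod \<Lambda>. \<exists>U V.
     is_nth_syzygy \<Lambda> n X U \<and> is_nth_syzygy \<Lambda> (n + r) Y V \<and> stable_retract \<Lambda> U V}"

text \<open>
  Exactness of \<open>0 \<rightarrow> C n \<rightarrow> \<dots> \<rightarrow> C 0 \<rightarrow> X \<rightarrow> 0\<close>, with \<open>d i : C (i + 1) \<rightarrow> C i\<close> for \<open>i < n\<close> and
  \<open>\<epsilon> : C 0 \<rightarrow> X\<close>.
\<close>

definition exact_left_resolution ::
  "('k, 'a) module \<Rightarrow> nat \<Rightarrow> (nat \<Rightarrow> ('a, 'c) rmodule) \<Rightarrow> (nat \<Rightarrow> 'c \<Rightarrow> 'c) \<Rightarrow> ('c \<Rightarrow> 'x) \<Rightarrow>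
   ('a, 'x) rmodule \<Rightarrow> bool" where
  "exact_left_resolution \<Lambda> n C d \<epsilon> X \<longleftrightarrow>
     (let im = (\<lambda>i. if i < n then d i ` carrier (C (Suc i)) else {\<zero>\<^bsub>C i\<^esub>}) in
       \<epsilon> \<in> epi_rhom \<Lambda> (C 0) X \<and> a_kernel (C 0) X \<epsilon> = im 0 \<and>
       (\<forall>i<n. d i \<in> rhom \<Lambda> (C (Suc i)) (C i) \<and> a_kernel (C (Suc i)) (C i) (d i) = im (Suc i)))"

definition ddell :: "('k, 'a) module \<Rightarrow> ('a, 'x) rmodule \<Rightarrow> enat" where
  "ddell \<Lambda> X = Inf {enat m | m. \<exists>n\<le>m. \<exists>(C :: nat \<Rightarrow> ('k, 'a) umod) d \<epsilon>.
     (\<forall>i\<le>n. C i \<in> fgmod \<Lambda>) \<and> exact_left_resolution \<Lambda> n C d \<epsilon> X \<and>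
     (\<forall>i\<le>n. dell \<Lambda> (i + 1) (C i) \<le> enat (m - i))}"


section \<open>One-point extensions\<close>

text \<open>
  The triple \<open>(a, m, b)\<close> is the matrix with rows \<open>(a, m)\<close> and \<open>(0, b)\<close>; the left action of \<open>a \<in> K\<close>
  on \<open>M\<close> is the right action of \<open>a 1\<^sub>B\<close>.
\<close>

definition one_point_ext ::
  "'k ring \<Rightarrow> ('k, 'b) module \<Rightarrow> ('b, 'm) rmodule \<Rightarrow> ('k, 'k \<times> 'm \<times> 'b) module" where
  "one_point_ext K B M = \<lparr>carrier = carrier K \<times> carrier M \<times> carrier B,
     mult = (\<lambda>(a, m, b) (a', m', b').
       (a \<otimes>\<^bsub>K\<^esub> a', m' \<triangleleft>\<^bsub>M\<^esub> (a \<odot>\<^bsub>B\<^esub> \<one>\<^bsub>B\<^esub>) \<oplus>\<^bsub>M\<^esub> m \<triangleleft>\<^bsub>M\<^esub> b', b \<otimes>\<^bsub>B\<^esub> b')),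
     one = (\<one>\<^bsub>K\<^esub>, \<zero>\<^bsub>M\<^esub>, \<one>\<^bsub>B\<^esub>),
     zero = (\<zero>\<^bsub>K\<^esub>, \<zero>\<^bsub>M\<^esub>, \<zero>\<^bsub>B\<^esub>),
     add = (\<lambda>(a, m, b) (a', m', b'). (a \<oplus>\<^bsub>K\<^esub> a', m \<oplus>\<^bsub>M\<^esub> m', b \<oplus>\<^bsub>B\<^esub> b')),
     smult = (\<lambda>c (a, m, b). (c \<otimes>\<^bsub>K\<^esub> a, m \<triangleleft>\<^bsub>M\<^esub> (c \<odot>\<^bsub>B\<^esub> \<one>\<^bsub>B\<^esub>), c \<odot>\<^bsub>B\<^esub> b))\<rparr>"

definition e\<^sub>0 :: "'k ring \<Rightarrow> ('k, 'b) module \<Rightarrow> ('b, 'm) rmodule \<Rightarrow> 'k \<times> 'm \<times> 'b" where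
  "e\<^sub>0 K B M = (\<one>\<^bsub>K\<^esub>, \<zero>\<^bsub>M\<^esub>, \<zero>\<^bsub>B\<^esub>)"

definition P\<^sub>0 ::
  "'k ring \<Rightarrow> ('k, 'b) module \<Rightarrow> ('b, 'm) rmodule \<Rightarrow> ('k \<times> 'm \<times> 'b, 'k \<times> 'm \<times> 'b) rmodule" where
  "P\<^sub>0 K B M = (let A = one_point_ext K B M in
     restrict_to (regular_rmodule A) {e\<^sub>0 K B M \<otimes>\<^bsub>A\<^esub> x | x. x \<in> carrier A})"

definition S\<^sub>0 ::
  "'k ring \<Rightarrow> ('k, 'b) module \<Rightarrow> ('b, 'm) rmodule \<Rightarrow>
   ('k \<times> 'm \<times> 'b, ('k \<times> 'm \<times> 'b) set) rmodule" where
  "S\<^sub>0 K B M = quot_rmodule (P\<^sub>0 K B M) (mod_rad (one_point_ext K B M) (P\<^sub>0 K B M))"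

definition T_class :: "('k, 'b) module \<Rightarrow> ('b, 'm) rmodule \<Rightarrow> ('k, 'b) umod set" where
  "T_class B M = {N \<in> fgmod B.
     \<exists>X\<in>add_closure B {rdsum (regular_rmodule B) M}. mono_rhom B N X \<noteq> {}}"

definition C_class :: "('k, 'b) module \<Rightarrow> ('b, 'm) rmodule \<Rightarrow> ('k, 'b) umod set" where
  "C_class B M = add_closure B (fgproj B \<union> {Z. \<exists>N\<in>T_class B M. is_syzygy B N Z})"


section \<open>Every finitely generated module is isomorphic to one in \<open>fgmod\<close>\<close>

definition transport :: "('x \<Rightarrow> 'y) \<Rightarrow> ('a, 'x) rmodule \<Rightarrow> ('a, 'y) rmodule" where
  "transport \<phi> X = (let \<psi> = inv_into (carrier X) \<phi> in
     \<lparr>carrier = \<phi> ` carrier X, mult = undefined, one = undefined, zero = \<phi> \<zero>\<^bsub>X\<^esub>,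
      add = (\<lambda>u v. \<phi> (\<psi> u \<oplus>\<^bsub>X\<^esub> \<psi> v)), ract = (\<lambda>u r. \<phi> (\<psi> u \<triangleleft>\<^bsub>X\<^esub> r))\<rparr>)"

context
  fixes \<Lambda> :: "('k, 'a) module" and X :: "('a, 'x) rmodule" and \<phi> :: "'x \<Rightarrow> 'y"
  assumes X: "fg_right_module \<Lambda> X" and inj: "inj_on \<phi> (carrier X)"
begin

interpretation X: fg_right_module \<Lambda> X by (fact X)

lemma transport_simps:
  "carrier (transport \<phi> X) = \<phi> ` carrier X"
  "\<zero>\<^bsub>transport \<phi> X\<^esub> = \<phi> \<zero>\<^bsub>X\<^esub>"
  "x \<in> carrier X \<Longrightarrow> y \<in> carrier X \<Longrightarrow> \<phi> x \<oplus>\<^bsub>transport \<phi> X\<^esub> \<phi> y = \<phi> (x \<oplus>\<^bsub>X\<^esub> y)"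
  "x \<in> carrier X \<Longrightarrow> \<phi> x \<triangleleft>\<^bsub>transport \<phi> X\<^esub> r = \<phi> (x \<triangleleft>\<^bsub>X\<^esub> r)"
  by (simp_all add: transport_def Let_def inj)

lemma abelian_group_transport: "abelian_group (transport \<phi> X)"
proof (rule abelian_groupI)
  fix x assume "x \<in> carrier (transport \<phi> X)"
  then obtain u where u: "x = \<phi> u" "u \<in> carrier X" by (auto simp: transport_simps)
  show "\<exists>y\<in>carrier (transport \<phi> X). y \<oplus>\<^bsub>transport \<phi> X\<^esub> x = \<zero>\<^bsub>transport \<phi> X\<^esub>"
    using u by (intro bexI[of _ "\<phi> (\<ominus>\<^bsub>X\<^esub> u)"]) (auto simp: transport_simps X.AbGr.l_neg)
qed (auto simp: transport_simps X.AbGr.a_ac)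

interpretation Y: abelian_group "transport \<phi> X" by (fact abelian_group_transport)

lemma transport_finsum:
  assumes "finite T" and "f \<in> T \<rightarrow> carrier X"
  shows "\<phi> (\<Oplus>\<^bsub>X\<^esub>t\<in>T. f t) = (\<Oplus>\<^bsub>transport \<phi> X\<^esub>t\<in>T. \<phi> (f t))"
  using assms
proof (induction T)
  case empty
  then show ?case by (simp add: transport_simps)
next
  case (insert t T)
  then have f: "f \<in> T \<rightarrow> carrier X" "f t \<in> carrier X" by auto
  then have "(\<lambda>t. \<phi> (f t)) \<in> T \<rightarrow> carrier (transport \<phi> X)" by (auto simp: transport_simps)
  with insert.hyps f have "(\<Oplus>\<^bsub>transport \<phi> X\<^esub>t\<in>insert t T. \<phi> (f t)) =
      \<phi> (f t) \<oplus>\<^bsub>transport \<phi> X\<^esub> \<phi> (\<Oplus>\<^bsub>X\<^esub>t\<in>T. f t)"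
    by (subst insert.IH) (auto simp: Y.finsum_insert transport_simps)
  with insert.hyps f show ?case
    by (simp add: X.AbGr.finsum_insert transport_simps X.AbGr.finsum_closed)
qed

lemma fg_right_module_transport: "fg_right_module \<Lambda> (transport \<phi> X)"
proof -
  interpret R: right_module \<Lambda> "transport \<phi> X"
  proof
    fix x r s assume x: "x \<in> carrier (transport \<phi> X)" and r: "r \<in> carrier \<Lambda>" "s \<in> carrier \<Lambda>"
    then obtain u where u: "x = \<phi> u" "u \<in> carrier X" by (auto simp: transport_simps)
    show "x \<triangleleft>\<^bsub>transport \<phi> X\<^esub> (r \<oplus>\<^bsub>\<Lambda>\<^esub> s) =
        x \<triangleleft>\<^bsub>transport \<phi> X\<^esub> r \<oplus>\<^bsub>transport \<phi> X\<^esub> x \<triangleleft>\<^bsub>transport \<phi> X\<^esub> s"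
      using u r by (simp add: transport_simps X.ract_closed X.ract_add_right)
    show "x \<triangleleft>\<^bsub>transport \<phi> X\<^esub> (r \<otimes>\<^bsub>\<Lambda>\<^esub> s) =
        (x \<triangleleft>\<^bsub>transport \<phi> X\<^esub> r) \<triangleleft>\<^bsub>transport \<phi> X\<^esub> s"
      using u r by (simp add: transport_simps X.ract_closed X.ract_mult)
  qed (auto simp: transport_simps X.ract_closed X.ract_add_left X.ract_one)
  show ?thesis
  proof
    obtain T where T: "finite T" "T \<subseteq> carrier X"
      and gen: "\<And>x. x \<in> carrier X \<Longrightarrow> \<exists>a\<in>T \<rightarrow> carrier \<Lambda>. x = (\<Oplus>\<^bsub>X\<^esub>t\<in>T. t \<triangleleft>\<^bsub>X\<^esub> a t)"
      using X.finitely_generated by blast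
    have injT: "inj_on \<phi> T" using inj T(2) by (rule inj_on_subset)
    show "\<exists>T. finite T \<and> T \<subseteq> carrier (transport \<phi> X) \<and>
      (\<forall>x\<in>carrier (transport \<phi> X). \<exists>a\<in>T \<rightarrow> carrier \<Lambda>.
        x = (\<Oplus>\<^bsub>transport \<phi> X\<^esub>t\<in>T. t \<triangleleft>\<^bsub>transport \<phi> X\<^esub> a t))"
    proof (intro exI[of _ "\<phi> ` T"] conjI ballI)
      fix x assume "x \<in> carrier (transport \<phi> X)"
      then obtain u where u: "x = \<phi> u" "u \<in> carrier X" by (auto simp: transport_simps)
      from gen[OF u(2)] obtain a where a: "a \<in> T \<rightarrow> carrier \<Lambda>"
        and ua: "u = (\<Oplus>\<^bsub>X\<^esub>t\<in>T. t \<triangleleft>\<^bsub>X\<^esub> a t)" by blast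
      define b where "b = (\<lambda>y. a (inv_into T \<phi> y))"
      have b: "b (\<phi> t) = a t" if "t \<in> T" for t using that injT by (simp add: b_def)
      have mem: "(\<lambda>t. t \<triangleleft>\<^bsub>X\<^esub> a t) \<in> T \<rightarrow> carrier X"
        using a T(2) by (auto intro: X.ract_closed)
      have "x = (\<Oplus>\<^bsub>transport \<phi> X\<^esub>t\<in>T. \<phi> (t \<triangleleft>\<^bsub>X\<^esub> a t))"
        unfolding u(1) ua by (rule transport_finsum[OF T(1) mem])
      also have "\<dots> = (\<Oplus>\<^bsub>transport \<phi> X\<^esub>t\<in>T. \<phi> t \<triangleleft>\<^bsub>transport \<phi> X\<^esub> b (\<phi> t))"
        using mem T(2) by (intro Y.finsum_cong') (auto simp: transport_simps b subset_iff)
      also have "\<dots> = (\<Oplus>\<^bsub>transport \<phi> X\<^esub>t\<in>\<phi> ` T. t \<triangleleft>\<^bsub>transport \<phi> X\<^esub> b t)"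
        using mem T(2) injT
        by (intro Y.finsum_reindex[symmetric]) (auto simp: transport_simps b subset_iff)
      finally have "x = (\<Oplus>\<^bsub>transport \<phi> X\<^esub>t\<in>\<phi> ` T. t \<triangleleft>\<^bsub>transport \<phi> X\<^esub> b t)" .
      moreover have "b \<in> \<phi> ` T \<rightarrow> carrier \<Lambda>" using a b by auto
      ultimately show "\<exists>b\<in>\<phi> ` T \<rightarrow> carrier \<Lambda>. x = (\<Oplus>\<^bsub>transport \<phi> X\<^esub>t\<in>\<phi> ` T. t \<triangleleft>\<^bsub>transport \<phi> X\<^esub> b t)"
        by blast
    qed (use T in \<open>auto simp: transport_simps\<close>)
  qed
qed

lemma riso_transport: "riso \<Lambda> X (transport \<phi> X)"
  using inj by (auto simp: riso_def rhom_def transport_simps bij_betw_def X.ract_closed)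

end

text \<open>An element is determined by the scalars with which it is expanded in finite spanning sets.\<close>

theorem ex_riso_fgmod:
  assumes "fd_algebra K \<Lambda>" and "fg_right_module \<Lambda> X"
  shows "\<exists>Y\<in>fgmod \<Lambda>. riso \<Lambda> X Y"
proof -
  interpret A: fd_algebra K \<Lambda> by fact
  interpret X: fg_right_module \<Lambda> X by fact
  obtain S where S: "finite S" "S \<subseteq> carrier \<Lambda>"
    and spanS: "\<And>r. r \<in> carrier \<Lambda> \<Longrightarrow> \<exists>c\<in>S \<rightarrow> carrier K. r = (\<Oplus>\<^bsub>\<Lambda>\<^esub>s\<in>S. c s \<odot>\<^bsub>\<Lambda>\<^esub> s)"
    using A.finite_dim by blast
  obtain T where T: "finite T" "T \<subseteq> carrier X"
    and genT: "\<And>x. x \<in> carrier X \<Longrightarrow> \<exists>a\<in>T \<rightarrow> carrier \<Lambda>. x = (\<Oplus>\<^bsub>X\<^esub>t\<in>T. t \<triangleleft>\<^bsub>X\<^esub> a t)"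
    using X.finitely_generated by blast
  obtain c where c: "\<And>r. r \<in> carrier \<Lambda> \<Longrightarrow> c r \<in> S \<rightarrow> carrier K \<and> r = (\<Oplus>\<^bsub>\<Lambda>\<^esub>s\<in>S. c r s \<odot>\<^bsub>\<Lambda>\<^esub> s)"
    using spanS by metis
  obtain a where a: "\<And>x. x \<in> carrier X \<Longrightarrow> a x \<in> T \<rightarrow> carrier \<Lambda> \<and> x = (\<Oplus>\<^bsub>X\<^esub>t\<in>T. t \<triangleleft>\<^bsub>X\<^esub> a x t)"
    using genT by metis
  obtain e :: "nat \<Rightarrow> 'c \<times> 'b" where e: "T \<times> S = e ` {..<card (T \<times> S)}"
    using ex_bij_betw_nat_finite[of "T \<times> S"] S(1) T(1)
    by (metis atLeast0LessThan bij_betw_imp_surj_on finite_SigmaI)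
  define \<phi> where "\<phi> = (\<lambda>x n. c (a x (fst (e n))) (snd (e n)))"
  have "inj_on \<phi> (carrier X)"
  proof (rule inj_onI)
    fix x y assume x: "x \<in> carrier X" and y: "y \<in> carrier X" and eq: "\<phi> x = \<phi> y"
    have ax: "a x t \<in> carrier \<Lambda>" and ay: "a y t \<in> carrier \<Lambda>" if "t \<in> T" for t
      using a[OF x] a[OF y] that by auto
    have ceq: "c (a x t) s = c (a y t) s" if "t \<in> T" "s \<in> S" for t s
    proof -
      from that e obtain n where "e n = (t, s)" by (metis (no_types, lifting) SigmaI imageE)
      then show ?thesis using fun_cong[OF eq, of n] by (simp add: \<phi>_def)
    qed
    have "a x t = a y t" if t: "t \<in> T" for t
    proof -
      have "(\<Oplus>\<^bsub>\<Lambda>\<^esub>s\<in>S. c (a x t) s \<odot>\<^bsub>\<Lambda>\<^esub> s) = (\<Oplus>\<^bsub>\<Lambda>\<^esub>s\<in>S. c (a y t) s \<odot>\<^bsub>\<Lambda>\<^esub> s)"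
        using c[OF ay[OF t]] S(2) ceq[OF t]
        by (intro A.Alg.finsum_cong') (auto intro!: A.Mod.smult_closed)
      then show ?thesis using c[OF ax[OF t]] c[OF ay[OF t]] by metis
    qed
    then have "(\<Oplus>\<^bsub>X\<^esub>t\<in>T. t \<triangleleft>\<^bsub>X\<^esub> a x t) = (\<Oplus>\<^bsub>X\<^esub>t\<in>T. t \<triangleleft>\<^bsub>X\<^esub> a y t)"
      using ay T(2) by (intro X.AbGr.finsum_cong') (auto intro: X.ract_closed)
    then show "x = y" using a[OF x] a[OF y] by metis
  qed
  then show ?thesis
    using fg_right_module_transport riso_transport assms(2) by (metis fgmod_def mem_Collect_eq)
qed

end

theory Submission
  imports Defs
begin

text \<open>
  First syzygies of \<open>A\<close>-modules are killed by \<open>e\<^sub>0\<close>, so they are \<open>B\<close>-modules; up to projective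
  summands they are the modules that embed into \<open>add (B \<oplus> M)\<close>, because the elements of \<open>A\<close>
  killed by \<open>e\<^sub>0\<close> form the right module \<open>M \<oplus> B\<close>. Over modules killed by \<open>e\<^sub>0\<close> projective covers
  over \<open>A\<close> and over \<open>B\<close> agree, hence a \<open>B\<close>-module is a stable retract of a second syzygy over \<open>A\<close>
  iff it lies in \<open>C_class\<close>. So \<open>ddell S\<^sub>0 \<le> 1\<close> means that there is an exact sequence
  \<open>0 \<longrightarrow> C1 \<longrightarrow> C0 \<longrightarrow> S\<^sub>0 \<longrightarrow> 0\<close> in which \<open>C1\<close> and the syzygy of \<open>C0\<close> are stably in \<open>C_class\<close>.
  Splitting off the copies of \<open>P\<^sub>0\<close> from \<open>C1\<close> leaves a quotient \<open>F\<close> of \<open>C1\<close> in \<open>C_class\<close>, and the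
  horseshoe for \<open>M = \<Omega> S\<^sub>0\<close> becomes \<open>0 \<longrightarrow> \<Omega> C0 \<longrightarrow> M \<oplus> Q \<longrightarrow> F \<longrightarrow> 0\<close>. Conversely such
  an extension is the syzygy sequence of the pushout of \<open>P\<^sub>0\<close> along \<open>M \<longrightarrow> F\<close>.
\<close>

section \<open>Homomorphisms, submodules and quotients\<close>

text \<open>Syzygies are defined by minimal covers, but minimality is awkward to carry along. No
  Krull-Schmidt decomposition is used. Everything modulo projectives is phrased as "retract of
  \<open>V \<oplus> P\<close> with \<open>P\<close> projective", and kernels of arbitrary
  presentations stand in for minimal ones, which is harmless by Schanuel. Inflation of modules from
  \<open>B\<close> to \<open>A\<close> is exact and has two adjoints. The right adjoint
  (\<open>B_part\<close>) is exact, so inflation keeps projectives. The left one, division by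
  \<open>X e A\<close> (\<open>trace_e\<close>), sends projectives over \<open>A\<close> to
  projectives over \<open>B\<close>. It also replaces the splitting off of copies of
  \<open>P0\<close>: being functorial, it respects retracts. The bounds on \<open>ddell\<close> meet
  because the shifts cancel: at index 0 the module \<open>\<Omega> C0\<close>, at index 1 the module
  \<open>C1\<close> itself, must be a stable retract of a second syzygy, so one class governs both
  ends of the extension.\<close>

lemma (in fg_right_module) is_right_module: "right_module \<Lambda> X" ..

context right_module
begin

lemma add_self_eq_zero: "x \<in> carrier X \<Longrightarrow> x \<oplus>\<^bsub>X\<^esub> x = x \<Longrightarrow> x = \<zero>\<^bsub>X\<^esub>"
  by (metis AbGr.add.r_cancel_one')

lemma zero_ract: "r \<in> carrier \<Lambda> \<Longrightarrow> \<zero>\<^bsub>X\<^esub> \<triangleleft>\<^bsub>X\<^esub> r = \<zero>\<^bsub>X\<^esub>"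
  by (rule add_self_eq_zero) (simp_all add: ract_closed ract_add_left[symmetric])

lemma ract_zero: "x \<in> carrier X \<Longrightarrow> x \<triangleleft>\<^bsub>X\<^esub> \<zero>\<^bsub>\<Lambda>\<^esub> = \<zero>\<^bsub>X\<^esub>"
  by (rule add_self_eq_zero) (simp_all add: ract_closed ract_add_right[symmetric])

lemma neg_ract: "x \<in> carrier X \<Longrightarrow> r \<in> carrier \<Lambda> \<Longrightarrow> (\<ominus>\<^bsub>X\<^esub> x) \<triangleleft>\<^bsub>X\<^esub> r = \<ominus>\<^bsub>X\<^esub> (x \<triangleleft>\<^bsub>X\<^esub> r)"
  by (rule AbGr.minus_equality[symmetric])
    (simp_all add: ract_closed ract_add_left[symmetric] AbGr.l_neg zero_ract)

lemma minus_ract: "x \<in> carrier X \<Longrightarrow> y \<in> carrier X \<Longrightarrow> r \<in> carrier \<Lambda> \<Longrightarrow>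
    (x \<ominus>\<^bsub>X\<^esub> y) \<triangleleft>\<^bsub>X\<^esub> r = x \<triangleleft>\<^bsub>X\<^esub> r \<ominus>\<^bsub>X\<^esub> y \<triangleleft>\<^bsub>X\<^esub> r"
  by (simp add: a_minus_def ract_add_left neg_ract)

lemma ract_neg_one: "x \<in> carrier X \<Longrightarrow> x \<triangleleft>\<^bsub>X\<^esub> (\<ominus>\<^bsub>\<Lambda>\<^esub> \<one>\<^bsub>\<Lambda>\<^esub>) = \<ominus>\<^bsub>X\<^esub> x"
proof (rule AbGr.minus_equality[symmetric])
  assume x: "x \<in> carrier X"
  have "x \<triangleleft>\<^bsub>X\<^esub> (\<ominus>\<^bsub>\<Lambda>\<^esub> \<one>\<^bsub>\<Lambda>\<^esub>) \<oplus>\<^bsub>X\<^esub> x \<triangleleft>\<^bsub>X\<^esub> \<one>\<^bsub>\<Lambda>\<^esub> = \<zero>\<^bsub>X\<^esub>"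
    using x by (simp add: ract_add_right[symmetric] Alg.l_neg ract_zero)
  then show "x \<triangleleft>\<^bsub>X\<^esub> (\<ominus>\<^bsub>\<Lambda>\<^esub> \<one>\<^bsub>\<Lambda>\<^esub>) \<oplus>\<^bsub>X\<^esub> x = \<zero>\<^bsub>X\<^esub>" using x by (simp add: ract_one)
qed (simp_all add: ract_closed)

lemmas rm_simps = ract_closed ract_add_left ract_add_right ract_one zero_ract ract_zero
  neg_ract minus_ract

lemma minus_add_cancel: "x \<in> carrier X \<Longrightarrow> y \<in> carrier X \<Longrightarrow> (x \<ominus>\<^bsub>X\<^esub> y) \<oplus>\<^bsub>X\<^esub> y = x"
  by (simp add: a_minus_def AbGr.a_assoc AbGr.l_neg)

lemma add_minus_cancel: "x \<in> carrier X \<Longrightarrow> y \<in> carrier X \<Longrightarrow> (x \<oplus>\<^bsub>X\<^esub> y) \<ominus>\<^bsub>X\<^esub> y = x"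
  by (simp add: a_minus_def AbGr.a_assoc AbGr.r_neg)

lemma minus_self: "x \<in> carrier X \<Longrightarrow> x \<ominus>\<^bsub>X\<^esub> x = \<zero>\<^bsub>X\<^esub>"
  by (simp add: a_minus_def AbGr.r_neg)

lemma minus_zero: "x \<in> carrier X \<Longrightarrow> x \<ominus>\<^bsub>X\<^esub> \<zero>\<^bsub>X\<^esub> = x"
  by (simp add: a_minus_def)

lemma minus_eq_zero_iff: "x \<in> carrier X \<Longrightarrow> y \<in> carrier X \<Longrightarrow> x \<ominus>\<^bsub>X\<^esub> y = \<zero>\<^bsub>X\<^esub> \<longleftrightarrow> x = y"
  by (metis minus_add_cancel minus_self AbGr.l_zero)

lemma add_minus_add: "\<lbrakk>x \<in> carrier X; y \<in> carrier X; u \<in> carrier X; v \<in> carrier X\<rbrakk> \<Longrightarrow>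
    (x \<oplus>\<^bsub>X\<^esub> y) \<ominus>\<^bsub>X\<^esub> (u \<oplus>\<^bsub>X\<^esub> v) = (x \<ominus>\<^bsub>X\<^esub> u) \<oplus>\<^bsub>X\<^esub> (y \<ominus>\<^bsub>X\<^esub> v)"
  by (simp add: a_minus_def AbGr.minus_add AbGr.a_ac)

end

lemma rhomI:
  assumes "\<And>x. x \<in> carrier X \<Longrightarrow> f x \<in> carrier Y"
    and "\<And>x y. x \<in> carrier X \<Longrightarrow> y \<in> carrier X \<Longrightarrow> f (x \<oplus>\<^bsub>X\<^esub> y) = f x \<oplus>\<^bsub>Y\<^esub> f y"
    and "\<And>x r. x \<in> carrier X \<Longrightarrow> r \<in> carrier \<Lambda> \<Longrightarrow> f (x \<triangleleft>\<^bsub>X\<^esub> r) = f x \<triangleleft>\<^bsub>Y\<^esub> r"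
  shows "f \<in> rhom \<Lambda> X Y"
  using assms by (auto simp: rhom_def)

lemma rhom_closed: "f \<in> rhom \<Lambda> X Y \<Longrightarrow> x \<in> carrier X \<Longrightarrow> f x \<in> carrier Y"
  by (auto simp: rhom_def)

lemma rhom_add: "f \<in> rhom \<Lambda> X Y \<Longrightarrow> x \<in> carrier X \<Longrightarrow> y \<in> carrier X \<Longrightarrow>
    f (x \<oplus>\<^bsub>X\<^esub> y) = f x \<oplus>\<^bsub>Y\<^esub> f y"
  by (auto simp: rhom_def)

lemma rhom_ract: "f \<in> rhom \<Lambda> X Y \<Longrightarrow> x \<in> carrier X \<Longrightarrow> r \<in> carrier \<Lambda> \<Longrightarrow>
    f (x \<triangleleft>\<^bsub>X\<^esub> r) = f x \<triangleleft>\<^bsub>Y\<^esub> r"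
  by (auto simp: rhom_def)

lemma rhom_zero:
  assumes "right_module \<Lambda> X" and "right_module \<Lambda> Y" and f: "f \<in> rhom \<Lambda> X Y"
  shows "f \<zero>\<^bsub>X\<^esub> = \<zero>\<^bsub>Y\<^esub>"
proof -
  interpret X: right_module \<Lambda> X by fact
  interpret Y: right_module \<Lambda> Y by fact
  show ?thesis
    by (rule Y.add_self_eq_zero) (simp_all add: rhom_closed[OF f] rhom_add[OF f, symmetric])
qed

lemma rhom_neg:
  assumes "right_module \<Lambda> X" and "right_module \<Lambda> Y" and f: "f \<in> rhom \<Lambda> X Y" and x: "x \<in> carrier X"
  shows "f (\<ominus>\<^bsub>X\<^esub> x) = \<ominus>\<^bsub>Y\<^esub> f x"
proof -
  interpret X: right_module \<Lambda> X by fact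
  interpret Y: right_module \<Lambda> Y by fact
  show ?thesis
    using x by (intro Y.AbGr.minus_equality[symmetric])
      (simp_all add: rhom_closed[OF f] rhom_add[OF f, symmetric] X.AbGr.l_neg
        rhom_zero[OF assms(1-3)])
qed

lemma rhom_minus:
  assumes "right_module \<Lambda> X" and "right_module \<Lambda> Y" and f: "f \<in> rhom \<Lambda> X Y"
    and "x \<in> carrier X" and "y \<in> carrier X"
  shows "f (x \<ominus>\<^bsub>X\<^esub> y) = f x \<ominus>\<^bsub>Y\<^esub> f y"
proof -
  interpret X: right_module \<Lambda> X by fact
  show ?thesis
    using assms by (simp add: a_minus_def rhom_add[OF f] rhom_neg)
qed

lemma rhom_id: "(\<lambda>x. x) \<in> rhom \<Lambda> X X"
  by (auto simp: rhom_def)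

lemma rhom_comp: "f \<in> rhom \<Lambda> X Y \<Longrightarrow> g \<in> rhom \<Lambda> Y Z \<Longrightarrow> (\<lambda>x. g (f x)) \<in> rhom \<Lambda> X Z"
  by (auto simp: rhom_def Pi_iff)

lemma rhom_zero_map:
  assumes "right_module \<Lambda> Y"
  shows "(\<lambda>x. \<zero>\<^bsub>Y\<^esub>) \<in> rhom \<Lambda> X Y"
proof -
  interpret Y: right_module \<Lambda> Y by fact
  show ?thesis by (rule rhomI) (simp_all add: Y.rm_simps)
qed

lemma rhom_plus:
  assumes "right_module \<Lambda> Y" and f: "f \<in> rhom \<Lambda> X Y" and g: "g \<in> rhom \<Lambda> X Y"
  shows "(\<lambda>x. f x \<oplus>\<^bsub>Y\<^esub> g x) \<in> rhom \<Lambda> X Y"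
proof -
  interpret Y: right_module \<Lambda> Y by fact
  show ?thesis
    by (rule rhomI)
      (simp_all add: rhom_closed[OF f] rhom_closed[OF g] rhom_add[OF f] rhom_add[OF g]
        rhom_ract[OF f] rhom_ract[OF g] Y.rm_simps Y.AbGr.a_ac)
qed

lemma rhom_diff:
  assumes "right_module \<Lambda> Y" and f: "f \<in> rhom \<Lambda> X Y" and g: "g \<in> rhom \<Lambda> X Y"
  shows "(\<lambda>x. f x \<ominus>\<^bsub>Y\<^esub> g x) \<in> rhom \<Lambda> X Y"
proof -
  interpret Y: right_module \<Lambda> Y by fact
  show ?thesis
    by (rule rhomI)
      (simp_all add: rhom_closed[OF f] rhom_closed[OF g] rhom_add[OF f] rhom_add[OF g]
        rhom_ract[OF f] rhom_ract[OF g] Y.rm_simps Y.add_minus_add)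
qed

lemma epi_rhomI: "f \<in> rhom \<Lambda> X Y \<Longrightarrow> (\<And>y. y \<in> carrier Y \<Longrightarrow> \<exists>x\<in>carrier X. f x = y) \<Longrightarrow> f \<in> epi_rhom \<Lambda> X Y"
  by (auto simp: epi_rhom_def dest: rhom_closed intro!: equalityI)

lemma epi_rhom_rhom: "f \<in> epi_rhom \<Lambda> X Y \<Longrightarrow> f \<in> rhom \<Lambda> X Y"
  by (simp add: epi_rhom_def)

lemma epi_rhomE:
  assumes "f \<in> epi_rhom \<Lambda> X Y" and "y \<in> carrier Y"
  obtains x where "x \<in> carrier X" and "f x = y"
proof -
  have "y \<in> f ` carrier X" using assms by (simp add: epi_rhom_def)
  then show thesis using that by auto
qed

lemma epi_rhom_comp: "f \<in> epi_rhom \<Lambda> X Y \<Longrightarrow> g \<in> epi_rhom \<Lambda> Y Z \<Longrightarrow> (\<lambda>x. g (f x)) \<in> epi_rhom \<Lambda> X Z"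
  unfolding epi_rhom_def using rhom_comp by (auto simp: image_image[symmetric])

lemma in_a_kernel: "x \<in> a_kernel X Y f \<longleftrightarrow> x \<in> carrier X \<and> f x = \<zero>\<^bsub>Y\<^esub>"
  by (simp add: a_kernel_def')

lemma inj_on_rhomI:
  assumes "right_module \<Lambda> X" and "right_module \<Lambda> Y" and f: "f \<in> rhom \<Lambda> X Y"
    and "\<And>x. x \<in> carrier X \<Longrightarrow> f x = \<zero>\<^bsub>Y\<^esub> \<Longrightarrow> x = \<zero>\<^bsub>X\<^esub>"
  shows "inj_on f (carrier X)"
proof (rule inj_onI)
  interpret X: right_module \<Lambda> X by fact
  interpret Y: right_module \<Lambda> Y by fact
  fix x y assume x: "x \<in> carrier X" "y \<in> carrier X" and eq: "f x = f y"
  then have "f (x \<ominus>\<^bsub>X\<^esub> y) = \<zero>\<^bsub>Y\<^esub>"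
    by (simp add: rhom_minus[OF assms(1-3)] Y.minus_self rhom_closed[OF f])
  with assms(4) x have "x \<ominus>\<^bsub>X\<^esub> y = \<zero>\<^bsub>X\<^esub>" by simp
  then show "x = y" using x by (simp add: X.minus_eq_zero_iff)
qed

text \<open>Closure under negation comes for free: \<open>\<ominus> x\<close> is \<open>x\<close>
  acted on by the negative of the unit of the algebra.\<close>

lemma rsubmoduleI:
  assumes "right_module \<Lambda> X" and "N \<subseteq> carrier X" and "\<zero>\<^bsub>X\<^esub> \<in> N"
    and add: "\<And>x y. x \<in> N \<Longrightarrow> y \<in> N \<Longrightarrow> x \<oplus>\<^bsub>X\<^esub> y \<in> N"
    and act: "\<And>x r. x \<in> N \<Longrightarrow> r \<in> carrier \<Lambda> \<Longrightarrow> x \<triangleleft>\<^bsub>X\<^esub> r \<in> N"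
  shows "rsubmodule \<Lambda> N X"
proof -
  interpret X: right_module \<Lambda> X by fact
  have "\<ominus>\<^bsub>X\<^esub> x \<in> N" if "x \<in> N" for x
    using act[OF that, of "\<ominus>\<^bsub>\<Lambda>\<^esub> \<one>\<^bsub>\<Lambda>\<^esub>"] that assms(2) by (auto simp: X.ract_neg_one subset_iff)
  then have "subgroup N (add_monoid X)"
    using assms by (intro X.AbGr.add.subgroupI) (auto simp: a_inv_def)
  then show ?thesis using act by (auto simp: rsubmodule_def additive_subgroup_def)
qed

lemma rsubmodule_subset: "rsubmodule \<Lambda> N X \<Longrightarrow> N \<subseteq> carrier X"
  using additive_subgroup.a_subset by (auto simp: rsubmodule_def)

lemma rsubmodule_carrier: "rsubmodule \<Lambda> N X \<Longrightarrow> x \<in> N \<Longrightarrow> x \<in> carrier X"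
  using rsubmodule_subset by blast

lemma rsubmodule_zero: "rsubmodule \<Lambda> N X \<Longrightarrow> \<zero>\<^bsub>X\<^esub> \<in> N"
  using additive_subgroup.zero_closed by (auto simp: rsubmodule_def)

lemma rsubmodule_add: "rsubmodule \<Lambda> N X \<Longrightarrow> x \<in> N \<Longrightarrow> y \<in> N \<Longrightarrow> x \<oplus>\<^bsub>X\<^esub> y \<in> N"
  using additive_subgroup.a_closed by (auto simp: rsubmodule_def)

lemma rsubmodule_ract: "rsubmodule \<Lambda> N X \<Longrightarrow> x \<in> N \<Longrightarrow> r \<in> carrier \<Lambda> \<Longrightarrow> x \<triangleleft>\<^bsub>X\<^esub> r \<in> N"
  by (auto simp: rsubmodule_def)

lemma rsubmodule_neg:
  assumes "right_module \<Lambda> X" and "rsubmodule \<Lambda> N X" and "x \<in> N"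
  shows "\<ominus>\<^bsub>X\<^esub> x \<in> N"
proof -
  interpret X: right_module \<Lambda> X by fact
  show ?thesis
    using rsubmodule_ract[OF assms(2,3), of "\<ominus>\<^bsub>\<Lambda>\<^esub> \<one>\<^bsub>\<Lambda>\<^esub>"] rsubmodule_carrier[OF assms(2,3)]
    by (simp add: X.ract_neg_one)
qed

lemma rsubmodule_minus:
  "right_module \<Lambda> X \<Longrightarrow> rsubmodule \<Lambda> N X \<Longrightarrow> x \<in> N \<Longrightarrow> y \<in> N \<Longrightarrow> x \<ominus>\<^bsub>X\<^esub> y \<in> N"
  by (simp add: a_minus_def rsubmodule_add rsubmodule_neg)

lemma rsubmodule_preimage:
  assumes "right_module \<Lambda> X" and "right_module \<Lambda> Y" and f: "f \<in> rhom \<Lambda> X Y"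
    and "rsubmodule \<Lambda> N Y"
  shows "rsubmodule \<Lambda> {x \<in> carrier X. f x \<in> N} X"
proof -
  interpret X: right_module \<Lambda> X by fact
  show ?thesis
    using assms by (intro rsubmoduleI)
      (auto simp: rhom_zero X.rm_simps rhom_add[OF f] rhom_ract[OF f]
        rsubmodule_zero rsubmodule_add rsubmodule_ract)
qed

lemma rsubmodule_image:
  assumes "right_module \<Lambda> X" and "right_module \<Lambda> Y" and f: "f \<in> rhom \<Lambda> X Y"
    and N: "rsubmodule \<Lambda> N X"
  shows "rsubmodule \<Lambda> (f ` N) Y"
proof (rule rsubmoduleI)
  interpret X: right_module \<Lambda> X by fact
  note c = rsubmodule_carrier[OF N]
  show "f ` N \<subseteq> carrier Y" using c by (auto simp: rhom_closed[OF f])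
  show "\<zero>\<^bsub>Y\<^esub> \<in> f ` N" using rhom_zero[OF assms(1-3)] rsubmodule_zero[OF N] by force
  show "x \<oplus>\<^bsub>Y\<^esub> y \<in> f ` N" if "x \<in> f ` N" "y \<in> f ` N" for x y
    using that c by (auto simp: rhom_add[OF f, symmetric] rsubmodule_add[OF N])
  show "x \<triangleleft>\<^bsub>Y\<^esub> r \<in> f ` N" if "x \<in> f ` N" "r \<in> carrier \<Lambda>" for x r
    using that c by (auto simp: rhom_ract[OF f, symmetric] rsubmodule_ract[OF N])
qed fact

lemma rsubmodule_zero_set: "right_module \<Lambda> X \<Longrightarrow> rsubmodule \<Lambda> {\<zero>\<^bsub>X\<^esub>} X"
proof -
  assume "right_module \<Lambda> X"
  then interpret X: right_module \<Lambda> X .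
  show ?thesis by (rule rsubmoduleI) (auto simp: X.rm_simps X.right_module_axioms)
qed

lemma rsubmodule_whole: "right_module \<Lambda> X \<Longrightarrow> rsubmodule \<Lambda> (carrier X) X"
proof -
  assume "right_module \<Lambda> X"
  then interpret X: right_module \<Lambda> X .
  show ?thesis by (rule rsubmoduleI) (auto simp: X.rm_simps X.right_module_axioms)
qed

lemma rsubmodule_a_kernel:
  assumes "right_module \<Lambda> X" and "right_module \<Lambda> Y" and "f \<in> rhom \<Lambda> X Y"
  shows "rsubmodule \<Lambda> (a_kernel X Y f) X"
  using rsubmodule_preimage[OF assms rsubmodule_zero_set[OF assms(2)]]
  by (simp add: a_kernel_def')

lemma rsubmodule_Inter:
  assumes "right_module \<Lambda> X" and sub: "\<And>N. N \<in> F \<Longrightarrow> rsubmodule \<Lambda> N X" and "F \<noteq> {}"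
  shows "rsubmodule \<Lambda> (\<Inter>F) X"
proof (rule rsubmoduleI)
  show "\<Inter>F \<subseteq> carrier X" using assms(3) rsubmodule_subset[OF sub] by blast
qed (use assms(1) rsubmodule_zero[OF sub] rsubmodule_add[OF sub] rsubmodule_ract[OF sub] in auto)

lemma set_addI: "a \<in> N \<Longrightarrow> b \<in> L \<Longrightarrow> a \<oplus>\<^bsub>X\<^esub> b \<in> N <+>\<^bsub>X\<^esub> L"
  by (auto simp: set_add_def')

lemma set_addE:
  assumes "x \<in> N <+>\<^bsub>X\<^esub> L"
  obtains a b where "a \<in> N" and "b \<in> L" and "x = a \<oplus>\<^bsub>X\<^esub> b"
  using assms by (auto simp: set_add_def')

lemma rsubmodule_set_add:
  assumes "right_module \<Lambda> X" and N: "rsubmodule \<Lambda> N X" and L: "rsubmodule \<Lambda> L X"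
  shows "rsubmodule \<Lambda> (N <+>\<^bsub>X\<^esub> L) X"
proof (rule rsubmoduleI)
  interpret X: right_module \<Lambda> X by fact
  note c = rsubmodule_carrier[OF N] rsubmodule_carrier[OF L]
  show "N <+>\<^bsub>X\<^esub> L \<subseteq> carrier X" using c by (auto elim!: set_addE)
  show "\<zero>\<^bsub>X\<^esub> \<in> N <+>\<^bsub>X\<^esub> L"
    using set_addI[OF rsubmodule_zero[OF N] rsubmodule_zero[OF L], of X] by simp
  fix x assume "x \<in> N <+>\<^bsub>X\<^esub> L"
  then obtain a b where x: "a \<in> N" "b \<in> L" "x = a \<oplus>\<^bsub>X\<^esub> b" by (rule set_addE)
  show "x \<triangleleft>\<^bsub>X\<^esub> r \<in> N <+>\<^bsub>X\<^esub> L" if r: "r \<in> carrier \<Lambda>" for r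
    using x r c set_addI[OF rsubmodule_ract[OF N x(1) r] rsubmodule_ract[OF L x(2) r], of X]
    by (simp add: X.ract_add_left)
  fix y assume "y \<in> N <+>\<^bsub>X\<^esub> L"
  then obtain a' b' where y: "a' \<in> N" "b' \<in> L" "y = a' \<oplus>\<^bsub>X\<^esub> b'" by (rule set_addE)
  have "x \<oplus>\<^bsub>X\<^esub> y = (a \<oplus>\<^bsub>X\<^esub> a') \<oplus>\<^bsub>X\<^esub> (b \<oplus>\<^bsub>X\<^esub> b')"
    using x y c by (simp add: X.AbGr.a_ac)
  then show "x \<oplus>\<^bsub>X\<^esub> y \<in> N <+>\<^bsub>X\<^esub> L"
    using set_addI[OF rsubmodule_add[OF N x(1) y(1)] rsubmodule_add[OF L x(2) y(2)], of X] by simp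
qed fact

lemma restrict_to_simps [simp]:
  "carrier (restrict_to X N) = N" "\<zero>\<^bsub>restrict_to X N\<^esub> = \<zero>\<^bsub>X\<^esub>"
  "x \<oplus>\<^bsub>restrict_to X N\<^esub> y = x \<oplus>\<^bsub>X\<^esub> y" "x \<triangleleft>\<^bsub>restrict_to X N\<^esub> r = x \<triangleleft>\<^bsub>X\<^esub> r"
  by (simp_all add: restrict_to_def)

lemma right_module_restrict_to:
  assumes "right_module \<Lambda> X" and N: "rsubmodule \<Lambda> N X"
  shows "right_module \<Lambda> (restrict_to X N)"
proof -
  interpret X: right_module \<Lambda> X by fact
  note c = rsubmodule_carrier[OF N]
  interpret abelian_group "restrict_to X N"
  proof (rule abelian_groupI)
    show "\<exists>y\<in>carrier (restrict_to X N). y \<oplus>\<^bsub>restrict_to X N\<^esub> x = \<zero>\<^bsub>restrict_to X N\<^esub>"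
      if "x \<in> carrier (restrict_to X N)" for x
      using that c rsubmodule_neg[OF assms] by (auto intro!: bexI[of _ "\<ominus>\<^bsub>X\<^esub> x"] simp: X.AbGr.l_neg)
  qed (use c in \<open>auto simp: rsubmodule_zero[OF N] rsubmodule_add[OF N] X.AbGr.a_ac\<close>)
  show ?thesis
    by unfold_locales (use c in \<open>auto simp: rsubmodule_ract[OF N] X.rm_simps X.ract_mult\<close>)
qed

lemma rsubmodule_restrict_to:
  assumes "right_module \<Lambda> X" and "rsubmodule \<Lambda> N X" and "rsubmodule \<Lambda> L (restrict_to X N)"
  shows "rsubmodule \<Lambda> L X"
  using rsubmodule_subset[OF assms(2)] rsubmodule_subset[OF assms(3)]
    rsubmodule_zero[OF assms(3)] rsubmodule_add[OF assms(3)] rsubmodule_ract[OF assms(3)] assms(1)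
  by (intro rsubmoduleI) auto

lemma rhom_inclusion: "rsubmodule \<Lambda> N X \<Longrightarrow> (\<lambda>x. x) \<in> rhom \<Lambda> (restrict_to X N) X"
  by (auto simp: rhom_def dest: rsubmodule_carrier)

lemma rhom_corestrict:
  "f \<in> rhom \<Lambda> X Y \<Longrightarrow> (\<And>x. x \<in> carrier X \<Longrightarrow> f x \<in> N) \<Longrightarrow> f \<in> rhom \<Lambda> X (restrict_to Y N)"
  by (auto simp: rhom_def)

lemma rhom_restrict:
  "f \<in> rhom \<Lambda> X Y \<Longrightarrow> N \<subseteq> carrier X \<Longrightarrow> f \<in> rhom \<Lambda> (restrict_to X N) Y"
  by (auto simp: rhom_def subset_iff Pi_iff)

text \<open>All module axioms are equations or have witnesses that can be pushed forward, so they
  pass along any surjection compatible with the operations. The target need not be known to be a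
  group beforehand, which is what quotients require.\<close>

lemma right_module_surj_image:
  assumes "right_module \<Lambda> X" and "carrier Y = q ` carrier X" and "q \<zero>\<^bsub>X\<^esub> = \<zero>\<^bsub>Y\<^esub>"
    and "\<And>x y. x \<in> carrier X \<Longrightarrow> y \<in> carrier X \<Longrightarrow> q x \<oplus>\<^bsub>Y\<^esub> q y = q (x \<oplus>\<^bsub>X\<^esub> y)"
    and "\<And>x r. x \<in> carrier X \<Longrightarrow> r \<in> carrier \<Lambda> \<Longrightarrow> q x \<triangleleft>\<^bsub>Y\<^esub> r = q (x \<triangleleft>\<^bsub>X\<^esub> r)"
  shows "right_module \<Lambda> Y"
proof -
  interpret X: right_module \<Lambda> X by fact
  note [simp] = assms(3)[symmetric] assms(2,4,5)
  interpret abelian_group Y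
  proof (rule abelian_groupI)
    show "\<exists>y\<in>carrier Y. y \<oplus>\<^bsub>Y\<^esub> x = \<zero>\<^bsub>Y\<^esub>" if "x \<in> carrier Y" for x
    proof -
      from that obtain u where "u \<in> carrier X" "x = q u" by auto
      then show ?thesis by (intro bexI[of _ "q (\<ominus>\<^bsub>X\<^esub> u)"]) (auto simp: X.AbGr.l_neg)
    qed
  qed (auto simp: X.AbGr.a_ac)
  show ?thesis by unfold_locales (auto simp: X.rm_simps X.ract_mult)
qed

lemma quot_rmodule:
  assumes X: "right_module \<Lambda> X" and N: "rsubmodule \<Lambda> N X"
  shows "right_module \<Lambda> (quot_rmodule X N)"
    and "(\<lambda>x. N +>\<^bsub>X\<^esub> x) \<in> epi_rhom \<Lambda> X (quot_rmodule X N)"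
    and "a_kernel X (quot_rmodule X N) (\<lambda>x. N +>\<^bsub>X\<^esub> x) = N"
proof -
  interpret X: right_module \<Lambda> X by fact
  interpret N: abelian_subgroup N X
    using N X.AbGr.abelian_group_axioms by (auto simp: rsubmodule_def intro: abelian_subgroupI3)
  let ?Q = "quot_rmodule X N" and ?q = "\<lambda>x. N +>\<^bsub>X\<^esub> x"
  have c: "carrier ?Q = ?q ` carrier X"
    by (simp add: quot_rmodule_def A_RCOSETS_def' UNION_singleton_eq_range)
  have zero: "\<zero>\<^bsub>?Q\<^esub> = N" by (simp add: quot_rmodule_def)
  have z: "?q \<zero>\<^bsub>X\<^esub> = \<zero>\<^bsub>?Q\<^esub>"
    unfolding zero by (rule X.AbGr.a_coset_add_zero[OF N.a_subset])
  have a: "?q x \<oplus>\<^bsub>?Q\<^esub> ?q y = ?q (x \<oplus>\<^bsub>X\<^esub> y)" if "x \<in> carrier X" "y \<in> carrier X" for x y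
    using N.a_rcos_sum[OF that] by (simp add: quot_rmodule_def)
  have eq: "?q x = ?q y" if "x \<in> ?q y" "y \<in> carrier X" for x y
    using X.AbGr.a_repr_independence[OF that N.a_subgroup] by simp
  have r: "?q x \<triangleleft>\<^bsub>?Q\<^esub> r = ?q (x \<triangleleft>\<^bsub>X\<^esub> r)" if x: "x \<in> carrier X" and r: "r \<in> carrier \<Lambda>" for x r
  proof -
    \<comment> \<open>All representatives of a coset give the same coset after acting by
      \<open>r\<close>, so the union in the definition of the quotient action is a single
      coset.\<close>
    have "?q (y \<triangleleft>\<^bsub>X\<^esub> r) = ?q (x \<triangleleft>\<^bsub>X\<^esub> r)" if "y \<in> ?q x" for y
    proof -
      from that obtain n where n: "n \<in> N" "y = n \<oplus>\<^bsub>X\<^esub> x" unfolding a_r_coset_def' by blast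
      then have "y \<triangleleft>\<^bsub>X\<^esub> r = n \<triangleleft>\<^bsub>X\<^esub> r \<oplus>\<^bsub>X\<^esub> x \<triangleleft>\<^bsub>X\<^esub> r"
        using x r rsubmodule_carrier[OF N] by (simp add: X.rm_simps)
      then have "y \<triangleleft>\<^bsub>X\<^esub> r \<in> ?q (x \<triangleleft>\<^bsub>X\<^esub> r)"
        using rsubmodule_ract[OF N n(1) r] unfolding a_r_coset_def' by blast
      then show ?thesis using eq x r by (simp add: X.rm_simps)
    qed
    moreover have "x \<in> ?q x" using x by (rule N.a_rcos_self)
    ultimately have "(\<Union>y\<in>?q x. ?q (y \<triangleleft>\<^bsub>X\<^esub> r)) = ?q (x \<triangleleft>\<^bsub>X\<^esub> r)"
      by (intro UN_constant_eq ballI)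
    then show ?thesis by (simp add: quot_rmodule_def)
  qed
  show Q: "right_module \<Lambda> ?Q" using X c z a r by (rule right_module_surj_image)
  show "?q \<in> epi_rhom \<Lambda> X ?Q"
    unfolding epi_rhom_def using c by (simp add: rhom_def a r)
  have "?q x = N \<longleftrightarrow> x \<in> N" if x: "x \<in> carrier X" for x
    using N.a_rcos_self[OF x] eq[of x "\<zero>\<^bsub>X\<^esub>"] unfolding z zero by auto
  then show "a_kernel X ?Q ?q = N"
    using rsubmodule_carrier[OF N] by (auto simp: in_a_kernel zero)
qed

text \<open>The universal property of a quotient. It is the only way in which maps out of quotients
  are built below.\<close>

lemma rhom_factor_epi:
  assumes X: "right_module \<Lambda> X" and Y: "right_module \<Lambda> Y" and Z: "right_module \<Lambda> Z"
    and g: "g \<in> epi_rhom \<Lambda> X Y" and f: "f \<in> rhom \<Lambda> X Z"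
    and ker: "\<And>x. x \<in> carrier X \<Longrightarrow> g x = \<zero>\<^bsub>Y\<^esub> \<Longrightarrow> f x = \<zero>\<^bsub>Z\<^esub>"
  shows "\<exists>h\<in>rhom \<Lambda> Y Z. \<forall>x\<in>carrier X. h (g x) = f x"
proof -
  interpret X: right_module \<Lambda> X by fact
  interpret Y: right_module \<Lambda> Y by fact
  interpret Z: right_module \<Lambda> Z by fact
  note g' = epi_rhom_rhom[OF g]
  \<comment> \<open>An arbitrary set-theoretic section of \<open>g\<close>. It is not linear, but
    \<open>f \<circ> s\<close> is, because \<open>f\<close> takes equal values on elements with
    equal image under \<open>g\<close>.\<close>
  define s where "s = inv_into (carrier X) g"
  have s: "s y \<in> carrier X" "g (s y) = y" if "y \<in> carrier Y" for y
    using that g by (auto simp: s_def epi_rhom_def inv_into_into f_inv_into_f)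
  have wd: "f x = f y" if "x \<in> carrier X" "y \<in> carrier X" "g x = g y" for x y
  proof -
    have "f (x \<ominus>\<^bsub>X\<^esub> y) = \<zero>\<^bsub>Z\<^esub>"
      using that by (intro ker) (simp_all add: rhom_minus[OF X Y g'] Y.minus_self rhom_closed[OF g'])
    then show ?thesis
      using that by (simp add: rhom_minus[OF X Z f] Z.minus_eq_zero_iff rhom_closed[OF f])
  qed
  have fs: "f (s (g x)) = f x" if "x \<in> carrier X" for x
    using that s[OF rhom_closed[OF g' that]] by (intro wd)
  have "(\<lambda>y. f (s y)) \<in> rhom \<Lambda> Y Z"
  proof (rule rhomI)
    fix y assume y: "y \<in> carrier Y"
    show "f (s y) \<in> carrier Z" using s y by (simp add: rhom_closed[OF f])
    show "f (s (y \<triangleleft>\<^bsub>Y\<^esub> r)) = f (s y) \<triangleleft>\<^bsub>Z\<^esub> r" if r: "r \<in> carrier \<Lambda>" for r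
      using fs[of "s y \<triangleleft>\<^bsub>X\<^esub> r"] s[OF y] r
      by (simp add: rhom_ract[OF g'] rhom_ract[OF f] X.rm_simps)
    fix z assume z: "z \<in> carrier Y"
    show "f (s (y \<oplus>\<^bsub>Y\<^esub> z)) = f (s y) \<oplus>\<^bsub>Z\<^esub> f (s z)"
      using fs[of "s y \<oplus>\<^bsub>X\<^esub> s z"] s[OF y] s[OF z]
      by (simp add: rhom_add[OF g'] rhom_add[OF f])
  qed
  then show ?thesis using fs by (intro bexI[of _ "\<lambda>y. f (s y)"]) auto
qed

text \<open>Serves both to factor a map through a submodule and, when \<open>j\<close> is bijective,
  to see that its inverse is linear.\<close>

lemma rhom_lift_mono:
  assumes X: "right_module \<Lambda> X" and Y: "right_module \<Lambda> Y" and j: "j \<in> mono_rhom \<Lambda> X Y"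
    and f: "f \<in> rhom \<Lambda> Z Y" and im: "\<And>z. z \<in> carrier Z \<Longrightarrow> f z \<in> j ` carrier X"
    and Z: "right_module \<Lambda> Z"
  shows "\<exists>h\<in>rhom \<Lambda> Z X. \<forall>z\<in>carrier Z. j (h z) = f z"
proof -
  interpret X: right_module \<Lambda> X by fact
  interpret Z: right_module \<Lambda> Z by fact
  have j': "j \<in> rhom \<Lambda> X Y" and inj: "inj_on j (carrier X)" using j by (auto simp: mono_rhom_def)
  define h where "h z = inv_into (carrier X) j (f z)" for z
  have h: "h z \<in> carrier X" "j (h z) = f z" if "z \<in> carrier Z" for z
    using im[OF that] by (auto simp: h_def inv_into_into f_inv_into_f)
  have "h \<in> rhom \<Lambda> Z X"
    \<comment> \<open>The equations in \<open>X\<close> are checked after applying the injective map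
      \<open>j\<close>.\<close>
    by (rule rhomI; (rule inj_onD[OF inj])?)
      (simp_all add: h rhom_add[OF f] rhom_ract[OF f] rhom_add[OF j'] rhom_ract[OF j'] X.rm_simps Z.rm_simps)
  then show ?thesis using h by blast
qed

section \<open>Isomorphisms, retracts and direct sums\<close>

lemma riso_refl: "riso \<Lambda> X X"
  unfolding riso_def by (rule bexI[OF _ rhom_id]) (simp add: bij_betw_def)

lemma riso_inverse:
  assumes "right_module \<Lambda> X" and "right_module \<Lambda> Y" and "riso \<Lambda> X Y"
  obtains f g where "f \<in> rhom \<Lambda> X Y" and "g \<in> rhom \<Lambda> Y X"
    and "\<And>x. x \<in> carrier X \<Longrightarrow> g (f x) = x" and "\<And>y. y \<in> carrier Y \<Longrightarrow> f (g y) = y"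
proof -
  from assms(3) obtain f where f: "f \<in> rhom \<Lambda> X Y" and bij: "bij_betw f (carrier X) (carrier Y)"
    by (auto simp: riso_def)
  then have "f \<in> mono_rhom \<Lambda> X Y" by (auto simp: mono_rhom_def bij_betw_def)
  from rhom_lift_mono[OF assms(1,2) this rhom_id _ assms(2)] bij
  obtain g where g: "g \<in> rhom \<Lambda> Y X" "\<And>y. y \<in> carrier Y \<Longrightarrow> f (g y) = y"
    by (auto simp: bij_betw_def)
  have "g (f x) = x" if "x \<in> carrier X" for x
    using bij g that by (metis bij_betw_def inj_onD rhom_closed f)
  then show ?thesis using that f g by blast
qed

lemma risoI:
  assumes f: "f \<in> rhom \<Lambda> X Y" and g: "g \<in> rhom \<Lambda> Y X"
    and "\<And>x. x \<in> carrier X \<Longrightarrow> g (f x) = x" and "\<And>y. y \<in> carrier Y \<Longrightarrow> f (g y) = y"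
  shows "riso \<Lambda> X Y"
  unfolding riso_def using assms
  by (intro bexI[of _ f] bij_betw_byWitness[of _ g]) (auto dest: rhom_closed)

lemma riso_sym:
  assumes "right_module \<Lambda> X" and "right_module \<Lambda> Y" and "riso \<Lambda> X Y"
  shows "riso \<Lambda> Y X"
  by (rule riso_inverse[OF assms], rule risoI) auto

lemma riso_trans: "riso \<Lambda> X Y \<Longrightarrow> riso \<Lambda> Y Z \<Longrightarrow> riso \<Lambda> X Z"
  unfolding riso_def using rhom_comp[of _ \<Lambda> X Y _ Z] bij_betw_trans by (fastforce simp: comp_def)

text \<open>Direct summands without a named complement. Retracts compose, survive additive functors
  and make sense across carrier types, whereas an isomorphism with a direct sum would have to be
  reassociated at each step.\<close>

definition rretract :: "('k, 'a) module \<Rightarrow> ('a, 'x) rmodule \<Rightarrow> ('a, 'y) rmodule \<Rightarrow> bool" where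
  "rretract \<Lambda> X Y \<longleftrightarrow> (\<exists>f\<in>rhom \<Lambda> X Y. \<exists>g\<in>rhom \<Lambda> Y X. \<forall>x\<in>carrier X. g (f x) = x)"

lemma rretractI: "f \<in> rhom \<Lambda> X Y \<Longrightarrow> g \<in> rhom \<Lambda> Y X \<Longrightarrow> (\<And>x. x \<in> carrier X \<Longrightarrow> g (f x) = x) \<Longrightarrow>
    rretract \<Lambda> X Y"
  by (auto simp: rretract_def)

lemma rretractE:
  assumes "rretract \<Lambda> X Y"
  obtains f g where "f \<in> rhom \<Lambda> X Y" and "g \<in> rhom \<Lambda> Y X" and "\<And>x. x \<in> carrier X \<Longrightarrow> g (f x) = x"
  using assms by (auto simp: rretract_def)

lemma rretract_refl: "rretract \<Lambda> X X"
  by (rule rretractI[OF rhom_id rhom_id]) simp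

lemma rretract_trans:
  assumes "rretract \<Lambda> X Y" and "rretract \<Lambda> Y Z"
  shows "rretract \<Lambda> X Z"
proof -
  obtain f g where 1: "f \<in> rhom \<Lambda> X Y" "g \<in> rhom \<Lambda> Y X" "\<And>x. x \<in> carrier X \<Longrightarrow> g (f x) = x"
    using assms(1) by (rule rretractE) blast
  obtain f' g' where 2: "f' \<in> rhom \<Lambda> Y Z" "g' \<in> rhom \<Lambda> Z Y" "\<And>x. x \<in> carrier Y \<Longrightarrow> g' (f' x) = x"
    using assms(2) by (rule rretractE) blast
  show ?thesis
    by (rule rretractI[OF rhom_comp[OF 1(1) 2(1)] rhom_comp[OF 2(2) 1(2)]])
      (simp add: 1 2 rhom_closed[OF 1(1)])
qed

lemma riso_rretract:
  assumes "right_module \<Lambda> X" and "right_module \<Lambda> Y" and "riso \<Lambda> X Y"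
  shows "rretract \<Lambda> X Y" and "rretract \<Lambda> Y X"
  by (rule riso_inverse[OF assms], rule rretractI; assumption)+

lemma rdsum_simps [simp]:
  "carrier (rdsum X Y) = carrier X \<times> carrier Y" "\<zero>\<^bsub>rdsum X Y\<^esub> = (\<zero>\<^bsub>X\<^esub>, \<zero>\<^bsub>Y\<^esub>)"
  "(x, y) \<oplus>\<^bsub>rdsum X Y\<^esub> (x', y') = (x \<oplus>\<^bsub>X\<^esub> x', y \<oplus>\<^bsub>Y\<^esub> y')"
  "(x, y) \<triangleleft>\<^bsub>rdsum X Y\<^esub> r = (x \<triangleleft>\<^bsub>X\<^esub> r, y \<triangleleft>\<^bsub>Y\<^esub> r)"
  by (simp_all add: rdsum_def)

lemma right_module_rdsum:
  assumes "right_module \<Lambda> X" and "right_module \<Lambda> Y"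
  shows "right_module \<Lambda> (rdsum X Y)"
proof -
  interpret X: right_module \<Lambda> X by fact
  interpret Y: right_module \<Lambda> Y by fact
  interpret abelian_group "rdsum X Y"
  proof (rule abelian_groupI)
    show "\<exists>y\<in>carrier (rdsum X Y). y \<oplus>\<^bsub>rdsum X Y\<^esub> x = \<zero>\<^bsub>rdsum X Y\<^esub>"
      if "x \<in> carrier (rdsum X Y)" for x
      using that
      by (intro bexI[of _ "(\<ominus>\<^bsub>X\<^esub> fst x, \<ominus>\<^bsub>Y\<^esub> snd x)"]) (auto simp: X.AbGr.l_neg Y.AbGr.l_neg)
  qed (auto simp: X.AbGr.a_ac Y.AbGr.a_ac)
  show ?thesis
    by unfold_locales (auto simp: X.rm_simps Y.rm_simps X.ract_mult Y.ract_mult)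
qed

lemma rhom_fst: "fst \<in> rhom \<Lambda> (rdsum X Y) X"
  by (rule rhomI) auto

lemma rhom_snd: "snd \<in> rhom \<Lambda> (rdsum X Y) Y"
  by (rule rhomI) auto

lemma rhom_pair: "f \<in> rhom \<Lambda> Z X \<Longrightarrow> g \<in> rhom \<Lambda> Z Y \<Longrightarrow> (\<lambda>z. (f z, g z)) \<in> rhom \<Lambda> Z (rdsum X Y)"
  by (rule rhomI) (simp_all add: rhom_closed rhom_add rhom_ract)

lemma rhom_inl: "right_module \<Lambda> Y \<Longrightarrow> (\<lambda>x. (x, \<zero>\<^bsub>Y\<^esub>)) \<in> rhom \<Lambda> X (rdsum X Y)"
  by (intro rhom_pair rhom_id rhom_zero_map)

lemma rhom_inr: "right_module \<Lambda> X \<Longrightarrow> (\<lambda>y. (\<zero>\<^bsub>X\<^esub>, y)) \<in> rhom \<Lambda> Y (rdsum X Y)"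
  by (intro rhom_pair rhom_id rhom_zero_map)

lemma rhom_copair:
  assumes "right_module \<Lambda> Z" and "f \<in> rhom \<Lambda> X Z" and "g \<in> rhom \<Lambda> Y Z"
  shows "(\<lambda>p. f (fst p) \<oplus>\<^bsub>Z\<^esub> g (snd p)) \<in> rhom \<Lambda> (rdsum X Y) Z"
  by (intro rhom_plus assms rhom_comp[OF rhom_fst] rhom_comp[OF rhom_snd])

lemma rhom_map_prod:
  "f \<in> rhom \<Lambda> X X' \<Longrightarrow> g \<in> rhom \<Lambda> Y Y' \<Longrightarrow>
    (\<lambda>p. (f (fst p), g (snd p))) \<in> rhom \<Lambda> (rdsum X Y) (rdsum X' Y')"
  by (intro rhom_pair rhom_comp[OF rhom_fst] rhom_comp[OF rhom_snd])

lemma rretract_rdsum_cong: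
  assumes "rretract \<Lambda> X X'" and "rretract \<Lambda> Y Y'"
  shows "rretract \<Lambda> (rdsum X Y) (rdsum X' Y')"
proof -
  obtain f g where 1: "f \<in> rhom \<Lambda> X X'" "g \<in> rhom \<Lambda> X' X" "\<And>x. x \<in> carrier X \<Longrightarrow> g (f x) = x"
    using assms(1) by (rule rretractE) blast
  obtain f' g' where 2: "f' \<in> rhom \<Lambda> Y Y'" "g' \<in> rhom \<Lambda> Y' Y" "\<And>x. x \<in> carrier Y \<Longrightarrow> g' (f' x) = x"
    using assms(2) by (rule rretractE) blast
  show ?thesis
    by (rule rretractI[OF rhom_map_prod[OF 1(1) 2(1)] rhom_map_prod[OF 1(2) 2(2)]]) (auto simp: 1 2)
qed

lemma rretract_rdsum_left: "right_module \<Lambda> X \<Longrightarrow> right_module \<Lambda> Y \<Longrightarrow> rretract \<Lambda> X (rdsum X Y)"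
  by (rule rretractI[OF rhom_inl rhom_fst]) auto

lemma rretract_rdsum_assoc: "rretract \<Lambda> (rdsum (rdsum X Y) Z) (rdsum X (rdsum Y Z))"
proof (rule rretractI)
  show "(\<lambda>p. (fst (fst p), snd (fst p), snd p)) \<in> rhom \<Lambda> (rdsum (rdsum X Y) Z) (rdsum X (rdsum Y Z))"
    by (intro rhom_pair rhom_comp[OF rhom_fst] rhom_comp[OF rhom_snd] rhom_fst rhom_snd)
  show "(\<lambda>p. ((fst p, fst (snd p)), snd (snd p))) \<in> rhom \<Lambda> (rdsum X (rdsum Y Z)) (rdsum (rdsum X Y) Z)"
    by (intro rhom_pair rhom_comp[OF rhom_fst] rhom_comp[OF rhom_snd] rhom_fst rhom_snd)
qed auto

text \<open>The idempotent \<open>f \<circ> g\<close> splits \<open>Y\<close> into its image, a copy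
  of \<open>X\<close>, and its kernel, which is the kernel of \<open>g\<close>.\<close>

lemma riso_rretract_complement:
  assumes X: "right_module \<Lambda> X" and Y: "right_module \<Lambda> Y"
    and f: "f \<in> rhom \<Lambda> X Y" and g: "g \<in> rhom \<Lambda> Y X" and gf: "\<And>x. x \<in> carrier X \<Longrightarrow> g (f x) = x"
  shows "riso \<Lambda> (rdsum X (restrict_to Y (a_kernel Y X g))) Y"
proof (rule risoI)
  interpret X: right_module \<Lambda> X by fact
  interpret Y: right_module \<Lambda> Y by fact
  note c = rhom_closed[OF f] rhom_closed[OF g]
  note K = rsubmodule_a_kernel[OF Y X g]
  show "(\<lambda>p. f (fst p) \<oplus>\<^bsub>Y\<^esub> snd p) \<in> rhom \<Lambda> (rdsum X (restrict_to Y (a_kernel Y X g))) Y"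
    by (rule rhom_copair[OF Y f rhom_inclusion[OF K]])
  have "(\<lambda>y. y \<ominus>\<^bsub>Y\<^esub> f (g y)) \<in> rhom \<Lambda> Y Y"
    by (rule rhom_diff[OF Y rhom_id rhom_comp[OF g f]])
  then have "(\<lambda>y. y \<ominus>\<^bsub>Y\<^esub> f (g y)) \<in> rhom \<Lambda> Y (restrict_to Y (a_kernel Y X g))"
    by (rule rhom_corestrict) (simp add: in_a_kernel c rhom_minus[OF Y X g] gf X.minus_self)
  from rhom_pair[OF g this]
  show "(\<lambda>y. (g y, y \<ominus>\<^bsub>Y\<^esub> f (g y))) \<in> rhom \<Lambda> Y (rdsum X (restrict_to Y (a_kernel Y X g)))" .
  show "(g (f (fst p) \<oplus>\<^bsub>Y\<^esub> snd p), (f (fst p) \<oplus>\<^bsub>Y\<^esub> snd p) \<ominus>\<^bsub>Y\<^esub> f (g (f (fst p) \<oplus>\<^bsub>Y\<^esub> snd p))) = p"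
    if mem: "p \<in> carrier (rdsum X (restrict_to Y (a_kernel Y X g)))" for p
  proof -
    obtain x y where p: "p = (x, y)" "x \<in> carrier X" "y \<in> carrier Y" "g y = \<zero>\<^bsub>X\<^esub>"
      using mem by (cases p) (auto simp: in_a_kernel)
    then have "g (f x \<oplus>\<^bsub>Y\<^esub> y) = x" by (simp add: rhom_add[OF g] c gf)
    then show ?thesis
      using p Y.add_minus_cancel[of y "f x"] by (simp add: Y.AbGr.a_comm c)
  qed
  show "f (fst (g y, y \<ominus>\<^bsub>Y\<^esub> f (g y))) \<oplus>\<^bsub>Y\<^esub> snd (g y, y \<ominus>\<^bsub>Y\<^esub> f (g y)) = y"
    if "y \<in> carrier Y" for y
    using that Y.minus_add_cancel[of y "f (g y)"] by (simp add: Y.AbGr.a_comm c)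
qed

section \<open>Finite generation\<close>

lemma (in abelian_monoid) finsum_in_subset:
  assumes "finite T" and "N \<subseteq> carrier G" and "\<zero> \<in> N" and "\<And>x y. x \<in> N \<Longrightarrow> y \<in> N \<Longrightarrow> x \<oplus> y \<in> N"
    and "f \<in> T \<rightarrow> N"
  shows "(\<Oplus>t\<in>T. f t) \<in> N"
  using assms(1,5)
proof (induction T)
  case empty
  then show ?case using assms(3) by simp
next
  case (insert t T)
  then have "f \<in> T \<rightarrow> carrier G" "f t \<in> carrier G" "f \<in> T \<rightarrow> N" "f t \<in> N" using assms(2) by auto
  with insert show ?case using assms(4) by (simp add: finsum_insert)
qed

lemma (in right_module) finsum_ract:
  assumes "finite T" and "f \<in> T \<rightarrow> carrier X" and "r \<in> carrier \<Lambda>"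
  shows "(\<Oplus>\<^bsub>X\<^esub>t\<in>T. f t) \<triangleleft>\<^bsub>X\<^esub> r = (\<Oplus>\<^bsub>X\<^esub>t\<in>T. f t \<triangleleft>\<^bsub>X\<^esub> r)"
  using assms(1,2)
proof (induction T)
  case empty
  then show ?case using assms(3) by (simp add: zero_ract)
next
  case (insert t T)
  then have f: "f \<in> T \<rightarrow> carrier X" "f t \<in> carrier X" by auto
  moreover have "(\<lambda>t. f t \<triangleleft>\<^bsub>X\<^esub> r) \<in> T \<rightarrow> carrier X" using f(1) assms(3) by (auto intro: ract_closed)
  ultimately show ?case
    using insert assms(3)
    by (simp add: AbGr.finsum_insert AbGr.finsum_closed ract_add_left ract_closed)
qed

text \<open>The linear combinations of \<open>T\<close> form a submodule that contains
  \<open>T\<close>. With this criterion no later argument has to write down coefficients.\<close>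

lemma fg_right_moduleI:
  assumes X: "right_module \<Lambda> X" and T: "finite T" "T \<subseteq> carrier X"
    and gen: "\<And>N. rsubmodule \<Lambda> N X \<Longrightarrow> T \<subseteq> N \<Longrightarrow> carrier X \<subseteq> N"
  shows "fg_right_module \<Lambda> X"
proof -
  interpret X: right_module \<Lambda> X by fact
  define N where "N = {\<Oplus>\<^bsub>X\<^esub>t\<in>T. t \<triangleleft>\<^bsub>X\<^esub> a t | a. a \<in> T \<rightarrow> carrier \<Lambda>}"
  have c: "(\<lambda>t. t \<triangleleft>\<^bsub>X\<^esub> a t) \<in> T \<rightarrow> carrier X" if "a \<in> T \<rightarrow> carrier \<Lambda>" for a
    using that T(2) by (auto intro!: X.ract_closed)
  have NI: "(\<Oplus>\<^bsub>X\<^esub>t\<in>T. t \<triangleleft>\<^bsub>X\<^esub> a t) \<in> N" if "a \<in> T \<rightarrow> carrier \<Lambda>" for a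
    using that by (auto simp: N_def)
  have "rsubmodule \<Lambda> N X"
  proof (rule rsubmoduleI[OF X])
    show "N \<subseteq> carrier X" using c by (auto simp: N_def intro!: X.AbGr.finsum_closed)
    have "(\<Oplus>\<^bsub>X\<^esub>t\<in>T. t \<triangleleft>\<^bsub>X\<^esub> \<zero>\<^bsub>\<Lambda>\<^esub>) = (\<Oplus>\<^bsub>X\<^esub>t\<in>T. \<zero>\<^bsub>X\<^esub>)"
      using T(2) by (intro X.AbGr.finsum_cong') (auto simp: X.ract_zero)
    then show "\<zero>\<^bsub>X\<^esub> \<in> N" using NI[of "\<lambda>_. \<zero>\<^bsub>\<Lambda>\<^esub>"] by (simp add: X.AbGr.finsum_zero)
  next
    fix x y assume "x \<in> N" "y \<in> N"
    then obtain a b where a: "a \<in> T \<rightarrow> carrier \<Lambda>" "x = (\<Oplus>\<^bsub>X\<^esub>t\<in>T. t \<triangleleft>\<^bsub>X\<^esub> a t)"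
      and b: "b \<in> T \<rightarrow> carrier \<Lambda>" "y = (\<Oplus>\<^bsub>X\<^esub>t\<in>T. t \<triangleleft>\<^bsub>X\<^esub> b t)" by (auto simp: N_def)
    have "x \<oplus>\<^bsub>X\<^esub> y = (\<Oplus>\<^bsub>X\<^esub>t\<in>T. t \<triangleleft>\<^bsub>X\<^esub> a t \<oplus>\<^bsub>X\<^esub> t \<triangleleft>\<^bsub>X\<^esub> b t)"
      using a b c by (simp add: X.AbGr.finsum_addf)
    also have "\<dots> = (\<Oplus>\<^bsub>X\<^esub>t\<in>T. t \<triangleleft>\<^bsub>X\<^esub> (a t \<oplus>\<^bsub>\<Lambda>\<^esub> b t))"
      using a(1) b(1) T(2)
      by (intro X.AbGr.finsum_cong') (auto simp: X.ract_add_right Pi_iff subset_iff intro!: X.ract_closed)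
    finally show "x \<oplus>\<^bsub>X\<^esub> y \<in> N" using NI[of "\<lambda>t. a t \<oplus>\<^bsub>\<Lambda>\<^esub> b t"] a(1) b(1) by auto
  next
    fix x r assume "x \<in> N" and r: "r \<in> carrier \<Lambda>"
    then obtain a where a: "a \<in> T \<rightarrow> carrier \<Lambda>" "x = (\<Oplus>\<^bsub>X\<^esub>t\<in>T. t \<triangleleft>\<^bsub>X\<^esub> a t)" by (auto simp: N_def)
    have "x \<triangleleft>\<^bsub>X\<^esub> r = (\<Oplus>\<^bsub>X\<^esub>t\<in>T. (t \<triangleleft>\<^bsub>X\<^esub> a t) \<triangleleft>\<^bsub>X\<^esub> r)"
      using a c r T(1) by (simp add: X.finsum_ract)
    also have "\<dots> = (\<Oplus>\<^bsub>X\<^esub>t\<in>T. t \<triangleleft>\<^bsub>X\<^esub> (a t \<otimes>\<^bsub>\<Lambda>\<^esub> r))"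
      using a(1) r T(2)
      by (intro X.AbGr.finsum_cong') (auto simp: X.ract_mult Pi_iff subset_iff intro!: X.ract_closed)
    finally show "x \<triangleleft>\<^bsub>X\<^esub> r \<in> N" using NI[of "\<lambda>t. a t \<otimes>\<^bsub>\<Lambda>\<^esub> r"] a(1) r by auto
  qed
  moreover have "T \<subseteq> N"
  proof
    fix u assume u: "u \<in> T"
    have "(\<Oplus>\<^bsub>X\<^esub>t\<in>T. t \<triangleleft>\<^bsub>X\<^esub> (if u = t then \<one>\<^bsub>\<Lambda>\<^esub> else \<zero>\<^bsub>\<Lambda>\<^esub>)) = (\<Oplus>\<^bsub>X\<^esub>t\<in>T. if u = t then t else \<zero>\<^bsub>X\<^esub>)"
      using T(2) by (intro X.AbGr.finsum_cong') (auto simp: X.rm_simps)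
    also have "\<dots> = u" using u T by (intro X.AbGr.finsum_singleton) auto
    finally show "u \<in> N" using NI[of "\<lambda>t. if u = t then \<one>\<^bsub>\<Lambda>\<^esub> else \<zero>\<^bsub>\<Lambda>\<^esub>"] by auto
  qed
  ultimately have "carrier X \<subseteq> N" by (rule gen)
  then show ?thesis
    by unfold_locales (rule exI[of _ T], use T in \<open>auto simp: N_def subset_iff\<close>)
qed

lemma fg_right_moduleE:
  assumes "fg_right_module \<Lambda> X"
  obtains T where "finite T" and "T \<subseteq> carrier X"
    and "\<And>N. rsubmodule \<Lambda> N X \<Longrightarrow> T \<subseteq> N \<Longrightarrow> N = carrier X"
proof -
  interpret X: fg_right_module \<Lambda> X by fact
  obtain T where T: "finite T" "T \<subseteq> carrier X"
    and gen: "\<And>x. x \<in> carrier X \<Longrightarrow> \<exists>a\<in>T \<rightarrow> carrier \<Lambda>. x = (\<Oplus>\<^bsub>X\<^esub>t\<in>T. t \<triangleleft>\<^bsub>X\<^esub> a t)"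
    using X.finitely_generated by blast
  have "N = carrier X" if N: "rsubmodule \<Lambda> N X" and TN: "T \<subseteq> N" for N
  proof (rule equalityI[OF rsubmodule_subset[OF N]], rule subsetI)
    fix x assume "x \<in> carrier X"
    from gen[OF this] obtain a where a: "a \<in> T \<rightarrow> carrier \<Lambda>" "x = (\<Oplus>\<^bsub>X\<^esub>t\<in>T. t \<triangleleft>\<^bsub>X\<^esub> a t)" by blast
    show "x \<in> N"
      unfolding a(2) using T(1) rsubmodule_subset[OF N] rsubmodule_zero[OF N] rsubmodule_add[OF N]
      by (rule X.AbGr.finsum_in_subset) (use a(1) TN rsubmodule_ract[OF N] in blast)+
  qed
  with T show thesis using that by blast
qed

lemma fg_right_module_epi:
  assumes "fg_right_module \<Lambda> X" and Y: "right_module \<Lambda> Y" and f: "f \<in> epi_rhom \<Lambda> X Y"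
  shows "fg_right_module \<Lambda> Y"
proof -
  interpret X: fg_right_module \<Lambda> X by fact
  obtain T where T: "finite T" "T \<subseteq> carrier X"
    "\<And>N. rsubmodule \<Lambda> N X \<Longrightarrow> T \<subseteq> N \<Longrightarrow> N = carrier X"
    by (rule fg_right_moduleE[OF assms(1)]) blast
  note f' = epi_rhom_rhom[OF f]
  show ?thesis
  proof (rule fg_right_moduleI[OF Y, of "f ` T"])
    fix N assume N: "rsubmodule \<Lambda> N Y" and TN: "f ` T \<subseteq> N"
    have "{x \<in> carrier X. f x \<in> N} = carrier X"
      by (rule T(3)[OF rsubmodule_preimage[OF X.is_right_module Y f' N]]) (use T(2) TN in auto)
    then show "carrier Y \<subseteq> N" by (auto elim!: epi_rhomE[OF f])
  qed (use T f' in \<open>auto dest: rhom_closed\<close>)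
qed

lemma fg_right_module_rretract:
  assumes "fg_right_module \<Lambda> Y" and "right_module \<Lambda> X" and "rretract \<Lambda> X Y"
  shows "fg_right_module \<Lambda> X"
proof -
  obtain f g where "f \<in> rhom \<Lambda> X Y" "g \<in> rhom \<Lambda> Y X" "\<And>x. x \<in> carrier X \<Longrightarrow> g (f x) = x"
    using assms(3) by (rule rretractE) blast
  then have "g \<in> epi_rhom \<Lambda> Y X" by (intro epi_rhomI) (auto dest: rhom_closed)
  then show ?thesis using assms fg_right_module_epi by blast
qed

lemma fg_right_module_rdsum:
  assumes "fg_right_module \<Lambda> X" and "fg_right_module \<Lambda> Y"
  shows "fg_right_module \<Lambda> (rdsum X Y)"
proof -
  interpret X: fg_right_module \<Lambda> X by fact
  interpret Y: fg_right_module \<Lambda> Y by fact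
  note R = right_module_rdsum[OF X.is_right_module Y.is_right_module]
  obtain T where T: "finite T" "T \<subseteq> carrier X"
    "\<And>N. rsubmodule \<Lambda> N X \<Longrightarrow> T \<subseteq> N \<Longrightarrow> N = carrier X"
    by (rule fg_right_moduleE[OF assms(1)]) blast
  obtain U where U: "finite U" "U \<subseteq> carrier Y"
    "\<And>N. rsubmodule \<Lambda> N Y \<Longrightarrow> U \<subseteq> N \<Longrightarrow> N = carrier Y"
    by (rule fg_right_moduleE[OF assms(2)]) blast
  let ?i = "\<lambda>x. (x, \<zero>\<^bsub>Y\<^esub>)" and ?j = "\<lambda>y. (\<zero>\<^bsub>X\<^esub>, y)"
  show ?thesis
  proof (rule fg_right_moduleI[OF R, of "?i ` T \<union> ?j ` U"])
    fix N assume N: "rsubmodule \<Lambda> N (rdsum X Y)" and sub: "?i ` T \<union> ?j ` U \<subseteq> N"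
    have 1: "{x \<in> carrier X. ?i x \<in> N} = carrier X"
      by (rule T(3)[OF rsubmodule_preimage[OF X.is_right_module R rhom_inl[OF Y.is_right_module] N]])
        (use sub T(2) in auto)
    have 2: "{y \<in> carrier Y. ?j y \<in> N} = carrier Y"
      by (rule U(3)[OF rsubmodule_preimage[OF Y.is_right_module R rhom_inr[OF X.is_right_module] N]])
        (use sub U(2) in auto)
    show "carrier (rdsum X Y) \<subseteq> N"
    proof
      fix p assume "p \<in> carrier (rdsum X Y)"
      then obtain x y where p: "p = (x, y)" "x \<in> carrier X" "y \<in> carrier Y" by auto
      with 1 2 have "?i x \<in> N" "?j y \<in> N" by auto
      from rsubmodule_add[OF N this] show "p \<in> N" using p by simp
    qed
  qed (use T U in auto)
qed

lemma fg_right_module_zero: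
  assumes "right_module \<Lambda> X"
  shows "fg_right_module \<Lambda> (restrict_to X {\<zero>\<^bsub>X\<^esub>})"
  using right_module_restrict_to[OF assms rsubmodule_zero_set[OF assms]]
  by (rule fg_right_moduleI[of _ _ "{}"]) (use rsubmodule_zero in fastforce)+

lemma right_module_fg: "fg_right_module \<Lambda> X \<Longrightarrow> right_module \<Lambda> X"
  by (rule fg_right_module.is_right_module)

lemma fgmodD: "X \<in> fgmod \<Lambda> \<Longrightarrow> fg_right_module \<Lambda> X"
  by (simp add: fgmod_def)

lemma fgprojD: "P \<in> fgproj \<Lambda> \<Longrightarrow> fg_right_module \<Lambda> P" "P \<in> fgproj \<Lambda> \<Longrightarrow> projective \<Lambda> P"
  by (simp_all add: fgproj_def fgmod_def)

subsection \<open>A strictly monotone measure on submodules\<close>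

text \<open>The \<open>K\<close>-span of a list, with \<open>c\<close> acting as
  \<open>c \<odot> \<one>\<close>. Recursion on the list yields the filtration along which
  dimensions of subspaces are counted.\<close>

primrec kspan :: "'k ring \<Rightarrow> ('k, 'a) module \<Rightarrow> ('a, 'x) rmodule \<Rightarrow> 'x list \<Rightarrow> 'x set" where
  "kspan K \<Lambda> X [] = {\<zero>\<^bsub>X\<^esub>}"
| "kspan K \<Lambda> X (t # ts) =
    {v \<oplus>\<^bsub>X\<^esub> t \<triangleleft>\<^bsub>X\<^esub> (c \<odot>\<^bsub>\<Lambda>\<^esub> \<one>\<^bsub>\<Lambda>\<^esub>) | v c. v \<in> kspan K \<Lambda> X ts \<and> c \<in> carrier K}"

text \<open>The dimension of \<open>N\<close>, computed as the number of jumps of the filtration that \<open>ts\<close> induces.\<close>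

primrec kdim :: "'k ring \<Rightarrow> ('k, 'a) module \<Rightarrow> ('a, 'x) rmodule \<Rightarrow> 'x set \<Rightarrow> 'x list \<Rightarrow> nat" where
  "kdim K \<Lambda> X N [] = 0"
| "kdim K \<Lambda> X N (t # ts) = kdim K \<Lambda> X N ts +
    (if N \<inter> kspan K \<Lambda> X (t # ts) \<subseteq> kspan K \<Lambda> X ts then 0 else 1)"

lemma kspan_subset:
  assumes "\<zero>\<^bsub>X\<^esub> \<in> N" and "\<And>x y. x \<in> N \<Longrightarrow> y \<in> N \<Longrightarrow> x \<oplus>\<^bsub>X\<^esub> y \<in> N"
    and "\<And>x c. x \<in> N \<Longrightarrow> c \<in> carrier K \<Longrightarrow> x \<triangleleft>\<^bsub>X\<^esub> (c \<odot>\<^bsub>\<Lambda>\<^esub> \<one>\<^bsub>\<Lambda>\<^esub>) \<in> N" and "set ts \<subseteq> N"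
  shows "kspan K \<Lambda> X ts \<subseteq> N"
  using assms(4)
proof (induction ts)
  case (Cons t ts)
  then show ?case using assms(2,3) by (auto simp: subset_iff)
qed (simp add: assms(1))

lemma kdim_le: "kdim K \<Lambda> X N ts \<le> length ts"
  by (induction ts) auto

lemma kdim_mono: "N \<subseteq> N' \<Longrightarrow> kdim K \<Lambda> X N ts \<le> kdim K \<Lambda> X N' ts"
proof (induction ts)
  case (Cons t ts)
  have "N \<inter> kspan K \<Lambda> X (t # ts) \<subseteq> kspan K \<Lambda> X ts"
    if "N' \<inter> kspan K \<Lambda> X (t # ts) \<subseteq> kspan K \<Lambda> X ts"
    using that Cons.prems by (meson Int_mono order.trans order_refl)
  then show ?case using Cons by (simp del: kspan.simps)
qed simp

context fd_algebra
begin

lemma scalar_closed: "c \<in> carrier K \<Longrightarrow> c \<odot>\<^bsub>\<Lambda>\<^esub> \<one>\<^bsub>\<Lambda>\<^esub> \<in> carrier \<Lambda>"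
  by (simp add: Mod.smult_closed)

lemma scalar_add: "c \<in> carrier K \<Longrightarrow> d \<in> carrier K \<Longrightarrow>
    (c \<oplus>\<^bsub>K\<^esub> d) \<odot>\<^bsub>\<Lambda>\<^esub> \<one>\<^bsub>\<Lambda>\<^esub> = c \<odot>\<^bsub>\<Lambda>\<^esub> \<one>\<^bsub>\<Lambda>\<^esub> \<oplus>\<^bsub>\<Lambda>\<^esub> d \<odot>\<^bsub>\<Lambda>\<^esub> \<one>\<^bsub>\<Lambda>\<^esub>"
  by (simp add: Mod.smult_l_distr)

lemma scalar_mult: "c \<in> carrier K \<Longrightarrow> d \<in> carrier K \<Longrightarrow>
    (c \<otimes>\<^bsub>K\<^esub> d) \<odot>\<^bsub>\<Lambda>\<^esub> \<one>\<^bsub>\<Lambda>\<^esub> = (c \<odot>\<^bsub>\<Lambda>\<^esub> \<one>\<^bsub>\<Lambda>\<^esub>) \<otimes>\<^bsub>\<Lambda>\<^esub> (d \<odot>\<^bsub>\<Lambda>\<^esub> \<one>\<^bsub>\<Lambda>\<^esub>)"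
  by (simp add: Mod.smult_assoc1 smult_mult_left scalar_closed)

lemma mult_scalar: "c \<in> carrier K \<Longrightarrow> r \<in> carrier \<Lambda> \<Longrightarrow> r \<otimes>\<^bsub>\<Lambda>\<^esub> (c \<odot>\<^bsub>\<Lambda>\<^esub> \<one>\<^bsub>\<Lambda>\<^esub>) = c \<odot>\<^bsub>\<Lambda>\<^esub> r"
  by (simp add: smult_mult_right)

lemma scalar_mult_left: "c \<in> carrier K \<Longrightarrow> r \<in> carrier \<Lambda> \<Longrightarrow> (c \<odot>\<^bsub>\<Lambda>\<^esub> \<one>\<^bsub>\<Lambda>\<^esub>) \<otimes>\<^bsub>\<Lambda>\<^esub> r = c \<odot>\<^bsub>\<Lambda>\<^esub> r"
  by (simp add: smult_mult_left)

lemma scalar_zero: "\<zero>\<^bsub>K\<^esub> \<odot>\<^bsub>\<Lambda>\<^esub> \<one>\<^bsub>\<Lambda>\<^esub> = \<zero>\<^bsub>\<Lambda>\<^esub>"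
  by (simp add: Mod.smult_l_null)

lemma kspan_closed:
  assumes X: "right_module \<Lambda> X" and "set ts \<subseteq> carrier X"
  shows "kspan K \<Lambda> X ts \<subseteq> carrier X" and "\<zero>\<^bsub>X\<^esub> \<in> kspan K \<Lambda> X ts"
    and "u \<in> kspan K \<Lambda> X ts \<Longrightarrow> v \<in> kspan K \<Lambda> X ts \<Longrightarrow> u \<oplus>\<^bsub>X\<^esub> v \<in> kspan K \<Lambda> X ts"
    and "u \<in> kspan K \<Lambda> X ts \<Longrightarrow> c \<in> carrier K \<Longrightarrow> u \<triangleleft>\<^bsub>X\<^esub> (c \<odot>\<^bsub>\<Lambda>\<^esub> \<one>\<^bsub>\<Lambda>\<^esub>) \<in> kspan K \<Lambda> X ts"
proof -
  interpret X: right_module \<Lambda> X by fact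
  \<comment> \<open>The four closure properties need each other in the induction and are therefore
    proved as one conjunction.\<close>
  let ?ok = "\<lambda>ts. kspan K \<Lambda> X ts \<subseteq> carrier X \<and> \<zero>\<^bsub>X\<^esub> \<in> kspan K \<Lambda> X ts \<and>
    (\<forall>u\<in>kspan K \<Lambda> X ts. \<forall>v\<in>kspan K \<Lambda> X ts. u \<oplus>\<^bsub>X\<^esub> v \<in> kspan K \<Lambda> X ts) \<and>
    (\<forall>u\<in>kspan K \<Lambda> X ts. \<forall>c\<in>carrier K. u \<triangleleft>\<^bsub>X\<^esub> (c \<odot>\<^bsub>\<Lambda>\<^esub> \<one>\<^bsub>\<Lambda>\<^esub>) \<in> kspan K \<Lambda> X ts)"
  have "?ok ts"
    using assms(2)
  proof (induction ts)
    case Nil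
    then show ?case by (simp add: X.zero_ract scalar_closed)
  next
    case (Cons t ts)
    let ?s = "\<lambda>c. c \<odot>\<^bsub>\<Lambda>\<^esub> \<one>\<^bsub>\<Lambda>\<^esub>" and ?V = "kspan K \<Lambda> X ts"
    have t: "t \<in> carrier X" and ts: "set ts \<subseteq> carrier X" using Cons.prems by auto
    have V: "?V \<subseteq> carrier X" "\<zero>\<^bsub>X\<^esub> \<in> ?V" "\<And>u v. u \<in> ?V \<Longrightarrow> v \<in> ?V \<Longrightarrow> u \<oplus>\<^bsub>X\<^esub> v \<in> ?V"
      "\<And>u c. u \<in> ?V \<Longrightarrow> c \<in> carrier K \<Longrightarrow> u \<triangleleft>\<^bsub>X\<^esub> ?s c \<in> ?V"
      using Cons.IH[OF ts] by auto
    have I: "v \<oplus>\<^bsub>X\<^esub> t \<triangleleft>\<^bsub>X\<^esub> ?s c \<in> kspan K \<Lambda> X (t # ts)" if "v \<in> ?V" "c \<in> carrier K" for v c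
      using that by auto
    have 1: "kspan K \<Lambda> X (t # ts) \<subseteq> carrier X"
      using V(1) t scalar_closed by (auto intro!: X.AbGr.a_closed X.ract_closed)
    have 2: "\<zero>\<^bsub>X\<^esub> \<in> kspan K \<Lambda> X (t # ts)"
      using I[OF V(2) K.zero_closed] t by (simp add: scalar_zero X.ract_zero)
    have 34: "u \<triangleleft>\<^bsub>X\<^esub> ?s d \<in> kspan K \<Lambda> X (t # ts)" "u \<oplus>\<^bsub>X\<^esub> v \<in> kspan K \<Lambda> X (t # ts)"
      if "u \<in> kspan K \<Lambda> X (t # ts)" "v \<in> kspan K \<Lambda> X (t # ts)" "d \<in> carrier K" for u v d
    proof -
      from that(1) obtain x c where u: "x \<in> ?V" "c \<in> carrier K" "u = x \<oplus>\<^bsub>X\<^esub> t \<triangleleft>\<^bsub>X\<^esub> ?s c" by auto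
      have x: "x \<in> carrier X" using u(1) V(1) by auto
      show "u \<triangleleft>\<^bsub>X\<^esub> ?s d \<in> kspan K \<Lambda> X (t # ts)"
      proof -
        note d = that(3)
        have "u \<triangleleft>\<^bsub>X\<^esub> ?s d = x \<triangleleft>\<^bsub>X\<^esub> ?s d \<oplus>\<^bsub>X\<^esub> t \<triangleleft>\<^bsub>X\<^esub> ?s (c \<otimes>\<^bsub>K\<^esub> d)"
          using u x t d by (simp add: X.rm_simps scalar_closed scalar_mult X.ract_mult)
        then show ?thesis using I[OF V(4)[OF u(1) d], of "c \<otimes>\<^bsub>K\<^esub> d"] u d by simp
      qed
      from that(2) obtain y e where v: "y \<in> ?V" "e \<in> carrier K" "v = y \<oplus>\<^bsub>X\<^esub> t \<triangleleft>\<^bsub>X\<^esub> ?s e" by auto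
      have y: "y \<in> carrier X" using v(1) V(1) by auto
      have "u \<oplus>\<^bsub>X\<^esub> v = (x \<oplus>\<^bsub>X\<^esub> y) \<oplus>\<^bsub>X\<^esub> t \<triangleleft>\<^bsub>X\<^esub> ?s (c \<oplus>\<^bsub>K\<^esub> e)"
        using u v x y t by (simp add: X.rm_simps scalar_closed scalar_add X.AbGr.a_ac)
      then show "u \<oplus>\<^bsub>X\<^esub> v \<in> kspan K \<Lambda> X (t # ts)"
        using I[OF V(3)[OF u(1) v(1)], of "c \<oplus>\<^bsub>K\<^esub> e"] u v by simp
    qed
    show ?case using 1 2 34 by blast
  qed
  then show "kspan K \<Lambda> X ts \<subseteq> carrier X" and "\<zero>\<^bsub>X\<^esub> \<in> kspan K \<Lambda> X ts"
    and "u \<in> kspan K \<Lambda> X ts \<Longrightarrow> v \<in> kspan K \<Lambda> X ts \<Longrightarrow> u \<oplus>\<^bsub>X\<^esub> v \<in> kspan K \<Lambda> X ts"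
    and "u \<in> kspan K \<Lambda> X ts \<Longrightarrow> c \<in> carrier K \<Longrightarrow> u \<triangleleft>\<^bsub>X\<^esub> (c \<odot>\<^bsub>\<Lambda>\<^esub> \<one>\<^bsub>\<Lambda>\<^esub>) \<in> kspan K \<Lambda> X ts"
    by blast+
qed

lemma set_subset_kspan:
  assumes X: "right_module \<Lambda> X" and "set ts \<subseteq> carrier X"
  shows "set ts \<subseteq> kspan K \<Lambda> X ts"
  using assms(2)
proof (induction ts)
  case (Cons t ts)
  interpret X: right_module \<Lambda> X by fact
  have t: "t \<in> carrier X" and ts: "set ts \<subseteq> carrier X" using Cons.prems by auto
  have I: "v \<oplus>\<^bsub>X\<^esub> t \<triangleleft>\<^bsub>X\<^esub> (c \<odot>\<^bsub>\<Lambda>\<^esub> \<one>\<^bsub>\<Lambda>\<^esub>) \<in> kspan K \<Lambda> X (t # ts)"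
    if "v \<in> kspan K \<Lambda> X ts" "c \<in> carrier K" for v c
    using that by auto
  have "t \<in> kspan K \<Lambda> X (t # ts)"
    using I[OF kspan_closed(2)[OF X ts] K.one_closed] t by (simp add: X.ract_one Mod.smult_one)
  moreover have "u \<in> kspan K \<Lambda> X (t # ts)" if "u \<in> kspan K \<Lambda> X ts" for u
    using I[OF that K.zero_closed] t kspan_closed(1)[OF X ts] that
    by (auto simp: scalar_zero X.ract_zero subset_iff)
  ultimately show ?case using Cons.IH[OF ts] by (auto simp del: kspan.simps)
qed simp

text \<open>The products of module generators with a \<open>K\<close>-spanning set of the algebra
  span \<open>X\<close> over \<open>K\<close>.\<close>

lemma ex_kspan_carrier:
  assumes "fg_right_module \<Lambda> X"
  shows "\<exists>ts. set ts \<subseteq> carrier X \<and> kspan K \<Lambda> X ts = carrier X"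
proof -
  interpret X: fg_right_module \<Lambda> X by fact
  note R = X.is_right_module
  obtain S where S: "finite S" "S \<subseteq> carrier \<Lambda>"
    and spanS: "\<And>r. r \<in> carrier \<Lambda> \<Longrightarrow> \<exists>c\<in>S \<rightarrow> carrier K. r = (\<Oplus>\<^bsub>\<Lambda>\<^esub>s\<in>S. c s \<odot>\<^bsub>\<Lambda>\<^esub> s)"
    using finite_dim by blast
  obtain T where T: "finite T" "T \<subseteq> carrier X"
    and gen: "\<And>x. x \<in> carrier X \<Longrightarrow> \<exists>a\<in>T \<rightarrow> carrier \<Lambda>. x = (\<Oplus>\<^bsub>X\<^esub>t\<in>T. t \<triangleleft>\<^bsub>X\<^esub> a t)"
    using X.finitely_generated by blast
  obtain ts where ts: "set ts = (\<lambda>(t, s). t \<triangleleft>\<^bsub>X\<^esub> s) ` (T \<times> S)"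
    using finite_list[of "(\<lambda>(t, s). t \<triangleleft>\<^bsub>X\<^esub> s) ` (T \<times> S)"] S(1) T(1) by auto
  have tsX: "set ts \<subseteq> carrier X"
    unfolding ts using S T by (auto intro!: X.ract_closed)
  let ?V = "kspan K \<Lambda> X ts"
  note V = kspan_closed[OF R tsX]
  have tV: "t \<triangleleft>\<^bsub>X\<^esub> r \<in> ?V" if t: "t \<in> T" and r: "r \<in> carrier \<Lambda>" for t r
  proof -
    from spanS[OF r] obtain c where c: "c \<in> S \<rightarrow> carrier K" "r = (\<Oplus>\<^bsub>\<Lambda>\<^esub>s\<in>S. c s \<odot>\<^bsub>\<Lambda>\<^esub> s)" by blast
    have tX: "t \<in> carrier X" using t T(2) by auto
    have "(\<Oplus>\<^bsub>\<Lambda>\<^esub>s\<in>S. c s \<odot>\<^bsub>\<Lambda>\<^esub> s) \<in> {r \<in> carrier \<Lambda>. t \<triangleleft>\<^bsub>X\<^esub> r \<in> ?V}"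
      using S(1)
    proof (rule Alg.finsum_in_subset)
      show "(\<lambda>s. c s \<odot>\<^bsub>\<Lambda>\<^esub> s) \<in> S \<rightarrow> {r \<in> carrier \<Lambda>. t \<triangleleft>\<^bsub>X\<^esub> r \<in> ?V}"
      proof (rule Pi_I, rule CollectI, rule conjI)
        fix s assume s: "s \<in> S"
        then have cs: "c s \<in> carrier K" "s \<in> carrier \<Lambda>" using c S(2) by auto
        then show "c s \<odot>\<^bsub>\<Lambda>\<^esub> s \<in> carrier \<Lambda>" by (rule Mod.smult_closed)
        have "t \<triangleleft>\<^bsub>X\<^esub> s \<in> ?V" using set_subset_kspan[OF R tsX] ts t s by force
        then show "t \<triangleleft>\<^bsub>X\<^esub> (c s \<odot>\<^bsub>\<Lambda>\<^esub> s) \<in> ?V"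
          using V(4)[of "t \<triangleleft>\<^bsub>X\<^esub> s" "c s"] cs tX
          by (simp add: X.ract_mult[symmetric] scalar_closed mult_scalar)
      qed
    qed (use V tX in \<open>auto simp: X.ract_zero X.ract_add_right\<close>)
    then show ?thesis using c(2) by simp
  qed
  have "x \<in> ?V" if "x \<in> carrier X" for x
  proof -
    from gen[OF that] obtain a where a: "a \<in> T \<rightarrow> carrier \<Lambda>" "x = (\<Oplus>\<^bsub>X\<^esub>t\<in>T. t \<triangleleft>\<^bsub>X\<^esub> a t)" by blast
    show ?thesis unfolding a(2) using T(1) V(1-3)
      by (rule X.AbGr.finsum_in_subset) (use a(1) tV in blast)+
  qed
  then show ?thesis using V(1) tsX by blast
qed

text \<open>Since \<open>N \<subseteq> N'\<close>, every jump of \<open>N\<close> is a jump of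
  \<open>N'\<close>, so equal counts mean equal sets of jumps. At a jump, an element of
  \<open>N\<close> with a nonzero coefficient at \<open>t\<close> can be used to clear that
  coefficient in an element of \<open>N'\<close>, and induction applies.\<close>

lemma kdim_eq:
  assumes X: "right_module \<Lambda> X" and N: "rsubmodule \<Lambda> N X" and N': "rsubmodule \<Lambda> N' X"
    and NN: "N \<subseteq> N'" and "set ts \<subseteq> carrier X" and "kdim K \<Lambda> X N ts = kdim K \<Lambda> X N' ts"
  shows "N' \<inter> kspan K \<Lambda> X ts \<subseteq> N"
  using assms(5,6)
proof (induction ts)
  case Nil
  then show ?case using rsubmodule_zero[OF N] by auto
next
  case (Cons t ts)
  interpret X: right_module \<Lambda> X by fact
  let ?s = "\<lambda>c. c \<odot>\<^bsub>\<Lambda>\<^esub> \<one>\<^bsub>\<Lambda>\<^esub>" and ?V = "kspan K \<Lambda> X ts" and ?W = "kspan K \<Lambda> X (t # ts)"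
  have t: "t \<in> carrier X" and ts: "set ts \<subseteq> carrier X" using Cons.prems by auto
  note V = kspan_closed[OF X ts]
  have le: "kdim K \<Lambda> X N ts \<le> kdim K \<Lambda> X N' ts" by (rule kdim_mono[OF NN])
  have "N' \<inter> ?W \<subseteq> ?V \<Longrightarrow> N \<inter> ?W \<subseteq> ?V" using NN by blast
  with Cons.prems(2) le have eq: "kdim K \<Lambda> X N ts = kdim K \<Lambda> X N' ts"
    and jump: "N \<inter> ?W \<subseteq> ?V \<Longrightarrow> N' \<inter> ?W \<subseteq> ?V"
    by (auto simp del: kspan.simps split: if_splits)
  note IH = Cons.IH[OF ts eq]
  show ?case
  proof
    fix x assume x: "x \<in> N' \<inter> ?W"
    show "x \<in> N"
    proof (cases "x \<in> ?V")
      case True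
      then show ?thesis using x IH by blast
    next
      case False
      with x jump obtain z where z: "z \<in> N" "z \<in> ?W" "z \<notin> ?V" by blast
      obtain v c where v: "v \<in> ?V" "c \<in> carrier K" "x = v \<oplus>\<^bsub>X\<^esub> t \<triangleleft>\<^bsub>X\<^esub> ?s c" using x by auto
      obtain w d where w: "w \<in> ?V" "d \<in> carrier K" "z = w \<oplus>\<^bsub>X\<^esub> t \<triangleleft>\<^bsub>X\<^esub> ?s d" using z(2) by auto
      have vw: "v \<in> carrier X" "w \<in> carrier X" using v w V(1) by auto
      have "d \<noteq> \<zero>\<^bsub>K\<^esub>" using z(3) w t vw by (auto simp: scalar_zero X.ract_zero)
      then have d: "inv\<^bsub>K\<^esub> d \<in> carrier K" "d \<otimes>\<^bsub>K\<^esub> inv\<^bsub>K\<^esub> d = \<one>\<^bsub>K\<^esub>"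
        using w(2) K.field_Units by auto
      \<comment> \<open>The scalar \<open>- c / d\<close>, chosen so that \<open>t\<close> has
        coefficient zero in \<open>x \<oplus> z e\<close>.\<close>
      define e where "e = \<ominus>\<^bsub>K\<^esub> (inv\<^bsub>K\<^esub> d \<otimes>\<^bsub>K\<^esub> c)"
      have e: "e \<in> carrier K" using d v by (simp add: e_def)
      have "d \<otimes>\<^bsub>K\<^esub> e = \<ominus>\<^bsub>K\<^esub> (d \<otimes>\<^bsub>K\<^esub> (inv\<^bsub>K\<^esub> d \<otimes>\<^bsub>K\<^esub> c))"
        using d(1) v(2) w(2) by (simp add: e_def K.r_minus)
      also have "d \<otimes>\<^bsub>K\<^esub> (inv\<^bsub>K\<^esub> d \<otimes>\<^bsub>K\<^esub> c) = c"
        using d v(2) w(2) by (simp add: K.m_assoc[symmetric])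
      finally have de: "c \<oplus>\<^bsub>K\<^esub> d \<otimes>\<^bsub>K\<^esub> e = \<zero>\<^bsub>K\<^esub>" using v(2) by (simp add: K.r_neg)
      have "x \<oplus>\<^bsub>X\<^esub> z \<triangleleft>\<^bsub>X\<^esub> ?s e = (v \<oplus>\<^bsub>X\<^esub> w \<triangleleft>\<^bsub>X\<^esub> ?s e) \<oplus>\<^bsub>X\<^esub> t \<triangleleft>\<^bsub>X\<^esub> ?s (c \<oplus>\<^bsub>K\<^esub> d \<otimes>\<^bsub>K\<^esub> e)"
        using v w e t vw
        by (simp add: X.rm_simps scalar_closed scalar_add scalar_mult X.ract_mult X.AbGr.a_ac)
      also have "\<dots> = v \<oplus>\<^bsub>X\<^esub> w \<triangleleft>\<^bsub>X\<^esub> ?s e"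
        using v w e t vw by (simp add: de scalar_zero X.ract_zero X.ract_closed scalar_closed)
      finally have "x \<oplus>\<^bsub>X\<^esub> z \<triangleleft>\<^bsub>X\<^esub> ?s e \<in> ?V" using V(3)[OF v(1) V(4)[OF w(1) e]] by simp
      moreover have ze: "z \<triangleleft>\<^bsub>X\<^esub> ?s e \<in> N" using rsubmodule_ract[OF N z(1)] e scalar_closed by simp
      then have "x \<oplus>\<^bsub>X\<^esub> z \<triangleleft>\<^bsub>X\<^esub> ?s e \<in> N'" using x NN rsubmodule_add[OF N'] by blast
      ultimately have "x \<oplus>\<^bsub>X\<^esub> z \<triangleleft>\<^bsub>X\<^esub> ?s e \<in> N" using IH by blast
      from rsubmodule_minus[OF X N this ze] show "x \<in> N"
        using x rsubmodule_carrier[OF N'] rsubmodule_carrier[OF N ze]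
        by (simp add: X.add_minus_cancel)
    qed
  qed
qed

text \<open>Bounded, monotone, and strict on submodules: this is all that is used of dimension.
  Ascending and descending chain conditions both become the choice of an extremal value of
  \<open>\<mu>\<close>.\<close>

lemma ex_submodule_measure:
  fixes X :: "('a, 'x) rmodule"
  assumes "fg_right_module \<Lambda> X"
  shows "\<exists>(\<mu> :: 'x set \<Rightarrow> nat) n. (\<forall>N. \<mu> N \<le> n) \<and> (\<forall>N N'. N \<subseteq> N' \<longrightarrow> \<mu> N \<le> \<mu> N') \<and>
    (\<forall>N N'. rsubmodule \<Lambda> N X \<longrightarrow> rsubmodule \<Lambda> N' X \<longrightarrow> N \<subseteq> N' \<longrightarrow> \<mu> N' \<le> \<mu> N \<longrightarrow> N = N')"
proof -
  obtain ts where ts: "set ts \<subseteq> carrier X" "kspan K \<Lambda> X ts = carrier X"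
    using ex_kspan_carrier[OF assms] by blast
  show ?thesis
  proof (intro exI conjI allI impI)
    fix N N' assume N: "rsubmodule \<Lambda> N X" and N': "rsubmodule \<Lambda> N' X" and sub: "N \<subseteq> N'"
      and le: "kdim K \<Lambda> X N' ts \<le> kdim K \<Lambda> X N ts"
    then have "kdim K \<Lambda> X N ts = kdim K \<Lambda> X N' ts" using kdim_mono[OF sub, of K \<Lambda> X ts] by simp
    from kdim_eq[OF right_module_fg[OF assms] N N' sub ts(1) this] show "N = N'"
      using ts(2) sub rsubmodule_subset[OF N'] by auto
  qed (rule kdim_le, erule kdim_mono)
qed

text \<open>Noetherianness: a finite subset of \<open>N\<close> whose generated submodule has the
  largest measure generates \<open>N\<close>, as adding one more element cannot enlarge it.\<close>

lemma fg_submodule: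
  assumes fg: "fg_right_module \<Lambda> X" and N: "rsubmodule \<Lambda> N X"
  shows "fg_right_module \<Lambda> (restrict_to X N)"
proof -
  note X = right_module_fg[OF fg]
  obtain \<mu> :: "_ \<Rightarrow> nat" and n where \<mu>: "\<And>N. \<mu> N \<le> n"
    "\<And>N N'. rsubmodule \<Lambda> N X \<Longrightarrow> rsubmodule \<Lambda> N' X \<Longrightarrow> N \<subseteq> N' \<Longrightarrow> \<mu> N' \<le> \<mu> N \<Longrightarrow> N = N'"
    using ex_submodule_measure[OF fg] by metis
  define sp where "sp T = \<Inter>{L. rsubmodule \<Lambda> L X \<and> T \<subseteq> L}" for T
  have sp: "rsubmodule \<Lambda> (sp T) X" if "T \<subseteq> carrier X" for T
    unfolding sp_def using that rsubmodule_whole[OF X] by (intro rsubmodule_Inter[OF X]) auto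
  have "\<exists>T. (finite T \<and> T \<subseteq> N) \<and> (\<forall>U. finite U \<and> U \<subseteq> N \<longrightarrow> \<mu> (sp U) \<le> \<mu> (sp T))"
    \<comment> \<open>The maximum principle asks for a strict upper bound, hence
      \<open>Suc n\<close>.\<close>
    by (rule ex_has_greatest_nat[of _ "{}" _ "Suc n"]) (use \<mu>(1) in \<open>auto simp: less_Suc_eq_le\<close>)
  then obtain T where T: "finite T" "T \<subseteq> N"
    and max: "\<And>U. finite U \<Longrightarrow> U \<subseteq> N \<Longrightarrow> \<mu> (sp U) \<le> \<mu> (sp T)" by blast
  have TX: "T \<subseteq> carrier X" using T(2) rsubmodule_subset[OF N] by blast
  have "x \<in> sp T" if x: "x \<in> N" for x
  proof -
    have "sp T \<subseteq> sp (insert x T)" by (auto simp: sp_def)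
    then have "sp T = sp (insert x T)"
      using x T TX rsubmodule_carrier[OF N x] max[of "insert x T"] by (intro \<mu>(2) sp) auto
    moreover have "x \<in> sp (insert x T)" by (auto simp: sp_def)
    ultimately show ?thesis by simp
  qed
  then show ?thesis
    by (intro fg_right_moduleI[OF right_module_restrict_to[OF X N], of T])
      (use T rsubmodule_restrict_to[OF X N] in \<open>auto simp: sp_def\<close>)
qed

text \<open>Cosets live on a type of sets, so the quotient is replaced by an isomorphic copy in
  \<open>fgmod\<close>.\<close>

lemma ex_quotient:
  assumes fg: "fg_right_module \<Lambda> X" and N: "rsubmodule \<Lambda> N X"
  shows "\<exists>Y\<in>fgmod \<Lambda>. \<exists>g\<in>epi_rhom \<Lambda> X Y. a_kernel X Y g = N"
proof -
  note X = right_module_fg[OF fg]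
  note Q = quot_rmodule[OF X N]
  have "fg_right_module \<Lambda> (quot_rmodule X N)" by (rule fg_right_module_epi[OF fg Q(1,2)])
  with ex_riso_fgmod[OF fd_algebra_axioms]
  obtain Y where Y: "Y \<in> fgmod \<Lambda>" "riso \<Lambda> (quot_rmodule X N) Y" by blast
  note RY = right_module_fg[OF fgmodD[OF Y(1)]]
  obtain f where f: "f \<in> rhom \<Lambda> (quot_rmodule X N) Y"
    "bij_betw f (carrier (quot_rmodule X N)) (carrier Y)" using Y(2) by (auto simp: riso_def)
  then have fe: "f \<in> epi_rhom \<Lambda> (quot_rmodule X N) Y" by (auto simp: epi_rhom_def bij_betw_def)
  let ?g = "\<lambda>x. f (N +>\<^bsub>X\<^esub> x)"
  have "f u = \<zero>\<^bsub>Y\<^esub> \<longleftrightarrow> u = \<zero>\<^bsub>quot_rmodule X N\<^esub>" if "u \<in> carrier (quot_rmodule X N)" for u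
    using f(2) rhom_zero[OF Q(1) RY f(1)] that rsubmodule_zero[OF rsubmodule_whole[OF Q(1)]]
    by (metis bij_betw_def inj_onD)
  then have "a_kernel X Y ?g = N"
    using Q(3) rhom_closed[OF epi_rhom_rhom[OF Q(2)]] by (auto simp: in_a_kernel set_eq_iff)
  then show ?thesis using Y(1) epi_rhom_comp[OF Q(2) fe] by blast
qed

end

section \<open>Projective modules and syzygies\<close>

text \<open>Pointwise separation by maps to \<open>C\<close>. For finitely generated modules this
  amounts to an embedding into a finite power of \<open>C\<close>, but it passes to submodules,
  retracts and direct sums without any choice of such a power.\<close>

definition cogenerated ::
  "('k, 'a) module \<Rightarrow> ('a, 'x) rmodule \<Rightarrow> ('a, 'y) rmodule \<Rightarrow> bool" where
  "cogenerated \<Lambda> X C \<longleftrightarrow> (\<forall>x\<in>carrier X. x \<noteq> \<zero>\<^bsub>X\<^esub> \<longrightarrow> (\<exists>h\<in>rhom \<Lambda> X C. h x \<noteq> \<zero>\<^bsub>C\<^esub>))"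

lemma cogeneratedE:
  assumes "cogenerated \<Lambda> X C" and "x \<in> carrier X" and "x \<noteq> \<zero>\<^bsub>X\<^esub>"
  obtains h where "h \<in> rhom \<Lambda> X C" and "h x \<noteq> \<zero>\<^bsub>C\<^esub>"
  using assms by (auto simp: cogenerated_def)

lemma cogenerated_inj:
  assumes "right_module \<Lambda> X" and "right_module \<Lambda> Y" and f: "f \<in> rhom \<Lambda> X Y"
    and inj: "inj_on f (carrier X)" and Y: "cogenerated \<Lambda> Y C"
  shows "cogenerated \<Lambda> X C"
  unfolding cogenerated_def
proof (intro ballI impI)
  interpret X: right_module \<Lambda> X by fact
  fix x assume x: "x \<in> carrier X" "x \<noteq> \<zero>\<^bsub>X\<^esub>"
  then have "f x \<noteq> \<zero>\<^bsub>Y\<^esub>"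
    using inj_onD[OF inj, of x "\<zero>\<^bsub>X\<^esub>"] rhom_zero[OF assms(1-3)] by auto
  with Y rhom_closed[OF f x(1)] obtain h where "h \<in> rhom \<Lambda> Y C" "h (f x) \<noteq> \<zero>\<^bsub>C\<^esub>"
    by (rule cogeneratedE)
  then show "\<exists>h\<in>rhom \<Lambda> X C. h x \<noteq> \<zero>\<^bsub>C\<^esub>"
    using rhom_comp[OF f] by (intro bexI[of _ "\<lambda>x. h (f x)"])
qed

lemma cogenerated_rretract:
  assumes "right_module \<Lambda> X" and "right_module \<Lambda> Y" and "rretract \<Lambda> X Y" and "cogenerated \<Lambda> Y C"
  shows "cogenerated \<Lambda> X C"
proof -
  obtain f g where f: "f \<in> rhom \<Lambda> X Y" "\<And>x. x \<in> carrier X \<Longrightarrow> g (f x) = x"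
    using assms(3) by (rule rretractE) blast
  then have "inj_on f (carrier X)" by (metis inj_onI)
  then show ?thesis using cogenerated_inj assms f by blast
qed

lemma cogenerated_rdsum:
  assumes "cogenerated \<Lambda> X C" and "cogenerated \<Lambda> Y C"
  shows "cogenerated \<Lambda> (rdsum X Y) C"
  unfolding cogenerated_def
proof (intro ballI impI)
  fix p assume p: "p \<in> carrier (rdsum X Y)" and "p \<noteq> \<zero>\<^bsub>rdsum X Y\<^esub>"
  then consider "fst p \<in> carrier X" "fst p \<noteq> \<zero>\<^bsub>X\<^esub>" | "snd p \<in> carrier Y" "snd p \<noteq> \<zero>\<^bsub>Y\<^esub>"
    by (cases p) auto
  then show "\<exists>h\<in>rhom \<Lambda> (rdsum X Y) C. h p \<noteq> \<zero>\<^bsub>C\<^esub>"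
  proof cases
    case 1
    with assms(1) obtain h where "h \<in> rhom \<Lambda> X C" "h (fst p) \<noteq> \<zero>\<^bsub>C\<^esub>" by (rule cogeneratedE)
    then show ?thesis using rhom_comp[OF rhom_fst] by (intro bexI[of _ "\<lambda>p. h (fst p)"])
  next
    case 2
    with assms(2) obtain h where "h \<in> rhom \<Lambda> Y C" "h (snd p) \<noteq> \<zero>\<^bsub>C\<^esub>" by (rule cogeneratedE)
    then show ?thesis using rhom_comp[OF rhom_snd] by (intro bexI[of _ "\<lambda>p. h (snd p)"])
  qed
qed

lemma regular_rmodule_simps [simp]:
  "carrier (regular_rmodule \<Lambda>) = carrier \<Lambda>" "\<zero>\<^bsub>regular_rmodule \<Lambda>\<^esub> = \<zero>\<^bsub>\<Lambda>\<^esub>"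
  "x \<oplus>\<^bsub>regular_rmodule \<Lambda>\<^esub> y = x \<oplus>\<^bsub>\<Lambda>\<^esub> y" "x \<triangleleft>\<^bsub>regular_rmodule \<Lambda>\<^esub> r = x \<otimes>\<^bsub>\<Lambda>\<^esub> r"
  by (simp_all add: regular_rmodule_def)

lemma rhom_regular:
  assumes "right_module \<Lambda> X" and "x \<in> carrier X"
  shows "(\<lambda>r. x \<triangleleft>\<^bsub>X\<^esub> r) \<in> rhom \<Lambda> (regular_rmodule \<Lambda>) X"
proof -
  interpret X: right_module \<Lambda> X by fact
  show ?thesis using assms(2) by (intro rhomI) (simp_all add: X.rm_simps X.ract_mult)
qed

lemma right_module_regular:
  assumes "ring \<Lambda>"
  shows "right_module \<Lambda> (regular_rmodule \<Lambda>)"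
proof -
  interpret ring \<Lambda> by fact
  interpret A: abelian_group "regular_rmodule \<Lambda>"
    by (rule abelian_groupI) (auto simp: a_ac intro: bexI[of _ "\<ominus>\<^bsub>\<Lambda>\<^esub> x" for x] l_neg)
  show ?thesis
    by unfold_locales (auto simp: l_distr r_distr m_assoc)
qed

lemma rhom_mult_left:
  assumes "ring \<Lambda>" and "x \<in> carrier \<Lambda>"
  shows "(\<lambda>r. x \<otimes>\<^bsub>\<Lambda>\<^esub> r) \<in> rhom \<Lambda> (regular_rmodule \<Lambda>) (regular_rmodule \<Lambda>)"
  using rhom_regular[OF right_module_regular[OF assms(1)], of x] assms(2) by simp

lemma fg_regular:
  assumes "ring \<Lambda>"
  shows "fg_right_module \<Lambda> (regular_rmodule \<Lambda>)"
proof -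
  interpret ring \<Lambda> by fact
  show ?thesis
    by (rule fg_right_moduleI[OF right_module_regular[OF assms], of "{\<one>\<^bsub>\<Lambda>\<^esub>}"])
      (use rsubmodule_ract[of _ _ "regular_rmodule \<Lambda>" "\<one>\<^bsub>\<Lambda>\<^esub>"] in fastforce)+
qed

lemma cogenerated_regular: "cogenerated \<Lambda> (regular_rmodule \<Lambda>) (regular_rmodule \<Lambda>)"
  unfolding cogenerated_def by (intro ballI impI bexI[OF _ rhom_id])

lemma riso_rdsum_cong:
  assumes "riso \<Lambda> X X'" and "riso \<Lambda> Y Y'"
  shows "riso \<Lambda> (rdsum X Y) (rdsum X' Y')"
proof -
  obtain f g where f: "f \<in> rhom \<Lambda> X X'" "bij_betw f (carrier X) (carrier X')"
    and g: "g \<in> rhom \<Lambda> Y Y'" "bij_betw g (carrier Y) (carrier Y')"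
    using assms by (auto simp: riso_def)
  have "bij_betw (\<lambda>p. (f (fst p), g (snd p))) (carrier X \<times> carrier Y) (carrier X' \<times> carrier Y')"
    using bij_betw_map_prod[OF f(2) g(2)] by (simp add: map_prod_def case_prod_beta')
  then show ?thesis
    using rhom_map_prod[OF f(1) g(1)] by (auto simp: riso_def)
qed

lemma projectiveD:
  "projective \<Lambda> P \<Longrightarrow> X \<in> fgmod \<Lambda> \<Longrightarrow> Y \<in> fgmod \<Lambda> \<Longrightarrow> g \<in> epi_rhom \<Lambda> X Y \<Longrightarrow> h \<in> rhom \<Lambda> P Y \<Longrightarrow>
    \<exists>f\<in>rhom \<Lambda> P X. \<forall>x\<in>carrier P. g (f x) = h x"
  unfolding projective_def by blast

lemma projective_rretract:
  assumes P: "projective \<Lambda> P" and "rretract \<Lambda> P' P"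
  shows "projective \<Lambda> P'"
  unfolding projective_def
proof (intro ballI)
  obtain f g where 1: "f \<in> rhom \<Lambda> P' P" "g \<in> rhom \<Lambda> P P'" "\<And>x. x \<in> carrier P' \<Longrightarrow> g (f x) = x"
    using assms(2) by (rule rretractE) blast
  fix X Y e h assume X: "X \<in> fgmod \<Lambda>" "Y \<in> fgmod \<Lambda>" "e \<in> epi_rhom \<Lambda> X Y" and h: "h \<in> rhom \<Lambda> P' Y"
  from projectiveD[OF P X rhom_comp[OF 1(2) h]] obtain l
    where l: "l \<in> rhom \<Lambda> P X" "\<forall>x\<in>carrier P. e (l x) = h (g x)" by blast
  then show "\<exists>f\<in>rhom \<Lambda> P' X. \<forall>x\<in>carrier P'. e (f x) = h x"
    using 1 by (intro bexI[OF _ rhom_comp[OF 1(1) l(1)]]) (auto dest: rhom_closed)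
qed

lemma projective_zero:
  assumes "right_module \<Lambda> X"
  shows "projective \<Lambda> (restrict_to X {\<zero>\<^bsub>X\<^esub>})"
  unfolding projective_def
proof (intro ballI)
  note Z = right_module_restrict_to[OF assms rsubmodule_zero_set[OF assms]]
  fix X' Y e h assume *: "X' \<in> fgmod \<Lambda>" "Y \<in> fgmod \<Lambda>" "e \<in> epi_rhom \<Lambda> X' Y"
    "h \<in> rhom \<Lambda> (restrict_to X {\<zero>\<^bsub>X\<^esub>}) Y"
  note X' = right_module_fg[OF fgmodD[OF *(1)]] and Y = right_module_fg[OF fgmodD[OF *(2)]]
  show "\<exists>f\<in>rhom \<Lambda> (restrict_to X {\<zero>\<^bsub>X\<^esub>}) X'. \<forall>x\<in>carrier (restrict_to X {\<zero>\<^bsub>X\<^esub>}). e (f x) = h x"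
    using rhom_zero[OF Z Y *(4)] rhom_zero[OF X' Y epi_rhom_rhom[OF *(3)]]
    by (intro bexI[OF _ rhom_zero_map[OF X']]) simp
qed

lemma projective_rdsum:
  assumes P: "projective \<Lambda> P" "right_module \<Lambda> P" and Q: "projective \<Lambda> Q" "right_module \<Lambda> Q"
  shows "projective \<Lambda> (rdsum P Q)"
  unfolding projective_def
proof (intro ballI)
  interpret P: right_module \<Lambda> P by fact
  interpret Q: right_module \<Lambda> Q by fact
  fix X Y e h assume *: "X \<in> fgmod \<Lambda>" "Y \<in> fgmod \<Lambda>" "e \<in> epi_rhom \<Lambda> X Y"
    and h: "h \<in> rhom \<Lambda> (rdsum P Q) Y"
  note X = right_module_fg[OF fgmodD[OF *(1)]] and e = epi_rhom_rhom[OF *(3)]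
  from projectiveD[OF P(1) * rhom_comp[OF rhom_inl[OF Q(2)] h]] obtain f
    where f: "f \<in> rhom \<Lambda> P X" "\<forall>x\<in>carrier P. e (f x) = h (x, \<zero>\<^bsub>Q\<^esub>)" by blast
  from projectiveD[OF Q(1) * rhom_comp[OF rhom_inr[OF P(2)] h]] obtain g
    where g: "g \<in> rhom \<Lambda> Q X" "\<forall>x\<in>carrier Q. e (g x) = h (\<zero>\<^bsub>P\<^esub>, x)" by blast
  have "e (f x \<oplus>\<^bsub>X\<^esub> g y) = h (x, y)" if "x \<in> carrier P" "y \<in> carrier Q" for x y
    using that f g rhom_add[OF h, of "(x, \<zero>\<^bsub>Q\<^esub>)" "(\<zero>\<^bsub>P\<^esub>, y)"]
    by (simp add: rhom_add[OF e] rhom_closed[OF f(1)] rhom_closed[OF g(1)])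
  then show "\<exists>f\<in>rhom \<Lambda> (rdsum P Q) X. \<forall>x\<in>carrier (rdsum P Q). e (f x) = h x"
    by (intro bexI[OF _ rhom_copair[OF X f(1) g(1)]]) auto
qed

lemma projective_regular:
  assumes "ring \<Lambda>"
  shows "projective \<Lambda> (regular_rmodule \<Lambda>)"
  unfolding projective_def
proof (intro ballI)
  interpret ring \<Lambda> by fact
  fix X Y e h assume *: "X \<in> fgmod \<Lambda>" "Y \<in> fgmod \<Lambda>" "e \<in> epi_rhom \<Lambda> X Y"
    and h: "h \<in> rhom \<Lambda> (regular_rmodule \<Lambda>) Y"
  note X = right_module_fg[OF fgmodD[OF *(1)]] and e = epi_rhom_rhom[OF *(3)]
  have "h \<one>\<^bsub>\<Lambda>\<^esub> \<in> carrier Y" using rhom_closed[OF h] by simp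
  with *(3) obtain x where x: "x \<in> carrier X" "e x = h \<one>\<^bsub>\<Lambda>\<^esub>" by (rule epi_rhomE)
  have "e (x \<triangleleft>\<^bsub>X\<^esub> r) = h r" if "r \<in> carrier \<Lambda>" for r
    using that x rhom_ract[OF h, of "\<one>\<^bsub>\<Lambda>\<^esub>" r] by (simp add: rhom_ract[OF e])
  then show "\<exists>f\<in>rhom \<Lambda> (regular_rmodule \<Lambda>) X. \<forall>x\<in>carrier (regular_rmodule \<Lambda>). e (f x) = h x"
    by (intro bexI[OF _ rhom_regular[OF X x(1)]]) simp
qed

context fd_algebra
begin

lemma ex_fgmod_copy:
  fixes X :: "('a, 'x) rmodule"
  assumes "fg_right_module \<Lambda> X"
  obtains Y f g where "Y \<in> fgmod \<Lambda>" and "f \<in> rhom \<Lambda> X Y" and "g \<in> rhom \<Lambda> Y X"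
    and "\<And>x. x \<in> carrier X \<Longrightarrow> g (f x) = x" and "\<And>y. y \<in> carrier Y \<Longrightarrow> f (g y) = y"
proof -
  obtain Y where Y: "Y \<in> fgmod \<Lambda>" "riso \<Lambda> X Y"
    using ex_riso_fgmod[OF fd_algebra_axioms assms] by blast
  show thesis
    by (rule riso_inverse[OF right_module_fg[OF assms] right_module_fg[OF fgmodD[OF Y(1)]] Y(2)])
      (rule that[OF Y(1)])
qed

text \<open>\<open>projective\<close> tests only epimorphisms inside \<open>fgmod\<close>. Modules
  on other carrier types, such as submodules and direct sums, are reached by moving the lifting
  problem to isomorphic copies.\<close>

lemma projective_lift:
  fixes X :: "('a, 'x) rmodule" and Y :: "('a, 'y) rmodule"
  assumes P: "projective \<Lambda> P" "right_module \<Lambda> P" and X: "fg_right_module \<Lambda> X"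
    and e: "e \<in> epi_rhom \<Lambda> X Y" and h: "h \<in> rhom \<Lambda> P Y" and Y: "right_module \<Lambda> Y"
  shows "\<exists>f\<in>rhom \<Lambda> P X. \<forall>x\<in>carrier P. e (f x) = h x"
proof -
  obtain X' f g where 1: "X' \<in> fgmod \<Lambda>" "f \<in> rhom \<Lambda> X X'" "g \<in> rhom \<Lambda> X' X"
    "\<And>x. x \<in> carrier X \<Longrightarrow> g (f x) = x" "\<And>y. y \<in> carrier X' \<Longrightarrow> f (g y) = y"
    using ex_fgmod_copy[OF X] by blast
  obtain Y' f' g' where 2: "Y' \<in> fgmod \<Lambda>" "f' \<in> rhom \<Lambda> Y Y'" "g' \<in> rhom \<Lambda> Y' Y"
    "\<And>x. x \<in> carrier Y \<Longrightarrow> g' (f' x) = x" "\<And>y. y \<in> carrier Y' \<Longrightarrow> f' (g' y) = y"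
    using ex_fgmod_copy[OF fg_right_module_epi[OF X Y e]] by blast
  note e' = epi_rhom_rhom[OF e]
  have "(\<lambda>x. f' (e (g x))) \<in> epi_rhom \<Lambda> X' Y'"
  proof (rule epi_rhomI[OF rhom_comp[OF rhom_comp[OF 1(3) e'] 2(2)]])
    fix y assume y: "y \<in> carrier Y'"
    obtain x where "x \<in> carrier X" "e x = g' y" using e rhom_closed[OF 2(3) y] by (rule epi_rhomE)
    then show "\<exists>x\<in>carrier X'. f' (e (g x)) = y"
      using 1 2 y by (intro bexI[of _ "f x"]) (auto simp: rhom_closed)
  qed
  from projectiveD[OF P(1) 1(1) 2(1) this rhom_comp[OF h 2(2)]] obtain l
    where l: "l \<in> rhom \<Lambda> P X'" "\<forall>x\<in>carrier P. f' (e (g (l x))) = f' (h x)" by blast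
  have "e (g (l x)) = h x" if "x \<in> carrier P" for x
    using l(2) that 2(4) rhom_closed[OF h] rhom_closed[OF e'] rhom_closed[OF 1(3)] rhom_closed[OF l(1)]
    by metis
  then show ?thesis by (intro bexI[OF _ rhom_comp[OF l(1) 1(3)]]) auto
qed

lemma ex_fgproj_copy:
  fixes P :: "('a, 'x) rmodule"
  assumes "fg_right_module \<Lambda> P" and "projective \<Lambda> P"
  obtains Q f g where "Q \<in> fgproj \<Lambda>" and "f \<in> rhom \<Lambda> P Q" and "g \<in> rhom \<Lambda> Q P"
    and "\<And>x. x \<in> carrier P \<Longrightarrow> g (f x) = x" and "\<And>y. y \<in> carrier Q \<Longrightarrow> f (g y) = y"
proof -
  obtain Q f g where 1: "Q \<in> fgmod \<Lambda>" "f \<in> rhom \<Lambda> P Q" "g \<in> rhom \<Lambda> Q P"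
    "\<And>x. x \<in> carrier P \<Longrightarrow> g (f x) = x" "\<And>y. y \<in> carrier Q \<Longrightarrow> f (g y) = y"
    by (rule ex_fgmod_copy[OF assms(1)]) blast
  then have "rretract \<Lambda> Q P" by (intro rretractI[of g _ _ _ f])
  then have "projective \<Lambda> Q" by (rule projective_rretract[OF assms(2)])
  with 1 that show thesis by (auto simp: fgproj_def)
qed

text \<open>The free module on a finite set of generators, built one generator at a time. Each stage
  is replaced by a copy in \<open>fgproj\<close>, since a direct sum changes the carrier type and
  the induction could not proceed. Separation by maps to the algebra is carried along for
  \<open>projective_cogenerated\<close>.\<close>

lemma ex_fgproj_epi_cogenerated:
  fixes X :: "('a, 'x) rmodule"
  assumes "fg_right_module \<Lambda> X"
  shows "\<exists>P\<in>fgproj \<Lambda>. cogenerated \<Lambda> P (regular_rmodule \<Lambda>) \<and> epi_rhom \<Lambda> P X \<noteq> {}"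
proof -
  interpret X: fg_right_module \<Lambda> X by fact
  note R = X.is_right_module and ring = Alg.ring_axioms
  have ex: "\<exists>P\<in>fgproj \<Lambda>. cogenerated \<Lambda> P (regular_rmodule \<Lambda>) \<and> (\<exists>p\<in>rhom \<Lambda> P X. F \<subseteq> p ` carrier P)"
    if "finite F" "F \<subseteq> carrier X" for F
    using that
  proof (induction F)
    case empty
    let ?Z = "restrict_to X {\<zero>\<^bsub>X\<^esub>}"
    obtain P f g where P: "P \<in> fgproj \<Lambda>" "f \<in> rhom \<Lambda> ?Z P" "g \<in> rhom \<Lambda> P ?Z"
      "\<And>x. x \<in> carrier ?Z \<Longrightarrow> g (f x) = x" "\<And>y. y \<in> carrier P \<Longrightarrow> f (g y) = y"
      by (rule ex_fgproj_copy[OF fg_right_module_zero[OF R] projective_zero[OF R]]) blast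
    note RP = right_module_fg[OF fgprojD(1)[OF P(1)]]
    interpret P: right_module \<Lambda> P by (rule RP)
    have "y = \<zero>\<^bsub>P\<^esub>" if "y \<in> carrier P" for y
    proof -
      have "g y = g \<zero>\<^bsub>P\<^esub>" using rhom_closed[OF P(3) that] rhom_closed[OF P(3) P.AbGr.zero_closed] by simp
      then show ?thesis using P(5) that P.AbGr.zero_closed by metis
    qed
    then have "cogenerated \<Lambda> P (regular_rmodule \<Lambda>)" by (auto simp: cogenerated_def)
    then show ?case using P(1) rhom_zero_map[OF R] by blast
  next
    case (insert x F)
    then obtain P p where P: "P \<in> fgproj \<Lambda>" "cogenerated \<Lambda> P (regular_rmodule \<Lambda>)"
      and p: "p \<in> rhom \<Lambda> P X" "F \<subseteq> p ` carrier P" by auto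
    have x: "x \<in> carrier X" using insert.prems by auto
    note fgP = fgprojD(1)[OF P(1)]
    note RP = right_module_fg[OF fgP]
    interpret P: right_module \<Lambda> P by (rule RP)
    let ?A = "regular_rmodule \<Lambda>" and ?S = "rdsum P (regular_rmodule \<Lambda>)"
    have fgS: "fg_right_module \<Lambda> ?S" by (rule fg_right_module_rdsum[OF fgP fg_regular[OF ring]])
    obtain Q f g where Q: "Q \<in> fgproj \<Lambda>" "f \<in> rhom \<Lambda> ?S Q" "g \<in> rhom \<Lambda> Q ?S"
      "\<And>x. x \<in> carrier ?S \<Longrightarrow> g (f x) = x" "\<And>y. y \<in> carrier Q \<Longrightarrow> f (g y) = y"
      by (rule ex_fgproj_copy[OF fgS projective_rdsum[OF fgprojD(2)[OF P(1)] RP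
              projective_regular[OF ring] right_module_regular[OF ring]]]) blast
    have "cogenerated \<Lambda> Q ?A"
      by (rule cogenerated_rretract[OF right_module_fg[OF fgprojD(1)[OF Q(1)]] right_module_fg[OF fgS]
            rretractI[OF Q(3,2,5)] cogenerated_rdsum[OF P(2) cogenerated_regular]])
    moreover
    let ?q = "\<lambda>y. p (fst (g y)) \<oplus>\<^bsub>X\<^esub> x \<triangleleft>\<^bsub>X\<^esub> snd (g y)"
    have "?q \<in> rhom \<Lambda> Q X"
      by (rule rhom_comp[OF Q(3) rhom_copair[OF R p(1) rhom_regular[OF R x]]])
    moreover have "insert x F \<subseteq> ?q ` carrier Q"
    proof
      fix y assume "y \<in> insert x F"
      then consider "y = x" | "y \<in> F" by blast
      then show "y \<in> ?q ` carrier Q"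
      proof cases
        case 1
        have m: "(\<zero>\<^bsub>P\<^esub>, \<one>\<^bsub>\<Lambda>\<^esub>) \<in> carrier ?S" by simp
        show ?thesis
          by (rule image_eqI[OF _ rhom_closed[OF Q(2) m]])
            (use 1 x in \<open>simp add: Q(4)[OF m] rhom_zero[OF RP R p(1)] X.ract_one\<close>)
      next
        case 2
        with p(2) obtain u where u: "u \<in> carrier P" "y = p u" by blast
        have m: "(u, \<zero>\<^bsub>\<Lambda>\<^esub>) \<in> carrier ?S" using u by simp
        show ?thesis
          by (rule image_eqI[OF _ rhom_closed[OF Q(2) m]])
            (use u x rhom_closed[OF p(1)] in \<open>simp add: Q(4)[OF m] X.ract_zero\<close>)
      qed
    qed
    ultimately show ?case using Q(1) by blast
  qed
  obtain T where T: "finite T" "T \<subseteq> carrier X"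
    "\<And>N. rsubmodule \<Lambda> N X \<Longrightarrow> T \<subseteq> N \<Longrightarrow> N = carrier X"
    by (rule fg_right_moduleE[OF assms]) blast
  from ex[OF T(1,2)] obtain P p where P: "P \<in> fgproj \<Lambda>" "cogenerated \<Lambda> P (regular_rmodule \<Lambda>)"
    and p: "p \<in> rhom \<Lambda> P X" "T \<subseteq> p ` carrier P" by blast
  note RP = right_module_fg[OF fgprojD(1)[OF P(1)]]
  have "p ` carrier P = carrier X"
    by (rule T(3)[OF rsubmodule_image[OF RP R p(1) rsubmodule_whole[OF RP]] p(2)])
  then show ?thesis using P p by (auto simp: epi_rhom_def)
qed

lemma ex_fgproj_epi:
  fixes X :: "('a, 'x) rmodule"
  assumes "fg_right_module \<Lambda> X"
  obtains P p where "P \<in> fgproj \<Lambda>" and "p \<in> epi_rhom \<Lambda> P X"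
  using ex_fgproj_epi_cogenerated[OF assms] by blast

text \<open>A projective module is a retract of the free module mapping onto it, and that module is
  separated by its coordinates.\<close>

lemma projective_cogenerated:
  fixes P :: "('a, 'x) rmodule"
  assumes fg: "fg_right_module \<Lambda> P" and P: "projective \<Lambda> P"
  shows "cogenerated \<Lambda> P (regular_rmodule \<Lambda>)"
proof -
  note R = right_module_fg[OF fg]
  obtain Q q where Q: "Q \<in> fgproj \<Lambda>" "cogenerated \<Lambda> Q (regular_rmodule \<Lambda>)" "q \<in> epi_rhom \<Lambda> Q P"
    using ex_fgproj_epi_cogenerated[OF fg] by blast
  from projective_lift[OF P R fgprojD(1)[OF Q(1)] Q(3) rhom_id R]
  obtain s where "s \<in> rhom \<Lambda> P Q" "\<forall>x\<in>carrier P. q (s x) = x" by blast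
  then have "rretract \<Lambda> P Q" using epi_rhom_rhom[OF Q(3)] by (blast intro: rretractI)
  then show ?thesis
    by (rule cogenerated_rretract[OF R right_module_fg[OF fgprojD(1)[OF Q(1)]] _ Q(2)])
qed

text \<open>Artinianness: among finite lists of homomorphisms take one whose common kernel has the
  least measure. A nonzero element of that kernel would be separated by a further homomorphism,
  which would shrink the kernel.\<close>

lemma cogenerated_finite:
  fixes X :: "('a, 'x) rmodule" and C :: "('a, 'y) rmodule"
  assumes fg: "fg_right_module \<Lambda> X" and C: "right_module \<Lambda> C" and cog: "cogenerated \<Lambda> X C"
  obtains n :: nat and h where "\<And>i. i < n \<Longrightarrow> h i \<in> rhom \<Lambda> X C"
    and "\<And>x. x \<in> carrier X \<Longrightarrow> (\<And>i. i < n \<Longrightarrow> h i x = \<zero>\<^bsub>C\<^esub>) \<Longrightarrow> x = \<zero>\<^bsub>X\<^esub>"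
proof -
  note X = right_module_fg[OF fg]
  obtain \<mu> :: "_ \<Rightarrow> nat" and n where \<mu>:
    "\<And>N N'. rsubmodule \<Lambda> N X \<Longrightarrow> rsubmodule \<Lambda> N' X \<Longrightarrow> N \<subseteq> N' \<Longrightarrow> \<mu> N' \<le> \<mu> N \<Longrightarrow> N = N'"
    using ex_submodule_measure[OF fg] by metis
  \<comment> \<open>Inserting the carrier makes the common kernel of the empty list the whole
    module.\<close>
  define k where "k hs = \<Inter>(insert (carrier X) (a_kernel X C ` set hs))" for hs
  have k: "rsubmodule \<Lambda> (k hs) X" if "set hs \<subseteq> rhom \<Lambda> X C" for hs
    unfolding k_def using that rsubmodule_whole[OF X] rsubmodule_a_kernel[OF X C]
    by (intro rsubmodule_Inter[OF X]) auto
  have "\<exists>hs. set hs \<subseteq> rhom \<Lambda> X C \<and> (\<forall>hs'. set hs' \<subseteq> rhom \<Lambda> X C \<longrightarrow> \<mu> (k hs) \<le> \<mu> (k hs'))"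
    by (rule ex_has_least_nat[of "\<lambda>hs. set hs \<subseteq> rhom \<Lambda> X C" "[]"]) simp
  then obtain hs where hs: "set hs \<subseteq> rhom \<Lambda> X C"
    and min: "\<And>hs'. set hs' \<subseteq> rhom \<Lambda> X C \<Longrightarrow> \<mu> (k hs) \<le> \<mu> (k hs')" by blast
  have zero: "x = \<zero>\<^bsub>X\<^esub>" if x: "x \<in> k hs" for x
  proof (rule ccontr)
    assume "x \<noteq> \<zero>\<^bsub>X\<^esub>"
    moreover have "x \<in> carrier X" using x by (simp add: k_def)
    ultimately obtain h where h: "h \<in> rhom \<Lambda> X C" "h x \<noteq> \<zero>\<^bsub>C\<^esub>" using cog cogeneratedE by metis
    have "k (h # hs) = k hs"
      using hs h(1) min[of "h # hs"] by (intro \<mu> k) (auto simp: k_def)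
    with x h(2) show False by (auto simp: k_def in_a_kernel)
  qed
  show thesis
  proof (rule that[of "length hs" "\<lambda>i. hs ! i"])
    show "hs ! i \<in> rhom \<Lambda> X C" if "i < length hs" for i using that hs nth_mem by blast
    show "x = \<zero>\<^bsub>X\<^esub>" if "x \<in> carrier X" "\<And>i. i < length hs \<Longrightarrow> (hs ! i) x = \<zero>\<^bsub>C\<^esub>" for x
      using that by (intro zero) (auto simp: k_def in_a_kernel in_set_conv_nth)
  qed
qed

end

lemma rhom_funpow: "h \<in> rhom \<Lambda> X X \<Longrightarrow> (h ^^ n) \<in> rhom \<Lambda> X X"
  by (induction n) (auto intro: rhom_id rhom_comp[of _ _ X X h] simp: comp_def id_def)

lemma fin_dsum_simps [simp]:
  "carrier (fin_dsum n F) = (\<Pi>\<^sub>E i\<in>{..<n}. carrier (F i))" "\<zero>\<^bsub>fin_dsum n F\<^esub> = (\<lambda>i\<in>{..<n}. \<zero>\<^bsub>F i\<^esub>)"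
  "x \<oplus>\<^bsub>fin_dsum n F\<^esub> y = (\<lambda>i\<in>{..<n}. x i \<oplus>\<^bsub>F i\<^esub> y i)"
  "x \<triangleleft>\<^bsub>fin_dsum n F\<^esub> r = (\<lambda>i\<in>{..<n}. x i \<triangleleft>\<^bsub>F i\<^esub> r)"
  by (simp_all add: fin_dsum_def)

lemma right_module_fin_dsum:
  assumes "ring \<Lambda>" and F: "\<And>i. i < n \<Longrightarrow> right_module \<Lambda> (F i)"
  shows "right_module \<Lambda> (fin_dsum n F)"
proof -
  interpret ring \<Lambda> by fact
  have A: "abelian_group (F i)" if "i < n" for i using F[OF that] by (rule right_module.axioms(2))
  note M = abelian_group.axioms(1)[OF A]
  note closed = abelian_monoid.a_closed[OF M] abelian_monoid.zero_closed[OF M]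
    right_module.ract_closed[OF F]
  interpret A: abelian_group "fin_dsum n F"
  proof (rule abelian_groupI)
    fix x y z assume x: "x \<in> carrier (fin_dsum n F)" and y: "y \<in> carrier (fin_dsum n F)"
      and z: "z \<in> carrier (fin_dsum n F)"
    show "x \<oplus>\<^bsub>fin_dsum n F\<^esub> y \<oplus>\<^bsub>fin_dsum n F\<^esub> z = x \<oplus>\<^bsub>fin_dsum n F\<^esub> (y \<oplus>\<^bsub>fin_dsum n F\<^esub> z)"
      using x y z by (auto simp: fun_eq_iff PiE_iff intro!: abelian_monoid.a_assoc[OF M])
    show "x \<oplus>\<^bsub>fin_dsum n F\<^esub> y = y \<oplus>\<^bsub>fin_dsum n F\<^esub> x"
      using x y by (auto simp: fun_eq_iff PiE_iff intro!: abelian_monoid.a_comm[OF M])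
    show "x \<oplus>\<^bsub>fin_dsum n F\<^esub> y \<in> carrier (fin_dsum n F)"
      using x y by (auto simp: PiE_iff closed)
    show "\<zero>\<^bsub>fin_dsum n F\<^esub> \<oplus>\<^bsub>fin_dsum n F\<^esub> x = x"
    proof
      show "(\<zero>\<^bsub>fin_dsum n F\<^esub> \<oplus>\<^bsub>fin_dsum n F\<^esub> x) i = x i" for i
        using x by (cases "i < n") (auto simp: PiE_iff extensional_def abelian_monoid.l_zero[OF M])
    qed
    show "\<exists>y\<in>carrier (fin_dsum n F). y \<oplus>\<^bsub>fin_dsum n F\<^esub> x = \<zero>\<^bsub>fin_dsum n F\<^esub>"
      using x by (intro bexI[of _ "\<lambda>i\<in>{..<n}. \<ominus>\<^bsub>F i\<^esub> x i"])
        (auto simp: fun_eq_iff PiE_iff abelian_group.l_neg[OF A] abelian_group.a_inv_closed[OF A])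
  qed (auto simp: closed)
  show ?thesis
  proof unfold_locales
    fix x r s assume x: "x \<in> carrier (fin_dsum n F)" and r: "r \<in> carrier \<Lambda>" "s \<in> carrier \<Lambda>"
    show "x \<triangleleft>\<^bsub>fin_dsum n F\<^esub> r \<in> carrier (fin_dsum n F)"
      using x r by (auto simp: PiE_iff closed)
    show "x \<triangleleft>\<^bsub>fin_dsum n F\<^esub> (r \<oplus>\<^bsub>\<Lambda>\<^esub> s) = x \<triangleleft>\<^bsub>fin_dsum n F\<^esub> r \<oplus>\<^bsub>fin_dsum n F\<^esub> x \<triangleleft>\<^bsub>fin_dsum n F\<^esub> s"
      using x r by (auto simp: fun_eq_iff PiE_iff right_module.ract_add_right[OF F])
    show "x \<triangleleft>\<^bsub>fin_dsum n F\<^esub> (r \<otimes>\<^bsub>\<Lambda>\<^esub> s) = x \<triangleleft>\<^bsub>fin_dsum n F\<^esub> r \<triangleleft>\<^bsub>fin_dsum n F\<^esub> s"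
      using x r by (auto simp: fun_eq_iff PiE_iff right_module.ract_mult[OF F])
    fix y assume y: "y \<in> carrier (fin_dsum n F)"
    show "(x \<oplus>\<^bsub>fin_dsum n F\<^esub> y) \<triangleleft>\<^bsub>fin_dsum n F\<^esub> r = x \<triangleleft>\<^bsub>fin_dsum n F\<^esub> r \<oplus>\<^bsub>fin_dsum n F\<^esub> y \<triangleleft>\<^bsub>fin_dsum n F\<^esub> r"
      using x y r by (auto simp: fun_eq_iff PiE_iff right_module.ract_add_left[OF F])
  next
    fix x assume x: "x \<in> carrier (fin_dsum n F)"
    show "x \<triangleleft>\<^bsub>fin_dsum n F\<^esub> \<one>\<^bsub>\<Lambda>\<^esub> = x"
    proof
      show "(x \<triangleleft>\<^bsub>fin_dsum n F\<^esub> \<one>\<^bsub>\<Lambda>\<^esub>) i = x i" for i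
        using x by (cases "i < n") (auto simp: PiE_iff extensional_def right_module.ract_one[OF F])
    qed
  qed
qed

lemma rhom_fin_dsum_proj: "i < n \<Longrightarrow> (\<lambda>x. x i) \<in> rhom \<Lambda> (fin_dsum n F) (F i)"
  by (rule rhomI) (auto simp: PiE_iff)

lemma rhom_fin_dsum:
  assumes "\<And>i. i < n \<Longrightarrow> f i \<in> rhom \<Lambda> X (F i)"
  shows "(\<lambda>x. \<lambda>i\<in>{..<n}. f i x) \<in> rhom \<Lambda> X (fin_dsum n F)"
  by (rule rhomI)
    (auto simp: PiE_iff fun_eq_iff rhom_closed[OF assms] rhom_add[OF assms] rhom_ract[OF assms])

text \<open>Reduces finite direct sums to binary ones, so that closure properties follow by
  induction on the number of summands.\<close>

lemma riso_fin_dsum_Suc: "riso \<Lambda> (fin_dsum (Suc n) F) (rdsum (fin_dsum n F) (F n))"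
proof (rule risoI)
  show "(\<lambda>x. ((\<lambda>i\<in>{..<n}. x i), x n)) \<in> rhom \<Lambda> (fin_dsum (Suc n) F) (rdsum (fin_dsum n F) (F n))"
    by (intro rhom_pair rhom_fin_dsum rhom_fin_dsum_proj) auto
  show "(\<lambda>p. \<lambda>i\<in>{..<Suc n}. if i < n then fst p i else snd p)
      \<in> rhom \<Lambda> (rdsum (fin_dsum n F) (F n)) (fin_dsum (Suc n) F)"
  proof (rule rhom_fin_dsum)
    fix i assume "i < Suc n"
    then consider "i < n" | "i = n" by linarith
    then show "(\<lambda>p. if i < n then fst p i else snd p) \<in> rhom \<Lambda> (rdsum (fin_dsum n F) (F n)) (F i)"
    proof cases
      case 1
      then show ?thesis using rhom_comp[OF rhom_fst rhom_fin_dsum_proj] by simp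
    next
      case 2
      then show ?thesis using rhom_snd by simp
    qed
  qed
  show "(\<lambda>i\<in>{..<Suc n}. if i < n then fst ((\<lambda>i\<in>{..<n}. x i), x n) i else snd ((\<lambda>i\<in>{..<n}. x i), x n)) = x"
    if "x \<in> carrier (fin_dsum (Suc n) F)" for x
  proof
    fix i
    show "(\<lambda>i\<in>{..<Suc n}. if i < n then fst ((\<lambda>i\<in>{..<n}. x i), x n) i else snd ((\<lambda>i\<in>{..<n}. x i), x n)) i = x i"
      using that by (cases "i < n"; cases "i = n") (auto simp: PiE_iff extensional_def)
  qed
  show "((\<lambda>i\<in>{..<n}. (\<lambda>i\<in>{..<Suc n}. if i < n then fst p i else snd p) i),
      (\<lambda>i\<in>{..<Suc n}. if i < n then fst p i else snd p) n) = p"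
    if "p \<in> carrier (rdsum (fin_dsum n F) (F n))" for p
    using that by (cases p) (auto simp: fun_eq_iff PiE_iff extensional_def)
qed

lemma is_syzygyE:
  assumes "is_syzygy \<Lambda> X Z"
  obtains P p where "P \<in> fgproj \<Lambda>" and "p \<in> epi_rhom \<Lambda> P X"
    and "superfluous \<Lambda> (a_kernel P X p) P" and "riso \<Lambda> (restrict_to P (a_kernel P X p)) Z"
    and "Z \<in> fgmod \<Lambda>"
  using assms by (auto simp: is_syzygy_def projective_cover_def)

context fd_algebra
begin

text \<open>
  Among the endomorphisms \<open>h\<close> of \<open>P\<close> over \<open>X\<close> choose one with minimal image, and among its powers
  one with maximal kernel. Its image is then a direct summand of \<open>P\<close> and carries the cover.
\<close>

lemma ex_projective_cover:
  fixes X :: "('a, 'x) rmodule"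
  assumes fg: "fg_right_module \<Lambda> X"
  shows "\<exists>P\<in>fgproj \<Lambda>. \<exists>p. projective_cover \<Lambda> P p X"
proof -
  note X = right_module_fg[OF fg]
  obtain P p where P: "P \<in> fgproj \<Lambda>" and p: "p \<in> epi_rhom \<Lambda> P X"
    by (rule ex_fgproj_epi[OF fg])
  note fgP = fgprojD(1)[OF P] and pP = fgprojD(2)[OF P] and p' = epi_rhom_rhom[OF p]
  note RP = right_module_fg[OF fgP]
  interpret P: right_module \<Lambda> P by (rule RP)
  obtain \<mu> :: "_ \<Rightarrow> nat" and b where \<mu>: "\<And>N. \<mu> N \<le> b" "\<And>N N'. N \<subseteq> N' \<Longrightarrow> \<mu> N \<le> \<mu> N'"
    "\<And>N N'. rsubmodule \<Lambda> N P \<Longrightarrow> rsubmodule \<Lambda> N' P \<Longrightarrow> N \<subseteq> N' \<Longrightarrow> \<mu> N' \<le> \<mu> N \<Longrightarrow> N = N'"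
    using ex_submodule_measure[OF fgP] by metis
  \<comment> \<open>The lifts of the identity of \<open>X\<close> along \<open>p\<close>; they are
    closed under composition.\<close>
  define H where "H = {h \<in> rhom \<Lambda> P P. \<forall>x\<in>carrier P. p (h x) = p x}"
  note im = rsubmodule_image[OF RP RP _ rsubmodule_whole[OF RP]]
  have "\<exists>h. h \<in> H \<and> (\<forall>h'. h' \<in> H \<longrightarrow> \<mu> (h ` carrier P) \<le> \<mu> (h' ` carrier P))"
    by (rule ex_has_least_nat[of "\<lambda>h. h \<in> H" "\<lambda>x. x"]) (simp add: H_def rhom_id)
  then obtain h where h: "h \<in> H" and min: "\<And>h'. h' \<in> H \<Longrightarrow> \<mu> (h ` carrier P) \<le> \<mu> (h' ` carrier P)"
    by blast
  have pow: "h ^^ n \<in> H" for n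
  proof (induction n)
    case 0
    then show ?case by (simp add: H_def id_def rhom_id)
  next
    case (Suc n)
    then have "h ^^ n \<in> rhom \<Lambda> P P" "\<forall>x\<in>carrier P. p ((h ^^ n) x) = p x" by (auto simp: H_def)
    then show ?case
      using h rhom_comp[of "h ^^ n" \<Lambda> P P h P] by (auto simp: H_def comp_def rhom_closed)
  qed
  \<comment> \<open>With \<open>Suc n\<close> the chosen power is at least the first, so its image
    stays inside that of \<open>h\<close>.\<close>
  let ?k = "\<lambda>n. a_kernel P P (h ^^ Suc n)"
  have "\<exists>n. True \<and> (\<forall>m. True \<longrightarrow> \<mu> (?k m) \<le> \<mu> (?k n))"
    by (rule ex_has_greatest_nat[of _ 0 _ "Suc b"]) (use \<mu>(1) in \<open>auto simp: less_Suc_eq_le\<close>)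
  then obtain n where max: "\<And>m. \<mu> (?k m) \<le> \<mu> (?k n)" by blast
  define f where "f = h ^^ Suc n"
  \<comment> \<open>Twice the exponent \<open>Suc n\<close> is \<open>Suc (Suc (n + n))\<close>, so
    \<open>f \<circ> f\<close> is again one of the powers whose kernels were compared.\<close>
  have ff: "f (f x) = (h ^^ Suc (Suc (n + n))) x" for x
    by (simp add: f_def funpow_add[symmetric] flip: comp_apply[of "h ^^ Suc n" "h ^^ Suc n" x]
        del: funpow.simps)
  have fH: "f \<in> H" using pow by (simp add: f_def del: funpow.simps)
  have pf: "p (f x) = p x" if "x \<in> carrier P" for x
    using fH that by (auto simp: H_def)
  have f: "f \<in> rhom \<Lambda> P P" using fH by (simp add: H_def)
  define I where "I = f ` carrier P"
  have I: "rsubmodule \<Lambda> I P" unfolding I_def by (rule im[OF f])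
  note cI = rsubmodule_carrier[OF I]
  have "I \<subseteq> h ` carrier P"
    using rhom_closed[OF rhom_funpow[of h \<Lambda> P n]] h by (auto simp: I_def f_def H_def)
  then have le: "\<mu> I \<le> \<mu> (h' ` carrier P)" if "h' \<in> H" for h'
    using \<mu>(2)[of I "h ` carrier P"] min[OF that] by linarith
  have min': "h' ` carrier P = I" if "h' \<in> H" "h' ` carrier P \<subseteq> I" for h'
    using that le[OF that(1)] by (intro \<mu>(3) im I) (auto simp: H_def)
  have "(\<lambda>x. f (f x)) ` carrier P \<subseteq> I" using rhom_closed[OF f] by (auto simp: I_def)
  \<comment> \<open>\<open>f \<circ> f\<close> lies in \<open>H\<close> and its image is contained
    in \<open>I\<close>, so minimality of the image forces equality.\<close>
  then have fI: "f ` I = I"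
    using min'[of "\<lambda>x. f (f x)"] pow[of "Suc (Suc (n + n))"]
    unfolding I_def ff by (simp add: image_image ff del: funpow.simps)
  \<comment> \<open>The kernels of \<open>f\<close> and \<open>f \<circ> f\<close> coincide by
    maximality. Together with \<open>fI\<close> this is Fitting's argument: \<open>f\<close> is
    bijective on its image \<open>I\<close>.\<close>
  have ker: "f x = \<zero>\<^bsub>P\<^esub>" if "x \<in> carrier P" "f (f x) = \<zero>\<^bsub>P\<^esub>" for x
  proof -
    have k: "?k n = {x \<in> carrier P. f x = \<zero>\<^bsub>P\<^esub>}"
      "?k (Suc (n + n)) = {x \<in> carrier P. f (f x) = \<zero>\<^bsub>P\<^esub>}"
      unfolding a_kernel_def' ff by (simp_all only: f_def)
    have "?k n \<subseteq> ?k (Suc (n + n))" unfolding k using rhom_zero[OF RP RP f] by auto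
    then have "?k n = ?k (Suc (n + n))"
      using pow by (intro \<mu>(3) rsubmodule_a_kernel[OF RP RP] max) (auto simp: H_def simp del: funpow.simps)
    then show ?thesis using that unfolding k by blast
  qed
  let ?I = "restrict_to P I"
  note RI = right_module_restrict_to[OF RP I] and fgI = fg_submodule[OF fgP I]
  have fII: "f \<in> rhom \<Lambda> ?I ?I"
    using rhom_corestrict[OF rhom_restrict[OF f rsubmodule_subset[OF I]]] fI by auto
  have "inj_on f (carrier ?I)"
  proof (rule inj_on_rhomI[OF RI RI fII])
    fix x assume x: "x \<in> carrier ?I" "f x = \<zero>\<^bsub>?I\<^esub>"
    then obtain y where "y \<in> carrier P" "x = f y" by (auto simp: I_def)
    then show "x = \<zero>\<^bsub>?I\<^esub>" using ker[of y] x(2) by simp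
  qed
  then have bij: "bij_betw f (carrier ?I) (carrier ?I)"
    using fI by (simp add: bij_betw_def)
  have "f \<in> mono_rhom \<Lambda> ?I ?I" using fII bij by (auto simp: mono_rhom_def bij_betw_def)
  \<comment> \<open>The retraction of \<open>P\<close> onto \<open>I\<close> is \<open>f\<close>
    followed by the inverse of \<open>f\<close> on \<open>I\<close>.\<close>
  from rhom_lift_mono[OF RI RI this _ _ RP, of f] obtain r
    where r: "r \<in> rhom \<Lambda> P ?I" "\<forall>x\<in>carrier P. f (r x) = f x"
    using rhom_corestrict[OF f, of I] fI by (auto simp: I_def)
  have "r x = x" if "x \<in> I" for x
    using that r(2) cI[OF that] rhom_closed[OF r(1) cI[OF that]] bij
    by (metis bij_betw_def inj_onD restrict_to_simps(1))
  then have "rretract \<Lambda> ?I P"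
    by (intro rretractI[OF rhom_inclusion[OF I] r(1)]) simp
  then have "projective \<Lambda> ?I" by (rule projective_rretract[OF pP])
  with fgI have IP: "?I \<in> fgproj \<Lambda>" by (simp add: fgproj_def fgmod_def)
  have pI: "p \<in> epi_rhom \<Lambda> ?I X"
  proof (rule epi_rhomI[OF rhom_restrict[OF p' rsubmodule_subset[OF I]]])
    fix x assume "x \<in> carrier X"
    with p obtain y where "y \<in> carrier P" "p y = x" by (rule epi_rhomE)
    then show "\<exists>z\<in>carrier ?I. p z = x" using pf by (intro bexI[of _ "f y"]) (auto simp: I_def)
  qed
  have "superfluous \<Lambda> (a_kernel ?I X p) ?I"
    unfolding superfluous_def
  proof (intro conjI allI impI rsubmodule_a_kernel[OF RI X epi_rhom_rhom[OF pI]], elim conjE)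
    fix L assume L: "rsubmodule \<Lambda> L ?I" and sum: "a_kernel ?I X p <+>\<^bsub>?I\<^esub> L = carrier ?I"
    have LP: "rsubmodule \<Lambda> L P" by (rule rsubmodule_restrict_to[OF RP I L])
    let ?L = "restrict_to P L"
    have "p \<in> epi_rhom \<Lambda> ?L X"
    proof (rule epi_rhomI[OF rhom_restrict[OF p' rsubmodule_subset[OF LP]]])
      fix x assume "x \<in> carrier X"
      with pI obtain y where y: "y \<in> carrier ?I" "p y = x" by (rule epi_rhomE)
      have "y \<in> a_kernel ?I X p <+>\<^bsub>?I\<^esub> L" using y(1) sum by simp
      then obtain k l where kl: "k \<in> a_kernel ?I X p" "l \<in> L" "y = k \<oplus>\<^bsub>?I\<^esub> l"
        by (rule set_addE)
      interpret X: right_module \<Lambda> X by (rule X)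
      have "p l = x"
        using kl y cI rsubmodule_carrier[OF LP] rhom_closed[OF p']
        by (auto simp: in_a_kernel rhom_add[OF p'])
      then show "\<exists>z\<in>carrier ?L. p z = x" using kl(2) by auto
    qed
    \<comment> \<open>As \<open>p\<close> maps \<open>L\<close> onto \<open>X\<close>, it lifts to
      an element of \<open>H\<close> with image in \<open>L \<subseteq> I\<close>, and no element of
      \<open>H\<close> has image properly inside \<open>I\<close>.\<close>
    from projective_lift[OF pP RP fg_submodule[OF fgP LP] this p' X] obtain g
      where g: "g \<in> rhom \<Lambda> P ?L" "\<forall>x\<in>carrier P. p (g x) = p x" by blast
    have "g \<in> H" using rhom_comp[OF g(1) rhom_inclusion[OF LP]] g(2) by (simp add: H_def)
    moreover have gL: "g ` carrier P \<subseteq> L" using rhom_closed[OF g(1)] by auto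
    moreover have LI: "L \<subseteq> I" using rsubmodule_subset[OF L] by simp
    ultimately have "g ` carrier P = I" by (intro min') auto
    with gL LI show "L = carrier ?I" by auto
  qed
  with IP fgI pI show ?thesis by (auto simp: projective_cover_def fgproj_def)
qed

lemma ex_is_syzygy:
  fixes X :: "('a, 'x) rmodule"
  assumes fg: "fg_right_module \<Lambda> X"
  shows "\<exists>Z. is_syzygy \<Lambda> X Z"
proof -
  obtain P p where P: "P \<in> fgproj \<Lambda>" and p: "projective_cover \<Lambda> P p X"
    using ex_projective_cover[OF fg] by blast
  note fgP = fgprojD(1)[OF P]
  have "p \<in> rhom \<Lambda> P X" using p by (simp add: projective_cover_def epi_rhom_def)
  then have "rsubmodule \<Lambda> (a_kernel P X p) P"
    by (rule rsubmodule_a_kernel[OF right_module_fg[OF fgP] right_module_fg[OF fg]])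
  then have "\<exists>Y\<in>fgmod \<Lambda>. riso \<Lambda> (restrict_to P (a_kernel P X p)) Y"
    by (intro ex_riso_fgmod[OF fd_algebra_axioms] fg_submodule[OF fgP])
  then show ?thesis using P p unfolding is_syzygy_def by blast
qed

text \<open>For \<open>X = Y\<close> this is a weak form of Schanuel's lemma.\<close>

lemma rretract_kernel:
  fixes X :: "('a, 'x) rmodule" and Y :: "('a, 'y) rmodule"
    and P :: "('a, 'p) rmodule" and Q :: "('a, 'q) rmodule"
  assumes X: "right_module \<Lambda> X" and Y: "right_module \<Lambda> Y"
    and P: "fg_right_module \<Lambda> P" "projective \<Lambda> P" and Q: "fg_right_module \<Lambda> Q" "projective \<Lambda> Q"
    and p: "p \<in> epi_rhom \<Lambda> P X" and q: "q \<in> epi_rhom \<Lambda> Q Y" and XY: "rretract \<Lambda> X Y"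
  shows "rretract \<Lambda> (restrict_to P (a_kernel P X p)) (rdsum (restrict_to Q (a_kernel Q Y q)) P)"
proof -
  obtain i r where i: "i \<in> rhom \<Lambda> X Y" and r: "r \<in> rhom \<Lambda> Y X" and ri: "\<And>x. x \<in> carrier X \<Longrightarrow> r (i x) = x"
    using XY by (rule rretractE) blast
  note RP = right_module_fg[OF P(1)] and RQ = right_module_fg[OF Q(1)]
  note p' = epi_rhom_rhom[OF p] and q' = epi_rhom_rhom[OF q]
  interpret P: right_module \<Lambda> P by (rule RP)
  interpret X: right_module \<Lambda> X by (rule X)
  from projective_lift[OF P(2) RP Q(1) q rhom_comp[OF p' i] Y] obtain f
    where f: "f \<in> rhom \<Lambda> P Q" "\<forall>x\<in>carrier P. q (f x) = i (p x)" by blast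
  from projective_lift[OF Q(2) RQ P(1) p rhom_comp[OF q' r] X] obtain g
    where g: "g \<in> rhom \<Lambda> Q P" "\<forall>x\<in>carrier Q. p (g x) = r (q x)" by blast
  let ?K = "restrict_to P (a_kernel P X p)" and ?L = "restrict_to Q (a_kernel Q Y q)"
  note K = rsubmodule_a_kernel[OF RP X p'] and L = rsubmodule_a_kernel[OF RQ Y q']
  have "f \<in> rhom \<Lambda> ?K ?L"
    by (rule rhom_corestrict[OF rhom_restrict[OF f(1) rsubmodule_subset[OF K]]])
      (use f rhom_zero[OF X Y i] in \<open>auto simp: in_a_kernel rhom_closed\<close>)
  then have 1: "(\<lambda>x. (f x, x)) \<in> rhom \<Lambda> ?K (rdsum ?L P)"
    by (rule rhom_pair[OF _ rhom_inclusion[OF K]])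
  \<comment> \<open>The lift \<open>g\<close> sends the kernel of \<open>q\<close> into that of
    \<open>p\<close>, and \<open>x - g (f x)\<close> lies in the kernel of \<open>p\<close> because
    \<open>p g f = r i p = p\<close>. On \<open>(f x, x)\<close> the two contributions add up to
    \<open>x\<close>.\<close>
  have "(\<lambda>p. g (fst p) \<oplus>\<^bsub>P\<^esub> (snd p \<ominus>\<^bsub>P\<^esub> g (f (snd p)))) \<in> rhom \<Lambda> (rdsum ?L P) P"
    by (rule rhom_copair[OF RP rhom_restrict[OF g(1) rsubmodule_subset[OF L]]
          rhom_diff[OF RP rhom_id rhom_comp[OF f(1) g(1)]]])
  then have 2: "(\<lambda>p. g (fst p) \<oplus>\<^bsub>P\<^esub> (snd p \<ominus>\<^bsub>P\<^esub> g (f (snd p)))) \<in> rhom \<Lambda> (rdsum ?L P) ?K"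
  proof (rule rhom_corestrict)
    fix u assume "u \<in> carrier (rdsum ?L P)"
    then obtain y x where u: "u = (y, x)" "y \<in> carrier Q" "q y = \<zero>\<^bsub>Y\<^esub>" "x \<in> carrier P"
      by (auto simp: in_a_kernel)
    have "p (g y) = \<zero>\<^bsub>X\<^esub>" using u g(2) rhom_zero[OF Y X r] by simp
    moreover have "p (g (f x)) = p x" using u f g ri rhom_closed[OF p'] rhom_closed[OF f(1)] by simp
    ultimately show "g (fst u) \<oplus>\<^bsub>P\<^esub> (snd u \<ominus>\<^bsub>P\<^esub> g (f (snd u))) \<in> a_kernel P X p"
      using u rhom_closed[OF f(1)] rhom_closed[OF g(1)] rhom_closed[OF p']
      by (simp add: in_a_kernel rhom_add[OF p'] rhom_minus[OF RP X p'] X.minus_self)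
  qed
  show ?thesis
  proof (rule rretractI[OF 1 2])
    fix x assume "x \<in> carrier ?K"
    then have "x \<in> carrier P" "g (f x) \<in> carrier P"
      using rhom_closed[OF f(1)] rhom_closed[OF g(1)] by (auto simp: in_a_kernel)
    then show "g (fst (f x, x)) \<oplus>\<^bsub>P\<^esub> (snd (f x, x) \<ominus>\<^bsub>P\<^esub> g (f (snd (f x, x)))) = x"
      using P.minus_add_cancel[of x "g (f x)"] by (simp add: P.AbGr.a_comm)
  qed
qed

text \<open>Taking syzygies respects stable retracts. The projective \<open>S\<close> is absorbed by
  presenting \<open>W \<oplus> S\<close> by \<open>T \<oplus> S\<close>, whose kernel is that of
  \<open>T -> W\<close>.\<close>

lemma rretract_kernel_syzygy:
  fixes X :: "('a, 'x) rmodule" and W :: "('a, 'w) rmodule"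
    and P :: "('a, 'p) rmodule" and S :: "('a, 's) rmodule"
  assumes X: "right_module \<Lambda> X" and W: "right_module \<Lambda> W"
    and P: "fg_right_module \<Lambda> P" "projective \<Lambda> P" and S: "fg_right_module \<Lambda> S" "projective \<Lambda> S"
    and p: "p \<in> epi_rhom \<Lambda> P X" and XW: "rretract \<Lambda> X (rdsum W S)" and V: "is_syzygy \<Lambda> W V"
  shows "rretract \<Lambda> (restrict_to P (a_kernel P X p)) (rdsum V P)"
proof -
  obtain T t where T: "T \<in> fgproj \<Lambda>" "t \<in> epi_rhom \<Lambda> T W" "riso \<Lambda> (restrict_to T (a_kernel T W t)) V"
    "V \<in> fgmod \<Lambda>"
    using V by (rule is_syzygyE)
  note fgT = fgprojD(1)[OF T(1)] and t = epi_rhom_rhom[OF T(2)]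
  note RT = right_module_fg[OF fgT] and RS = right_module_fg[OF S(1)] and RP = right_module_fg[OF P(1)]
  let ?q = "\<lambda>y. (t (fst y), snd y)"
  have q: "?q \<in> epi_rhom \<Lambda> (rdsum T S) (rdsum W S)"
    by (rule epi_rhomI[OF rhom_map_prod[OF t rhom_id]])
      (force elim: epi_rhomE[OF T(2)])
  have Rq: "right_module \<Lambda> (restrict_to (rdsum T S) (a_kernel (rdsum T S) (rdsum W S) ?q))"
    by (rule right_module_restrict_to[OF right_module_rdsum[OF RT RS]
          rsubmodule_a_kernel[OF right_module_rdsum[OF RT RS] right_module_rdsum[OF W RS]
            epi_rhom_rhom[OF q]]])
  have kt: "rsubmodule \<Lambda> (a_kernel T W t) T" by (rule rsubmodule_a_kernel[OF RT W t])
  interpret S: right_module \<Lambda> S by (rule RS)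
  have "rretract \<Lambda> (restrict_to (rdsum T S) (a_kernel (rdsum T S) (rdsum W S) ?q))
      (restrict_to T (a_kernel T W t))"
  proof (rule rretractI)
    show "fst \<in> rhom \<Lambda> (restrict_to (rdsum T S) (a_kernel (rdsum T S) (rdsum W S) ?q))
        (restrict_to T (a_kernel T W t))"
      by (rule rhom_corestrict[OF rhom_restrict[OF rhom_fst]]) (auto simp: in_a_kernel)
    show "(\<lambda>x. (x, \<zero>\<^bsub>S\<^esub>)) \<in> rhom \<Lambda> (restrict_to T (a_kernel T W t))
        (restrict_to (rdsum T S) (a_kernel (rdsum T S) (rdsum W S) ?q))"
      by (rule rhom_corestrict[OF rhom_restrict[OF rhom_inl[OF RS] rsubmodule_subset[OF kt]]])
        (auto simp: in_a_kernel)
  qed (auto simp: in_a_kernel)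
  moreover have "rretract \<Lambda> (restrict_to T (a_kernel T W t)) V"
    by (rule riso_rretract(1)[OF right_module_restrict_to[OF RT kt] right_module_fg[OF fgmodD[OF T(4)]] T(3)])
  ultimately have "rretract \<Lambda> (restrict_to (rdsum T S) (a_kernel (rdsum T S) (rdsum W S) ?q)) V"
    by (rule rretract_trans)
  from rretract_trans[OF rretract_kernel[OF X right_module_rdsum[OF W RS] P
        fg_right_module_rdsum[OF fgT S(1)] projective_rdsum[OF fgprojD(2)[OF T(1)] RT S(2) RS] p q XW]
      rretract_rdsum_cong[OF this rretract_refl]]
  show ?thesis .
qed

text \<open>A factorisation of \<open>id - g f\<close> through \<open>P\<close> supplies exactly the
  second components of maps \<open>X -> Z \<oplus> P -> X\<close>. From here on stable retracts are
  handled as honest ones.\<close>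

lemma stable_retract_iff:
  fixes X :: "('a, 'x) rmodule" and Z :: "('a, 'z) rmodule"
  assumes X: "right_module \<Lambda> X" and Z: "right_module \<Lambda> Z"
  shows "stable_retract \<Lambda> X Z \<longleftrightarrow> (\<exists>P\<in>fgproj \<Lambda>. rretract \<Lambda> X (rdsum Z P))"
proof
  interpret X: right_module \<Lambda> X by (rule X)
  assume "stable_retract \<Lambda> X Z"
  then obtain f g P a b where f: "f \<in> rhom \<Lambda> X Z" and g: "g \<in> rhom \<Lambda> Z X" and P: "P \<in> fgproj \<Lambda>"
    and a: "a \<in> rhom \<Lambda> X P" and b: "b \<in> rhom \<Lambda> P X"
    and eq: "\<forall>x\<in>carrier X. x \<ominus>\<^bsub>X\<^esub> g (f x) = b (a x)"
    unfolding stable_retract_def factors_through_projective_def by blast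
  have "g (f x) \<oplus>\<^bsub>X\<^esub> b (a x) = x" if "x \<in> carrier X" for x
    using that eq[rule_format, OF that, symmetric] X.minus_add_cancel[of x "g (f x)"]
      rhom_closed[OF f] rhom_closed[OF g] by (simp add: X.AbGr.a_comm)
  then have "rretract \<Lambda> X (rdsum Z P)"
    by (intro rretractI[OF rhom_pair[OF f a] rhom_copair[OF X g b]]) simp
  with P show "\<exists>P\<in>fgproj \<Lambda>. rretract \<Lambda> X (rdsum Z P)" by blast
next
  interpret X: right_module \<Lambda> X by (rule X)
  interpret Z: right_module \<Lambda> Z by (rule Z)
  assume "\<exists>P\<in>fgproj \<Lambda>. rretract \<Lambda> X (rdsum Z P)"
  then obtain P where P: "P \<in> fgproj \<Lambda>" "rretract \<Lambda> X (rdsum Z P)" by blast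
  note RP = right_module_fg[OF fgprojD(1)[OF P(1)]]
  interpret P: right_module \<Lambda> P by (rule RP)
  obtain i r where i: "i \<in> rhom \<Lambda> X (rdsum Z P)" and r: "r \<in> rhom \<Lambda> (rdsum Z P) X"
    and ri: "\<And>x. x \<in> carrier X \<Longrightarrow> r (i x) = x"
    using P(2) by (rule rretractE) blast
  let ?f = "\<lambda>x. fst (i x)" and ?g = "\<lambda>z. r (z, \<zero>\<^bsub>P\<^esub>)" and ?a = "\<lambda>x. snd (i x)" and ?b = "\<lambda>p. r (\<zero>\<^bsub>Z\<^esub>, p)"
  have f: "?f \<in> rhom \<Lambda> X Z" and a: "?a \<in> rhom \<Lambda> X P"
    by (rule rhom_comp[OF i rhom_fst], rule rhom_comp[OF i rhom_snd])
  have g: "?g \<in> rhom \<Lambda> Z X" and b: "?b \<in> rhom \<Lambda> P X"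
    by (rule rhom_comp[OF rhom_inl[OF RP] r], rule rhom_comp[OF rhom_inr[OF Z] r])
  have "x \<ominus>\<^bsub>X\<^esub> ?g (?f x) = ?b (?a x)" if x: "x \<in> carrier X" for x
  proof -
    have c: "?f x \<in> carrier Z" "?a x \<in> carrier P" using rhom_closed[OF f x] rhom_closed[OF a x] by auto
    have e: "?b (?a x) \<oplus>\<^bsub>X\<^esub> ?g (?f x) = x"
      using c rhom_add[OF r, of "(\<zero>\<^bsub>Z\<^esub>, ?a x)" "(?f x, \<zero>\<^bsub>P\<^esub>)"] ri[OF x] by simp
    show ?thesis
      using X.add_minus_cancel[OF rhom_closed[OF b c(2)] rhom_closed[OF g c(1)]] by (simp only: e)
  qed
  then have "factors_through_projective \<Lambda> X X (\<lambda>x. x \<ominus>\<^bsub>X\<^esub> ?g (?f x))"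
    unfolding factors_through_projective_def using P(1) a b by (intro bexI ballI)
  then show "stable_retract \<Lambda> X Z"
    unfolding stable_retract_def using f g by (intro bexI)
qed

text \<open>\<open>add_closure\<close> asks for a complement inside \<open>fgmod\<close>; this turns
  retracts into members of it.\<close>

lemma ex_complement:
  fixes X :: "('a, 'x) rmodule" and Y :: "('a, 'y) rmodule"
  assumes X: "right_module \<Lambda> X" and Y: "fg_right_module \<Lambda> Y" and "rretract \<Lambda> X Y"
  shows "\<exists>C\<in>fgmod \<Lambda>. riso \<Lambda> (rdsum X C) Y"
proof -
  obtain f g where f: "f \<in> rhom \<Lambda> X Y" "g \<in> rhom \<Lambda> Y X" "\<And>x. x \<in> carrier X \<Longrightarrow> g (f x) = x"
    using assms(3) by (rule rretractE) blast
  note RY = right_module_fg[OF Y]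
  let ?C = "restrict_to Y (a_kernel Y X g)"
  have fgC: "fg_right_module \<Lambda> ?C" by (rule fg_submodule[OF Y rsubmodule_a_kernel[OF RY X f(2)]])
  obtain C where C: "C \<in> fgmod \<Lambda>" "riso \<Lambda> ?C C"
    using ex_riso_fgmod[OF fd_algebra_axioms fgC] by blast
  have "riso \<Lambda> (rdsum X C) (rdsum X ?C)"
    by (rule riso_rdsum_cong[OF riso_refl riso_sym[OF right_module_fg[OF fgC] right_module_fg[OF fgmodD[OF C(1)]] C(2)]])
  then show ?thesis
    using C(1) riso_trans riso_rretract_complement[OF X RY f] by blast
qed

end

lemma fg_right_module_fin_dsum:
  assumes ring: "ring \<Lambda>" and F: "\<And>i. i < n \<Longrightarrow> fg_right_module \<Lambda> (F i)"
  shows "fg_right_module \<Lambda> (fin_dsum n F)"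
  using F
proof (induction n)
  case 0
  have "rsubmodule \<Lambda> N (fin_dsum 0 F) \<Longrightarrow> carrier (fin_dsum 0 F) \<subseteq> N" for N
    using rsubmodule_zero[of \<Lambda> N "fin_dsum 0 F"] by (auto simp: restrict_def)
  then show ?case
    using right_module_fin_dsum[OF ring, of 0 F] by (intro fg_right_moduleI[of _ _ "{}"]) auto
next
  case (Suc n)
  have S: "right_module \<Lambda> (fin_dsum (Suc n) F)"
    using Suc.prems by (intro right_module_fin_dsum[OF ring] right_module_fg)
  have D: "fg_right_module \<Lambda> (rdsum (fin_dsum n F) (F n))"
    using Suc by (intro fg_right_module_rdsum) auto
  show ?case
    by (rule fg_right_module_rretract[OF D S riso_rretract(1)[OF S right_module_fg[OF D] riso_fin_dsum_Suc]])
qed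

lemma projective_fin_dsum:
  assumes ring: "ring \<Lambda>" and F: "\<And>i. i < n \<Longrightarrow> right_module \<Lambda> (F i)" "\<And>i. i < n \<Longrightarrow> projective \<Lambda> (F i)"
  shows "projective \<Lambda> (fin_dsum n F)"
  using F
proof (induction n)
  case 0
  have R0: "right_module \<Lambda> (fin_dsum 0 F)" by (rule right_module_fin_dsum[OF ring]) simp
  have "restrict_to (fin_dsum 0 F) {\<zero>\<^bsub>fin_dsum 0 F\<^esub>} = fin_dsum 0 F"
    by (simp add: restrict_to_def fin_dsum_def restrict_def)
  then show ?case using projective_zero[OF R0] by simp
next
  case (Suc n)
  have R: "right_module \<Lambda> (fin_dsum n F)" "right_module \<Lambda> (fin_dsum (Suc n) F)"
    using Suc.prems by (auto intro!: right_module_fin_dsum[OF ring])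
  have Rn: "right_module \<Lambda> (F n)" using Suc.prems by simp
  have "projective \<Lambda> (rdsum (fin_dsum n F) (F n))"
    using Suc by (intro projective_rdsum R Rn) auto
  then show ?case
    by (rule projective_rretract)
      (rule riso_rretract(1)[OF R(2) right_module_rdsum[OF R(1) Rn] riso_fin_dsum_Suc])
qed

section \<open>The derived delooping level\<close>

text \<open>A finite infimum of natural numbers is attained.\<close>

lemma Inf_enat_le_iff: "Inf {enat n | n. P n} \<le> enat k \<longleftrightarrow> (\<exists>n\<le>k. P n)"
proof
  assume le: "Inf {enat n | n. P n} \<le> enat k"
  then obtain n where "P n" by (auto simp: Inf_enat_def split: if_splits)
  then have "Inf {enat n | n. P n} \<in> {enat n | n. P n}" by (intro wellorder_InfI[of "enat n"]) auto
  with le show "\<exists>n\<le>k. P n" by auto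
next
  assume "\<exists>n\<le>k. P n"
  then obtain n where "n \<le> k" "P n" by blast
  then have "Inf {enat n | n. P n} \<le> enat n" by (intro Inf_lower) blast
  also have "enat n \<le> enat k" using \<open>n \<le> k\<close> by simp
  finally show "Inf {enat n | n. P n} \<le> enat k" .
qed

lemma dell_le_iff:
  "dell \<Lambda> r X \<le> enat k \<longleftrightarrow> (\<exists>n\<le>k. \<exists>Y\<in>fgmod \<Lambda>. \<exists>U V.
     is_nth_syzygy \<Lambda> n X U \<and> is_nth_syzygy \<Lambda> (n + r) Y V \<and> stable_retract \<Lambda> U V)"
  unfolding dell_def by (rule Inf_enat_le_iff)

lemma dell_leI:
  "n \<le> k \<Longrightarrow> Y \<in> fgmod \<Lambda> \<Longrightarrow> is_nth_syzygy \<Lambda> n X U \<Longrightarrow> is_nth_syzygy \<Lambda> (n + r) Y V \<Longrightarrow>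
    stable_retract \<Lambda> U V \<Longrightarrow> dell \<Lambda> r X \<le> enat k"
  unfolding dell_le_iff by blast

lemma ddell_le_iff:
  fixes \<Lambda> :: "('k, 'a) module"
  shows "ddell \<Lambda> X \<le> enat k \<longleftrightarrow> (\<exists>m\<le>k. \<exists>n\<le>m. \<exists>(C :: nat \<Rightarrow> ('k, 'a) umod) d \<epsilon>.
     (\<forall>i\<le>n. C i \<in> fgmod \<Lambda>) \<and> exact_left_resolution \<Lambda> n C d \<epsilon> X \<and>
     (\<forall>i\<le>n. dell \<Lambda> (i + 1) (C i) \<le> enat (m - i)))"
  unfolding ddell_def by (rule Inf_enat_le_iff)

lemma exact_left_resolution_1:
  "exact_left_resolution \<Lambda> 1 C d \<epsilon> X \<longleftrightarrow> \<epsilon> \<in> epi_rhom \<Lambda> (C 0) X \<and>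
     a_kernel (C 0) X \<epsilon> = d 0 ` carrier (C 1) \<and> d 0 \<in> rhom \<Lambda> (C 1) (C 0) \<and>
     a_kernel (C 1) (C 0) (d 0) = {\<zero>\<^bsub>C 1\<^esub>}"
  by (simp add: exact_left_resolution_def Let_def)

section \<open>The one-point extension\<close>

locale one_point = B: fd_algebra K B + M: fg_right_module B M
  for K :: "'k ring" and B :: "('k, 'b) module" and M :: "('b, 'm) rmodule"
begin

abbreviation A where "A \<equiv> one_point_ext K B M"

lemma A_simps [simp]:
  "carrier A = carrier K \<times> carrier M \<times> carrier B"
  "\<zero>\<^bsub>A\<^esub> = (\<zero>\<^bsub>K\<^esub>, \<zero>\<^bsub>M\<^esub>, \<zero>\<^bsub>B\<^esub>)" "\<one>\<^bsub>A\<^esub> = (\<one>\<^bsub>K\<^esub>, \<zero>\<^bsub>M\<^esub>, \<one>\<^bsub>B\<^esub>)"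
  "(a, m, b) \<oplus>\<^bsub>A\<^esub> (a', m', b') = (a \<oplus>\<^bsub>K\<^esub> a', m \<oplus>\<^bsub>M\<^esub> m', b \<oplus>\<^bsub>B\<^esub> b')"
  "(a, m, b) \<otimes>\<^bsub>A\<^esub> (a', m', b') =
    (a \<otimes>\<^bsub>K\<^esub> a', m' \<triangleleft>\<^bsub>M\<^esub> (a \<odot>\<^bsub>B\<^esub> \<one>\<^bsub>B\<^esub>) \<oplus>\<^bsub>M\<^esub> m \<triangleleft>\<^bsub>M\<^esub> b', b \<otimes>\<^bsub>B\<^esub> b')"
  "c \<odot>\<^bsub>A\<^esub> (a, m, b) = (c \<otimes>\<^bsub>K\<^esub> a, m \<triangleleft>\<^bsub>M\<^esub> (c \<odot>\<^bsub>B\<^esub> \<one>\<^bsub>B\<^esub>), c \<odot>\<^bsub>B\<^esub> b)"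
  by (simp_all add: one_point_ext_def)

lemma scalar_commute:
  "c \<in> carrier K \<Longrightarrow> r \<in> carrier B \<Longrightarrow> (c \<odot>\<^bsub>B\<^esub> \<one>\<^bsub>B\<^esub>) \<otimes>\<^bsub>B\<^esub> r = r \<otimes>\<^bsub>B\<^esub> (c \<odot>\<^bsub>B\<^esub> \<one>\<^bsub>B\<^esub>)"
  by (simp add: B.scalar_mult_left B.mult_scalar)

lemma scalar_swap: "c \<in> carrier K \<Longrightarrow> r \<in> carrier B \<Longrightarrow> m \<in> carrier M \<Longrightarrow>
    m \<triangleleft>\<^bsub>M\<^esub> (c \<odot>\<^bsub>B\<^esub> \<one>\<^bsub>B\<^esub>) \<triangleleft>\<^bsub>M\<^esub> r = m \<triangleleft>\<^bsub>M\<^esub> r \<triangleleft>\<^bsub>M\<^esub> (c \<odot>\<^bsub>B\<^esub> \<one>\<^bsub>B\<^esub>)"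
  by (simp add: M.ract_mult[symmetric] scalar_commute B.scalar_closed)

text \<open>This is \<open>(c d) m = c (d m)\<close> for the left action of \<open>K\<close> on
  \<open>M\<close>, written on the right, which reverses the order of the factors; it rests on
  commutativity of \<open>K\<close>.\<close>

lemma scalar_twice: "c \<in> carrier K \<Longrightarrow> d \<in> carrier K \<Longrightarrow> m \<in> carrier M \<Longrightarrow>
    m \<triangleleft>\<^bsub>M\<^esub> ((c \<otimes>\<^bsub>K\<^esub> d) \<odot>\<^bsub>B\<^esub> \<one>\<^bsub>B\<^esub>) = m \<triangleleft>\<^bsub>M\<^esub> (d \<odot>\<^bsub>B\<^esub> \<one>\<^bsub>B\<^esub>) \<triangleleft>\<^bsub>M\<^esub> (c \<odot>\<^bsub>B\<^esub> \<one>\<^bsub>B\<^esub>)"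
  by (simp add: B.K.m_comm[of c] B.scalar_mult M.ract_mult B.scalar_closed)

lemmas sc_simps = M.rm_simps B.scalar_closed B.scalar_add B.scalar_zero
  B.Mod.smult_one

lemma abelian_group_A: "abelian_group A"
proof (rule abelian_groupI)
  fix x assume "x \<in> carrier A"
  then obtain a m b where x: "x = (a, m, b)" "a \<in> carrier K" "m \<in> carrier M" "b \<in> carrier B" by auto
  then show "\<exists>y\<in>carrier A. y \<oplus>\<^bsub>A\<^esub> x = \<zero>\<^bsub>A\<^esub>"
    by (intro bexI[of _ "(\<ominus>\<^bsub>K\<^esub> a, \<ominus>\<^bsub>M\<^esub> m, \<ominus>\<^bsub>B\<^esub> b)"]) (simp_all add: B.K.l_neg M.AbGr.l_neg B.Alg.l_neg)
qed (auto simp: B.K.a_ac M.AbGr.a_ac B.Alg.a_ac)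

lemma ring_A: "ring A"
proof (rule ringI[OF abelian_group_A])
  show "monoid A"
  proof (rule monoidI)
    fix x y z assume "x \<in> carrier A" "y \<in> carrier A" "z \<in> carrier A"
    then obtain a m b a' m' b' a'' m'' b''
      where x: "x = (a, m, b)" "a \<in> carrier K" "m \<in> carrier M" "b \<in> carrier B"
        and y: "y = (a', m', b')" "a' \<in> carrier K" "m' \<in> carrier M" "b' \<in> carrier B"
        and z: "z = (a'', m'', b'')" "a'' \<in> carrier K" "m'' \<in> carrier M" "b'' \<in> carrier B" by auto
    show "x \<otimes>\<^bsub>A\<^esub> y \<in> carrier A" using x y by (simp add: sc_simps)
    show "x \<otimes>\<^bsub>A\<^esub> y \<otimes>\<^bsub>A\<^esub> z = x \<otimes>\<^bsub>A\<^esub> (y \<otimes>\<^bsub>A\<^esub> z)"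
      using x y z
      by (simp add: scalar_twice scalar_swap[of a b'' m'] M.ract_mult M.ract_closed M.ract_add_left
          B.scalar_closed B.K.m_assoc B.Alg.m_assoc M.AbGr.a_assoc)
  qed (auto simp: sc_simps)
next
  fix x y z assume "x \<in> carrier A" "y \<in> carrier A" "z \<in> carrier A"
  then obtain a m b a' m' b' a'' m'' b''
    where x: "x = (a, m, b)" "a \<in> carrier K" "m \<in> carrier M" "b \<in> carrier B"
      and y: "y = (a', m', b')" "a' \<in> carrier K" "m' \<in> carrier M" "b' \<in> carrier B"
      and z: "z = (a'', m'', b'')" "a'' \<in> carrier K" "m'' \<in> carrier M" "b'' \<in> carrier B" by auto
  show "(x \<oplus>\<^bsub>A\<^esub> y) \<otimes>\<^bsub>A\<^esub> z = x \<otimes>\<^bsub>A\<^esub> z \<oplus>\<^bsub>A\<^esub> y \<otimes>\<^bsub>A\<^esub> z"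
    using x y z by (simp add: sc_simps B.K.l_distr B.Alg.l_distr M.AbGr.a_ac)
  show "z \<otimes>\<^bsub>A\<^esub> (x \<oplus>\<^bsub>A\<^esub> y) = z \<otimes>\<^bsub>A\<^esub> x \<oplus>\<^bsub>A\<^esub> z \<otimes>\<^bsub>A\<^esub> y"
    using x y z by (simp add: sc_simps B.K.r_distr B.Alg.r_distr M.AbGr.a_ac)
qed

lemma module_A: "module K A"
proof (rule moduleI[OF B.K.is_cring abelian_group_A])
  fix c d x y assume c: "c \<in> carrier K" and d: "d \<in> carrier K" and "x \<in> carrier A"
  then obtain a m b where x: "x = (a, m, b)" "a \<in> carrier K" "m \<in> carrier M" "b \<in> carrier B" by auto
  show "c \<odot>\<^bsub>A\<^esub> x \<in> carrier A" using c x by (simp add: sc_simps)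
  show "(c \<oplus>\<^bsub>K\<^esub> d) \<odot>\<^bsub>A\<^esub> x = c \<odot>\<^bsub>A\<^esub> x \<oplus>\<^bsub>A\<^esub> d \<odot>\<^bsub>A\<^esub> x"
    using c d x by (simp add: sc_simps B.K.l_distr B.Mod.smult_l_distr)
  show "(c \<otimes>\<^bsub>K\<^esub> d) \<odot>\<^bsub>A\<^esub> x = c \<odot>\<^bsub>A\<^esub> (d \<odot>\<^bsub>A\<^esub> x)"
    using c d x
    by (simp add: sc_simps B.K.m_assoc B.Mod.smult_assoc1[of c d b] scalar_twice)
next
  show "\<one>\<^bsub>K\<^esub> \<odot>\<^bsub>A\<^esub> x = x" if "x \<in> carrier A" for x
    using that by (auto simp: sc_simps)
next
  fix c x y assume c: "c \<in> carrier K" and "x \<in> carrier A" "y \<in> carrier A"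
  then obtain a m b a' m' b'
    where x: "x = (a, m, b)" "a \<in> carrier K" "m \<in> carrier M" "b \<in> carrier B"
      and y: "y = (a', m', b')" "a' \<in> carrier K" "m' \<in> carrier M" "b' \<in> carrier B" by auto
  show "c \<odot>\<^bsub>A\<^esub> (x \<oplus>\<^bsub>A\<^esub> y) = c \<odot>\<^bsub>A\<^esub> x \<oplus>\<^bsub>A\<^esub> c \<odot>\<^bsub>A\<^esub> y"
    using c x y by (simp add: sc_simps B.K.r_distr B.Mod.smult_r_distr)
qed

lemma A_smult_mult:
  assumes c: "c \<in> carrier K" and "x \<in> carrier A" and "y \<in> carrier A"
  shows "(c \<odot>\<^bsub>A\<^esub> x) \<otimes>\<^bsub>A\<^esub> y = c \<odot>\<^bsub>A\<^esub> (x \<otimes>\<^bsub>A\<^esub> y)" and "x \<otimes>\<^bsub>A\<^esub> (c \<odot>\<^bsub>A\<^esub> y) = c \<odot>\<^bsub>A\<^esub> (x \<otimes>\<^bsub>A\<^esub> y)"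
proof -
  obtain a m b a' m' b'
    where x: "x = (a, m, b)" "a \<in> carrier K" "m \<in> carrier M" "b \<in> carrier B"
      and y: "y = (a', m', b')" "a' \<in> carrier K" "m' \<in> carrier M" "b' \<in> carrier B"
    using assms(2,3) by auto
  have sm: "m \<triangleleft>\<^bsub>M\<^esub> (c \<odot>\<^bsub>B\<^esub> b') = m \<triangleleft>\<^bsub>M\<^esub> b' \<triangleleft>\<^bsub>M\<^esub> (c \<odot>\<^bsub>B\<^esub> \<one>\<^bsub>B\<^esub>)"
    using c x y M.ract_mult[of m b' "c \<odot>\<^bsub>B\<^esub> \<one>\<^bsub>B\<^esub>"] by (simp add: B.mult_scalar B.scalar_closed)
  show "(c \<odot>\<^bsub>A\<^esub> x) \<otimes>\<^bsub>A\<^esub> y = c \<odot>\<^bsub>A\<^esub> (x \<otimes>\<^bsub>A\<^esub> y)"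
    using c x y
    by (simp add: M.rm_simps B.scalar_closed B.K.m_assoc B.smult_mult_left scalar_twice
        scalar_swap[of c b' m])
  show "x \<otimes>\<^bsub>A\<^esub> (c \<odot>\<^bsub>A\<^esub> y) = c \<odot>\<^bsub>A\<^esub> (x \<otimes>\<^bsub>A\<^esub> y)"
    using c x y sm
    by (simp add: scalar_swap[of a "c \<odot>\<^bsub>B\<^esub> \<one>\<^bsub>B\<^esub>" m', symmetric] M.rm_simps B.scalar_closed B.K.m_lcomm B.smult_mult_right)
qed

text \<open>
  Regarding \<open>A\<close> as a module over \<open>K\<close> reduces the claim to a statement about subspaces
  that contain a spanning set of each of the three entries.
\<close>

lemma finite_dim_A:
  "\<exists>S. finite S \<and> S \<subseteq> carrier A \<and>
    (\<forall>x\<in>carrier A. \<exists>c\<in>S \<rightarrow> carrier K. x = (\<Oplus>\<^bsub>A\<^esub>s\<in>S. c s \<odot>\<^bsub>A\<^esub> s))"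
proof -
  interpret A: module K A by (rule module_A)
  \<comment> \<open>\<open>K\<close> as an algebra over itself and \<open>V\<close> as
    \<open>A\<close> with \<open>K\<close> acting on the right: in this shape the criterion
    \<open>fg_right_moduleI\<close> applies to the spanning problem.\<close>
  define K' :: "('k, 'k) module" where "K' = \<lparr>carrier = carrier K, mult = (\<otimes>\<^bsub>K\<^esub>), one = \<one>\<^bsub>K\<^esub>,
    zero = \<zero>\<^bsub>K\<^esub>, add = (\<oplus>\<^bsub>K\<^esub>), smult = (\<otimes>\<^bsub>K\<^esub>)\<rparr>"
  define V :: "('k, 'k \<times> 'm \<times> 'b) rmodule" where "V = \<lparr>carrier = carrier A, mult = undefined,
    one = undefined, zero = \<zero>\<^bsub>A\<^esub>, add = (\<oplus>\<^bsub>A\<^esub>), ract = (\<lambda>x c. c \<odot>\<^bsub>A\<^esub> x)\<rparr>"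
  have K'_simps: "carrier K' = carrier K" "x \<otimes>\<^bsub>K'\<^esub> y = x \<otimes>\<^bsub>K\<^esub> y" "\<one>\<^bsub>K'\<^esub> = \<one>\<^bsub>K\<^esub>" "\<zero>\<^bsub>K'\<^esub> = \<zero>\<^bsub>K\<^esub>"
    "x \<oplus>\<^bsub>K'\<^esub> y = x \<oplus>\<^bsub>K\<^esub> y" for x y
    by (simp_all add: K'_def)
  have V_simps: "carrier V = carrier A" "\<zero>\<^bsub>V\<^esub> = \<zero>\<^bsub>A\<^esub>" "x \<oplus>\<^bsub>V\<^esub> y = x \<oplus>\<^bsub>A\<^esub> y" "x \<triangleleft>\<^bsub>V\<^esub> c = c \<odot>\<^bsub>A\<^esub> x"
    for x y c
    by (simp_all add: V_def)
  have "\<exists>y\<in>carrier K. y \<oplus>\<^bsub>K\<^esub> x = \<zero>\<^bsub>K\<^esub>" if "x \<in> carrier K" for x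
    using B.K.l_neg[OF that] B.K.a_inv_closed[OF that] by blast
  then interpret K': abelian_group K'
    by (intro abelian_groupI) (simp_all add: K'_simps B.K.a_ac)
  interpret K': ring K'
    by (rule ringI[OF K'.abelian_group_axioms monoidI])
      (auto simp: K'_simps B.K.m_assoc B.K.l_distr B.K.r_distr)
  have "\<exists>y\<in>carrier A. y \<oplus>\<^bsub>A\<^esub> x = \<zero>\<^bsub>A\<^esub>" if "x \<in> carrier A" for x
    using A.l_neg[OF that] A.a_inv_closed[OF that] by blast
  then interpret V: abelian_group V
    unfolding V_def by (intro abelian_groupI) (simp_all add: A.a_ac del: A_simps)
  have V: "right_module K' V"
    by unfold_locales
      (simp_all add: V_simps K'_simps A.smult_l_distr A.smult_r_distr A.smult_assoc1[symmetric]
        B.K.m_comm del: A_simps)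
  obtain ts where ts: "set ts \<subseteq> carrier M" "kspan K B M ts = carrier M"
    using B.ex_kspan_carrier[OF M.fg_right_module_axioms] by blast
  obtain us where us: "set us \<subseteq> carrier B" "kspan K B (regular_rmodule B) us = carrier B"
    using B.ex_kspan_carrier[OF fg_regular[OF B.Alg.ring_axioms]] by auto
  let ?i = "\<lambda>m. (\<zero>\<^bsub>K\<^esub>, m, \<zero>\<^bsub>B\<^esub>)" and ?j = "\<lambda>b. (\<zero>\<^bsub>K\<^esub>, \<zero>\<^bsub>M\<^esub>, b)" and ?e = "(\<one>\<^bsub>K\<^esub>, \<zero>\<^bsub>M\<^esub>, \<zero>\<^bsub>B\<^esub>)"
  have "fg_right_module K' V"
  proof (rule fg_right_moduleI[OF V, of "insert ?e (?i ` set ts \<union> ?j ` set us)"])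
    show "insert ?e (?i ` set ts \<union> ?j ` set us) \<subseteq> carrier V" using ts us by (auto simp: V_simps)
    fix N assume N: "rsubmodule K' N V" and sub: "insert ?e (?i ` set ts \<union> ?j ` set us) \<subseteq> N"
    have zero: "(\<zero>\<^bsub>K\<^esub>, \<zero>\<^bsub>M\<^esub>, \<zero>\<^bsub>B\<^esub>) \<in> N" using rsubmodule_zero[OF N] by (simp add: V_simps)
    have add: "x \<oplus>\<^bsub>A\<^esub> y \<in> N" if "x \<in> N" "y \<in> N" for x y
      using rsubmodule_add[OF N that] by (simp add: V_simps)
    have act: "c \<odot>\<^bsub>A\<^esub> x \<in> N" if "x \<in> N" "c \<in> carrier K" for x c
      using rsubmodule_ract[OF N that(1), of c] that(2) by (simp add: V_simps K'_simps)
    have 1: "kspan K B M ts \<subseteq> {m \<in> carrier M. ?i m \<in> N}"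
    proof (rule kspan_subset)
      show "x \<oplus>\<^bsub>M\<^esub> y \<in> {m \<in> carrier M. ?i m \<in> N}"
        if "x \<in> {m \<in> carrier M. ?i m \<in> N}" "y \<in> {m \<in> carrier M. ?i m \<in> N}" for x y
        using add[of "?i x" "?i y"] that by auto
      show "x \<triangleleft>\<^bsub>M\<^esub> (c \<odot>\<^bsub>B\<^esub> \<one>\<^bsub>B\<^esub>) \<in> {m \<in> carrier M. ?i m \<in> N}"
        if "x \<in> {m \<in> carrier M. ?i m \<in> N}" "c \<in> carrier K" for x c
        using act[of "?i x" c] that by (auto simp: sc_simps)
    qed (use zero ts sub in auto)
    have 2: "kspan K B (regular_rmodule B) us \<subseteq> {b \<in> carrier B. ?j b \<in> N}"
    proof (rule kspan_subset)
      show "x \<oplus>\<^bsub>regular_rmodule B\<^esub> y \<in> {b \<in> carrier B. ?j b \<in> N}"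
        if "x \<in> {b \<in> carrier B. ?j b \<in> N}" "y \<in> {b \<in> carrier B. ?j b \<in> N}" for x y
        using add[of "?j x" "?j y"] that by auto
      show "x \<triangleleft>\<^bsub>regular_rmodule B\<^esub> (c \<odot>\<^bsub>B\<^esub> \<one>\<^bsub>B\<^esub>) \<in> {b \<in> carrier B. ?j b \<in> N}"
        if "x \<in> {b \<in> carrier B. ?j b \<in> N}" "c \<in> carrier K" for x c
        using act[of "?j x" c] that by (auto simp: sc_simps B.mult_scalar)
    qed (use zero us sub in auto)
    show "carrier V \<subseteq> N"
    proof
      fix x assume "x \<in> carrier V"
      then obtain a m b where x: "x = (a, m, b)" "a \<in> carrier K" "m \<in> carrier M" "b \<in> carrier B"
        by (auto simp: V_simps)
      with 1 2 ts(2) us(2) have "?i m \<in> N" "?j b \<in> N" by blast+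
      moreover have "?e \<in> N" using sub by blast
      ultimately have "a \<odot>\<^bsub>A\<^esub> ?e \<oplus>\<^bsub>A\<^esub> (?i m \<oplus>\<^bsub>A\<^esub> ?j b) \<in> N" using x(2) by (intro add act)
      then show "x \<in> N" using x by (simp add: sc_simps)
    qed
  qed simp
  then interpret VK: fg_right_module K' V .
  obtain T where T: "finite T" "T \<subseteq> carrier V"
    "\<forall>x\<in>carrier V. \<exists>a\<in>T \<rightarrow> carrier K'. x = (\<Oplus>\<^bsub>V\<^esub>t\<in>T. t \<triangleleft>\<^bsub>V\<^esub> a t)"
    using VK.finitely_generated by blast
  \<comment> \<open>Finite sums read only carrier, zero and addition, and these are the same for
    \<open>V\<close> and \<open>A\<close>.\<close>
  have "finsum V = (finsum A :: ('k \<times> 'm \<times> 'b \<Rightarrow> _) \<Rightarrow> _)"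
    by (intro ext) (simp add: finsum_def finprod_def V_def)
  then show ?thesis using T by (intro exI[of _ T]) (simp add: V_simps K'_simps del: A_simps)
qed

text \<open>Makes presentations, covers and syzygies available over \<open>A\<close> in the same way
  as over \<open>B\<close>.\<close>

sublocale A: fd_algebra K A
proof -
  interpret ring A by (rule ring_A)
  interpret module K A by (rule module_A)
  show "fd_algebra K A"
    by unfold_locales (simp_all add: A_smult_mult finite_dim_A del: A_simps)
qed

section \<open>Modules over \<open>B\<close> as modules over the one-point extension\<close>

text \<open>A right \<open>A\<close>-module comes from \<open>B\<close> iff it is annihilated by \<open>e\<^sub>0\<close>.\<close>

definition from_B :: "('k \<times> 'm \<times> 'b, 'x) rmodule \<Rightarrow> bool" where
  "from_B X \<longleftrightarrow> (\<forall>x\<in>carrier X. x \<triangleleft>\<^bsub>X\<^esub> (\<zero>\<^bsub>K\<^esub>, \<zero>\<^bsub>M\<^esub>, \<one>\<^bsub>B\<^esub>) = x)"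

text \<open>Inflation along the algebra homomorphism \<open>A -> B\<close>,
  \<open>(a, m, b) \<mapsto> b\<close>. The idle fields \<open>mult\<close> and \<open>one\<close>
  are copied so that \<open>res\<close> undoes it as an equality of records.\<close>

definition infl :: "('b, 'x) rmodule \<Rightarrow> ('k \<times> 'm \<times> 'b, 'x) rmodule" where
  "infl N = \<lparr>carrier = carrier N, mult = monoid.mult N, one = monoid.one N, zero = \<zero>\<^bsub>N\<^esub>,
     add = add N, ract = (\<lambda>x r. x \<triangleleft>\<^bsub>N\<^esub> snd (snd r))\<rparr>"

text \<open>Restriction along \<open>b \<mapsto> (0, 0, b)\<close>. This map does not preserve the
  unit, so the result is a \<open>B\<close>-module only for modules with
  \<open>from_B\<close>.\<close>

definition res :: "('k \<times> 'm \<times> 'b, 'x) rmodule \<Rightarrow> ('b, 'x) rmodule" where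
  "res X = \<lparr>carrier = carrier X, mult = monoid.mult X, one = monoid.one X, zero = \<zero>\<^bsub>X\<^esub>,
     add = add X, ract = (\<lambda>x b. x \<triangleleft>\<^bsub>X\<^esub> (\<zero>\<^bsub>K\<^esub>, \<zero>\<^bsub>M\<^esub>, b))\<rparr>"

lemma infl_simps [simp]:
  "carrier (infl N) = carrier N" "\<zero>\<^bsub>infl N\<^esub> = \<zero>\<^bsub>N\<^esub>" "x \<oplus>\<^bsub>infl N\<^esub> y = x \<oplus>\<^bsub>N\<^esub> y"
  "x \<triangleleft>\<^bsub>infl N\<^esub> (a, m, b) = x \<triangleleft>\<^bsub>N\<^esub> b"
  by (simp_all add: infl_def)

lemma res_simps [simp]:
  "carrier (res X) = carrier X" "\<zero>\<^bsub>res X\<^esub> = \<zero>\<^bsub>X\<^esub>" "x \<oplus>\<^bsub>res X\<^esub> y = x \<oplus>\<^bsub>X\<^esub> y"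
  "x \<triangleleft>\<^bsub>res X\<^esub> b = x \<triangleleft>\<^bsub>X\<^esub> (\<zero>\<^bsub>K\<^esub>, \<zero>\<^bsub>M\<^esub>, b)"
  by (simp_all add: res_def)

lemma res_infl [simp]: "res (infl N) = N"
  by (simp add: res_def infl_def)

lemma res_restrict_to: "res (restrict_to X S) = restrict_to (res X) S"
  by (simp add: res_def restrict_to_def)

lemma infl_restrict_to: "infl (restrict_to N S) = restrict_to (infl N) S"
  by (simp add: infl_def restrict_to_def)

lemma res_rdsum: "res (rdsum X Y) = rdsum (res X) (res Y)"
  by (simp add: res_def rdsum_def fun_eq_iff)

lemma infl_rdsum: "infl (rdsum X Y) = rdsum (infl X) (infl Y)"
  by (simp add: infl_def rdsum_def fun_eq_iff)

lemma a_kernel_res [simp]: "a_kernel (res X) (res Y) f = a_kernel X Y f"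
  by (simp add: a_kernel_def')

lemma a_kernel_infl [simp]: "a_kernel (infl X) (infl Y) f = a_kernel X Y f"
  by (simp add: a_kernel_def')

text \<open>With \<open>f = (0, 0, 1)\<close> one has \<open>x = x f\<close> and
  \<open>f (a, m, b) = (0, 0, b)\<close>.\<close>

lemma from_B_ract:
  assumes X: "right_module A X" and "from_B X" and x: "x \<in> carrier X"
    and "a \<in> carrier K" "m \<in> carrier M" "b \<in> carrier B"
  shows "x \<triangleleft>\<^bsub>X\<^esub> (a, m, b) = x \<triangleleft>\<^bsub>X\<^esub> (\<zero>\<^bsub>K\<^esub>, \<zero>\<^bsub>M\<^esub>, b)"
proof -
  interpret X: right_module A X by (rule X)
  have "x \<triangleleft>\<^bsub>X\<^esub> (a, m, b) = x \<triangleleft>\<^bsub>X\<^esub> (\<zero>\<^bsub>K\<^esub>, \<zero>\<^bsub>M\<^esub>, \<one>\<^bsub>B\<^esub>) \<triangleleft>\<^bsub>X\<^esub> (a, m, b)"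
    using assms(2) x by (simp add: from_B_def)
  also have "\<dots> = x \<triangleleft>\<^bsub>X\<^esub> ((\<zero>\<^bsub>K\<^esub>, \<zero>\<^bsub>M\<^esub>, \<one>\<^bsub>B\<^esub>) \<otimes>\<^bsub>A\<^esub> (a, m, b))"
    using x assms(4-6) by (intro X.ract_mult[symmetric]) auto
  also have "(\<zero>\<^bsub>K\<^esub>, \<zero>\<^bsub>M\<^esub>, \<one>\<^bsub>B\<^esub>) \<otimes>\<^bsub>A\<^esub> (a, m, b) = (\<zero>\<^bsub>K\<^esub>, \<zero>\<^bsub>M\<^esub>, b)"
    using assms(4-6) by (simp add: sc_simps)
  finally show ?thesis .
qed

text \<open>The idempotents \<open>(1, 0, 0)\<close> and \<open>(0, 0, 1)\<close> add up to the
  unit.\<close>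

lemma from_B_iff:
  assumes X: "right_module A X"
  shows "from_B X \<longleftrightarrow> (\<forall>x\<in>carrier X. x \<triangleleft>\<^bsub>X\<^esub> (\<one>\<^bsub>K\<^esub>, \<zero>\<^bsub>M\<^esub>, \<zero>\<^bsub>B\<^esub>) = \<zero>\<^bsub>X\<^esub>)"
proof -
  interpret X: right_module A X by (rule X)
  have "x \<triangleleft>\<^bsub>X\<^esub> (\<zero>\<^bsub>K\<^esub>, \<zero>\<^bsub>M\<^esub>, \<one>\<^bsub>B\<^esub>) = x \<longleftrightarrow> x \<triangleleft>\<^bsub>X\<^esub> (\<one>\<^bsub>K\<^esub>, \<zero>\<^bsub>M\<^esub>, \<zero>\<^bsub>B\<^esub>) = \<zero>\<^bsub>X\<^esub>"
    if x: "x \<in> carrier X" for x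
  proof -
    let ?e = "(\<one>\<^bsub>K\<^esub>, \<zero>\<^bsub>M\<^esub>, \<zero>\<^bsub>B\<^esub>)" and ?f = "(\<zero>\<^bsub>K\<^esub>, \<zero>\<^bsub>M\<^esub>, \<one>\<^bsub>B\<^esub>)"
    have c: "?e \<in> carrier A" "?f \<in> carrier A" by simp_all
    have "?e \<oplus>\<^bsub>A\<^esub> ?f = \<one>\<^bsub>A\<^esub>" by simp
    then have "x \<triangleleft>\<^bsub>X\<^esub> ?e \<oplus>\<^bsub>X\<^esub> x \<triangleleft>\<^bsub>X\<^esub> ?f = x"
      using X.ract_add_right[OF x c] X.ract_one[OF x] by metis
    then show ?thesis
      using X.ract_closed[OF x c(1)] X.ract_closed[OF x c(2)] x
      by (metis X.AbGr.l_zero X.AbGr.add.r_cancel_one)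
  qed
  then show ?thesis by (auto simp: from_B_def)
qed

lemma from_B_infl: "right_module B N \<Longrightarrow> from_B (infl N)"
  by (simp add: from_B_def right_module.ract_one)

lemma right_module_infl:
  assumes "right_module B N"
  shows "right_module A (infl N)"
proof -
  interpret N: right_module B N by (rule assms)
  have "\<exists>y\<in>carrier N. y \<oplus>\<^bsub>N\<^esub> x = \<zero>\<^bsub>N\<^esub>" if "x \<in> carrier N" for x
    using N.AbGr.l_neg[OF that] N.AbGr.a_inv_closed[OF that] by blast
  then interpret abelian_group "infl N"
    by (intro abelian_groupI) (auto simp: N.AbGr.a_ac)
  show ?thesis
    by unfold_locales (auto simp: N.rm_simps N.ract_mult)
qed

lemma right_module_res:
  assumes X: "right_module A X" and van: "from_B X"
  shows "right_module B (res X)"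
proof -
  interpret X: right_module A X by (rule X)
  have "\<exists>y\<in>carrier X. y \<oplus>\<^bsub>X\<^esub> x = \<zero>\<^bsub>X\<^esub>" if "x \<in> carrier X" for x
    using X.AbGr.l_neg[OF that] X.AbGr.a_inv_closed[OF that] by blast
  then interpret abelian_group "res X"
    by (intro abelian_groupI) (auto simp: X.AbGr.a_ac)
  show ?thesis
  proof unfold_locales
    fix x r s assume x: "x \<in> carrier (res X)" and r: "r \<in> carrier B" "s \<in> carrier B"
    show "x \<triangleleft>\<^bsub>res X\<^esub> (r \<oplus>\<^bsub>B\<^esub> s) = x \<triangleleft>\<^bsub>res X\<^esub> r \<oplus>\<^bsub>res X\<^esub> x \<triangleleft>\<^bsub>res X\<^esub> s"
      using X.ract_add_right[of x "(\<zero>\<^bsub>K\<^esub>, \<zero>\<^bsub>M\<^esub>, r)" "(\<zero>\<^bsub>K\<^esub>, \<zero>\<^bsub>M\<^esub>, s)"] x r by simp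
    show "x \<triangleleft>\<^bsub>res X\<^esub> (r \<otimes>\<^bsub>B\<^esub> s) = x \<triangleleft>\<^bsub>res X\<^esub> r \<triangleleft>\<^bsub>res X\<^esub> s"
      using X.ract_mult[of x "(\<zero>\<^bsub>K\<^esub>, \<zero>\<^bsub>M\<^esub>, r)" "(\<zero>\<^bsub>K\<^esub>, \<zero>\<^bsub>M\<^esub>, s)"] x r by (simp add: sc_simps)
  qed (use van in \<open>auto simp: X.ract_closed X.ract_add_left from_B_def\<close>)
qed

lemma rhom_res: "f \<in> rhom A X Y \<Longrightarrow> f \<in> rhom B (res X) (res Y)"
  by (auto simp: rhom_def)

lemma rhom_infl: "f \<in> rhom B X Y \<Longrightarrow> f \<in> rhom A (infl X) (infl Y)"
  by (auto simp: rhom_def)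

text \<open>Modules over \<open>B\<close> form a full subcategory of the modules over
  \<open>A\<close>: on them only the \<open>B\<close>-entry of an element of \<open>A\<close>
  acts.\<close>

lemma rhom_from_res:
  assumes X: "right_module A X" "from_B X" and Y: "right_module A Y" "from_B Y"
    and f: "f \<in> rhom B (res X) (res Y)"
  shows "f \<in> rhom A X Y"
proof (rule rhomI)
  fix x r assume x: "x \<in> carrier X" and "r \<in> carrier A"
  then obtain a m b where r: "r = (a, m, b)" "a \<in> carrier K" "m \<in> carrier M" "b \<in> carrier B" by auto
  have fx: "f x \<in> carrier Y" using rhom_closed[OF f] x by simp
  show "f (x \<triangleleft>\<^bsub>X\<^esub> r) = f x \<triangleleft>\<^bsub>Y\<^esub> r"
    using rhom_ract[OF f, of x b] x unfolding r(1) from_B_ract[OF X x r(2-4)] from_B_ract[OF Y fx r(2-4)]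
    by (simp add: r)
qed (use rhom_closed[OF f] rhom_add[OF f] in auto)

lemma rhom_into_infl:
  assumes "right_module A X" "from_B X" and "right_module B N" and f: "f \<in> rhom B (res X) N"
  shows "f \<in> rhom A X (infl N)"
  by (rule rhom_from_res[OF assms(1,2) right_module_infl[OF assms(3)] from_B_infl[OF assms(3)]])
    (simp add: f)

lemma rhom_from_infl:
  assumes "right_module A X" "from_B X" and "right_module B N" and f: "f \<in> rhom B N (res X)"
  shows "f \<in> rhom A (infl N) X"
  by (rule rhom_from_res[OF right_module_infl[OF assms(3)] from_B_infl[OF assms(3)] assms(1,2)])
    (simp add: f)

lemma epi_rhom_res: "f \<in> epi_rhom A X Y \<Longrightarrow> f \<in> epi_rhom B (res X) (res Y)"
  by (auto simp: epi_rhom_def rhom_res)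

lemma epi_rhom_infl: "f \<in> epi_rhom B X Y \<Longrightarrow> f \<in> epi_rhom A (infl X) (infl Y)"
  by (auto simp: epi_rhom_def rhom_infl)

lemma rretract_res: "rretract A X Y \<Longrightarrow> rretract B (res X) (res Y)"
  by (erule rretractE, rule rretractI[OF rhom_res rhom_res]) simp_all

lemma rretract_infl: "rretract B X Y \<Longrightarrow> rretract A (infl X) (infl Y)"
  by (erule rretractE, rule rretractI[OF rhom_infl rhom_infl]) simp_all

lemma from_B_rretract:
  assumes X: "right_module A X" and Y: "right_module A Y" "from_B Y" and "rretract A X Y"
  shows "from_B X"
  unfolding from_B_def
proof
  obtain f g where fg: "f \<in> rhom A X Y" "g \<in> rhom A Y X" "\<And>x. x \<in> carrier X \<Longrightarrow> g (f x) = x"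
    using assms(4) by (rule rretractE) blast
  fix x assume x: "x \<in> carrier X"
  then show "x \<triangleleft>\<^bsub>X\<^esub> (\<zero>\<^bsub>K\<^esub>, \<zero>\<^bsub>M\<^esub>, \<one>\<^bsub>B\<^esub>) = x"
    using rhom_ract[OF fg(2) rhom_closed[OF fg(1) x], of "(\<zero>\<^bsub>K\<^esub>, \<zero>\<^bsub>M\<^esub>, \<one>\<^bsub>B\<^esub>)"] fg(3) Y(2)
      rhom_closed[OF fg(1) x]
    by (simp add: from_B_def)
qed

lemma from_B_rdsum: "from_B X \<Longrightarrow> from_B Y \<Longrightarrow> from_B (rdsum X Y)"
  by (auto simp: from_B_def)

lemma from_B_restrict_to: "from_B X \<Longrightarrow> S \<subseteq> carrier X \<Longrightarrow> from_B (restrict_to X S)"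
  by (auto simp: from_B_def)

lemma rsubmodule_res:
  assumes X: "right_module A X" "from_B X" and N: "rsubmodule A N X"
  shows "rsubmodule B N (res X)"
proof (rule rsubmoduleI[OF right_module_res[OF X]])
  fix x b assume "x \<in> N" and "b \<in> carrier B"
  then show "x \<triangleleft>\<^bsub>res X\<^esub> b \<in> N" using rsubmodule_ract[OF N, of x "(\<zero>\<^bsub>K\<^esub>, \<zero>\<^bsub>M\<^esub>, b)"] by simp
qed (use rsubmodule_subset[OF N] rsubmodule_zero[OF N] rsubmodule_add[OF N] in auto)

lemma rsubmodule_from_res:
  assumes X: "right_module A X" "from_B X" and N: "rsubmodule B N (res X)"
  shows "rsubmodule A N X"
proof (rule rsubmoduleI[OF X(1)])
  show "N \<subseteq> carrier X" using rsubmodule_subset[OF N] by simp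
  fix x r assume x: "x \<in> N" and "r \<in> carrier A"
  then obtain a m b where r: "r = (a, m, b)" "a \<in> carrier K" "m \<in> carrier M" "b \<in> carrier B" by auto
  have xX: "x \<in> carrier X" using rsubmodule_carrier[OF N x] by simp
  show "x \<triangleleft>\<^bsub>X\<^esub> r \<in> N"
    using rsubmodule_ract[OF N x r(4)] unfolding r(1) from_B_ract[OF X xX r(2-4)] by simp
qed (use rsubmodule_zero[OF N] rsubmodule_add[OF N] in auto)

lemma rsubmodule_infl:
  assumes "right_module B N" and "rsubmodule B S N"
  shows "rsubmodule A S (infl N)"
  using rsubmodule_from_res[OF right_module_infl[OF assms(1)] from_B_infl[OF assms(1)]] assms(2)
  by simp

lemma fg_res:
  assumes "fg_right_module A X" and van: "from_B X"
  shows "fg_right_module B (res X)"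
proof -
  note X = right_module_fg[OF assms(1)]
  obtain T where T: "finite T" "T \<subseteq> carrier X" "\<And>N. rsubmodule A N X \<Longrightarrow> T \<subseteq> N \<Longrightarrow> N = carrier X"
    by (rule fg_right_moduleE[OF assms(1)]) blast
  show ?thesis
    by (rule fg_right_moduleI[OF right_module_res[OF X van] T(1)])
      (use T rsubmodule_from_res[OF X van] in auto)
qed

lemma fg_infl:
  assumes "fg_right_module B N"
  shows "fg_right_module A (infl N)"
proof -
  note N = right_module_fg[OF assms]
  obtain T where T: "finite T" "T \<subseteq> carrier N" "\<And>S. rsubmodule B S N \<Longrightarrow> T \<subseteq> S \<Longrightarrow> S = carrier N"
    by (rule fg_right_moduleE[OF assms]) blast
  show ?thesis
    by (rule fg_right_moduleI[OF right_module_infl[OF N] T(1)])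
      (use T rsubmodule_res[OF right_module_infl[OF N] from_B_infl[OF N]] in auto)
qed

lemma fgmod_res: "X \<in> fgmod A \<Longrightarrow> from_B X \<Longrightarrow> res X \<in> fgmod B"
  by (simp add: fgmod_def fg_res)

lemma fgmod_infl: "N \<in> fgmod B \<Longrightarrow> infl N \<in> fgmod A"
  by (simp add: fgmod_def fg_infl)

lemma projective_res:
  assumes P: "projective A P" and X: "right_module A P" "from_B P"
  shows "projective B (res P)"
  unfolding projective_def
proof (intro ballI)
  fix Y Z e h assume *: "Y \<in> fgmod B" "Z \<in> fgmod B" "e \<in> epi_rhom B Y Z" and h: "h \<in> rhom B (res P) Z"
  note RZ = right_module_fg[OF fgmodD[OF *(2)]]
  from projectiveD[OF P fgmod_infl[OF *(1)] fgmod_infl[OF *(2)] epi_rhom_infl[OF *(3)]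
      rhom_into_infl[OF X RZ h]]
  obtain f where "f \<in> rhom A P (infl Y)" "\<forall>x\<in>carrier P. e (f x) = h x" by blast
  then show "\<exists>f\<in>rhom B (res P) Y. \<forall>x\<in>carrier (res P). e (f x) = h x"
    using rhom_res[of f P "infl Y"] by (intro bexI[of _ f]) auto
qed

text \<open>This is \<open>X f\<close> for \<open>f = (0, 0, 1)\<close>. As \<open>f A\<close>
  consists of the elements \<open>(0, 0, b)\<close>, it is closed under \<open>A\<close>; it is the
  largest submodule that comes from \<open>B\<close>, and its formation is right adjoint to
  inflation.\<close>

definition B_part :: "('k \<times> 'm \<times> 'b, 'x) rmodule \<Rightarrow> 'x set" where
  "B_part X = {x \<in> carrier X. x \<triangleleft>\<^bsub>X\<^esub> (\<zero>\<^bsub>K\<^esub>, \<zero>\<^bsub>M\<^esub>, \<one>\<^bsub>B\<^esub>) = x}"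

lemma ract_B_part:
  assumes X: "right_module A X" and x: "x \<in> carrier X"
  shows "x \<triangleleft>\<^bsub>X\<^esub> (\<zero>\<^bsub>K\<^esub>, \<zero>\<^bsub>M\<^esub>, \<one>\<^bsub>B\<^esub>) \<in> B_part X"
proof -
  interpret X: right_module A X by (rule X)
  show ?thesis
    using x X.ract_mult[OF x, of "(\<zero>\<^bsub>K\<^esub>, \<zero>\<^bsub>M\<^esub>, \<one>\<^bsub>B\<^esub>)" "(\<zero>\<^bsub>K\<^esub>, \<zero>\<^bsub>M\<^esub>, \<one>\<^bsub>B\<^esub>)"]
    by (simp add: B_part_def X.ract_closed sc_simps)
qed

lemma rsubmodule_B_part:
  assumes X: "right_module A X"
  shows "rsubmodule A (B_part X) X"
proof -
  interpret X: right_module A X by (rule X)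
  show ?thesis
  proof (rule rsubmoduleI[OF X])
    fix x r assume "x \<in> B_part X" and "r \<in> carrier A"
    then obtain a m b where x: "x \<in> carrier X" "x \<triangleleft>\<^bsub>X\<^esub> (\<zero>\<^bsub>K\<^esub>, \<zero>\<^bsub>M\<^esub>, \<one>\<^bsub>B\<^esub>) = x"
      and r: "r = (a, m, b)" "a \<in> carrier K" "m \<in> carrier M" "b \<in> carrier B"
      by (auto simp: B_part_def)
    let ?f = "(\<zero>\<^bsub>K\<^esub>, \<zero>\<^bsub>M\<^esub>, \<one>\<^bsub>B\<^esub>)"
    have c: "?f \<in> carrier A" "r \<in> carrier A" "(\<zero>\<^bsub>K\<^esub>, \<zero>\<^bsub>M\<^esub>, b) \<in> carrier A" using r by auto
    have e: "?f \<otimes>\<^bsub>A\<^esub> r = (\<zero>\<^bsub>K\<^esub>, \<zero>\<^bsub>M\<^esub>, b)" "(\<zero>\<^bsub>K\<^esub>, \<zero>\<^bsub>M\<^esub>, b) \<otimes>\<^bsub>A\<^esub> ?f = (\<zero>\<^bsub>K\<^esub>, \<zero>\<^bsub>M\<^esub>, b)"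
      using r by (simp_all add: sc_simps)
    have 1: "x \<triangleleft>\<^bsub>X\<^esub> r = x \<triangleleft>\<^bsub>X\<^esub> (\<zero>\<^bsub>K\<^esub>, \<zero>\<^bsub>M\<^esub>, b)"
      using X.ract_mult[OF x(1) c(1,2)] unfolding e x(2) by simp
    have "x \<triangleleft>\<^bsub>X\<^esub> r \<triangleleft>\<^bsub>X\<^esub> ?f = x \<triangleleft>\<^bsub>X\<^esub> r"
      using X.ract_mult[OF x(1) c(3,1)] unfolding e 1 by simp
    then show "x \<triangleleft>\<^bsub>X\<^esub> r \<in> B_part X" using X.ract_closed[OF x(1) c(2)] by (simp add: B_part_def)
  qed (auto simp: B_part_def X.rm_simps)
qed

lemma from_B_B_part: "from_B (restrict_to X (B_part X))"
  by (simp add: from_B_def B_part_def)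

lemma rhom_B_part:
  "f \<in> rhom A X Y \<Longrightarrow> x \<in> B_part X \<Longrightarrow> f x \<in> B_part Y"
  using rhom_ract[of f A X Y x "(\<zero>\<^bsub>K\<^esub>, \<zero>\<^bsub>M\<^esub>, \<one>\<^bsub>B\<^esub>)"] by (auto simp: B_part_def rhom_closed)

lemma B_part_from_B: "from_B X \<Longrightarrow> B_part X = carrier X"
  by (auto simp: from_B_def B_part_def)

text \<open>A map from an inflated module lands in the \<open>B_part\<close> of its target, and
  epimorphisms stay surjective on \<open>B_part\<close>: if \<open>e y = z\<close> and
  \<open>z f = z\<close> for \<open>f = (0, 0, 1)\<close>, then \<open>e (y f) = z\<close>. So the
  lifting problem can be solved over \<open>B\<close>.\<close>

lemma projective_infl:
  assumes P: "projective B P" and RP: "right_module B P"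
  shows "projective A (infl P)"
  unfolding projective_def
proof (intro ballI)
  note iP = right_module_infl[OF RP]
  fix Y Z e h assume *: "Y \<in> fgmod A" "Z \<in> fgmod A" "e \<in> epi_rhom A Y Z"
    and h: "h \<in> rhom A (infl P) Z"
  note fgY = fgmodD[OF *(1)] and fgZ = fgmodD[OF *(2)]
  note RY = right_module_fg[OF fgY] and RZ = right_module_fg[OF fgZ]
  note e = epi_rhom_rhom[OF *(3)]
  note bY = rsubmodule_B_part[OF RY] and bZ = rsubmodule_B_part[OF RZ]
  let ?Y = "restrict_to Y (B_part Y)" and ?Z = "restrict_to Z (B_part Z)"
  note RbY = right_module_restrict_to[OF RY bY] and RbZ = right_module_restrict_to[OF RZ bZ]
  have "e \<in> epi_rhom A ?Y ?Z"
  proof (rule epi_rhomI)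
    show "e \<in> rhom A ?Y ?Z"
      by (rule rhom_corestrict[OF rhom_restrict[OF e rsubmodule_subset[OF bY]]])
        (simp add: rhom_B_part[OF e])
    fix z assume "z \<in> carrier ?Z"
    then have z: "z \<in> carrier Z" "z \<triangleleft>\<^bsub>Z\<^esub> (\<zero>\<^bsub>K\<^esub>, \<zero>\<^bsub>M\<^esub>, \<one>\<^bsub>B\<^esub>) = z" by (auto simp: B_part_def)
    obtain y where y: "y \<in> carrier Y" "e y = z" using *(3) z(1) by (rule epi_rhomE)
    then have "e (y \<triangleleft>\<^bsub>Y\<^esub> (\<zero>\<^bsub>K\<^esub>, \<zero>\<^bsub>M\<^esub>, \<one>\<^bsub>B\<^esub>)) = z" using z by (simp add: rhom_ract[OF e])
    then show "\<exists>y\<in>carrier ?Y. e y = z" using ract_B_part[OF RY y(1)] by auto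
  qed
  moreover have h': "h \<in> rhom A (infl P) ?Z"
    using rhom_B_part[OF h] B_part_from_B[OF from_B_infl[OF RP]] by (intro rhom_corestrict[OF h]) simp
  moreover have "?Y \<in> fgmod A" "?Z \<in> fgmod A"
    using A.fg_submodule[OF fgY bY] A.fg_submodule[OF fgZ bZ] by (simp_all add: fgmod_def)
  ultimately obtain f where f: "f \<in> rhom B P (res ?Y)" "\<forall>x\<in>carrier P. e (f x) = h x"
    using projectiveD[OF P fgmod_res fgmod_res epi_rhom_res, of ?Y ?Z e h] rhom_res[OF h']
      from_B_B_part by auto
  have "f \<in> rhom A (infl P) Y"
    by (rule rhom_comp[OF rhom_from_infl[OF RbY from_B_B_part RP f(1)] rhom_inclusion[OF bY]])
  with f(2) show "\<exists>f\<in>rhom A (infl P) Y. \<forall>x\<in>carrier (infl P). e (f x) = h x" by auto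
qed

lemma fgproj_infl: "P \<in> fgproj B \<Longrightarrow> infl P \<in> fgproj A"
  by (simp add: fgproj_def fgmod_infl projective_infl fgmodD right_module_fg)

section \<open>A description of \<open>C_class\<close>\<close>

abbreviation BM where "BM \<equiv> rdsum (regular_rmodule B) M"

lemma right_module_BM: "right_module B BM"
  by (rule right_module_rdsum[OF right_module_regular[OF B.Alg.ring_axioms] M.is_right_module])

lemma fg_BM: "fg_right_module B BM"
  by (rule fg_right_module_rdsum[OF fg_regular[OF B.Alg.ring_axioms] M.fg_right_module_axioms])

text \<open>
  By Artinianness, \<open>P / Z\<close> embeds into a finite direct sum of copies of \<open>B \<oplus> M\<close> as soon as its
  nonzero elements are separated from zero by homomorphisms to \<open>B \<oplus> M\<close>. So the modules \<open>Z\<close>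
  below are the syzygies of the modules in \<open>T_class\<close>, up to projective summands. In this form
  finite direct sums are easy to handle.
\<close>

definition C_mod :: "('b, 'x) rmodule \<Rightarrow> bool" where
  "C_mod X \<longleftrightarrow> (\<exists>P\<in>fgproj B. \<exists>Z. rsubmodule B Z P \<and>
     (\<forall>x\<in>carrier P - Z. \<exists>h\<in>rhom B P BM. (\<forall>z\<in>Z. h z = \<zero>\<^bsub>BM\<^esub>) \<and> h x \<noteq> \<zero>\<^bsub>BM\<^esub>) \<and>
     rretract B X (restrict_to P Z))"

text \<open>The definition keeps \<open>P\<close> in \<open>fgproj B\<close>. Here \<open>P\<close>
  may live on any carrier type, and the submodule with its separating maps is moved along an
  isomorphism.\<close>

lemma C_modI:
  fixes P :: "('b, 'p) rmodule"
  assumes P: "fg_right_module B P" "projective B P" and Z: "rsubmodule B Z P"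
    and sep: "\<And>x. x \<in> carrier P \<Longrightarrow> x \<notin> Z \<Longrightarrow> \<exists>h\<in>rhom B P BM. (\<forall>z\<in>Z. h z = \<zero>\<^bsub>BM\<^esub>) \<and> h x \<noteq> \<zero>\<^bsub>BM\<^esub>"
    and X: "rretract B X (restrict_to P Z)"
  shows "C_mod X"
proof -
  note RP = right_module_fg[OF P(1)]
  obtain Q f g where Q: "Q \<in> fgproj B" "f \<in> rhom B P Q" "g \<in> rhom B Q P"
    "\<And>x. x \<in> carrier P \<Longrightarrow> g (f x) = x" "\<And>y. y \<in> carrier Q \<Longrightarrow> f (g y) = y"
    by (rule B.ex_fgproj_copy[OF P]) blast
  note RQ = right_module_fg[OF fgprojD(1)[OF Q(1)]]
  define W where "W = {y \<in> carrier Q. g y \<in> Z}"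
  have W: "rsubmodule B W Q" unfolding W_def by (rule rsubmodule_preimage[OF RQ RP Q(3) Z])
  have "f \<in> rhom B (restrict_to P Z) (restrict_to Q W)"
    by (rule rhom_corestrict[OF rhom_restrict[OF Q(2) rsubmodule_subset[OF Z]]])
      (use rsubmodule_carrier[OF Z] in \<open>simp add: W_def Q(4) rhom_closed[OF Q(2)]\<close>)
  moreover have "g \<in> rhom B (restrict_to Q W) (restrict_to P Z)"
    by (rule rhom_corestrict[OF rhom_restrict[OF Q(3) rsubmodule_subset[OF W]]]) (simp add: W_def)
  ultimately have "rretract B (restrict_to P Z) (restrict_to Q W)"
    by (rule rretractI) (use rsubmodule_carrier[OF Z] Q(4) in simp)
  with X have "rretract B X (restrict_to Q W)" by (rule rretract_trans)
  moreover have "\<exists>h\<in>rhom B Q BM. (\<forall>z\<in>W. h z = \<zero>\<^bsub>BM\<^esub>) \<and> h y \<noteq> \<zero>\<^bsub>BM\<^esub>"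
    if "y \<in> carrier Q - W" for y
  proof -
    have "g y \<in> carrier P" "g y \<notin> Z" using that by (auto simp: W_def rhom_closed[OF Q(3)])
    from sep[OF this] obtain h where "h \<in> rhom B P BM" "\<forall>z\<in>Z. h z = \<zero>\<^bsub>BM\<^esub>" "h (g y) \<noteq> \<zero>\<^bsub>BM\<^esub>" by blast
    then show ?thesis
      using rhom_comp[OF Q(3)] by (intro bexI[of _ "\<lambda>y. h (g y)"]) (auto simp: W_def)
  qed
  ultimately show ?thesis using Q(1) W unfolding C_mod_def by blast
qed

text \<open>An element outside the kernel has nonzero image in \<open>N\<close>, where a map to
  \<open>BM\<close> detects it.\<close>

lemma C_mod_kernel:
  fixes P :: "('b, 'p) rmodule" and N :: "('b, 'n) rmodule"
  assumes P: "fg_right_module B P" "projective B P" and N: "right_module B N"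
    and cog: "cogenerated B N BM" and f: "f \<in> rhom B P N"
    and X: "rretract B X (restrict_to P (a_kernel P N f))"
  shows "C_mod X"
proof (rule C_modI[OF P _ _ X])
  note RP = right_module_fg[OF P(1)]
  show "rsubmodule B (a_kernel P N f) P" by (rule rsubmodule_a_kernel[OF RP N f])
  fix x assume x: "x \<in> carrier P" "x \<notin> a_kernel P N f"
  then have "f x \<in> carrier N" "f x \<noteq> \<zero>\<^bsub>N\<^esub>" by (auto simp: in_a_kernel rhom_closed[OF f])
  with cog obtain h where h: "h \<in> rhom B N BM" "h (f x) \<noteq> \<zero>\<^bsub>BM\<^esub>" by (rule cogeneratedE)
  then show "\<exists>h\<in>rhom B P BM. (\<forall>z\<in>a_kernel P N f. h z = \<zero>\<^bsub>BM\<^esub>) \<and> h x \<noteq> \<zero>\<^bsub>BM\<^esub>"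
    using rhom_zero[OF N right_module_BM h(1)]
    by (intro bexI[of _ "\<lambda>x. h (f x)"] rhom_comp[OF f]) (auto simp: in_a_kernel)
qed

lemma C_mod_rretract: "C_mod Y \<Longrightarrow> rretract B X Y \<Longrightarrow> C_mod X"
  unfolding C_mod_def using rretract_trans by blast

lemma C_mod_projective:
  fixes P :: "('b, 'p) rmodule"
  assumes P: "fg_right_module B P" "projective B P"
  shows "C_mod P"
proof (rule C_modI[OF P rsubmodule_whole[OF right_module_fg[OF P(1)]]])
  show "rretract B P (restrict_to P (carrier P))" by (simp add: restrict_to_def rretract_refl)
qed simp

text \<open>A point outside \<open>Z \<times> W\<close> has a coordinate outside \<open>Z\<close> or
  outside \<open>W\<close>, and the map separating that coordinate does the work.\<close>

lemma C_mod_rdsum: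
  assumes "C_mod X" and "C_mod Y"
  shows "C_mod (rdsum X Y)"
proof -
  obtain P Z where P: "P \<in> fgproj B" "rsubmodule B Z P" "rretract B X (restrict_to P Z)"
    and sP: "\<And>x. x \<in> carrier P - Z \<Longrightarrow> \<exists>h\<in>rhom B P BM. (\<forall>z\<in>Z. h z = \<zero>\<^bsub>BM\<^esub>) \<and> h x \<noteq> \<zero>\<^bsub>BM\<^esub>"
    using assms(1) unfolding C_mod_def by blast
  obtain Q W where Q: "Q \<in> fgproj B" "rsubmodule B W Q" "rretract B Y (restrict_to Q W)"
    and sQ: "\<And>x. x \<in> carrier Q - W \<Longrightarrow> \<exists>h\<in>rhom B Q BM. (\<forall>z\<in>W. h z = \<zero>\<^bsub>BM\<^esub>) \<and> h x \<noteq> \<zero>\<^bsub>BM\<^esub>"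
    using assms(2) unfolding C_mod_def by blast
  note fgP = fgprojD(1)[OF P(1)] and fgQ = fgprojD(1)[OF Q(1)]
  note RP = right_module_fg[OF fgP] and RQ = right_module_fg[OF fgQ]
  show ?thesis
  proof (rule C_modI[of "rdsum P Q" "Z \<times> W"])
    show "fg_right_module B (rdsum P Q)" by (rule fg_right_module_rdsum[OF fgP fgQ])
    show "projective B (rdsum P Q)"
      by (rule projective_rdsum[OF fgprojD(2)[OF P(1)] RP fgprojD(2)[OF Q(1)] RQ])
    show "rsubmodule B (Z \<times> W) (rdsum P Q)"
      using rsubmodule_subset[OF P(2)] rsubmodule_subset[OF Q(2)] rsubmodule_zero[OF P(2)]
        rsubmodule_zero[OF Q(2)] rsubmodule_add[OF P(2)] rsubmodule_add[OF Q(2)]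
        rsubmodule_ract[OF P(2)] rsubmodule_ract[OF Q(2)]
      by (intro rsubmoduleI[OF right_module_rdsum[OF RP RQ]]) auto
    have "restrict_to (rdsum P Q) (Z \<times> W) = rdsum (restrict_to P Z) (restrict_to Q W)"
      by (simp add: restrict_to_def rdsum_def)
    then show "rretract B (rdsum X Y) (restrict_to (rdsum P Q) (Z \<times> W))"
      using rretract_rdsum_cong[OF P(3) Q(3)] by simp
    fix p assume p: "p \<in> carrier (rdsum P Q)" "p \<notin> Z \<times> W"
    then consider "fst p \<in> carrier P - Z" | "snd p \<in> carrier Q - W" by (cases p) auto
    then show "\<exists>h\<in>rhom B (rdsum P Q) BM. (\<forall>z\<in>Z \<times> W. h z = \<zero>\<^bsub>BM\<^esub>) \<and> h p \<noteq> \<zero>\<^bsub>BM\<^esub>"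
    proof cases
      case 1
      from sP[OF 1] obtain h where "h \<in> rhom B P BM" "\<forall>z\<in>Z. h z = \<zero>\<^bsub>BM\<^esub>" "h (fst p) \<noteq> \<zero>\<^bsub>BM\<^esub>" by blast
      then show ?thesis
        by (intro bexI[of _ "\<lambda>p. h (fst p)"] rhom_comp[OF rhom_fst]) auto
    next
      case 2
      from sQ[OF 2] obtain h where "h \<in> rhom B Q BM" "\<forall>z\<in>W. h z = \<zero>\<^bsub>BM\<^esub>" "h (snd p) \<noteq> \<zero>\<^bsub>BM\<^esub>" by blast
      then show ?thesis
        by (intro bexI[of _ "\<lambda>p. h (snd p)"] rhom_comp[OF rhom_snd]) auto
    qed
  qed
qed

lemma C_mod_fin_dsum:
  assumes "\<And>i. i < n \<Longrightarrow> right_module B (F i)" and "\<And>i. i < n \<Longrightarrow> C_mod (F i)"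
  shows "C_mod (fin_dsum n F)"
  using assms
proof (induction n)
  case 0
  let ?B = "regular_rmodule B"
  note RB = right_module_regular[OF B.Alg.ring_axioms]
  note R0 = right_module_fin_dsum[OF B.Alg.ring_axioms, of 0 F]
  have "C_mod (restrict_to ?B {\<zero>\<^bsub>?B\<^esub>})"
    by (rule C_mod_projective[OF fg_right_module_zero[OF RB] projective_zero[OF RB]])
  moreover have "rretract B (fin_dsum 0 F) (restrict_to ?B {\<zero>\<^bsub>?B\<^esub>})"
  proof (rule rretractI)
    show "(\<lambda>x. \<zero>\<^bsub>restrict_to ?B {\<zero>\<^bsub>?B\<^esub>}\<^esub>) \<in> rhom B (fin_dsum 0 F) (restrict_to ?B {\<zero>\<^bsub>?B\<^esub>})"
      by (rule rhom_zero_map[OF right_module_restrict_to[OF RB rsubmodule_zero_set[OF RB]]])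
    show "(\<lambda>x. \<zero>\<^bsub>fin_dsum 0 F\<^esub>) \<in> rhom B (restrict_to ?B {\<zero>\<^bsub>?B\<^esub>}) (fin_dsum 0 F)"
      using R0 by (intro rhom_zero_map) simp
  qed (auto simp: restrict_def)
  ultimately show ?case by (rule C_mod_rretract)
next
  case (Suc n)
  have "rretract B (fin_dsum (Suc n) F) (rdsum (fin_dsum n F) (F n))"
    using Suc.prems
    by (intro riso_rretract(1)[OF _ _ riso_fin_dsum_Suc] right_module_rdsum right_module_fin_dsum)
      (auto simp: B.Alg.ring_axioms)
  moreover have "C_mod (rdsum (fin_dsum n F) (F n))"
    using Suc.IH Suc.prems by (intro C_mod_rdsum) simp_all
  ultimately show ?case using C_mod_rretract by blast
qed

text \<open>The coordinate projections separate the points of a finite power of \<open>BM\<close>,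
  and separation passes to its summands and their submodules.\<close>

lemma T_class_cogenerated:
  assumes "N \<in> T_class B M"
  shows "cogenerated B N BM"
proof -
  from assms obtain X j where X: "X \<in> add_closure B {BM}" and j: "j \<in> mono_rhom B N X"
    and N: "N \<in> fgmod B" by (auto simp: T_class_def)
  then obtain Y n F where Y: "X \<in> fgmod B" "Y \<in> fgmod B" "\<forall>i<n. F i = BM"
    "riso B (rdsum X Y) (fin_dsum n F)" by (auto simp: add_closure_def)
  note RX = right_module_fg[OF fgmodD[OF Y(1)]] and RY = right_module_fg[OF fgmodD[OF Y(2)]]
  have RF: "right_module B (fin_dsum n F)"
    using Y(3) right_module_BM by (intro right_module_fin_dsum B.Alg.ring_axioms) auto
  have "cogenerated B (fin_dsum n F) BM"
    unfolding cogenerated_def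
  proof (intro ballI impI)
    fix x assume x: "x \<in> carrier (fin_dsum n F)" "x \<noteq> \<zero>\<^bsub>fin_dsum n F\<^esub>"
    have "\<exists>i<n. x i \<noteq> \<zero>\<^bsub>F i\<^esub>"
    proof (rule ccontr)
      assume "\<not> ?thesis"
      then have "x = \<zero>\<^bsub>fin_dsum n F\<^esub>" using x(1) by (auto simp: fun_eq_iff PiE_iff extensional_def)
      with x(2) show False by simp
    qed
    then obtain i where i: "i < n" "x i \<noteq> \<zero>\<^bsub>F i\<^esub>" by blast
    then show "\<exists>h\<in>rhom B (fin_dsum n F) BM. h x \<noteq> \<zero>\<^bsub>BM\<^esub>"
      using rhom_fin_dsum_proj[OF i(1), of B F] Y(3) by (intro bexI[of _ "\<lambda>x. x i"]) auto
  qed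
  then have "cogenerated B X BM"
    using rretract_trans[OF rretract_rdsum_left[OF RX RY]
        riso_rretract(1)[OF right_module_rdsum[OF RX RY] RF Y(4)]] cogenerated_rretract[OF RX RF] by blast
  then show ?thesis
    using j by (intro cogenerated_inj[OF right_module_fg[OF fgmodD[OF N]] RX]) (auto simp: mono_rhom_def)
qed

text \<open>Finitely many separating maps assemble to an embedding into a power of
  \<open>BM\<close>. Membership in \<open>add_closure\<close> needs a copy \<open>L\<close> of that
  power in \<open>fgmod\<close>, with a complement that is supplied by
  \<open>ex_complement\<close>.\<close>

lemma cogenerated_T_class:
  assumes N: "N \<in> fgmod B" and cog: "cogenerated B N BM"
  shows "N \<in> T_class B M"
proof -
  note RN = right_module_fg[OF fgmodD[OF N]]
  obtain n :: nat and h where h: "\<And>i. i < n \<Longrightarrow> h i \<in> rhom B N BM"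
    and inj: "\<And>x. x \<in> carrier N \<Longrightarrow> (\<And>i. i < n \<Longrightarrow> h i x = \<zero>\<^bsub>BM\<^esub>) \<Longrightarrow> x = \<zero>\<^bsub>N\<^esub>"
    by (rule B.cogenerated_finite[OF fgmodD[OF N] right_module_BM cog]) blast
  let ?S = "fin_dsum n (\<lambda>_. BM)"
  have fgS: "fg_right_module B ?S" by (rule fg_right_module_fin_dsum[OF B.Alg.ring_axioms fg_BM])
  note RS = right_module_fg[OF fgS]
  obtain L f g where L: "L \<in> fgmod B" "f \<in> rhom B ?S L" "g \<in> rhom B L ?S"
    "\<And>x. x \<in> carrier ?S \<Longrightarrow> g (f x) = x" "\<And>y. y \<in> carrier L \<Longrightarrow> f (g y) = y"
    by (rule B.ex_fgmod_copy[OF fgS]) blast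
  note RL = right_module_fg[OF fgmodD[OF L(1)]]
  have "rretract B L ?S" by (rule rretractI[OF L(3,2)]) (simp add: L(5))
  with B.ex_complement[OF RL fgS] obtain C where "C \<in> fgmod B" "riso B (rdsum L C) ?S" by blast
  then have "L \<in> add_closure B {BM}"
    unfolding add_closure_def using L(1)
    by (intro CollectI conjI bexI[of _ C] exI[of _ n] exI[of _ "\<lambda>_. BM"]) simp_all
  moreover
  let ?j = "\<lambda>x. f (\<lambda>i\<in>{..<n}. h i x)"
  have hS: "(\<lambda>x. \<lambda>i\<in>{..<n}. h i x) \<in> rhom B N ?S" using h by (rule rhom_fin_dsum)
  have j: "?j \<in> rhom B N L" by (rule rhom_comp[OF hS L(2)])
  have "inj_on ?j (carrier N)"
  proof (rule inj_on_rhomI[OF RN RL j], rule inj)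
    fix x i assume x: "x \<in> carrier N" "f (\<lambda>i\<in>{..<n}. h i x) = \<zero>\<^bsub>L\<^esub>" and i: "i < n"
    have "(\<lambda>i\<in>{..<n}. h i x) = g \<zero>\<^bsub>L\<^esub>" using L(4) rhom_closed[OF hS x(1)] x(2) by metis
    then have "(\<lambda>i\<in>{..<n}. h i x) i = \<zero>\<^bsub>?S\<^esub> i" using rhom_zero[OF RL RS L(3)] by simp
    then show "h i x = \<zero>\<^bsub>BM\<^esub>" using i by simp
  qed
  with j have "?j \<in> mono_rhom B N L" by (simp add: mono_rhom_def)
  ultimately show ?thesis using N unfolding T_class_def by blast
qed

text \<open>Here \<open>N\<close> is \<open>P / Z\<close>. The separating maps vanish on
  \<open>Z\<close> and therefore descend to \<open>N\<close>.\<close>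

lemma C_modE:
  fixes X :: "('b, 'x) rmodule"
  assumes "C_mod X"
  obtains P N g where "P \<in> fgproj B" and "N \<in> fgmod B" and "cogenerated B N BM"
    and "g \<in> epi_rhom B P N" and "rretract B X (restrict_to P (a_kernel P N g))"
proof -
  from assms obtain P Z where P: "P \<in> fgproj B" and Z: "rsubmodule B Z P"
    and sep: "\<And>x. x \<in> carrier P - Z \<Longrightarrow> \<exists>h\<in>rhom B P BM. (\<forall>z\<in>Z. h z = \<zero>\<^bsub>BM\<^esub>) \<and> h x \<noteq> \<zero>\<^bsub>BM\<^esub>"
    and ret: "rretract B X (restrict_to P Z)"
    unfolding C_mod_def by blast
  note fgP = fgprojD(1)[OF P]
  note RP = right_module_fg[OF fgP]
  obtain N g where N: "N \<in> fgmod B" and g: "g \<in> epi_rhom B P N" and kg: "a_kernel P N g = Z"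
    using B.ex_quotient[OF fgP Z] by blast
  note fgN = fgmodD[OF N]
  note RN = right_module_fg[OF fgN]
  have "cogenerated B N BM"
    unfolding cogenerated_def
  proof (intro ballI impI)
    fix y assume y: "y \<in> carrier N" "y \<noteq> \<zero>\<^bsub>N\<^esub>"
    obtain x where x: "x \<in> carrier P" "g x = y" using g y(1) by (rule epi_rhomE)
    then have "x \<in> carrier P - Z" using y(2) kg[symmetric] by (auto simp: in_a_kernel)
    from sep[OF this] obtain h where h: "h \<in> rhom B P BM" "\<forall>z\<in>Z. h z = \<zero>\<^bsub>BM\<^esub>" "h x \<noteq> \<zero>\<^bsub>BM\<^esub>" by blast
    have "h z = \<zero>\<^bsub>BM\<^esub>" if "z \<in> carrier P" "g z = \<zero>\<^bsub>N\<^esub>" for z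
      using h(2) that kg by (auto simp: in_a_kernel)
    from rhom_factor_epi[OF RP RN right_module_BM g h(1) this] obtain k
      where "k \<in> rhom B N BM" "\<forall>x\<in>carrier P. k (g x) = h x" by blast
    then show "\<exists>h\<in>rhom B N BM. h y \<noteq> \<zero>\<^bsub>BM\<^esub>" using x h(3) by (intro bexI[of _ k]) auto
  qed
  then show thesis using that[OF P N _ g] ret kg by blast
qed

text \<open>The left side is built from minimal syzygies, \<open>C_mod\<close> from kernels of
  arbitrary presentations. By \<open>rretract_kernel\<close> the latter are retracts of the former
  plus a projective, and projectives belong to the class.\<close>

lemma C_class_eq: "C_class B M = {X \<in> fgmod B. C_mod X}"
proof (intro equalityI subsetI)
  fix X assume "X \<in> C_class B M"
  then obtain Y n F where X: "X \<in> fgmod B" "Y \<in> fgmod B"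
    and F: "\<forall>i<n. F i \<in> fgproj B \<union> {Z. \<exists>N\<in>T_class B M. is_syzygy B N Z}"
    and iso: "riso B (rdsum X Y) (fin_dsum n F)"
    unfolding C_class_def add_closure_def by blast
  have "fg_right_module B (F i) \<and> C_mod (F i)" if "i < n" for i
    using F that
  proof (cases "F i \<in> fgproj B")
    case True
    then show ?thesis using fgprojD C_mod_projective by blast
  next
    case False
    with F that obtain N where N: "N \<in> T_class B M" "is_syzygy B N (F i)" by blast
    then have fgN: "fg_right_module B N" by (simp add: T_class_def fgmod_def)
    obtain P p where P: "P \<in> fgproj B" "p \<in> epi_rhom B P N" "F i \<in> fgmod B"
      "riso B (restrict_to P (a_kernel P N p)) (F i)"
      using N(2) by (rule is_syzygyE)
    note RP = right_module_fg[OF fgprojD(1)[OF P(1)]] and RN = right_module_fg[OF fgN]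
    note p = epi_rhom_rhom[OF P(2)]
    have "rretract B (F i) (restrict_to P (a_kernel P N p))"
      by (rule riso_rretract(2)[OF right_module_restrict_to[OF RP rsubmodule_a_kernel[OF RP RN p]]
            right_module_fg[OF fgmodD[OF P(3)]] P(4)])
    then have "C_mod (F i)"
      by (rule C_mod_kernel[OF fgprojD[OF P(1)] RN T_class_cogenerated[OF N(1)] p])
    then show ?thesis using fgmodD[OF P(3)] by blast
  qed
  then have 1: "\<And>i. i < n \<Longrightarrow> right_module B (F i)" "\<And>i. i < n \<Longrightarrow> C_mod (F i)"
    using right_module_fg by blast+
  note RX = right_module_fg[OF fgmodD[OF X(1)]] and RY = right_module_fg[OF fgmodD[OF X(2)]]
  have "rretract B X (fin_dsum n F)"
    using rretract_rdsum_left[OF RX RY]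
      riso_rretract(1)[OF right_module_rdsum[OF RX RY] right_module_fin_dsum[OF B.Alg.ring_axioms 1(1)] iso]
    by (rule rretract_trans)
  from C_mod_rretract[OF C_mod_fin_dsum[OF 1] this] X(1) show "X \<in> {X \<in> fgmod B. C_mod X}"
    by simp
next
  fix X assume "X \<in> {X \<in> fgmod B. C_mod X}"
  then have X: "X \<in> fgmod B" and "C_mod X" by auto
  then obtain P N g where P: "P \<in> fgproj B" and N: "N \<in> fgmod B" and cog: "cogenerated B N BM"
    and g: "g \<in> epi_rhom B P N" and ret: "rretract B X (restrict_to P (a_kernel P N g))"
    by (blast elim: C_modE)
  note fgP = fgprojD(1)[OF P] and fgN = fgmodD[OF N]
  note RX = right_module_fg[OF fgmodD[OF X]] and RN = right_module_fg[OF fgN]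
  have T: "N \<in> T_class B M" by (rule cogenerated_T_class[OF N cog])
  obtain W where W: "is_syzygy B N W" using B.ex_is_syzygy[OF fgN] by blast
  obtain Q q where Q: "Q \<in> fgproj B" "q \<in> epi_rhom B Q N" "W \<in> fgmod B"
    "riso B (restrict_to Q (a_kernel Q N q)) W"
    using W by (rule is_syzygyE)
  note RQ = right_module_fg[OF fgprojD(1)[OF Q(1)]]
  note RW = right_module_fg[OF fgmodD[OF Q(3)]]
  have "rretract B (restrict_to Q (a_kernel Q N q)) W"
    by (rule riso_rretract(1)[OF right_module_restrict_to[OF RQ rsubmodule_a_kernel[OF RQ RN
            epi_rhom_rhom[OF Q(2)]]] RW Q(4)])
  from rretract_trans[OF B.rretract_kernel[OF RN RN fgP fgprojD(2)[OF P] fgprojD[OF Q(1)] g Q(2) rretract_refl]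
      rretract_rdsum_cong[OF this rretract_refl]]
  have ZW: "rretract B (restrict_to P (a_kernel P N g)) (rdsum W P)" .
  \<comment> \<open>The two summands come from Schanuel: the kernel of \<open>P -> N\<close> is a
    retract of the minimal syzygy \<open>W\<close> plus \<open>P\<close>.\<close>
  define F where "F i = (if i = 0 then W else P)" for i :: nat
  have "rretract B (rdsum W P) (fin_dsum 2 F)"
  proof (rule rretractI)
    show "(\<lambda>p. \<lambda>i\<in>{..<2}. (if i = 0 then fst else snd) p) \<in> rhom B (rdsum W P) (fin_dsum 2 F)"
      by (rule rhom_fin_dsum) (simp add: F_def rhom_fst rhom_snd)
    show "(\<lambda>x. (x 0, x 1)) \<in> rhom B (fin_dsum 2 F) (rdsum W P)"
      using rhom_fin_dsum_proj[of 0 2 B F] rhom_fin_dsum_proj[of 1 2 B F]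
      by (intro rhom_pair) (simp_all add: F_def)
  qed auto
  from rretract_trans[OF ret rretract_trans[OF ZW this]] have "rretract B X (fin_dsum 2 F)" .
  moreover have "fg_right_module B (fin_dsum 2 F)"
    using fgP fgmodD[OF Q(3)] by (intro fg_right_module_fin_dsum B.Alg.ring_axioms) (simp add: F_def)
  ultimately obtain C where "C \<in> fgmod B" "riso B (rdsum X C) (fin_dsum 2 F)"
    using B.ex_complement[OF RX] by blast
  moreover have "\<forall>i<2. F i \<in> fgproj B \<union> {Z. \<exists>N\<in>T_class B M. is_syzygy B N Z}"
    using P T W by (auto simp: F_def)
  ultimately show "X \<in> C_class B M"
    using X unfolding C_class_def add_closure_def by blast
qed

section \<open>The quotient by the submodule generated by \<open>e\<^sub>0\<close>\<close>

abbreviation e where "e \<equiv> (\<one>\<^bsub>K\<^esub>, \<zero>\<^bsub>M\<^esub>, \<zero>\<^bsub>B\<^esub>)"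

lemma e_closed: "e \<in> carrier A"
  by simp

lemma e_idem: "e \<otimes>\<^bsub>A\<^esub> e = e"
  by (simp add: sc_simps)

lemma from_B_e: "right_module A X \<Longrightarrow> from_B X \<Longrightarrow> x \<in> carrier X \<Longrightarrow> x \<triangleleft>\<^bsub>X\<^esub> e = \<zero>\<^bsub>X\<^esub>"
  by (simp add: from_B_iff)

text \<open>For a right module this is \<open>X e A\<close>, the trace of \<open>P0\<close> in
  \<open>X\<close>. Division by it gives the largest quotient that comes from \<open>B\<close>, the
  left adjoint of inflation.\<close>

definition trace_e :: "('k \<times> 'm \<times> 'b, 'x) rmodule \<Rightarrow> 'x set" where
  "trace_e X = \<Inter>{N. rsubmodule A N X \<and> (\<forall>x\<in>carrier X. x \<triangleleft>\<^bsub>X\<^esub> e \<in> N)}"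

lemma rsubmodule_trace_e:
  assumes "right_module A X"
  shows "rsubmodule A (trace_e X) X"
proof -
  interpret X: right_module A X by fact
  show ?thesis
    unfolding trace_e_def
    using rsubmodule_whole[OF assms] X.ract_closed[OF _ e_closed]
    by (intro rsubmodule_Inter[OF assms]) auto
qed

lemma e_in_trace_e: "x \<in> carrier X \<Longrightarrow> x \<triangleleft>\<^bsub>X\<^esub> e \<in> trace_e X"
  by (simp add: trace_e_def)

lemma trace_e_least:
  "rsubmodule A N X \<Longrightarrow> (\<And>x. x \<in> carrier X \<Longrightarrow> x \<triangleleft>\<^bsub>X\<^esub> e \<in> N) \<Longrightarrow> trace_e X \<subseteq> N"
  by (auto simp: trace_e_def)

text \<open>The target is kept general because the lemma is also applied to maps into
  \<open>P0\<close>, which does not come from \<open>B\<close>.\<close>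

lemma zero_on_trace_e:
  assumes X: "right_module A X" and Y: "right_module A Y" and f: "f \<in> rhom A X Y"
    and "\<And>x. x \<in> carrier X \<Longrightarrow> f (x \<triangleleft>\<^bsub>X\<^esub> e) = \<zero>\<^bsub>Y\<^esub>" and x: "x \<in> trace_e X"
  shows "f x = \<zero>\<^bsub>Y\<^esub>"
proof -
  interpret X: right_module A X by (rule X)
  have "trace_e X \<subseteq> a_kernel X Y f"
    using assms(4) X.ract_closed[OF _ e_closed]
    by (intro trace_e_least rsubmodule_a_kernel[OF X Y f]) (simp add: in_a_kernel)
  with x show ?thesis by (auto simp: in_a_kernel)
qed

text \<open>Here \<open>f (x e) = f x e = 0\<close>, and the elements \<open>x e\<close> generate
  the trace.\<close>

lemma from_B_zero_on_trace_e:
  assumes X: "right_module A X" and Y: "right_module A Y" "from_B Y" and f: "f \<in> rhom A X Y"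
    and x: "x \<in> trace_e X"
  shows "f x = \<zero>\<^bsub>Y\<^esub>"
  by (rule zero_on_trace_e[OF X Y(1) f _ x])
    (simp add: rhom_ract[OF f _ e_closed] from_B_e[OF Y] rhom_closed[OF f])

lemma trace_e_from_B:
  assumes X: "right_module A X" "from_B X"
  shows "trace_e X = {\<zero>\<^bsub>X\<^esub>}"
  using from_B_zero_on_trace_e[OF X(1) X rhom_id] rsubmodule_zero[OF rsubmodule_trace_e[OF X(1)]]
  by blast

lemma ex_top:
  fixes X :: "('k \<times> 'm \<times> 'b, 'x) rmodule"
  assumes fg: "fg_right_module A X"
  obtains F g where "F \<in> fgmod A" and "g \<in> epi_rhom A X F" and "a_kernel X F g = trace_e X"
    and "from_B F"
proof -
  note X = right_module_fg[OF fg]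
  interpret X: right_module A X by (rule X)
  obtain F g where F: "F \<in> fgmod A" "g \<in> epi_rhom A X F" "a_kernel X F g = trace_e X"
    using A.ex_quotient[OF fg rsubmodule_trace_e[OF X]] by blast
  note RF = right_module_fg[OF fgmodD[OF F(1)]]
  have "y \<triangleleft>\<^bsub>F\<^esub> e = \<zero>\<^bsub>F\<^esub>" if y: "y \<in> carrier F" for y
  proof -
    obtain x where x: "x \<in> carrier X" "g x = y" using F(2) y by (rule epi_rhomE)
    then have "x \<triangleleft>\<^bsub>X\<^esub> e \<in> a_kernel X F g" unfolding F(3) by (intro e_in_trace_e)
    then show ?thesis
      using x rhom_ract[OF epi_rhom_rhom[OF F(2)] x(1) e_closed] by (simp add: in_a_kernel)
  qed
  then show thesis using that F from_B_iff[OF RF] by blast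
qed

text \<open>Division by the trace is a functor, so the retract \<open>X\<close> of
  \<open>V \<oplus> P\<close> yields a retract \<open>F\<close> of
  \<open>V \<oplus> P / P e A\<close>. A module from \<open>B\<close> is left unchanged, and a
  projective becomes projective over \<open>B\<close>.\<close>

lemma top_C_mod:
  fixes X :: "('k \<times> 'm \<times> 'b, 'x) rmodule" and V :: "('k \<times> 'm \<times> 'b, 'v) rmodule"
    and P :: "('k \<times> 'm \<times> 'b, 'p) rmodule" and F :: "('k \<times> 'm \<times> 'b, 'f) rmodule"
  assumes X: "right_module A X" and V: "right_module A V" "from_B V" "C_mod (res V)"
    and P: "fg_right_module A P" "projective A P" and XVP: "rretract A X (rdsum V P)"
    and F: "right_module A F" "from_B F" and g: "g \<in> epi_rhom A X F"
    and kg: "a_kernel X F g = trace_e X"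
  shows "C_mod (res F)"
proof -
  note RP = right_module_fg[OF P(1)]
  obtain Q q where Q: "Q \<in> fgmod A" "q \<in> epi_rhom A P Q" "a_kernel P Q q = trace_e P" "from_B Q"
    by (rule ex_top[OF P(1)])
  note RQ = right_module_fg[OF fgmodD[OF Q(1)]] and q = epi_rhom_rhom[OF Q(2)]
  note g' = epi_rhom_rhom[OF g]
  have kq: "x \<in> trace_e P" if "x \<in> carrier P" "q x = \<zero>\<^bsub>Q\<^esub>" for x
    using that unfolding Q(3)[symmetric] by (simp add: in_a_kernel)
  have kg': "x \<in> trace_e X" if "x \<in> carrier X" "g x = \<zero>\<^bsub>F\<^esub>" for x
    using that unfolding kg[symmetric] by (simp add: in_a_kernel)
  \<comment> \<open>A map from \<open>P / P e A\<close> to a module over \<open>B\<close> is lifted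
    over \<open>A\<close> from \<open>P\<close>; the lift vanishes on the trace and so
    descends.\<close>
  have "projective B (res Q)"
    unfolding projective_def
  proof (intro ballI)
    fix Y Z c h assume *: "Y \<in> fgmod B" "Z \<in> fgmod B" "c \<in> epi_rhom B Y Z" and h: "h \<in> rhom B (res Q) Z"
    note RZ = right_module_fg[OF fgmodD[OF *(2)]]
    note iY = right_module_infl[OF right_module_fg[OF fgmodD[OF *(1)]]]
      from_B_infl[OF right_module_fg[OF fgmodD[OF *(1)]]]
    from projectiveD[OF P(2) fgmod_infl[OF *(1)] fgmod_infl[OF *(2)] epi_rhom_infl[OF *(3)]
        rhom_comp[OF q rhom_into_infl[OF RQ Q(4) RZ h]]]
    obtain l where l: "l \<in> rhom A P (infl Y)" "\<forall>x\<in>carrier P. c (l x) = h (q x)" by blast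
    have "l x = \<zero>\<^bsub>infl Y\<^esub>" if "x \<in> carrier P" "q x = \<zero>\<^bsub>Q\<^esub>" for x
      by (rule from_B_zero_on_trace_e[OF RP iY l(1) kq[OF that]])
    from rhom_factor_epi[OF RP RQ iY(1) Q(2) l(1) this] obtain k
      where k: "k \<in> rhom A Q (infl Y)" "\<forall>x\<in>carrier P. k (q x) = l x" by blast
    have "c (k y) = h y" if y: "y \<in> carrier Q" for y
    proof -
      obtain x where "x \<in> carrier P" "q x = y" using Q(2) y by (rule epi_rhomE)
      then show ?thesis using k(2) l(2) by auto
    qed
    then show "\<exists>f\<in>rhom B (res Q) Y. \<forall>x\<in>carrier (res Q). c (f x) = h x"
      using rhom_res[OF k(1)] by (intro bexI[of _ k]) auto
  qed
  moreover have "fg_right_module B (res Q)" by (rule fg_res[OF fgmodD[OF Q(1)] Q(4)])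
  ultimately have "C_mod (rdsum (res V) (res Q))" using V(3) C_mod_projective by (intro C_mod_rdsum)
  moreover
  obtain i r where i: "i \<in> rhom A X (rdsum V P)" and r: "r \<in> rhom A (rdsum V P) X"
    and ri: "\<And>x. x \<in> carrier X \<Longrightarrow> r (i x) = x"
    using XVP by (rule rretractE) blast
  \<comment> \<open>\<open>V \<oplus> Q\<close> with \<open>Q = P / P e A\<close>. Both maps of the
    retract kill the relevant traces and hence pass to \<open>F\<close> and to this quotient of
    \<open>V \<oplus> P\<close>.\<close>
  let ?W = "rdsum V Q" and ?qq = "\<lambda>y. (fst y, q (snd y))"
  note RVP = right_module_rdsum[OF V(1) RP]
  have RW: "right_module A ?W" "from_B ?W"
    using V Q RQ by (auto intro: right_module_rdsum from_B_rdsum)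
  have qq: "?qq \<in> epi_rhom A (rdsum V P) ?W"
    by (rule epi_rhomI[OF rhom_map_prod[OF rhom_id q]]) (force elim: epi_rhomE[OF Q(2)])
  note u = rhom_comp[OF i epi_rhom_rhom[OF qq]]
  have "?qq (i x) = \<zero>\<^bsub>?W\<^esub>" if "x \<in> carrier X" "g x = \<zero>\<^bsub>F\<^esub>" for x
    by (rule from_B_zero_on_trace_e[OF X RW u kg'[OF that]])
  from rhom_factor_epi[OF X F(1) RW(1) g u this] obtain u'
    where u': "u' \<in> rhom A F ?W" "\<forall>x\<in>carrier X. u' (g x) = ?qq (i x)" by blast
  note v = rhom_comp[OF r g']
  interpret V: right_module A V by (rule V(1))
  have "g (r y) = \<zero>\<^bsub>F\<^esub>" if y: "y \<in> carrier (rdsum V P)" "?qq y = \<zero>\<^bsub>?W\<^esub>" for y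
  proof -
    have "snd y \<in> trace_e P" "y = (\<zero>\<^bsub>V\<^esub>, snd y)"
      using y by (auto intro!: kq)
    then show ?thesis
      using from_B_zero_on_trace_e[OF RP F rhom_comp[OF rhom_inr[OF V(1)] v]] by metis
  qed
  from rhom_factor_epi[OF RVP RW(1) F(1) qq v this] obtain v'
    where v': "v' \<in> rhom A ?W F" "\<forall>y\<in>carrier (rdsum V P). v' (?qq y) = g (r y)" by blast
  have "v' (u' y) = y" if y: "y \<in> carrier F" for y
  proof -
    obtain x where x: "x \<in> carrier X" "g x = y" using g y by (rule epi_rhomE)
    have "v' (?qq (i x)) = g (r (i x))" using v'(2) rhom_closed[OF i x(1)] by blast
    then show ?thesis using u'(2)[rule_format, OF x(1)] ri[OF x(1)] x(2) by simp
  qed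
  with u'(1) v'(1) have "rretract A F ?W" by (rule rretractI)
  then have "rretract B (res F) (rdsum (res V) (res Q))"
    using rretract_res by (metis res_rdsum)
  ultimately show ?thesis by (rule C_mod_rretract)
qed

text \<open>A module that comes from \<open>B\<close> has zero trace and is its own largest such
  quotient.\<close>

lemma from_B_C_mod:
  fixes X :: "('k \<times> 'm \<times> 'b, 'x) rmodule" and V :: "('k \<times> 'm \<times> 'b, 'v) rmodule"
    and P :: "('k \<times> 'm \<times> 'b, 'p) rmodule"
  assumes X: "right_module A X" "from_B X" and V: "right_module A V" "from_B V" "C_mod (res V)"
    and P: "fg_right_module A P" "projective A P" and XVP: "rretract A X (rdsum V P)"
  shows "C_mod (res X)"
proof (rule top_C_mod[OF X(1) V P XVP X])
  show "(\<lambda>x. x) \<in> epi_rhom A X X" by (simp add: epi_rhom_def rhom_id)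
  show "a_kernel X X (\<lambda>x. x) = trace_e X"
    using rsubmodule_zero[OF rsubmodule_whole[OF X(1)]]
    by (auto simp: trace_e_from_B[OF X] in_a_kernel)
qed

section \<open>Syzygies over the one-point extension\<close>

lemma superfluous_e:
  fixes P :: "('k \<times> 'm \<times> 'b, 'p) rmodule"
  assumes P: "fg_right_module A P" "projective A P" and N: "superfluous A N P" and x: "x \<in> N"
  shows "x \<triangleleft>\<^bsub>P\<^esub> e = \<zero>\<^bsub>P\<^esub>"
proof (rule ccontr)
  note RP = right_module_fg[OF P(1)] and ring = A.Alg.ring_axioms
  note RA = right_module_regular[OF ring]
  interpret P: right_module A P by (rule RP)
  have NP: "rsubmodule A N P" using N by (simp add: superfluous_def)
  assume nz: "x \<triangleleft>\<^bsub>P\<^esub> e \<noteq> \<zero>\<^bsub>P\<^esub>"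
  have xP: "x \<in> carrier P" by (rule rsubmodule_carrier[OF NP x])
  have yN: "x \<triangleleft>\<^bsub>P\<^esub> e \<in> N" by (rule rsubmodule_ract[OF NP x e_closed])
  have yP: "x \<triangleleft>\<^bsub>P\<^esub> e \<in> carrier P" by (rule rsubmodule_carrier[OF NP yN])
  obtain h where h: "h \<in> rhom A P (regular_rmodule A)" "h (x \<triangleleft>\<^bsub>P\<^esub> e) \<noteq> \<zero>\<^bsub>A\<^esub>"
    using A.projective_cogenerated[OF P] yP nz by (auto elim: cogeneratedE)
  obtain a m b where hx: "h x = (a, m, b)" "a \<in> carrier K" "m \<in> carrier M" "b \<in> carrier B"
    using rhom_closed[OF h(1) xP] by (cases "h x") auto
  have "h (x \<triangleleft>\<^bsub>P\<^esub> e) = h x \<otimes>\<^bsub>A\<^esub> e" using rhom_ract[OF h(1) xP e_closed] by simp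
  then have hy: "h (x \<triangleleft>\<^bsub>P\<^esub> e) = (a, \<zero>\<^bsub>M\<^esub>, \<zero>\<^bsub>B\<^esub>)" using hx by (simp add: sc_simps)
  with h(2) have "a \<noteq> \<zero>\<^bsub>K\<^esub>" by auto
  then have a: "inv\<^bsub>K\<^esub> a \<in> carrier K" "a \<otimes>\<^bsub>K\<^esub> inv\<^bsub>K\<^esub> a = \<one>\<^bsub>K\<^esub>"
    using hx(2) B.K.field_Units by auto
  let ?l = "\<lambda>p. e \<otimes>\<^bsub>A\<^esub> h p"
  have l: "?l \<in> rhom A P (regular_rmodule A)" by (rule rhom_comp[OF h(1) rhom_mult_left[OF ring e_closed]])
  define L where "L = a_kernel P (regular_rmodule A) ?l"
  have L: "rsubmodule A L P" unfolding L_def by (rule rsubmodule_a_kernel[OF RP RA l])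
  have "p \<in> N <+>\<^bsub>P\<^esub> L" if p: "p \<in> carrier P" for p
  proof -
    obtain c m' b' where hp: "h p = (c, m', b')" "c \<in> carrier K" "m' \<in> carrier M" "b' \<in> carrier B"
      using rhom_closed[OF h(1) p] by (cases "h p") auto
    \<comment> \<open>The solution of \<open>(a, 0, 0) r = (c, m', 0)\<close>, that is, the inverse
      of \<open>a\<close> times \<open>e (h p)\<close>.\<close>
    let ?r = "(inv\<^bsub>K\<^esub> a \<otimes>\<^bsub>K\<^esub> c, m' \<triangleleft>\<^bsub>M\<^esub> (inv\<^bsub>K\<^esub> a \<odot>\<^bsub>B\<^esub> \<one>\<^bsub>B\<^esub>), \<zero>\<^bsub>B\<^esub>)"
    have r: "?r \<in> carrier A" using a hp by (simp add: sc_simps)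
    let ?y = "x \<triangleleft>\<^bsub>P\<^esub> e \<triangleleft>\<^bsub>P\<^esub> ?r"
    have yN': "?y \<in> N" by (rule rsubmodule_ract[OF NP yN r])
    have yP': "?y \<in> carrier P" by (rule rsubmodule_carrier[OF NP yN'])
    have e1: "m' \<triangleleft>\<^bsub>M\<^esub> (inv\<^bsub>K\<^esub> a \<odot>\<^bsub>B\<^esub> \<one>\<^bsub>B\<^esub>) \<triangleleft>\<^bsub>M\<^esub> (a \<odot>\<^bsub>B\<^esub> \<one>\<^bsub>B\<^esub>) = m'"
      using scalar_twice[OF hx(2) a(1) hp(3)] a hp(3) by (simp add: sc_simps)
    have e2: "a \<otimes>\<^bsub>K\<^esub> (inv\<^bsub>K\<^esub> a \<otimes>\<^bsub>K\<^esub> c) = c"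
      using B.K.m_assoc[OF hx(2) a(1) hp(2)] a(2) hp(2) by simp
    have "?l ?y = ?l (x \<triangleleft>\<^bsub>P\<^esub> e) \<otimes>\<^bsub>A\<^esub> ?r" using rhom_ract[OF l yP r] by simp
    also have "\<dots> = (c, m', \<zero>\<^bsub>B\<^esub>)" unfolding hy using hx hp a e1 e2 by (simp add: sc_simps)
    also have "\<dots> = ?l p" using hp by (simp add: sc_simps)
    finally have "p \<ominus>\<^bsub>P\<^esub> ?y \<in> L"
      using p yP' rhom_minus[OF RP RA l p yP'] right_module.minus_self[OF RA rhom_closed[OF l p]]
      by (simp add: L_def in_a_kernel)
    from set_addI[OF yN' this, of P] show ?thesis
      using p yP' P.minus_add_cancel[OF p yP'] by (simp add: P.AbGr.a_comm)
  qed
  then have "N <+>\<^bsub>P\<^esub> L = carrier P"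
    using rsubmodule_subset[OF rsubmodule_set_add[OF RP NP L]] by blast
  with N L have "L = carrier P" unfolding superfluous_def by blast
  with yP have "?l (x \<triangleleft>\<^bsub>P\<^esub> e) = \<zero>\<^bsub>regular_rmodule A\<^esub>" by (auto simp: L_def in_a_kernel)
  then show False using hy hx(2) \<open>a \<noteq> \<zero>\<^bsub>K\<^esub>\<close> by simp
qed

lemma is_syzygy_from_B:
  fixes Y :: "('k \<times> 'm \<times> 'b, 'y) rmodule"
  assumes Y: "fg_right_module A Y" and W: "is_syzygy A Y W"
  shows "from_B W" and "cogenerated B (res W) BM"
proof -
  note RY = right_module_fg[OF Y] and ring = A.Alg.ring_axioms
  obtain P p where P: "P \<in> fgproj A" "p \<in> epi_rhom A P Y" "superfluous A (a_kernel P Y p) P"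
    "riso A (restrict_to P (a_kernel P Y p)) W" "W \<in> fgmod A"
    using W by (rule is_syzygyE)
  note RP = right_module_fg[OF fgprojD(1)[OF P(1)]] and RW = right_module_fg[OF fgmodD[OF P(5)]]
  note k = rsubmodule_a_kernel[OF RP RY epi_rhom_rhom[OF P(2)]]
  let ?N = "restrict_to P (a_kernel P Y p)"
  note RN = right_module_restrict_to[OF RP k]
  have vN: "from_B ?N"
    using superfluous_e[OF fgprojD[OF P(1)] P(3)] by (simp add: from_B_iff[OF RN])
  have "rretract A W ?N" by (rule riso_rretract(2)[OF RN RW P(4)])
  then show W: "from_B W" by (rule from_B_rretract[OF RW RN vN])
  have "cogenerated B (res ?N) BM"
    unfolding cogenerated_def
  proof (intro ballI impI)
    fix x assume x: "x \<in> carrier (res ?N)" "x \<noteq> \<zero>\<^bsub>res ?N\<^esub>"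
    then have "x \<in> carrier P" "x \<noteq> \<zero>\<^bsub>P\<^esub>" using rsubmodule_carrier[OF k] by auto
    with A.projective_cogenerated[OF fgprojD[OF P(1)]]
    obtain h where h: "h \<in> rhom A P (regular_rmodule A)" "h x \<noteq> \<zero>\<^bsub>regular_rmodule A\<^esub>"
      by (rule cogeneratedE)
    have hN: "\<exists>m b. h z = (\<zero>\<^bsub>K\<^esub>, m, b) \<and> m \<in> carrier M \<and> b \<in> carrier B" if "z \<in> a_kernel P Y p" for z
    proof -
      have z: "z \<in> carrier P" by (rule rsubmodule_carrier[OF k that])
      obtain a m b where hz: "h z = (a, m, b)" "a \<in> carrier K" "m \<in> carrier M" "b \<in> carrier B"
        using rhom_closed[OF h(1) z] by (cases "h z") auto
      have "z \<triangleleft>\<^bsub>P\<^esub> (\<zero>\<^bsub>K\<^esub>, \<zero>\<^bsub>M\<^esub>, \<one>\<^bsub>B\<^esub>) = z" using vN that by (simp add: from_B_def)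
      then have "h z = h z \<otimes>\<^bsub>A\<^esub> (\<zero>\<^bsub>K\<^esub>, \<zero>\<^bsub>M\<^esub>, \<one>\<^bsub>B\<^esub>)"
        using rhom_ract[OF h(1) z, of "(\<zero>\<^bsub>K\<^esub>, \<zero>\<^bsub>M\<^esub>, \<one>\<^bsub>B\<^esub>)"] by simp
      then have "a = \<zero>\<^bsub>K\<^esub>" using hz by (simp add: sc_simps)
      with hz show ?thesis by blast
    qed
    \<comment> \<open>The entries are swapped because \<open>BM\<close> lists \<open>B\<close>
      before \<open>M\<close>.\<close>
    let ?f = "\<lambda>z. (snd (snd (h z)), fst (snd (h z)))"
    have "?f \<in> rhom B (res ?N) BM"
    proof (rule rhomI)
      fix z assume z: "z \<in> carrier (res ?N)"
      then have zk: "z \<in> a_kernel P Y p" by simp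
      obtain m b where hz: "h z = (\<zero>\<^bsub>K\<^esub>, m, b)" "m \<in> carrier M" "b \<in> carrier B" using hN[OF zk] by blast
      then show "?f z \<in> carrier BM" by simp
      show "?f (z \<triangleleft>\<^bsub>res ?N\<^esub> c) = ?f z \<triangleleft>\<^bsub>BM\<^esub> c" if "c \<in> carrier B" for c
        using that hz rhom_ract[OF h(1) rsubmodule_carrier[OF k zk], of "(\<zero>\<^bsub>K\<^esub>, \<zero>\<^bsub>M\<^esub>, c)"]
        by (simp add: sc_simps)
      fix y assume y: "y \<in> carrier (res ?N)"
      then have yk: "y \<in> a_kernel P Y p" by simp
      obtain m' b' where "h y = (\<zero>\<^bsub>K\<^esub>, m', b')" "m' \<in> carrier M" "b' \<in> carrier B" using hN[OF yk] by blast
      then show "?f (z \<oplus>\<^bsub>res ?N\<^esub> y) = ?f z \<oplus>\<^bsub>BM\<^esub> ?f y"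
        using hz rhom_add[OF h(1) rsubmodule_carrier[OF k zk] rsubmodule_carrier[OF k yk]] by simp
    qed
    moreover have "?f x \<noteq> \<zero>\<^bsub>BM\<^esub>" using h(2) hN[of x] x(1) by auto
    ultimately show "\<exists>h\<in>rhom B (res ?N) BM. h x \<noteq> \<zero>\<^bsub>BM\<^esub>" by (intro bexI[of _ ?f])
  qed
  then show "cogenerated B (res W) BM"
    using rretract_res[OF \<open>rretract A W ?N\<close>]
    by (intro cogenerated_rretract[OF right_module_res[OF RW W] right_module_res[OF RN vN]])
qed

lemma is_syzygy_C_mod:
  fixes W :: "('k \<times> 'm \<times> 'b, 'w) rmodule"
  assumes W: "fg_right_module A W" "from_B W" "cogenerated B (res W) BM" and V: "is_syzygy A W V"
  shows "C_mod (res V)"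
proof -
  note RW = right_module_fg[OF W(1)]
  obtain P p where P: "P \<in> fgproj A" "p \<in> epi_rhom A P W" "superfluous A (a_kernel P W p) P"
    "riso A (restrict_to P (a_kernel P W p)) V" "V \<in> fgmod A"
    using V by (rule is_syzygyE)
  note RP = right_module_fg[OF fgprojD(1)[OF P(1)]] and p = epi_rhom_rhom[OF P(2)]
  interpret P: right_module A P by (rule RP)
  note k = rsubmodule_a_kernel[OF RP RW p]
  have "x \<triangleleft>\<^bsub>P\<^esub> e = \<zero>\<^bsub>P\<^esub>" if x: "x \<in> carrier P" for x
  proof -
    have xe: "x \<triangleleft>\<^bsub>P\<^esub> e \<in> carrier P" by (rule P.ract_closed[OF x e_closed])
    then have "x \<triangleleft>\<^bsub>P\<^esub> e \<in> a_kernel P W p"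
      using x rhom_ract[OF p x e_closed] from_B_e[OF RW W(2) rhom_closed[OF p x]] by (simp add: in_a_kernel)
    from superfluous_e[OF fgprojD[OF P(1)] P(3) this]
    show ?thesis using P.ract_mult[OF x e_closed e_closed] unfolding e_idem by simp
  qed
  then have vP: "from_B P" by (simp add: from_B_iff[OF RP])
  have "rretract A V (restrict_to P (a_kernel P W p))"
    by (rule riso_rretract(2)[OF right_module_restrict_to[OF RP k] right_module_fg[OF fgmodD[OF P(5)]] P(4)])
  from rretract_res[OF this]
  have "rretract B (res V) (restrict_to (res P) (a_kernel (res P) (res W) p))"
    by (simp add: res_restrict_to)
  then show ?thesis
    by (rule C_mod_kernel[OF fg_res[OF fgprojD(1)[OF P(1)] vP] projective_res[OF fgprojD(2)[OF P(1)] RP vP]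
          right_module_res[OF RW W(2)] W(3) rhom_res[OF p]])
qed

lemma second_syzygy_C_mod:
  assumes Y: "fg_right_module A Y" and W: "is_syzygy A Y W" and V: "is_syzygy A W V"
  shows "from_B V" and "C_mod (res V)" and "V \<in> fgmod A"
proof -
  have W': "fg_right_module A W" using W by (simp add: is_syzygy_def fgmod_def)
  show "from_B V" by (rule is_syzygy_from_B(1)[OF W' V])
  show "C_mod (res V)" by (rule is_syzygy_C_mod[OF W' is_syzygy_from_B[OF Y W] V])
  show "V \<in> fgmod A" using V by (simp add: is_syzygy_def)
qed

text \<open>The module \<open>N\<close> embeds into a power of \<open>A\<close>; let
  \<open>Y\<close> be the cokernel. Then \<open>N\<close> is stably a retract of
  \<open>\<Omega> Y\<close>, and the kernel of \<open>P -> N\<close>, a presentation that stays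
  projective after inflation, is stably a retract of the second syzygy of \<open>Y\<close>.\<close>

lemma C_mod_second_syzygy:
  fixes X :: "('b, 'x) rmodule"
  assumes X: "right_module B X" and "C_mod X"
  obtains Y V where "Y \<in> fgmod A" and "is_nth_syzygy A 2 Y V"
    and "V \<in> fgmod A" and "stable_retract A (infl X) V"
proof -
  note ring = A.Alg.ring_axioms
  obtain P N g where P: "P \<in> fgproj B" and N: "N \<in> fgmod B" and cog: "cogenerated B N BM"
    and g: "g \<in> epi_rhom B P N" and ret: "rretract B X (restrict_to P (a_kernel P N g))"
    by (rule C_modE[OF assms(2)])
  note RN = right_module_fg[OF fgmodD[OF N]]
  note iP = fgproj_infl[OF P] and iN = right_module_infl[OF RN]
  obtain n :: nat and h where h: "\<And>i. i < n \<Longrightarrow> h i \<in> rhom B N BM"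
    and inj: "\<And>x. x \<in> carrier N \<Longrightarrow> (\<And>i. i < n \<Longrightarrow> h i x = \<zero>\<^bsub>BM\<^esub>) \<Longrightarrow> x = \<zero>\<^bsub>N\<^esub>"
    by (rule B.cogenerated_finite[OF fgmodD[OF N] right_module_BM cog]) blast
  let ?R = "regular_rmodule A" and ?S = "fin_dsum n (\<lambda>_. regular_rmodule A)"
  have fgS: "fg_right_module A ?S" by (rule fg_right_module_fin_dsum[OF ring fg_regular[OF ring]])
  have pS: "projective A ?S"
    by (rule projective_fin_dsum[OF ring right_module_regular[OF ring] projective_regular[OF ring]])
  note RS = right_module_fg[OF fgS]
  \<comment> \<open>Identifies \<open>BM\<close> with the elements of \<open>A\<close> that have
    \<open>K\<close>-entry zero, as a right ideal of \<open>A\<close>.\<close>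
  have t: "(\<lambda>x. (\<zero>\<^bsub>K\<^esub>, snd x, fst x)) \<in> rhom A (infl BM) ?R"
    by (rule rhomI) (auto simp: sc_simps)
  let ?j = "\<lambda>x. \<lambda>i\<in>{..<n}. (\<zero>\<^bsub>K\<^esub>, snd (h i x), fst (h i x))"
  have j: "?j \<in> rhom A (infl N) ?S"
    by (rule rhom_fin_dsum, rule rhom_comp[OF rhom_infl[OF h] t])
  have "inj_on ?j (carrier (infl N))"
  proof (rule inj_on_rhomI[OF iN RS j])
    fix x assume x: "x \<in> carrier (infl N)" and z: "?j x = \<zero>\<^bsub>?S\<^esub>"
    have "h i x = \<zero>\<^bsub>BM\<^esub>" if "i < n" for i
      using fun_cong[OF z, of i] that by (cases "h i x") simp
    then show "x = \<zero>\<^bsub>infl N\<^esub>" using inj x by simp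
  qed
  with j have jm: "?j \<in> mono_rhom A (infl N) ?S" by (simp add: mono_rhom_def)
  let ?I = "?j ` carrier (infl N)"
  have I: "rsubmodule A ?I ?S" by (rule rsubmodule_image[OF iN RS j rsubmodule_whole[OF iN]])
  obtain Y q where Y: "Y \<in> fgmod A" and q: "q \<in> epi_rhom A ?S Y" and kq: "a_kernel ?S Y q = ?I"
    using A.ex_quotient[OF fgS I] by blast
  note RY = right_module_fg[OF fgmodD[OF Y]]
  obtain W where W: "is_syzygy A Y W" using A.ex_is_syzygy[OF fgmodD[OF Y]] by blast
  then have fgW: "W \<in> fgmod A" by (simp add: is_syzygy_def)
  note RW = right_module_fg[OF fgmodD[OF fgW]]
  obtain V where V: "is_syzygy A W V" using A.ex_is_syzygy[OF fgmodD[OF fgW]] by blast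
  then have fgV: "V \<in> fgmod A" by (simp add: is_syzygy_def)
  have nth: "is_nth_syzygy A 2 Y V"
    using Y W V fgW riso_refl[of A Y] unfolding numeral_2_eq_2 by auto
  obtain s where s: "s \<in> rhom A (restrict_to ?S ?I) (infl N)" "\<forall>y\<in>?I. ?j (s y) = y"
    using rhom_lift_mono[OF iN RS jm rhom_inclusion[OF I] _ right_module_restrict_to[OF RS I]] by auto
  have N_I: "rretract A (infl N) (restrict_to ?S ?I)"
  proof (rule rretractI[OF rhom_corestrict[OF j] s(1)])
    fix x assume x: "x \<in> carrier (infl N)"
    then have "?j x \<in> ?I" by (rule imageI)
    then have "?j (s (?j x)) = ?j x" "s (?j x) \<in> carrier (infl N)"
      using s(2) rhom_closed[OF s(1)] by auto
    then show "s (?j x) = x" using jm x unfolding mono_rhom_def by (auto dest: inj_onD)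
  qed blast
  have "rretract A (restrict_to ?S ?I) (rdsum W ?S)"
    using A.rretract_kernel_syzygy[OF RY RY fgS pS fgS pS q rretract_rdsum_left[OF RY RS] W]
    unfolding kq .
  from rretract_trans[OF N_I this] have "rretract A (infl N) (rdsum W ?S)" .
  from A.rretract_kernel_syzygy[OF iN RW fgprojD[OF iP] fgS pS epi_rhom_infl[OF g] this V]
  have "rretract A (infl (restrict_to P (a_kernel P N g))) (rdsum V (infl P))"
    by (simp add: infl_restrict_to)
  from rretract_trans[OF rretract_infl[OF ret] this] have "rretract A (infl X) (rdsum V (infl P))" .
  then have "stable_retract A (infl X) V"
    using A.stable_retract_iff[OF right_module_infl[OF X] right_module_fg[OF fgmodD[OF fgV]]] iP by blast
  with that Y fgV nth show thesis by blast
qed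

section \<open>The modules \<open>P\<^sub>0\<close> and \<open>S\<^sub>0\<close>\<close>

abbreviation P0 where "P0 \<equiv> P\<^sub>0 K B M"
abbreviation S0 where "S0 \<equiv> S\<^sub>0 K B M"
abbreviation J where "J \<equiv> {\<zero>\<^bsub>K\<^esub>} \<times> carrier M \<times> {\<zero>\<^bsub>B\<^esub>}"

lemma P0_eq: "P0 = restrict_to (regular_rmodule A) (carrier K \<times> carrier M \<times> {\<zero>\<^bsub>B\<^esub>})"
proof -
  have "{e\<^sub>0 K B M \<otimes>\<^bsub>A\<^esub> x | x. x \<in> carrier A} = carrier K \<times> carrier M \<times> {\<zero>\<^bsub>B\<^esub>}"
  proof (intro equalityI subsetI)
    fix y assume "y \<in> {e\<^sub>0 K B M \<otimes>\<^bsub>A\<^esub> x | x. x \<in> carrier A}"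
    then show "y \<in> carrier K \<times> carrier M \<times> {\<zero>\<^bsub>B\<^esub>}" by (auto simp: e\<^sub>0_def sc_simps)
  next
    fix y assume "y \<in> carrier K \<times> carrier M \<times> {\<zero>\<^bsub>B\<^esub>}"
    then obtain a m where y: "y = (a, m, \<zero>\<^bsub>B\<^esub>)" "a \<in> carrier K" "m \<in> carrier M" by auto
    then have "y = e\<^sub>0 K B M \<otimes>\<^bsub>A\<^esub> y" "y \<in> carrier A" by (simp_all add: e\<^sub>0_def sc_simps)
    then show "y \<in> {e\<^sub>0 K B M \<otimes>\<^bsub>A\<^esub> x | x. x \<in> carrier A}" by blast
  qed
  then show ?thesis by (simp add: P\<^sub>0_def Let_def)
qed

lemma P0_simps [simp]:
  "carrier P0 = carrier K \<times> carrier M \<times> {\<zero>\<^bsub>B\<^esub>}" "\<zero>\<^bsub>P0\<^esub> = (\<zero>\<^bsub>K\<^esub>, \<zero>\<^bsub>M\<^esub>, \<zero>\<^bsub>B\<^esub>)"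
  "x \<oplus>\<^bsub>P0\<^esub> y = x \<oplus>\<^bsub>A\<^esub> y" "x \<triangleleft>\<^bsub>P0\<^esub> r = x \<otimes>\<^bsub>A\<^esub> r"
  by (simp_all add: P0_eq)

lemma rsubmodule_P0: "rsubmodule A (carrier K \<times> carrier M \<times> {\<zero>\<^bsub>B\<^esub>}) (regular_rmodule A)"
  by (rule rsubmoduleI[OF right_module_regular[OF A.Alg.ring_axioms]]) (auto simp: sc_simps)

lemma right_module_P0: "right_module A P0"
  unfolding P0_eq by (rule right_module_restrict_to[OF right_module_regular[OF A.Alg.ring_axioms] rsubmodule_P0])

lemma rretract_P0: "rretract A P0 (regular_rmodule A)"
proof (rule rretractI)
  show "(\<lambda>x. x) \<in> rhom A P0 (regular_rmodule A)" unfolding P0_eq by (rule rhom_inclusion[OF rsubmodule_P0])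
  show "(\<lambda>x. e \<otimes>\<^bsub>A\<^esub> x) \<in> rhom A (regular_rmodule A) P0"
    unfolding P0_eq
    by (rule rhom_corestrict[OF rhom_mult_left[OF A.Alg.ring_axioms e_closed]]) (auto simp: sc_simps)
qed (auto simp: sc_simps)

lemma fg_P0: "fg_right_module A P0"
  by (rule fg_right_module_rretract[OF fg_regular[OF A.Alg.ring_axioms] right_module_P0 rretract_P0])

lemma projective_P0: "projective A P0"
  by (rule projective_rretract[OF projective_regular[OF A.Alg.ring_axioms] rretract_P0])

lemma rsubmodule_J: "rsubmodule A J P0"
  by (rule rsubmoduleI[OF right_module_P0]) (auto simp: sc_simps)

text \<open>An element of \<open>P0\<close> outside \<open>J\<close> has an invertible
  \<open>K\<close>-entry and hence generates \<open>e\<close>. So \<open>J\<close> contains every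
  proper submodule and is the only maximal one.\<close>

lemma mod_rad_P0: "mod_rad A P0 = J"
proof -
  have top: "N = carrier P0" if N: "rsubmodule A N P0" and x: "x \<in> N" "x \<notin> J" for N x
  proof -
    obtain a m where a: "x = (a, m, \<zero>\<^bsub>B\<^esub>)" "a \<in> carrier K" "m \<in> carrier M"
      using rsubmodule_carrier[OF N x(1)] by auto
    then have "a \<noteq> \<zero>\<^bsub>K\<^esub>" using x(2) by auto
    then have inv: "inv\<^bsub>K\<^esub> a \<in> carrier K" "a \<otimes>\<^bsub>K\<^esub> inv\<^bsub>K\<^esub> a = \<one>\<^bsub>K\<^esub>"
      using a(2) B.K.field_Units by auto
    then have "e \<in> N"
      using rsubmodule_ract[OF N x(1), of "(inv\<^bsub>K\<^esub> a, \<zero>\<^bsub>M\<^esub>, \<zero>\<^bsub>B\<^esub>)"] a by (simp add: sc_simps)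
    then have "y \<in> N" if "y \<in> carrier P0" for y
      using rsubmodule_ract[OF N, of e y] that by (auto simp: sc_simps)
    then show ?thesis using rsubmodule_subset[OF N] by blast
  qed
  have "e \<notin> J" by simp
  moreover have "e \<in> carrier P0" by simp
  ultimately have J: "J \<noteq> carrier P0" by blast
  have "maximal_rsubmodule A N P0 \<longleftrightarrow> N = J" for N
  proof
    assume N: "maximal_rsubmodule A N P0"
    then have "N \<subseteq> J" using top unfolding maximal_rsubmodule_def by blast
    then show "N = J" using N J rsubmodule_J unfolding maximal_rsubmodule_def by blast
  next
    assume "N = J"
    then show "maximal_rsubmodule A N P0"
      using J rsubmodule_J top unfolding maximal_rsubmodule_def by blast
  qed
  then show ?thesis using rsubmodule_subset[OF rsubmodule_J] by (auto simp: mod_rad_def)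
qed

text \<open>The kernel \<open>J\<close> is a copy of the inflation of \<open>M\<close>. The simple
  module enters the remaining arguments only through this presentation.\<close>

lemma S0_quotient:
  obtains t where "right_module A S0" and "t \<in> epi_rhom A P0 S0" and "a_kernel P0 S0 t = J"
  using quot_rmodule[OF right_module_P0 rsubmodule_J] that by (simp add: S\<^sub>0_def mod_rad_P0)

lemma rhom_J_infl: "(\<lambda>u. fst (snd u)) \<in> rhom A (restrict_to P0 J) (infl M)"
  by (rule rhomI) (auto simp: sc_simps)

lemma rhom_infl_J: "(\<lambda>m. (\<zero>\<^bsub>K\<^esub>, m, \<zero>\<^bsub>B\<^esub>)) \<in> rhom A (infl M) (restrict_to P0 J)"
  by (rule rhomI) (auto simp: sc_simps)

lemma rhom_infl_P0: "(\<lambda>m. (\<zero>\<^bsub>K\<^esub>, m, \<zero>\<^bsub>B\<^esub>)) \<in> rhom A (infl M) P0"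
  by (rule rhom_comp[OF rhom_infl_J rhom_inclusion[OF rsubmodule_J]])

lemma rhom_from_P0:
  assumes "right_module A X" and "x \<in> carrier X"
  shows "(\<lambda>u. x \<triangleleft>\<^bsub>X\<^esub> u) \<in> rhom A P0 X"
  unfolding P0_eq by (rule rhom_restrict[OF rhom_regular[OF assms]]) auto

section \<open>From a resolution of \<open>S\<^sub>0\<close> to an extension\<close>

text \<open>
  Let \<open>C0 \<longrightarrow> S\<^sub>0\<close> have kernel \<open>X1\<close>, let \<open>P \<longrightarrow> C0\<close> be a projective presentation, and let \<open>F\<close> be the
  largest quotient of \<open>X1\<close> killed by \<open>e\<^sub>0\<close>. A preimage \<open>c0\<close> of the generator of \<open>S\<^sub>0\<close> gives
  \<open>M \<longrightarrow> X1 \<longrightarrow> F\<close>, which together with a projective presentation \<open>Q \<longrightarrow> F\<close> is the required epimorphism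
  \<open>M \<oplus> Q \<longrightarrow> F\<close>. Its kernel is a retract of \<open>ker (P \<longrightarrow> C0) \<oplus> Q\<close>: as \<open>X1\<close> is a retract of \<open>V1 \<oplus> P1\<close>
  with \<open>V1\<close> killed by \<open>e\<^sub>0\<close>, the map \<open>P \<longrightarrow> C0\<close> has a section over the submodule generated
  by \<open>X1 e\<^sub>0\<close>.
\<close>

lemma resolution_imp_extension:
  fixes C0 :: "('k \<times> 'm \<times> 'b, 'c) rmodule" and V1 :: "('k \<times> 'm \<times> 'b, 'v) rmodule"
    and P1 :: "('k \<times> 'm \<times> 'b, 'p) rmodule" and V2 :: "('k \<times> 'm \<times> 'b, 'w) rmodule"
    and P2 :: "('k \<times> 'm \<times> 'b, 'q) rmodule"
  assumes C0: "fg_right_module A C0" and \<epsilon>: "\<epsilon> \<in> epi_rhom A C0 S0"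
    and V1: "right_module A V1" "from_B V1" "C_mod (res V1)"
    and P1: "fg_right_module A P1" "projective A P1"
    and X1: "rretract A (restrict_to C0 (a_kernel C0 S0 \<epsilon>)) (rdsum V1 P1)"
    and P: "P \<in> fgproj A" and \<pi>: "\<pi> \<in> epi_rhom A P C0"
    and V2: "right_module A V2" "from_B V2" "C_mod (res V2)"
    and P2: "fg_right_module A P2" "projective A P2"
    and K: "rretract A (restrict_to P (a_kernel P C0 \<pi>)) (rdsum V2 P2)"
  shows "\<exists>Q\<in>fgproj B. rdsum M Q \<in> extension_class B (C_class B M) (C_class B M)"
proof -
  note RC = right_module_fg[OF C0] and \<epsilon>' = epi_rhom_rhom[OF \<epsilon>] and \<pi>' = epi_rhom_rhom[OF \<pi>]
  note fgP = fgprojD(1)[OF P]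
  note RP = right_module_fg[OF fgP] and RP1 = right_module_fg[OF P1(1)]
  obtain t where RS: "right_module A S0" and t: "t \<in> epi_rhom A P0 S0" and kt: "a_kernel P0 S0 t = J"
    by (rule S0_quotient)
  note t' = epi_rhom_rhom[OF t]
  have t0: "u \<in> J" if "u \<in> carrier P0" "t u = \<zero>\<^bsub>S0\<^esub>" for u
    using that unfolding kt[symmetric] by (simp add: in_a_kernel)
  have tJ: "t u = \<zero>\<^bsub>S0\<^esub>" if "u \<in> J" for u
    using that unfolding kt[symmetric] by (simp add: in_a_kernel)
  interpret C0: right_module A C0 by (rule RC)
  interpret P: right_module A P by (rule RP)
  interpret S0: right_module A S0 by (rule RS)
  interpret P0: right_module A P0 by (rule right_module_P0)
  interpret V1: right_module A V1 by (rule V1(1))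

  \<comment> \<open>A lift of the generator of \<open>S0\<close> to \<open>C0\<close>\<close>
  have eP0: "e \<in> carrier P0" by simp
  obtain x where x: "x \<in> carrier C0" "\<epsilon> x = t e"
    using \<epsilon> rhom_closed[OF t' eP0] by (rule epi_rhomE)
  \<comment> \<open>Multiplying by \<open>e\<close> gives \<open>c e = c\<close> without changing
    the image in \<open>S0\<close>, so \<open>\<kappa> : P0 -> C0\<close>,
    \<open>u \<mapsto> c u\<close>, is a lift of \<open>t\<close> through
    \<open>\<epsilon>\<close>.\<close>
  define c where "c = x \<triangleleft>\<^bsub>C0\<^esub> e"
  have c: "c \<in> carrier C0" unfolding c_def by (rule C0.ract_closed[OF x(1) e_closed])
  have ce: "c \<triangleleft>\<^bsub>C0\<^esub> e = c"
    using C0.ract_mult[OF x(1) e_closed e_closed] unfolding e_idem c_def by simp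
  have \<epsilon>c: "\<epsilon> c = t e"
    using rhom_ract[OF \<epsilon>' x(1) e_closed] rhom_ract[OF t' eP0 e_closed] x(2) e_idem
    unfolding c_def by simp
  define \<kappa> where "\<kappa> = (\<lambda>u. c \<triangleleft>\<^bsub>C0\<^esub> u)"
  have \<kappa>: "\<kappa> \<in> rhom A P0 C0" unfolding \<kappa>_def by (rule rhom_from_P0[OF RC c])
  have \<epsilon>\<kappa>: "\<epsilon> (\<kappa> u) = t u" if "u \<in> carrier P0" for u
  proof -
    have u: "u \<in> carrier A" "e \<otimes>\<^bsub>A\<^esub> u = u" using that by (auto simp: sc_simps)
    then show ?thesis
      using rhom_ract[OF \<epsilon>' c u(1)] rhom_ract[OF t' eP0 u(1)] \<epsilon>c by (simp add: \<kappa>_def)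
  qed

  \<comment> \<open>The kernel of \<open>\<epsilon>\<close> and its largest quotient
    \<open>F\<close> over \<open>B\<close>\<close>
  let ?I = "a_kernel C0 S0 \<epsilon>"
  let ?X = "restrict_to C0 ?I"
  have I: "rsubmodule A ?I C0" by (rule rsubmodule_a_kernel[OF RC RS \<epsilon>'])
  note cI = rsubmodule_carrier[OF I]
  have fgX: "fg_right_module A ?X" by (rule A.fg_submodule[OF C0 I])
  note RX = right_module_fg[OF fgX]
  interpret X: right_module A ?X by (rule RX)
  note incX = rhom_inclusion[OF I]
  obtain F g where F: "F \<in> fgmod A" and g: "g \<in> epi_rhom A ?X F" and kg: "a_kernel ?X F g = trace_e ?X"
    and vF: "from_B F"
    by (rule ex_top[OF fgX])
  note RF = right_module_fg[OF fgmodD[OF F]] and g' = epi_rhom_rhom[OF g]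
  interpret F: right_module A F by (rule RF)
  have g0: "y \<in> trace_e ?X" if "y \<in> ?I" "g y = \<zero>\<^bsub>F\<^esub>" for y
    using that unfolding kg[symmetric] by (simp add: in_a_kernel)
  have CF: "C_mod (res F)" by (rule top_C_mod[OF RX V1 P1 X1 RF vF g kg])
  have rF: "res F \<in> fgmod B" by (rule fgmod_res[OF F vF])
  note RrF = right_module_fg[OF fgmodD[OF rF]]

  obtain Q \<beta> where Q: "Q \<in> fgproj B" and \<beta>B: "\<beta> \<in> epi_rhom B Q (res F)"
    by (rule B.ex_fgproj_epi[OF fgmodD[OF rF]])
  note RQ = right_module_fg[OF fgprojD(1)[OF Q]]
  let ?Q = "infl Q"
  note iQ = fgproj_infl[OF Q]
  note fgiQ = fgprojD(1)[OF iQ]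
  note RiQ = right_module_fg[OF fgiQ] and viQ = from_B_infl[OF RQ]
  interpret Q: right_module A ?Q by (rule RiQ)
  have \<beta>: "\<beta> \<in> epi_rhom A ?Q F"
    using \<beta>B rhom_from_infl[OF RF vF RQ] by (auto simp: epi_rhom_def)
  note \<beta>' = epi_rhom_rhom[OF \<beta>]
  \<comment> \<open>Lifting \<open>\<beta>\<close> to the kernel of \<open>\<epsilon>\<close> lets
    \<open>\<Theta>\<close> factor as \<open>g \<circ> w\<close>; then \<open>w\<close> sends the
    kernel of \<open>\<Theta>\<close> into the trace.\<close>
  from A.projective_lift[OF fgprojD(2)[OF iQ] RiQ fgX g \<beta>' RF] obtain b
    where b: "b \<in> rhom A ?Q ?X" and gb: "\<And>q. q \<in> carrier Q \<Longrightarrow> g (b q) = \<beta> q" by auto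
  have bC: "b \<in> rhom A ?Q C0" by (rule rhom_comp[OF b incX])
  let ?M = "infl M"
  note RM = right_module_infl[OF M.is_right_module] and vM = from_B_infl[OF M.is_right_module]
  let ?\<iota> = "\<lambda>m. (\<zero>\<^bsub>K\<^esub>, m, \<zero>\<^bsub>B\<^esub>)"
  define \<psi> where "\<psi> = (\<lambda>m. \<kappa> (?\<iota> m))"
  have \<psi>C: "\<psi> \<in> rhom A ?M C0" unfolding \<psi>_def by (rule rhom_comp[OF rhom_infl_P0 \<kappa>])
  have \<psi>: "\<psi> \<in> rhom A ?M ?X"
  proof (rule rhom_corestrict[OF \<psi>C])
    fix m assume "m \<in> carrier ?M"
    then show "\<psi> m \<in> ?I"
      using rhom_closed[OF \<psi>C] \<epsilon>\<kappa>[of "?\<iota> m"] tJ[of "?\<iota> m"] by (simp add: in_a_kernel \<psi>_def)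
  qed
  let ?E = "rdsum ?M ?Q"
  define w where "w = (\<lambda>p. \<psi> (fst p) \<oplus>\<^bsub>?X\<^esub> b (snd p))"
  have w: "w \<in> rhom A ?E ?X" unfolding w_def by (rule rhom_copair[OF RX \<psi> b])
  define \<Theta> where "\<Theta> = (\<lambda>p. g (w p))"
  have \<Theta>: "\<Theta> \<in> epi_rhom A ?E F"
    unfolding \<Theta>_def
  proof (rule epi_rhomI[OF rhom_comp[OF w g']])
    fix y assume "y \<in> carrier F"
    with \<beta> obtain q where q: "q \<in> carrier ?Q" "\<beta> q = y" by (rule epi_rhomE)
    have "b q \<in> carrier C0" using rhom_closed[OF bC q(1)] .
    then have "g (w (\<zero>\<^bsub>M\<^esub>, q)) = y"
      using q gb[of q] rhom_zero[OF RM RX \<psi>] by (simp add: w_def)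
    then show "\<exists>p\<in>carrier ?E. g (w p) = y" using q(1) by (intro bexI[of _ "(\<zero>\<^bsub>M\<^esub>, q)"]) auto
  qed
  note \<Theta>' = epi_rhom_rhom[OF \<Theta>]
  let ?G = "a_kernel ?E F \<Theta>"
  have RE: "right_module A ?E" by (rule right_module_rdsum[OF RM RiQ])
  have vE: "from_B ?E" by (rule from_B_rdsum[OF vM viQ])
  have G: "rsubmodule A ?G ?E" by (rule rsubmodule_a_kernel[OF RE RF \<Theta>'])
  note cG = rsubmodule_carrier[OF G]

  \<comment> \<open>A section of \<open>\<pi>\<close> over the trace\<close>
  obtain i r where i: "i \<in> rhom A ?X (rdsum V1 P1)" and r: "r \<in> rhom A (rdsum V1 P1) ?X"
    and ri: "\<And>y. y \<in> ?I \<Longrightarrow> r (i y) = y"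
    using X1 by (rule rretractE) auto
  from A.projective_lift[OF P1(2) RP1 fgP \<pi> rhom_comp[OF rhom_comp[OF rhom_inr[OF V1(1)] r] incX] RC]
  obtain \<rho> where \<rho>: "\<rho> \<in> rhom A P1 P" "\<And>y. y \<in> carrier P1 \<Longrightarrow> \<pi> (\<rho> y) = r (\<zero>\<^bsub>V1\<^esub>, y)" by blast
  \<comment> \<open>Retracting through \<open>V1 \<oplus> P1\<close> and lifting only the
    \<open>P1\<close>-component to \<open>P\<close>. On the trace nothing is lost, since the
    \<open>V1\<close>-component vanishes there.\<close>
  define \<sigma> where "\<sigma> = (\<lambda>y. \<rho> (snd (i y)))"
  have \<sigma>: "\<sigma> \<in> rhom A ?X P" unfolding \<sigma>_def by (rule rhom_comp[OF rhom_comp[OF i rhom_snd] \<rho>(1)])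
  have \<pi>\<sigma>: "\<pi> (\<sigma> y) = y" if y: "y \<in> trace_e ?X" for y
  proof -
    have yI: "y \<in> ?I" using rsubmodule_subset[OF rsubmodule_trace_e[OF RX]] y by auto
    have "fst (i y) = \<zero>\<^bsub>V1\<^esub>"
      by (rule from_B_zero_on_trace_e[OF RX V1(1,2) rhom_comp[OF i rhom_fst] y])
    then have "i y = (\<zero>\<^bsub>V1\<^esub>, snd (i y))" by (metis prod.collapse)
    moreover have "snd (i y) \<in> carrier P1" using rhom_closed[OF i, of y] yI by auto
    ultimately show ?thesis using \<rho>(2) ri[OF yI] by (metis \<sigma>_def)
  qed

  \<comment> \<open>Comparison of \<open>P\<close> with \<open>P0 \<oplus> Q\<close>\<close>
  from A.projective_lift[OF fgprojD(2)[OF iQ] RiQ fgP \<pi> bC RC] obtain l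
    where l: "l \<in> rhom A ?Q P" and \<pi>l: "\<And>q. q \<in> carrier Q \<Longrightarrow> \<pi> (l q) = b q" by auto
  from A.projective_lift[OF fgprojD(2)[OF P] RP fg_P0 t rhom_comp[OF \<pi>' \<epsilon>'] RS] obtain \<tau>
    where \<tau>: "\<tau> \<in> rhom A P P0" and t\<tau>: "\<And>p. p \<in> carrier P \<Longrightarrow> t (\<tau> p) = \<epsilon> (\<pi> p)" by blast
  \<comment> \<open>Both \<open>\<pi>\<close> and \<open>\<kappa> \<circ> \<tau>\<close> lie over
    the same map to \<open>S0\<close>, so their difference lands in the kernel of
    \<open>\<epsilon>\<close>; its image in \<open>F\<close> is then lifted to \<open>Q\<close> by
    \<open>s\<close>.\<close>
  define \<nu> where "\<nu> = (\<lambda>p. \<pi> p \<ominus>\<^bsub>C0\<^esub> \<kappa> (\<tau> p))"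
  have \<nu>C: "\<nu> \<in> rhom A P C0"
    unfolding \<nu>_def by (rule rhom_diff[OF RC \<pi>' rhom_comp[OF \<tau> \<kappa>]])
  have \<nu>: "\<nu> \<in> rhom A P ?X"
  proof (rule rhom_corestrict[OF \<nu>C])
    fix p assume p: "p \<in> carrier P"
    have "\<pi> p \<in> carrier C0" "\<kappa> (\<tau> p) \<in> carrier C0"
      using p by (auto intro: rhom_closed[OF \<pi>'] rhom_closed[OF rhom_comp[OF \<tau> \<kappa>]])
    then show "\<nu> p \<in> ?I"
      using rhom_closed[OF \<nu>C p] p t\<tau> \<epsilon>\<kappa>[OF rhom_closed[OF \<tau> p]] rhom_closed[OF \<epsilon>']
      by (simp add: in_a_kernel \<nu>_def rhom_minus[OF RC RS \<epsilon>'] S0.minus_self)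
  qed
  from A.projective_lift[OF fgprojD(2)[OF P] RP fgiQ \<beta> rhom_comp[OF \<nu> g'] RF] obtain s
    where s: "s \<in> rhom A P ?Q" and \<beta>s: "\<And>p. p \<in> carrier P \<Longrightarrow> \<beta> (s p) = g (\<nu> p)" by blast

  \<comment> \<open>The lift \<open>\<mu>\<close> of \<open>M\<close> to \<open>P\<close>, and the
    vanishing of \<open>\<tau>\<close> and \<open>s\<close>\<close>
  obtain y where y: "y \<in> carrier P" "\<pi> y = c" using \<pi> c by (rule epi_rhomE)
  define p where "p = y \<triangleleft>\<^bsub>P\<^esub> e"
  have p: "p \<in> carrier P" unfolding p_def by (rule P.ract_closed[OF y(1) e_closed])
  have pe: "p \<triangleleft>\<^bsub>P\<^esub> e = p"
    using P.ract_mult[OF y(1) e_closed e_closed] unfolding e_idem p_def by simp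
  have \<pi>p: "\<pi> p = c" using rhom_ract[OF \<pi>' y(1) e_closed] y(2) ce by (simp add: p_def)
  have e_part: "\<exists>a. \<tau> z = (a, \<zero>\<^bsub>M\<^esub>, \<zero>\<^bsub>B\<^esub>) \<and> a \<in> carrier K" if z: "z \<in> carrier P" "z \<triangleleft>\<^bsub>P\<^esub> e = z" for z
  proof -
    obtain a m where a: "\<tau> z = (a, m, \<zero>\<^bsub>B\<^esub>)" "a \<in> carrier K" "m \<in> carrier M"
      using rhom_closed[OF \<tau> z(1)] by (cases "\<tau> z") auto
    have "\<tau> z = \<tau> z \<otimes>\<^bsub>A\<^esub> e" using rhom_ract[OF \<tau> z(1) e_closed] z(2) by simp
    then have "m = \<zero>\<^bsub>M\<^esub>" using a by (simp add: sc_simps)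
    with a show ?thesis by blast
  qed
  \<comment> \<open>As \<open>p e = p\<close>, the element \<open>\<tau> p\<close> lies in
    \<open>K e\<close>; as it has the same image in \<open>S0\<close> as \<open>e\<close>, it
    differs from \<open>e\<close> by an element of \<open>J\<close>. Since \<open>K e\<close> meets
    \<open>J\<close> only in zero, it equals \<open>e\<close>.\<close>
  have \<tau>p: "\<tau> p = e"
  proof -
    obtain a where a: "\<tau> p = (a, \<zero>\<^bsub>M\<^esub>, \<zero>\<^bsub>B\<^esub>)" "a \<in> carrier K" using e_part[OF p pe] by blast
    have tp: "\<tau> p \<in> carrier P0" by (rule rhom_closed[OF \<tau> p])
    have "t (\<tau> p \<ominus>\<^bsub>P0\<^esub> e) = \<zero>\<^bsub>S0\<^esub>"
      using t\<tau>[OF p] \<pi>p \<epsilon>c rhom_minus[OF right_module_P0 RS t' tp eP0]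
        S0.minus_self[OF rhom_closed[OF t' eP0]] by simp
    moreover have "\<tau> p \<ominus>\<^bsub>P0\<^esub> e \<in> carrier P0" using tp eP0 by (intro P0.AbGr.minus_closed)
    ultimately have J: "\<tau> p \<ominus>\<^bsub>P0\<^esub> e \<in> J" by (intro t0)
    then obtain m where m: "\<tau> p \<ominus>\<^bsub>P0\<^esub> e = (\<zero>\<^bsub>K\<^esub>, m, \<zero>\<^bsub>B\<^esub>)" "m \<in> carrier M" by auto
    have "(\<tau> p \<ominus>\<^bsub>P0\<^esub> e) \<oplus>\<^bsub>P0\<^esub> e = \<tau> p" by (rule P0.minus_add_cancel[OF tp eP0])
    then show ?thesis using m a by simp
  qed
  define \<mu> where "\<mu> = (\<lambda>m. p \<triangleleft>\<^bsub>P\<^esub> ?\<iota> m)"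
  have \<mu>: "\<mu> \<in> rhom A ?M P"
    unfolding \<mu>_def by (rule rhom_comp[OF rhom_infl_P0 rhom_from_P0[OF RP p]])
  have \<iota>A: "?\<iota> m \<in> carrier A" if "m \<in> carrier M" for m using that by simp
  have \<pi>\<mu>: "\<pi> (\<mu> m) = \<psi> m" if "m \<in> carrier M" for m
    using rhom_ract[OF \<pi>' p \<iota>A[OF that]] \<pi>p by (simp add: \<mu>_def \<psi>_def \<kappa>_def)
  have \<tau>\<mu>: "\<tau> (\<mu> m) = ?\<iota> m" if "m \<in> carrier M" for m
    using rhom_ract[OF \<tau> p \<iota>A[OF that]] \<tau>p that by (simp add: \<mu>_def sc_simps)
  \<comment> \<open>On the inflated module \<open>Q\<close> an element \<open>(0, m, 0)\<close> acts
    as zero.\<close>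
  have s\<mu>: "s (\<mu> m) = \<zero>\<^bsub>Q\<^esub>" if "m \<in> carrier M" for m
    using rhom_ract[OF s p \<iota>A[OF that]] right_module.ract_zero[OF RQ] rhom_closed[OF s p]
    by (simp add: \<mu>_def)
  \<comment> \<open>On the generators \<open>u e\<close> of the trace the value lies in
    \<open>K e\<close>, and also in \<open>J\<close> because \<open>\<pi> \<sigma>\<close> is the
    identity there and \<open>\<epsilon>\<close> vanishes.\<close>
  have \<tau>\<sigma>: "\<tau> (\<sigma> v) = \<zero>\<^bsub>P0\<^esub>" if v: "v \<in> trace_e ?X" for v
  proof (rule zero_on_trace_e[OF RX right_module_P0 rhom_comp[OF \<sigma> \<tau>] _ v])
    fix u assume u: "u \<in> carrier ?X"
    let ?z = "u \<triangleleft>\<^bsub>?X\<^esub> e"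
    have z: "?z \<in> trace_e ?X" by (rule e_in_trace_e[OF u])
    have zX: "?z \<in> carrier ?X" by (rule X.ract_closed[OF u e_closed])
    have "\<sigma> ?z = \<sigma> u \<triangleleft>\<^bsub>P\<^esub> e" by (rule rhom_ract[OF \<sigma> u e_closed])
    then have "\<sigma> ?z \<triangleleft>\<^bsub>P\<^esub> e = \<sigma> ?z"
      using P.ract_mult[OF rhom_closed[OF \<sigma> u] e_closed e_closed] unfolding e_idem by simp
    then obtain a where a: "\<tau> (\<sigma> ?z) = (a, \<zero>\<^bsub>M\<^esub>, \<zero>\<^bsub>B\<^esub>)"
      using e_part[OF rhom_closed[OF \<sigma> zX]] by blast
    have "t (\<tau> (\<sigma> ?z)) = \<zero>\<^bsub>S0\<^esub>"
      using t\<tau>[OF rhom_closed[OF \<sigma> zX]] \<pi>\<sigma>[OF z] zX by (simp add: in_a_kernel)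
    then have "\<tau> (\<sigma> ?z) \<in> J" by (intro t0 rhom_closed[OF rhom_comp[OF \<sigma> \<tau>] zX])
    with a show "\<tau> (\<sigma> ?z) = \<zero>\<^bsub>P0\<^esub>" by simp
  qed
  have s\<sigma>: "s (\<sigma> v) = \<zero>\<^bsub>Q\<^esub>" if "v \<in> trace_e ?X" for v
    using from_B_zero_on_trace_e[OF RX RiQ viQ rhom_comp[OF \<sigma> s] that] by simp

  \<comment> \<open>The kernel of \<open>\<Theta>\<close> as a retract of the kernel of
    \<open>\<pi>\<close> plus \<open>Q\<close>\<close>
  let ?K = "restrict_to P (a_kernel P C0 \<pi>)"
  have kK: "rsubmodule A (a_kernel P C0 \<pi>) P" by (rule rsubmodule_a_kernel[OF RP RC \<pi>'])
  \<comment> \<open>For \<open>u = (m, q)\<close> in the kernel of \<open>\<Theta>\<close> the image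
    under \<open>\<pi>\<close> is \<open>\<psi> m - w u + b q\<close>, which is zero because
    \<open>w u = \<psi> m + b q\<close>. The correction \<open>\<sigma> (w u)\<close> is allowed
    since \<open>w u\<close> lies in the trace.\<close>
  let ?f = "\<lambda>u. (\<mu> (fst u) \<ominus>\<^bsub>P\<^esub> \<sigma> (w u)) \<oplus>\<^bsub>P\<^esub> l (snd u)"
  have f1: "(\<lambda>u. \<mu> (fst u) \<ominus>\<^bsub>P\<^esub> \<sigma> (w u)) \<in> rhom A ?E P"
    by (rule rhom_diff[OF RP rhom_comp[OF rhom_fst \<mu>] rhom_comp[OF w \<sigma>]])
  have f: "?f \<in> rhom A ?E P" by (rule rhom_plus[OF RP f1 rhom_comp[OF rhom_snd l]])
  have Gw: "w u \<in> trace_e ?X" if "u \<in> ?G" for u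
    using that rhom_closed[OF w cG[OF that]] by (intro g0) (auto simp: in_a_kernel \<Theta>_def)
  have fK: "?f u \<in> a_kernel P C0 \<pi>" if u: "u \<in> ?G" for u
  proof -
    obtain m q where mq: "u = (m, q)" "m \<in> carrier M" "q \<in> carrier Q" using cG[OF u] by auto
    have cl: "\<psi> m \<in> carrier C0" "b q \<in> carrier C0" "\<mu> m \<in> carrier P" "\<sigma> (w u) \<in> carrier P" "l q \<in> carrier P"
      using mq rhom_closed[OF \<psi>C] rhom_closed[OF bC] rhom_closed[OF \<mu>] rhom_closed[OF l]
        rhom_closed[OF rhom_comp[OF w \<sigma>] cG[OF u]] by auto
    have wu: "w u = \<psi> m \<oplus>\<^bsub>C0\<^esub> b q" by (simp add: w_def mq)
    have "(\<psi> m \<ominus>\<^bsub>C0\<^esub> w u) \<oplus>\<^bsub>C0\<^esub> b q = \<zero>\<^bsub>C0\<^esub>"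
      using cl unfolding wu
      by (simp add: a_minus_def C0.AbGr.minus_add C0.AbGr.a_assoc[symmetric] C0.AbGr.r_neg C0.AbGr.l_neg)
    moreover have "\<pi> (?f u) = (\<psi> m \<ominus>\<^bsub>C0\<^esub> w u) \<oplus>\<^bsub>C0\<^esub> b q"
      using mq cl \<pi>\<mu> \<pi>l \<pi>\<sigma>[OF Gw[OF u]]
      by (simp add: rhom_add[OF \<pi>'] rhom_minus[OF RP RC \<pi>'])
    ultimately show ?thesis using rhom_closed[OF f cG[OF u]] by (simp only: in_a_kernel)
  qed
  let ?GE = "restrict_to ?E ?G"
  have forward: "(\<lambda>u. (?f u, snd u)) \<in> rhom A ?GE (rdsum ?K ?Q)"
    by (rule rhom_pair[OF rhom_corestrict[OF rhom_restrict[OF f rsubmodule_subset[OF G]]]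
          rhom_restrict[OF rhom_snd rsubmodule_subset[OF G]]])
      (simp add: fK)
  \<comment> \<open>Applied to \<open>(f u, q)\<close> this recovers
    \<open>\<mu> m - \<sigma> (w u)\<close>, from which \<open>\<tau>\<close> reads off
    \<open>m\<close> and which \<open>s\<close> kills.\<close>
  let ?d = "\<lambda>v. fst v \<ominus>\<^bsub>P\<^esub> l (snd v)"
  have d: "?d \<in> rhom A (rdsum ?K ?Q) P"
    by (rule rhom_diff[OF RP rhom_comp[OF rhom_fst rhom_inclusion[OF kK]] rhom_comp[OF rhom_snd l]])
  have \<pi>d: "\<pi> (?d v) = \<ominus>\<^bsub>C0\<^esub> b (snd v)" if v: "v \<in> carrier (rdsum ?K ?Q)" for v
  proof -
    have "fst v \<in> carrier P" "\<pi> (fst v) = \<zero>\<^bsub>C0\<^esub>" "snd v \<in> carrier Q" using v by (auto simp: in_a_kernel)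
    moreover from this have "l (snd v) \<in> carrier P" "b (snd v) \<in> carrier C0"
      using rhom_closed[OF l, of "snd v"] rhom_closed[OF bC, of "snd v"] by auto
    ultimately have "\<pi> (?d v) = \<zero>\<^bsub>C0\<^esub> \<ominus>\<^bsub>C0\<^esub> b (snd v)" "b (snd v) \<in> carrier C0"
      using \<pi>l by (simp_all add: rhom_minus[OF RP RC \<pi>'])
    then show ?thesis by (simp add: a_minus_def)
  qed
  have dJ: "\<tau> (?d v) \<in> J" if v: "v \<in> carrier (rdsum ?K ?Q)" for v
  proof (rule t0[OF rhom_closed[OF rhom_comp[OF d \<tau>] v]])
    have "b (snd v) \<in> ?I" using v rhom_closed[OF b, of "snd v"] by auto
    then have "b (snd v) \<in> carrier C0" "\<epsilon> (b (snd v)) = \<zero>\<^bsub>S0\<^esub>" by (auto simp: in_a_kernel)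
    then show "t (\<tau> (?d v)) = \<zero>\<^bsub>S0\<^esub>"
      using t\<tau>[OF rhom_closed[OF d v]] \<pi>d[OF v] by (simp add: rhom_neg[OF RC RS \<epsilon>'])
  qed
  let ?n = "\<lambda>v. fst (snd (\<tau> (?d v)))"
  have n: "?n \<in> rhom A (rdsum ?K ?Q) ?M"
    by (rule rhom_comp[OF rhom_corestrict[OF rhom_comp[OF d \<tau>]] rhom_J_infl]) (rule dJ)
  \<comment> \<open>The summand \<open>s (d v)\<close> forces the value into the kernel of
    \<open>\<Theta>\<close>: in \<open>F\<close> it contributes \<open>g (\<nu> (d v))\<close>, and
    \<open>\<nu> (d v)\<close> is the negative of \<open>b q + \<psi> n\<close>, where
    \<open>q = snd v\<close> and \<open>n\<close> is the \<open>M\<close>-entry of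
    \<open>\<tau> (d v)\<close>.\<close>
  let ?h = "\<lambda>v. (?n v, snd v \<oplus>\<^bsub>?Q\<^esub> s (?d v))"
  have h: "?h \<in> rhom A (rdsum ?K ?Q) ?E"
    by (rule rhom_pair[OF n rhom_plus[OF RiQ rhom_snd rhom_comp[OF d s]]])
  have backward: "?h \<in> rhom A (rdsum ?K ?Q) ?GE"
  proof (rule rhom_corestrict[OF h])
    fix v assume v: "v \<in> carrier (rdsum ?K ?Q)"
    have q: "snd v \<in> carrier Q" using v by auto
    have dv: "?d v \<in> carrier P" by (rule rhom_closed[OF d v])
    have sd: "s (?d v) \<in> carrier Q" using rhom_closed[OF s dv] by simp
    let ?u = "\<psi> (?n v)" and ?x = "b (snd v)"
    have "\<tau> (?d v) = ?\<iota> (?n v)" using dJ[OF v] by auto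
    then have u: "\<kappa> (\<tau> (?d v)) = ?u" by (simp add: \<psi>_def)
    have cl: "?u \<in> ?I" "?x \<in> ?I" "b (s (?d v)) \<in> ?I"
      using rhom_closed[OF \<psi>, of "?n v"] rhom_closed[OF n v] rhom_closed[OF b, of "snd v"]
        rhom_closed[OF b, of "s (?d v)"] q sd by simp_all
    note clC = cl[THEN cI]
    have \<nu>d: "\<nu> (?d v) = (\<ominus>\<^bsub>C0\<^esub> ?x) \<ominus>\<^bsub>C0\<^esub> ?u" by (simp add: \<nu>_def \<pi>d[OF v] u)
    have \<nu>I: "\<nu> (?d v) \<in> ?I" using rhom_closed[OF \<nu> dv] by simp
    have "\<Theta> (?h v) = g ?u \<oplus>\<^bsub>F\<^esub> (g ?x \<oplus>\<^bsub>F\<^esub> g (b (s (?d v))))"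
      using cl q sd X.AbGr.a_closed[of ?x "b (s (?d v))"]
      by (simp add: \<Theta>_def w_def rhom_add[OF b, simplified] rhom_add[OF g', simplified])
    also have "g (b (s (?d v))) = g (\<nu> (?d v))" using gb[OF sd] \<beta>s[OF dv] by simp
    also have "g ?u \<oplus>\<^bsub>F\<^esub> (g ?x \<oplus>\<^bsub>F\<^esub> g (\<nu> (?d v))) = g (?u \<oplus>\<^bsub>C0\<^esub> (?x \<oplus>\<^bsub>C0\<^esub> \<nu> (?d v)))"
      using cl \<nu>I X.AbGr.a_closed[of ?x "\<nu> (?d v)"] by (simp add: rhom_add[OF g', simplified])
    also have "?u \<oplus>\<^bsub>C0\<^esub> (?x \<oplus>\<^bsub>C0\<^esub> \<nu> (?d v)) = \<zero>\<^bsub>C0\<^esub>"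
      using clC unfolding \<nu>d
      by (simp add: a_minus_def C0.AbGr.a_assoc[symmetric] C0.AbGr.r_neg)
    also have "g \<zero>\<^bsub>C0\<^esub> = \<zero>\<^bsub>F\<^esub>" using rhom_zero[OF RX RF g'] by simp
    finally show "?h v \<in> ?G" using rhom_closed[OF h v] by (simp only: in_a_kernel)
  qed
  have "rretract A ?GE (rdsum ?K ?Q)"
  proof (rule rretractI[OF forward backward])
    fix u assume "u \<in> carrier ?GE"
    then have u: "u \<in> ?G" by simp
    obtain m q where mq: "u = (m, q)" "m \<in> carrier M" "q \<in> carrier Q" using cG[OF u] by auto
    have cl: "\<mu> m \<in> carrier P" "\<sigma> (w u) \<in> carrier P" "l q \<in> carrier P"
      using mq rhom_closed[OF \<mu>] rhom_closed[OF l] rhom_closed[OF rhom_comp[OF w \<sigma>] cG[OF u]] by auto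
    have e1: "?d (?f u, snd u) = \<mu> m \<ominus>\<^bsub>P\<^esub> \<sigma> (w u)"
      using cl mq by (simp add: P.add_minus_cancel)
    have "\<tau> (\<mu> m \<ominus>\<^bsub>P\<^esub> \<sigma> (w u)) = ?\<iota> m"
      using cl mq \<tau>\<mu> \<tau>\<sigma>[OF Gw[OF u]] rhom_minus[OF RP right_module_P0 \<tau>]
        P0.minus_zero[of "?\<iota> m"] by simp
    moreover have "s (\<mu> m \<ominus>\<^bsub>P\<^esub> \<sigma> (w u)) = \<zero>\<^bsub>Q\<^esub>"
      using cl mq s\<mu> s\<sigma>[OF Gw[OF u]] rhom_minus[OF RP RiQ s] Q.minus_zero[of "\<zero>\<^bsub>Q\<^esub>"] Q.AbGr.zero_closed
      by simp
    ultimately show "?h (?f u, snd u) = u"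
      unfolding e1 using mq Q.AbGr.r_zero[of q] by simp
  qed
  from rretract_trans[OF this rretract_trans[OF rretract_rdsum_cong[OF K rretract_refl] rretract_rdsum_assoc]]
  have ret: "rretract A ?GE (rdsum V2 (rdsum P2 ?Q))" .

  \<comment> \<open>Return to modules over \<open>B\<close>\<close>
  have RGE: "right_module A ?GE" by (rule right_module_restrict_to[OF RE G])
  have vGE: "from_B ?GE" by (rule from_B_restrict_to[OF vE rsubmodule_subset[OF G]])
  have "C_mod (res ?GE)"
    by (rule from_B_C_mod[OF RGE vGE V2 fg_right_module_rdsum[OF P2(1) fgiQ]
          projective_rdsum[OF P2(2) right_module_fg[OF P2(1)] fgprojD(2)[OF iQ] RiQ] ret])
  moreover have resE: "res ?E = rdsum M Q" by (simp add: res_rdsum)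
  ultimately have CG: "C_mod (restrict_to (rdsum M Q) ?G)" by (simp add: res_restrict_to)
  have fgE: "fg_right_module B (rdsum M Q)"
    by (rule fg_right_module_rdsum[OF M.fg_right_module_axioms fgprojD(1)[OF Q]])
  have \<Theta>B: "\<Theta> \<in> epi_rhom B (rdsum M Q) (res F)" using epi_rhom_res[OF \<Theta>] resE by simp
  have GB: "rsubmodule B ?G (rdsum M Q)" using rsubmodule_res[OF RE vE G] resE by simp
  have fgG: "fg_right_module B (restrict_to (rdsum M Q) ?G)" by (rule B.fg_submodule[OF fgE GB])
  \<comment> \<open>The kernel lives on a type of pairs, while the ends of the extension must belong
    to \<open>fgmod\<close>.\<close>
  obtain U f' g2 where U: "U \<in> fgmod B" "f' \<in> rhom B (restrict_to (rdsum M Q) ?G) U"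
    "g2 \<in> rhom B U (restrict_to (rdsum M Q) ?G)"
    and gf: "\<And>x. x \<in> carrier (restrict_to (rdsum M Q) ?G) \<Longrightarrow> g2 (f' x) = x"
    and fg: "\<And>y. y \<in> carrier U \<Longrightarrow> f' (g2 y) = y"
    by (rule B.ex_fgmod_copy[OF fgG]) blast
  have "C_mod U" by (rule C_mod_rretract[OF CG rretractI[OF U(3,2) fg]])
  then have "U \<in> C_class B M" using U(1) by (simp add: C_class_eq)
  moreover have "res F \<in> C_class B M" using rF CF by (simp add: C_class_eq)
  moreover have "g2 \<in> mono_rhom B U (rdsum M Q)"
    using rhom_comp[OF U(3) rhom_inclusion[OF GB]] inj_on_inverseI[OF fg] by (simp add: mono_rhom_def)
  moreover have "g2 ` carrier U = a_kernel (rdsum M Q) (res F) \<Theta>"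
  proof -
    have "g2 ` carrier U = ?G"
    proof (intro equalityI subsetI)
      show "v \<in> ?G" if "v \<in> g2 ` carrier U" for v using that rhom_closed[OF U(3)] by auto
      show "v \<in> g2 ` carrier U" if "v \<in> ?G" for v
        using that gf[of v] rhom_closed[OF U(2), of v] by (intro image_eqI[of _ _ "f' v"]) auto
    qed
    then show ?thesis by (simp add: a_kernel_def')
  qed
  ultimately have "rdsum M Q \<in> extension_class B (C_class B M) (C_class B M)"
    using fgE \<Theta>B unfolding extension_class_def by blast
  then show ?thesis using Q by blast
qed

text \<open>The zeroth syzygy is only an isomorphic copy, hence \<open>Y'\<close> in place of
  \<open>Y\<close>.\<close>

lemma is_nth_syzygy_2E:
  assumes "is_nth_syzygy A 2 Y V"
  obtains Y' W where "Y' \<in> fgmod A" and "is_syzygy A Y' W" and "is_syzygy A W V"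
  using assms unfolding numeral_2_eq_2 by auto

lemma nth_syzygy_2_C_mod:
  assumes "is_nth_syzygy A 2 Y V"
  shows "from_B V" and "C_mod (res V)" and "V \<in> fgmod A"
proof -
  obtain Y' W where "Y' \<in> fgmod A" "is_syzygy A Y' W" "is_syzygy A W V"
    using assms by (rule is_nth_syzygy_2E)
  from second_syzygy_C_mod[OF fgmodD[OF this(1)] this(2,3)]
  show "from_B V" "C_mod (res V)" "V \<in> fgmod A" .
qed

text \<open>The level is attained at 0 or at 1. At 1 the syzygy of \<open>X\<close> is a stable
  retract of a second syzygy. At 0 the module \<open>X\<close> itself is one of a first syzygy, and
  taking syzygies once more leads to the same conclusion.\<close>

lemma dell_1_le_1:
  assumes X: "X \<in> fgmod A" and "dell A 1 X \<le> enat 1"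
  obtains P p V Q where "P \<in> fgproj A" and "p \<in> epi_rhom A P X" and "V \<in> fgmod A" and "from_B V"
    and "C_mod (res V)" and "Q \<in> fgproj A"
    and "rretract A (restrict_to P (a_kernel P X p)) (rdsum V Q)"
proof -
  note RX = right_module_fg[OF fgmodD[OF X]]
  from assms(2) obtain n Y U V where n: "n \<le> 1" and Y: "Y \<in> fgmod A" and U: "is_nth_syzygy A n X U"
    and V: "is_nth_syzygy A (n + 1) Y V" and UV: "stable_retract A U V"
    unfolding dell_le_iff by blast
  from n consider "n = 0" | "n = 1" by linarith
  then show thesis
  proof cases
    case 1
    then have U': "U \<in> fgmod A" "riso A X U" using U by simp_all
    obtain W where W: "W \<in> fgmod A" "riso A Y W" "is_syzygy A W V" using V 1 by auto
    then have V': "V \<in> fgmod A" by (simp add: is_syzygy_def)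
    note RU = right_module_fg[OF fgmodD[OF U'(1)]] and RV = right_module_fg[OF fgmodD[OF V']]
    obtain Q where Q: "Q \<in> fgproj A" "rretract A U (rdsum V Q)"
      using UV A.stable_retract_iff[OF RU RV] by blast
    obtain V2 where V2: "is_syzygy A V V2" using A.ex_is_syzygy[OF fgmodD[OF V']] by blast
    obtain P p where P: "P \<in> fgproj A" "p \<in> epi_rhom A P X" by (rule A.ex_fgproj_epi[OF fgmodD[OF X]])
    have "rretract A X (rdsum V Q)" by (rule rretract_trans[OF riso_rretract(1)[OF RX RU U'(2)] Q(2)])
    from A.rretract_kernel_syzygy[OF RX RV fgprojD[OF P(1)] fgprojD[OF Q(1)] P(2) this V2]
      second_syzygy_C_mod[OF fgmodD[OF W(1)] W(3) V2]
    show thesis using that P by blast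
  next
    case 2
    then obtain W where W: "W \<in> fgmod A" "riso A X W" "is_syzygy A W U" using U by auto
    note RW = right_module_fg[OF fgmodD[OF W(1)]]
    obtain P p where P: "P \<in> fgproj A" "p \<in> epi_rhom A P W" "riso A (restrict_to P (a_kernel P W p)) U"
      "U \<in> fgmod A"
      using W(3) by (rule is_syzygyE)
    note RP = right_module_fg[OF fgprojD(1)[OF P(1)]] and RU = right_module_fg[OF fgmodD[OF P(4)]]
    have V2: "is_nth_syzygy A 2 Y V" using V 2 by (simp add: numeral_2_eq_2)
    note V' = nth_syzygy_2_C_mod[OF V2]
    obtain Q where Q: "Q \<in> fgproj A" "rretract A U (rdsum V Q)"
      using UV A.stable_retract_iff[OF RU right_module_fg[OF fgmodD[OF V'(3)]]] by blast
    obtain f g where f: "f \<in> rhom A X W" and g: "g \<in> rhom A W X"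
      and gf: "\<And>x. x \<in> carrier X \<Longrightarrow> g (f x) = x" and fg: "\<And>y. y \<in> carrier W \<Longrightarrow> f (g y) = y"
      by (rule riso_inverse[OF RX RW W(2)]) blast
    have "g \<in> epi_rhom A W X"
      using gf rhom_closed[OF f] by (intro epi_rhomI[OF g]) blast
    \<comment> \<open>The presentation of the copy \<open>W\<close> is carried over to
      \<open>X\<close>; the isomorphism leaves the kernel unchanged.\<close>
    from epi_rhom_comp[OF P(2) this] have gp: "(\<lambda>x. g (p x)) \<in> epi_rhom A P X" .
    have g0: "g y = \<zero>\<^bsub>X\<^esub> \<longleftrightarrow> y = \<zero>\<^bsub>W\<^esub>" if "y \<in> carrier W" for y
      using fg[OF that] rhom_zero[OF RW RX g] rhom_zero[OF RX RW f] by auto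
    have "a_kernel P X (\<lambda>x. g (p x)) = a_kernel P W p"
      using g0 rhom_closed[OF epi_rhom_rhom[OF P(2)]]
      unfolding a_kernel_def' by (intro Collect_cong conj_cong) auto
    then have "rretract A (restrict_to P (a_kernel P X (\<lambda>x. g (p x)))) U"
      using riso_rretract(1)[OF right_module_restrict_to[OF RP rsubmodule_a_kernel[OF RP RW
            epi_rhom_rhom[OF P(2)]]] RU P(3)] by simp
    from that[OF P(1) gp V'(3,1,2) Q(1) rretract_trans[OF this Q(2)]] show thesis .
  qed
qed

text \<open>With bound 0 no syzygy of \<open>X\<close> is taken: \<open>X\<close> itself is a stable
  retract of a second syzygy.\<close>

lemma dell_2_le_0:
  assumes X: "X \<in> fgmod A" and "dell A 2 X \<le> enat 0"
  obtains V Q where "V \<in> fgmod A" and "from_B V" and "C_mod (res V)" and "Q \<in> fgproj A"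
    and "rretract A X (rdsum V Q)"
proof -
  note RX = right_module_fg[OF fgmodD[OF X]]
  from assms(2) obtain n Y U V where "n \<le> 0" and "Y \<in> fgmod A" and U: "is_nth_syzygy A n X U"
    and V: "is_nth_syzygy A (n + 2) Y V" and UV: "stable_retract A U V"
    unfolding dell_le_iff by blast
  from \<open>n \<le> 0\<close> have n: "n = 0" by simp
  from U n have U': "U \<in> fgmod A" "riso A X U" by simp_all
  note V' = nth_syzygy_2_C_mod[OF V[unfolded n add_0]]
  note RU = right_module_fg[OF fgmodD[OF U'(1)]]
  obtain Q where Q: "Q \<in> fgproj A" "rretract A U (rdsum V Q)"
    using UV A.stable_retract_iff[OF RU right_module_fg[OF fgmodD[OF V'(3)]]] by blast
  from that[OF V'(3,1,2) Q(1) rretract_trans[OF riso_rretract(1)[OF RX RU U'(2)] Q(2)]]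
  show thesis .
qed

lemma dell_2_infl:
  assumes X: "X \<in> fgmod B" and "C_mod X"
  shows "dell A 2 (infl X) \<le> enat 0"
proof -
  obtain Y V where Y: "Y \<in> fgmod A" "is_nth_syzygy A 2 Y V" "stable_retract A (infl X) V"
    by (rule C_mod_second_syzygy[OF right_module_fg[OF fgmodD[OF X]] assms(2)])
  have "is_nth_syzygy A 0 (infl X) (infl X)"
    using fgmod_infl[OF X] by (simp add: riso_refl)
  moreover have "is_nth_syzygy A (0 + 2) Y V" using Y(2) by (simp only: add_0)
  ultimately show ?thesis using dell_leI[OF order_refl Y(1) _ _ Y(3)] by blast
qed

text \<open>The presentation \<open>R -> X\<close> may fail to be minimal. By Schanuel the minimal
  syzygy \<open>W\<close> is a retract of its kernel plus \<open>P\<close>, and the projectives that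
  accumulate are collected in \<open>T\<close>, so level 1 is reached.\<close>

lemma dell_1_kernel:
  fixes R :: "('k \<times> 'm \<times> 'b, 'r) rmodule" and U :: "('b, 'u) rmodule"
  assumes X: "X \<in> fgmod A" and R: "fg_right_module A R" "projective A R" and p: "p \<in> epi_rhom A R X"
    and U: "right_module B U" "C_mod U" and K: "rretract A (restrict_to R (a_kernel R X p)) (infl U)"
  shows "dell A 1 X \<le> enat 1"
proof -
  note RX = right_module_fg[OF fgmodD[OF X]]
  obtain W where W: "is_syzygy A X W" using A.ex_is_syzygy[OF fgmodD[OF X]] by blast
  then have W': "is_nth_syzygy A 1 X W" using X by (auto intro: riso_refl)
  obtain P q where P: "P \<in> fgproj A" "q \<in> epi_rhom A P X" "riso A (restrict_to P (a_kernel P X q)) W"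
    "W \<in> fgmod A"
    using W by (rule is_syzygyE)
  note RP = right_module_fg[OF fgprojD(1)[OF P(1)]] and RW = right_module_fg[OF fgmodD[OF P(4)]]
  obtain Y V where Y: "Y \<in> fgmod A" and V: "is_nth_syzygy A 2 Y V" "V \<in> fgmod A"
    and UV: "stable_retract A (infl U) V"
    by (rule C_mod_second_syzygy[OF U])
  note RV = right_module_fg[OF fgmodD[OF V(2)]]
  obtain S where S: "S \<in> fgproj A" "rretract A (infl U) (rdsum V S)"
    using UV A.stable_retract_iff[OF right_module_infl[OF U(1)] RV] by blast
  note RS = right_module_fg[OF fgprojD(1)[OF S(1)]]
  obtain T f g where T: "T \<in> fgproj A" "f \<in> rhom A (rdsum S P) T" "g \<in> rhom A T (rdsum S P)"
    "\<And>x. x \<in> carrier (rdsum S P) \<Longrightarrow> g (f x) = x"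
    by (rule A.ex_fgproj_copy[OF fg_right_module_rdsum[OF fgprojD(1)[OF S(1)] fgprojD(1)[OF P(1)]]
          projective_rdsum[OF fgprojD(2)[OF S(1)] RS fgprojD(2)[OF P(1)] RP]]) blast
  have 1: "rretract A W (restrict_to P (a_kernel P X q))"
    by (rule riso_rretract(2)[OF right_module_restrict_to[OF RP rsubmodule_a_kernel[OF RP RX
          epi_rhom_rhom[OF P(2)]]] RW P(3)])
  have 2: "rretract A (restrict_to P (a_kernel P X q)) (rdsum (restrict_to R (a_kernel R X p)) P)"
    by (rule A.rretract_kernel[OF RX RX fgprojD[OF P(1)] R P(2) p rretract_refl])
  have 3: "rretract A (rdsum (restrict_to R (a_kernel R X p)) P) (rdsum (rdsum V S) P)"
    by (rule rretract_rdsum_cong[OF rretract_trans[OF K S(2)] rretract_refl])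
  have 4: "rretract A (rdsum (rdsum V S) P) (rdsum V T)"
    by (rule rretract_trans[OF rretract_rdsum_assoc rretract_rdsum_cong[OF rretract_refl rretractI[OF T(2,3)]]])
      (rule T(4))
  have "rretract A W (rdsum V T)"
    by (rule rretract_trans[OF 1 rretract_trans[OF 2 rretract_trans[OF 3 4]]])
  then have "stable_retract A W V" using A.stable_retract_iff[OF RW RV] T(1) by blast
  moreover have "is_nth_syzygy A (1 + 1) Y V" using V(1) by (simp only: one_add_one)
  ultimately show ?thesis using dell_leI[OF order_refl Y W'] by blast
qed

text \<open>As \<open>m \<le> 1\<close>, the resolution has length 0 or 1; in both cases the kernel
  of \<open>C 0 -> S0\<close> is a retract of a module from the class plus a projective, as the
  construction above expects.\<close>

lemma ddell_imp_extension:
  assumes "ddell A S0 \<le> 1"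
  shows "\<exists>Q\<in>fgproj B. rdsum M Q \<in> extension_class B (C_class B M) (C_class B M)"
proof -
  from assms have "ddell A S0 \<le> enat 1" by (simp add: one_enat_def)
  then obtain m n C d \<epsilon> where m: "m \<le> 1" "n \<le> m" and C: "\<forall>i\<le>n. C i \<in> fgmod A"
    and res: "exact_left_resolution A n C d \<epsilon> S0" and dell: "\<forall>i\<le>n. dell A (i + 1) (C i) \<le> enat (m - i)"
    unfolding ddell_le_iff by blast
  have C0: "C 0 \<in> fgmod A" using C by simp
  have \<epsilon>: "\<epsilon> \<in> epi_rhom A (C 0) S0" using res by (simp add: exact_left_resolution_def Let_def)
  note RC = right_module_fg[OF fgmodD[OF C0]]
  have RS: "right_module A S0" by (rule S0_quotient)
  note I = rsubmodule_a_kernel[OF RC RS epi_rhom_rhom[OF \<epsilon>]]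
  have "dell A 1 (C 0) \<le> enat m" using dell by auto
  also have "enat m \<le> enat 1" using m by simp
  finally obtain P p V2 P2 where P: "P \<in> fgproj A" "p \<in> epi_rhom A P (C 0)"
    and V2: "V2 \<in> fgmod A" "from_B V2" "C_mod (res V2)" and P2: "P2 \<in> fgproj A"
    and K: "rretract A (restrict_to P (a_kernel P (C 0) p)) (rdsum V2 P2)"
    by (rule dell_1_le_1[OF C0])
  note RV2 = right_module_fg[OF fgmodD[OF V2(1)]]
  note RP2 = right_module_fg[OF fgprojD(1)[OF P2]]
  have "\<exists>V1 P1. V1 \<in> fgmod A \<and> from_B V1 \<and> C_mod (res V1) \<and> P1 \<in> fgproj A \<and>
    rretract A (restrict_to (C 0) (a_kernel (C 0) S0 \<epsilon>)) (rdsum V1 P1)"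
  proof (cases n)
    case 0
    then have k: "a_kernel (C 0) S0 \<epsilon> = {\<zero>\<^bsub>C 0\<^esub>}"
      using res by (simp add: exact_left_resolution_def Let_def)
    note RX = right_module_restrict_to[OF RC I]
    \<comment> \<open>The kernel is zero and thus a retract of any module, so the modules already
      found for \<open>C 0\<close> serve again.\<close>
    have "rretract A (restrict_to (C 0) (a_kernel (C 0) S0 \<epsilon>)) (rdsum V2 P2)"
      by (rule rretractI[OF rhom_zero_map[OF right_module_rdsum[OF RV2 RP2]] rhom_zero_map[OF RX]])
        (simp add: k)
    then show ?thesis using V2 P2 by blast
  next
    case (Suc n')
    \<comment> \<open>Length 1 forces \<open>m = 1\<close>, which leaves the bound
      \<open>m - 1 = 0\<close> at index 1.\<close>
    with m have n: "n = 1" "m = 1" by auto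
    then have C1: "C 1 \<in> fgmod A" using C by simp
    have dell1: "dell A 2 (C 1) \<le> enat 0" using dell n by (auto simp: numeral_2_eq_2)
    note RC1 = right_module_fg[OF fgmodD[OF C1]]
    have k: "a_kernel (C 0) S0 \<epsilon> = d 0 ` carrier (C 1)" and d: "d 0 \<in> rhom A (C 1) (C 0)"
      and kd: "a_kernel (C 1) (C 0) (d 0) = {\<zero>\<^bsub>C 1\<^esub>}"
      using res unfolding n exact_left_resolution_1 by auto
    have "inj_on (d 0) (carrier (C 1))"
      using kd by (intro inj_on_rhomI[OF RC1 RC d]) (auto simp: a_kernel_def')
    then have dm: "d 0 \<in> mono_rhom A (C 1) (C 0)" using d by (simp add: mono_rhom_def)
    note RX = right_module_restrict_to[OF RC I]
    obtain s where s: "s \<in> rhom A (restrict_to (C 0) (a_kernel (C 0) S0 \<epsilon>)) (C 1)"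
      "\<forall>z\<in>a_kernel (C 0) S0 \<epsilon>. d 0 (s z) = z"
      using rhom_lift_mono[OF RC1 RC dm rhom_inclusion[OF I] _ RX] k by auto
    have "d 0 \<in> rhom A (C 1) (restrict_to (C 0) (a_kernel (C 0) S0 \<epsilon>))"
      by (rule rhom_corestrict[OF d]) (simp add: k)
    from rretractI[OF s(1) this] s(2)
    have *: "rretract A (restrict_to (C 0) (a_kernel (C 0) S0 \<epsilon>)) (C 1)" by simp
    obtain V1 P1 where "V1 \<in> fgmod A" "from_B V1" "C_mod (res V1)" "P1 \<in> fgproj A"
      "rretract A (C 1) (rdsum V1 P1)"
      by (rule dell_2_le_0[OF C1 dell1])
    with rretract_trans[OF * this(5)] show ?thesis by blast
  qed
  then obtain V1 P1 where V1: "V1 \<in> fgmod A" "from_B V1" "C_mod (res V1)" and P1: "P1 \<in> fgproj A"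
    and X1: "rretract A (restrict_to (C 0) (a_kernel (C 0) S0 \<epsilon>)) (rdsum V1 P1)"
    by blast
  show ?thesis
    by (rule resolution_imp_extension[OF fgmodD[OF C0] \<epsilon> right_module_fg[OF fgmodD[OF V1(1)]] V1(2,3)
          fgprojD[OF P1] X1 P RV2 V2(2,3) fgprojD[OF P2] K])
qed

text \<open>
  Conversely, for \<open>0 \<longrightarrow> U \<longrightarrow> M \<oplus> Q \<longrightarrow> V \<longrightarrow> 0\<close> the module \<open>C0 = (P\<^sub>0 \<oplus> Q) / U\<close> is an extension of
  \<open>S\<^sub>0\<close> by \<open>V\<close> with syzygy \<open>U\<close>.
\<close>

lemma extension_imp_ddell:
  assumes Q: "Q \<in> fgproj B" and ext: "rdsum M Q \<in> extension_class B (C_class B M) (C_class B M)"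
  shows "ddell A S0 \<le> 1"
proof -
  let ?E = "rdsum M Q"
  from ext obtain U V f g where U: "U \<in> C_class B M" and V: "V \<in> C_class B M"
    and f: "f \<in> mono_rhom B U ?E" and g: "g \<in> epi_rhom B ?E V"
    and fg: "f ` carrier U = a_kernel ?E V g"
    unfolding extension_class_def by blast
  have U': "U \<in> fgmod B" "C_mod U" and V': "V \<in> fgmod B" "C_mod V"
    using U V by (simp_all add: C_class_eq)
  note RU = right_module_fg[OF fgmodD[OF U'(1)]] and RV = right_module_fg[OF fgmodD[OF V'(1)]]
  note RQ = right_module_fg[OF fgprojD(1)[OF Q]]
  note RE = right_module_rdsum[OF M.is_right_module RQ]
  note iQ = fgproj_infl[OF Q] and iV = right_module_infl[OF RV] and iE = right_module_infl[OF RE]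
  have f': "f \<in> rhom B U ?E" using f by (simp add: mono_rhom_def)
  note g' = epi_rhom_rhom[OF g]
  note RiQ = right_module_fg[OF fgprojD(1)[OF iQ]]
  interpret M: right_module B M by (rule M.is_right_module)
  interpret Q: right_module B Q by (rule RQ)
  interpret E: right_module B ?E by (rule RE)
  obtain t where RS: "right_module A S0" and t: "t \<in> epi_rhom A P0 S0" and kt: "a_kernel P0 S0 t = J"
    by (rule S0_quotient)
  note t' = epi_rhom_rhom[OF t]
  have t0: "t u = \<zero>\<^bsub>S0\<^esub> \<longleftrightarrow> u \<in> J" if "u \<in> carrier P0" for u
    using that unfolding kt[symmetric] by (simp add: in_a_kernel)

  \<comment> \<open>The module \<open>C0\<close> and its presentation by
    \<open>P0 \<oplus> Q\<close>\<close>
  let ?R = "rdsum P0 (infl Q)"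
  have fgR: "fg_right_module A ?R" by (rule fg_right_module_rdsum[OF fg_P0 fgprojD(1)[OF iQ]])
  have pR: "projective A ?R"
    by (rule projective_rdsum[OF projective_P0 right_module_P0 fgprojD(2)[OF iQ] RiQ])
  note RR = right_module_fg[OF fgR]
  let ?j = "\<lambda>v. ((\<zero>\<^bsub>K\<^esub>, fst v, \<zero>\<^bsub>B\<^esub>), snd v)"
  have j: "?j \<in> rhom A (infl ?E) ?R"
    unfolding infl_rdsum by (rule rhom_map_prod[OF rhom_infl_P0 rhom_id])
  have K: "rsubmodule A (a_kernel ?E V g) (infl ?E)"
    by (rule rsubmodule_infl[OF RE rsubmodule_a_kernel[OF RE RV g']])
  \<comment> \<open>The copy of \<open>U\<close> inside \<open>P0 \<oplus> Q\<close>, where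
    \<open>M \<oplus> Q\<close> sits as \<open>J \<oplus> Q\<close> with cokernel
    \<open>S0\<close>.\<close>
  let ?T = "?j ` a_kernel ?E V g"
  have T: "rsubmodule A ?T ?R" by (rule rsubmodule_image[OF iE RR j K])
  obtain C0 p where C0: "C0 \<in> fgmod A" and p: "p \<in> epi_rhom A ?R C0" and kp: "a_kernel ?R C0 p = ?T"
    using A.ex_quotient[OF fgR T] by blast
  note RC = right_module_fg[OF fgmodD[OF C0]] and p' = epi_rhom_rhom[OF p]
  have p0: "x \<in> ?T" if "x \<in> carrier ?R" "p x = \<zero>\<^bsub>C0\<^esub>" for x
    using that unfolding kp[symmetric] by (simp add: in_a_kernel)
  have pT: "p x = \<zero>\<^bsub>C0\<^esub>" if "x \<in> ?T" for x
    using that unfolding kp[symmetric] by (simp add: in_a_kernel)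

  \<comment> \<open>The maps of the resolution\<close>
  have tf: "(\<lambda>x. t (fst x)) \<in> rhom A ?R S0" by (rule rhom_comp[OF rhom_fst t'])
  have "t (fst x) = \<zero>\<^bsub>S0\<^esub>" if x: "x \<in> carrier ?R" "p x = \<zero>\<^bsub>C0\<^esub>" for x
  proof -
    obtain v where v: "x = ?j v" "v \<in> a_kernel ?E V g" using p0[OF x] by blast
    then have "v \<in> carrier ?E" by (simp add: in_a_kernel)
    then have "fst x \<in> J" unfolding v(1) by auto
    moreover from this have "fst x \<in> carrier P0" by auto
    ultimately show ?thesis by (simp only: t0)
  qed
  from rhom_factor_epi[OF RR RC RS p tf this] obtain \<epsilon>
    where \<epsilon>': "\<epsilon> \<in> rhom A C0 S0" and \<epsilon>p: "\<And>x. x \<in> carrier ?R \<Longrightarrow> \<epsilon> (p x) = t (fst x)" by blast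
  have \<epsilon>: "\<epsilon> \<in> epi_rhom A C0 S0"
  proof (rule epi_rhomI[OF \<epsilon>'])
    fix y assume "y \<in> carrier S0"
    with t obtain u where u: "u \<in> carrier P0" "t u = y" by (rule epi_rhomE)
    have x: "(u, \<zero>\<^bsub>Q\<^esub>) \<in> carrier ?R" using u(1) by simp
    show "\<exists>z\<in>carrier C0. \<epsilon> z = y"
      using \<epsilon>p[OF x] u(2) rhom_closed[OF p' x] by (intro bexI[of _ "p (u, \<zero>\<^bsub>Q\<^esub>)"]) auto
  qed
  have pj: "(\<lambda>v. p (?j v)) \<in> rhom A (infl ?E) C0" by (rule rhom_comp[OF j p'])
  have "p (?j v) = \<zero>\<^bsub>C0\<^esub>" if "v \<in> carrier (infl ?E)" "g v = \<zero>\<^bsub>infl V\<^esub>" for v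
    using that by (intro pT imageI) (simp add: in_a_kernel)
  \<comment> \<open>As \<open>V\<close> is \<open>(M \<oplus> Q) / U\<close>, the embedding of
    \<open>M \<oplus> Q\<close> into \<open>P0 \<oplus> Q\<close> induces a map from
    \<open>V\<close> to \<open>C0\<close>.\<close>
  from rhom_factor_epi[OF iE iV RC epi_rhom_infl[OF g] pj this] obtain d
    where d: "d \<in> rhom A (infl V) C0" and dg: "\<And>v. v \<in> carrier ?E \<Longrightarrow> d (g v) = p (?j v)" by auto

  \<comment> \<open>Exactness\<close>
  have kd: "a_kernel (infl V) C0 d = {\<zero>\<^bsub>V\<^esub>}"
  proof (intro equalityI subsetI)
    fix y assume "y \<in> a_kernel (infl V) C0 d"
    then have y: "y \<in> carrier V" "d y = \<zero>\<^bsub>C0\<^esub>" by (auto simp: in_a_kernel)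
    obtain v where v: "v \<in> carrier ?E" "g v = y" using g y(1) by (rule epi_rhomE)
    have jv: "?j v \<in> carrier ?R" using rhom_closed[OF j, of v] v(1) by simp
    have "?j v \<in> ?T" using dg[OF v(1)] v(2) y(2) by (intro p0[OF jv]) simp
    then obtain v' where v': "v' \<in> a_kernel ?E V g" "?j v = ?j v'" by blast
    then have "v = v'" by (simp add: prod_eq_iff)
    then show "y \<in> {\<zero>\<^bsub>V\<^esub>}" using v' v(2) by (simp add: in_a_kernel)
  next
    fix y assume "y \<in> {\<zero>\<^bsub>V\<^esub>}"
    then show "y \<in> a_kernel (infl V) C0 d"
      using rhom_zero[OF iV RC d] rsubmodule_zero[OF rsubmodule_whole[OF RV]] by (simp add: in_a_kernel)
  qed
  have ke: "a_kernel C0 S0 \<epsilon> = d ` carrier (infl V)"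
  proof (intro equalityI subsetI)
    fix z assume "z \<in> a_kernel C0 S0 \<epsilon>"
    then have z: "z \<in> carrier C0" "\<epsilon> z = \<zero>\<^bsub>S0\<^esub>" by (auto simp: in_a_kernel)
    obtain x where x: "x \<in> carrier ?R" "p x = z" using p z(1) by (rule epi_rhomE)
    have xP: "fst x \<in> carrier P0" "snd x \<in> carrier Q" using x(1) by auto
    have "fst x \<in> J" using \<epsilon>p[OF x(1)] x(2) z(2) t0[OF xP(1)] by simp
    then obtain m where m: "fst x = (\<zero>\<^bsub>K\<^esub>, m, \<zero>\<^bsub>B\<^esub>)" "m \<in> carrier M" by auto
    have v: "(m, snd x) \<in> carrier ?E" using m xP by simp
    have "x = ?j (m, snd x)" using m by (simp add: prod_eq_iff)
    then have "z = d (g (m, snd x))" using dg[OF v] x(2) by simp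
    then show "z \<in> d ` carrier (infl V)" using rhom_closed[OF g' v] by simp
  next
    fix z assume "z \<in> d ` carrier (infl V)"
    then obtain y where y: "y \<in> carrier V" "z = d y" by auto
    obtain v where v: "v \<in> carrier ?E" "g v = y" using g y(1) by (rule epi_rhomE)
    have jv: "?j v \<in> carrier ?R" using rhom_closed[OF j, of v] v(1) by simp
    have zp: "z = p (?j v)" using dg[OF v(1)] v(2) y(2) by simp
    have "fst (?j v) \<in> J" "fst (?j v) \<in> carrier P0" using v(1) by auto
    then have "\<epsilon> z = \<zero>\<^bsub>S0\<^esub>" unfolding zp \<epsilon>p[OF jv] by (simp only: t0)
    then show "z \<in> a_kernel C0 S0 \<epsilon>" using rhom_closed[OF p' jv] zp by (simp add: in_a_kernel)
  qed

  \<comment> \<open>The kernel of the presentation of \<open>C0\<close> is a copy of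
    \<open>U\<close>\<close>
  have fm: "f \<in> mono_rhom A (infl U) (infl ?E)"
    using f by (simp add: mono_rhom_def rhom_infl)
  let ?T' = "restrict_to ?R ?T"
  have c1: "(\<lambda>x. (fst (snd (fst x)), snd x)) \<in> rhom A ?T' (infl ?E)"
    unfolding infl_rdsum
  proof (rule rhom_pair)
    have "fst \<in> rhom A ?T' (restrict_to P0 J)"
      by (rule rhom_corestrict[OF rhom_restrict[OF rhom_fst rsubmodule_subset[OF T]]])
        (auto simp: in_a_kernel)
    from rhom_comp[OF this rhom_J_infl] show "(\<lambda>x. fst (snd (fst x))) \<in> rhom A ?T' (infl M)" .
    show "snd \<in> rhom A ?T' (infl Q)" by (rule rhom_restrict[OF rhom_snd rsubmodule_subset[OF T]])
  qed
  have c2: "(fst (snd (fst x)), snd x) \<in> f ` carrier (infl U)" if "x \<in> carrier ?T'" for x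
    using that unfolding infl_simps fg by auto
  from rhom_lift_mono[OF right_module_infl[OF RU] iE fm c1 c2 right_module_restrict_to[OF RR T]]
  obtain h where h: "h \<in> rhom A ?T' (infl U)"
    and fh: "\<forall>x\<in>carrier ?T'. f (h x) = (fst (snd (fst x)), snd x)" by blast
  have "(\<lambda>u. ?j (f u)) \<in> rhom A (infl U) ?T'"
    by (rule rhom_corestrict[OF rhom_comp[OF rhom_infl[OF f'] j]]) (use fg in auto)
  with h have "rretract A ?T' (infl U)"
  proof (rule rretractI)
    fix x assume x: "x \<in> carrier ?T'"
    then obtain v where v: "x = ?j v" unfolding restrict_to_simps by blast
    have "?j (f (h x)) = ?j (fst (snd (fst x)), snd x)" by (simp only: fh[rule_format, OF x])
    then show "?j (f (h x)) = x" unfolding v by simp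
  qed
  then have "dell A 1 C0 \<le> enat 1"
    using kp by (intro dell_1_kernel[OF C0 fgR pR p RU U'(2)]) simp
  moreover have "dell A 2 (infl V) \<le> enat 0" by (rule dell_2_infl[OF V'])
  moreover define C where "C i = (if i = 0 then C0 else infl V)" for i :: nat
  ultimately have "\<forall>i\<le>1. dell A (i + 1) (C i) \<le> enat (1 - i)"
    by (auto simp: le_Suc_eq numeral_2_eq_2 C_def)
  moreover have "\<forall>i\<le>1. C i \<in> fgmod A" using C0 fgmod_infl[OF V'(1)] by (simp add: C_def)
  moreover have "exact_left_resolution A 1 C (\<lambda>_. d) \<epsilon> S0"
    unfolding exact_left_resolution_1 using \<epsilon> ke d kd by (simp add: C_def)
  ultimately have "ddell A S0 \<le> enat 1"
    unfolding ddell_le_iff by blast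
  then show ?thesis by (simp add: one_enat_def)
qed

end

theorem theorem3p3:
  fixes K :: "'k ring" and B :: "('k, 'b) module" and M :: "('b, 'm) rmodule"
  assumes "fd_algebra K B" and "fg_right_module B M"
  shows "ddell (one_point_ext K B M) (S\<^sub>0 K B M) \<le> 1 \<longleftrightarrow>
    (\<exists>Q\<in>fgproj B. rdsum M Q \<in> extension_class B (C_class B M) (C_class B M))"
proof -
  interpret one_point K B M
    using assms by (simp add: one_point_def)
  show ?thesis
    using ddell_imp_extension extension_imp_ddell by blast
qed

end
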